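(* Let $N\in\{3,4\}$, let $\Omega\subset\mathbb{R}^N$ be a bounded regular domain, let $m\ge 2$ be an integer, and let $\mu_i\neq 0$ and $\beta_{ij}=\beta_{ji}\neq 0$ ($i,j\in\{1,\dots,m\}$, $i\ne j$) be real numbers. Consider the system $$-\Delta u_i+\lambda_iu_i=\mu_iu_i^3+\sum_{k\ne i}\beta_{ki}u_k^2u_i\ \text{ in }\Omega,\qquad u_i\in H_0^1(\Omega),\qquad i=1,\dots,m.$$ Then the set of semi-trivial bifurcation points of this system is exactly $$\Big\{(\lambda_1,\dots,\lambda_m)\in\mathbb{R}^m:\ \exists\, i\in\{1,\dots,m\},\ \lambda_i\text{ is an eigenvalue of }-\Delta\text{ on }H_0^1(\Omega)\Big\}.$$ Moreover, for every integer $d$ with $1\le d\le m-1$, the set of $d$-semi-trivial bifurcation points of this system is exactly $$\Big\{(\lambda_1,\dots,\lambda_m)\in\mathbb{R}^m:\ \exists\, i_1<\dots<i_d\text{ in }\{1,\dots,m\},\ \lambda_{i_1},\dots,\lambda_{i_d}\text{ are eigenvalues of }-\Delta\text{ on }H_0^1(\Omega)\Big\}.$$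
   Context: A vector $\vec\lambda^*=(\lambda_1^*,\dots,\lambda_m^* )\in\mathbb{R}^m$ is a bifurcation point of the system if there is a sequence $\{(\lambda_{n,1},\dots,\lambda_{n,m};\vec u_n)\}\subset\mathbb{R}^m\times H_0^1(\Omega,\mathbb{R}^m)$ such that $\vec u_n\not\equiv 0$ solves the system with $\lambda_i=\lambda_{n,i}$ ($i=1,\dots,m$), $-\lambda_{n,i}\to\lambda_i^*$ for every $i=1,\dots,m$, and $\vec u_n\to 0$ strongly in $H_0^1(\Omega,\mathbb{R}^m)$ as $n\to\infty$. (Note the sign: $-\lambda_{n,i}\to\lambda_i^*$. No $L^2$-norm is prescribed.) It is a semi-trivial bifurcation point if the sequence can be chosen with every $\vec u_n$ semi-trivial, meaning that some components of $\vec u_n$ vanish identically and the other ones (at least one) do not. It is a $d$-semi-trivial bifurcation point if the sequence can be chosen with every $\vec u_n$ having exactly $d$ components that are not identically zero. "Regular" means that the boundary is sufficiently smooth. *)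

theory Defs
  imports "HOL-Analysis.Analysis"
begin

section \<open>Smooth functions and regular domains\<close>

definition partial_deriv :: "'n::finite \<Rightarrow> (real^'n \<Rightarrow> real) \<Rightarrow> real^'n \<Rightarrow> real" where
  "partial_deriv j f x = frechet_derivative f (at x) (axis j 1)"

text \<open>Used only for open \<open>U\<close>.\<close>

primrec Ck_on :: "nat \<Rightarrow> (real^'n::finite) set \<Rightarrow> (real^'n \<Rightarrow> real) \<Rightarrow> bool" where
  "Ck_on 0 U f \<longleftrightarrow> continuous_on U f"
| "Ck_on (Suc k) U f \<longleftrightarrow>
     (\<forall>x\<in>U. f differentiable (at x)) \<and> (\<forall>j. Ck_on k U (partial_deriv j f))"

definition test_functions :: "(real^'n::finite) set \<Rightarrow> (real^'n \<Rightarrow> real) set" where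
  "test_functions \<Omega> = {\<phi>. (\<forall>k. Ck_on k UNIV \<phi>) \<and>
     compact (closure {x. \<phi> x \<noteq> 0}) \<and> closure {x. \<phi> x \<noteq> 0} \<subseteq> \<Omega>}"

text \<open>Local defining functions; \<open>\<Omega>\<close> lies locally on one side of its boundary.\<close>

definition Ck_boundary :: "nat \<Rightarrow> (real^'n::finite) set \<Rightarrow> bool" where
  "Ck_boundary k \<Omega> \<longleftrightarrow>
     (\<forall>p\<in>frontier \<Omega>. \<exists>U \<rho>. open U \<and> p \<in> U \<and> Ck_on k U \<rho> \<and>
        (\<forall>x\<in>U. \<exists>j. partial_deriv j \<rho> x \<noteq> 0) \<and>
        \<Omega> \<inter> U = {x\<in>U. \<rho> x < 0})"

text \<open>``Sufficiently smooth'' is read as \<open>C\<^sup>1\<close>, so that domains with a boundary of class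
  \<open>C\<^sup>k\<close>, \<open>k \<ge> 1\<close>, or \<open>C\<^sup>\<infinity>\<close> are all included.\<close>

definition regular_domain :: "(real^'n::finite) set \<Rightarrow> bool" where
  "regular_domain \<Omega> \<longleftrightarrow> open \<Omega> \<and> connected \<Omega> \<and> \<Omega> \<noteq> {} \<and> Ck_boundary 1 \<Omega>"


section \<open>The Sobolev space \<open>H\<^sub>0\<^sup>1(\<Omega>)\<close>\<close>

text \<open>Elements of \<open>L\<^sup>2(\<Omega>)\<close> are represented by functions on the whole space of which only the
  values on \<open>\<Omega>\<close>, up to null sets, matter. In particular \<open>u \<equiv> 0\<close> is rendered as
  \<open>vanishes \<Omega> u\<close>.\<close>

definition vanishes :: "(real^'n::finite) set \<Rightarrow> (real^'n \<Rightarrow> real) \<Rightarrow> bool" where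
  "vanishes \<Omega> u \<longleftrightarrow> (AE x in lebesgue_on \<Omega>. u x = 0)"

definition L2 :: "(real^'n::finite) set \<Rightarrow> (real^'n \<Rightarrow> real) set" where
  "L2 \<Omega> = {u \<in> borel_measurable (lebesgue_on \<Omega>). integrable (lebesgue_on \<Omega>) (\<lambda>x. (u x)\<^sup>2)}"

definition is_weak_grad ::
  "(real^'n::finite) set \<Rightarrow> (real^'n \<Rightarrow> real) \<Rightarrow> (real^'n \<Rightarrow> real^'n) \<Rightarrow> bool" where
  "is_weak_grad \<Omega> u g \<longleftrightarrow>
     (\<forall>j. (\<lambda>x. g x $ j) \<in> L2 \<Omega>) \<and>
     (\<forall>\<phi>\<in>test_functions \<Omega>. \<forall>j.
        integral\<^sup>L (lebesgue_on \<Omega>) (\<lambda>x. u x * partial_deriv j \<phi> x) =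
        - integral\<^sup>L (lebesgue_on \<Omega>) (\<lambda>x. g x $ j * \<phi> x))"

text \<open>The weak gradient is unique up to null sets, so the choice is immaterial.\<close>

definition weak_grad :: "(real^'n::finite) set \<Rightarrow> (real^'n \<Rightarrow> real) \<Rightarrow> real^'n \<Rightarrow> real^'n" where
  "weak_grad \<Omega> u = (SOME g. is_weak_grad \<Omega> u g)"

definition H1 :: "(real^'n::finite) set \<Rightarrow> (real^'n \<Rightarrow> real) set" where
  "H1 \<Omega> = {u \<in> L2 \<Omega>. \<exists>g. is_weak_grad \<Omega> u g}"

definition H1_norm :: "(real^'n::finite) set \<Rightarrow> (real^'n \<Rightarrow> real) \<Rightarrow> real" where
  "H1_norm \<Omega> u = sqrt (integral\<^sup>L (lebesgue_on \<Omega>) (\<lambda>x. (norm (weak_grad \<Omega> u x))\<^sup>2)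
                     + integral\<^sup>L (lebesgue_on \<Omega>) (\<lambda>x. (u x)\<^sup>2))"

definition H10 :: "(real^'n::finite) set \<Rightarrow> (real^'n \<Rightarrow> real) set" where
  "H10 \<Omega> = {u \<in> H1 \<Omega>. \<exists>\<phi>::nat \<Rightarrow> real^'n \<Rightarrow> real.
     (\<forall>n. \<phi> n \<in> test_functions \<Omega>) \<and> (\<lambda>n. H1_norm \<Omega> (\<lambda>x. u x - \<phi> n x)) \<longlonglongrightarrow> 0}"

definition H10_vec :: "(real^'n::finite) set \<Rightarrow> (real^'n \<Rightarrow> real^'m::finite) set" where
  "H10_vec \<Omega> = {u. \<forall>i. (\<lambda>x. u x $ i) \<in> H10 \<Omega>}"

definition H1_norm_vec :: "(real^'n::finite) set \<Rightarrow> (real^'n \<Rightarrow> real^'m::finite) \<Rightarrow> real" where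
  "H1_norm_vec \<Omega> u = sqrt (\<Sum>i\<in>UNIV. (H1_norm \<Omega> (\<lambda>x. u x $ i))\<^sup>2)"


section \<open>Dirichlet problems and bifurcation points\<close>

text \<open>Weak form of \<open>-\<Delta>u + c u = f\<close> in \<open>\<Omega>\<close>, \<open>u \<in> H\<^sub>0\<^sup>1(\<Omega>)\<close>. Integrability of \<open>f \<phi>\<close> is demanded
  because the Bochner integral of a non-integrable function is 0 by convention; for the cubic
  \<open>f\<close> below it is automatic in dimension at most 4, by the Sobolev embedding into \<open>L\<^sup>4\<close>.\<close>

definition weak_solution ::
  "(real^'n::finite) set \<Rightarrow> real \<Rightarrow> (real^'n \<Rightarrow> real) \<Rightarrow> (real^'n \<Rightarrow> real) \<Rightarrow> bool" where
  "weak_solution \<Omega> c f u \<longleftrightarrow> u \<in> H10 \<Omega> \<and>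
     (\<forall>\<phi>\<in>H10 \<Omega>. integrable (lebesgue_on \<Omega>) (\<lambda>x. f x * \<phi> x) \<and>
        integral\<^sup>L (lebesgue_on \<Omega>) (\<lambda>x. weak_grad \<Omega> u x \<bullet> weak_grad \<Omega> \<phi> x)
        + c * integral\<^sup>L (lebesgue_on \<Omega>) (\<lambda>x. u x * \<phi> x)
        = integral\<^sup>L (lebesgue_on \<Omega>) (\<lambda>x. f x * \<phi> x))"

definition dirichlet_eigenvalue :: "(real^'n::finite) set \<Rightarrow> real \<Rightarrow> bool" where
  "dirichlet_eigenvalue \<Omega> l \<longleftrightarrow>
     (\<exists>u. \<not> vanishes \<Omega> u \<and> weak_solution \<Omega> 0 (\<lambda>x. l * u x) u)"

definition solves_system ::
  "(real^'n::finite) set \<Rightarrow> real^'m::finite \<Rightarrow> real^'m^'m \<Rightarrow> real^'m \<Rightarrow> (real^'n \<Rightarrow> real^'m) \<Rightarrow> bool"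
  where
  "solves_system \<Omega> \<mu> \<beta> l u \<longleftrightarrow>
     (\<forall>i. weak_solution \<Omega> (l $ i)
        (\<lambda>x. \<mu> $ i * (u x $ i)^3 + (\<Sum>k\<in>UNIV - {i}. \<beta> $ k $ i * (u x $ k)\<^sup>2 * u x $ i))
        (\<lambda>x. u x $ i))"

definition nonzero_components ::
  "(real^'n::finite) set \<Rightarrow> (real^'n \<Rightarrow> real^'m::finite) \<Rightarrow> 'm set" where
  "nonzero_components \<Omega> u = {i. \<not> vanishes \<Omega> (\<lambda>x. u x $ i)}"

definition semi_trivial :: "(real^'n::finite) set \<Rightarrow> (real^'n \<Rightarrow> real^'m::finite) \<Rightarrow> bool" where
  "semi_trivial \<Omega> u \<longleftrightarrow> nonzero_components \<Omega> u \<noteq> UNIV \<and> nonzero_components \<Omega> u \<noteq> {}"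

text \<open>Note the sign: it is \<open>-l n\<close> that converges to the bifurcation point.\<close>

definition bifurcation_sequence ::
  "(real^'n::finite) set \<Rightarrow> real^'m::finite \<Rightarrow> real^'m^'m \<Rightarrow> real^'m \<Rightarrow>
   (nat \<Rightarrow> real^'m) \<Rightarrow> (nat \<Rightarrow> real^'n \<Rightarrow> real^'m) \<Rightarrow> bool" where
  "bifurcation_sequence \<Omega> \<mu> \<beta> lam l u \<longleftrightarrow>
     (\<forall>n. u n \<in> H10_vec \<Omega> \<and> nonzero_components \<Omega> (u n) \<noteq> {} \<and>
          solves_system \<Omega> \<mu> \<beta> (l n) (u n)) \<and>
     (\<forall>i. (\<lambda>n. - (l n $ i)) \<longlonglongrightarrow> lam $ i) \<and>
     (\<lambda>n. H1_norm_vec \<Omega> (u n)) \<longlonglongrightarrow> 0"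

definition semi_trivial_bifurcation_points ::
  "(real^'n::finite) set \<Rightarrow> real^'m::finite \<Rightarrow> real^'m^'m \<Rightarrow> (real^'m) set" where
  "semi_trivial_bifurcation_points \<Omega> \<mu> \<beta> =
     {lam. \<exists>l u. bifurcation_sequence \<Omega> \<mu> \<beta> lam l u \<and> (\<forall>n. semi_trivial \<Omega> (u n))}"

definition d_semi_trivial_bifurcation_points ::
  "nat \<Rightarrow> (real^'n::finite) set \<Rightarrow> real^'m::finite \<Rightarrow> real^'m^'m \<Rightarrow> (real^'m) set" where
  "d_semi_trivial_bifurcation_points d \<Omega> \<mu> \<beta> =
     {lam. \<exists>l u. bifurcation_sequence \<Omega> \<mu> \<beta> lam l u \<and>
                 (\<forall>n. card (nonzero_components \<Omega> (u n)) = d)}"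

end

theory Submission
  imports Defs
begin

text \<open>
  Representing the Dirichlet form and the cubic terms by Riesz' theorem turns the system into
  \<open>U\<^sub>i - (1 - \<lambda>\<^sub>i) K U\<^sub>i = N\<^sub>i(U)\<close> in a Hilbert space, where \<open>K\<close> is compact and self-adjoint (Rellich),
  \<open>N\<^sub>i(U) = O(\<bar>U\<bar>\<^sup>2 \<bar>U\<^sub>i\<bar>)\<close> (Sobolev embedding into \<open>L\<^sup>4\<close>), and \<open>N\<close> is a gradient because \<open>\<beta>\<close> is
  symmetric.

  Necessity: a component that is nonzero along a subsequence solves, once normalised, a linear
  equation up to an error tending to zero; by compactness it converges to an eigenfunction.

  Sufficiency: given a set \<open>I\<close> of indices for which \<open>\<lambda>\<^sub>i\<close> is an eigenvalue, put \<open>U\<^sub>i = 0\<close> for \<open>i \<notin> I\<close>,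
  scale \<open>U\<close> by a small \<open>\<rho>\<close>, and normalise every component with index in \<open>I\<close> by its \<open>L\<^sup>2\<close> norm. A
  Lyapunov--Schmidt reduction solves the equations orthogonally to the eigenspaces and leaves an
  energy on the product of their unit spheres. This product is compact, so the energy has a
  minimiser, and the Lagrange multipliers of the normalisation shift each \<open>\<lambda>\<^sub>i\<close> by \<open>O(\<rho>\<^sup>2)\<close> only. As
  each component is normalised separately, none of those with index in \<open>I\<close> can vanish.
\<close>

section \<open>Hilbert space preliminaries\<close>

text \<open>The eigenvalues may have any multiplicity, and different components may sit at different
  eigenvalues, so the argument rests on the variational structure instead of a crossing or a simple
  eigenvalue. Minimisation yields solutions of prescribed norm with \<lambda> as a multiplier, which
  suffices because a bifurcation point only asks \<lambda> to converge. The eigenvalue is absorbed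
  into the operator: with the full H^1 inner product, -\<Delta>u = lam u reads u = (lam + 1) K u, so
  K_i = (lam_i + 1) K has the eigenspace as its fixed points, and the normalisation takes the form
  <K_i U_i, U_i> = 1. The reduction is a contraction argument whose solution map G is only shown to
  be Lipschitz, so the energy of G is never differentiated. A Taylor estimate with quadratic error
  replaces the chain rule: the constraint holds on the whole image of G, hence the multiplier term
  can be inserted at second order cost, and the residual takes the place of the gradient. In
  dimension four the exponent 4 is critical and the cubic terms are only continuous; all compactness
  comes from K.\<close>

lemma norm_add_scaleR_square:
  fixes x y :: "'a::real_inner"
  shows "(norm (x + t *\<^sub>R y))\<^sup>2 = (norm x)\<^sup>2 + 2 * t * inner x y + t\<^sup>2 * (norm y)\<^sup>2"
  unfolding power2_norm_eq_inner inner_add_left inner_add_right inner_scaleR_left inner_scaleR_right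
    inner_commute[of y x] power2_eq_square[of t] by algebra

section \<open>Riesz representation and orthogonal projection\<close>

text \<open>Direct method: the representing vector minimises |x|^2 / 2 - f x over \<open>S\<close>.
  The parallelogram law makes the minimising sequence Cauchy, so completeness takes the place of
  weak compactness.\<close>

lemma riesz_subspace:
  fixes S :: "'a::{real_inner,complete_space} set"
  assumes S: "subspace S" "closed S" and f: "bounded_linear f"
  obtains z where "z \<in> S" "\<And>y. y \<in> S \<Longrightarrow> f y = inner z y"
proof -
  interpret f: bounded_linear f by fact
  define J where "J x = (norm x)\<^sup>2 / 2 - f x" for x
  obtain C where C: "\<And>x. norm (f x) \<le> norm x * C" using f.bounded by blast
  have J_lower: "J x \<ge> - (C\<^sup>2 / 2)" for x
  proof -
    have "f x \<le> norm x * C" using C[of x] by simp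
    moreover have "0 \<le> (norm x - C)\<^sup>2" by simp
    ultimately show ?thesis by (simp add: J_def power2_eq_square algebra_simps)
  qed
  define m where "m = (INF x\<in>S. J x)"
  have S0: "0 \<in> S" using S(1) by (simp add: subspace_0)
  have bdd: "bdd_below (J ` S)" using J_lower by (rule bdd_belowI2)
  have m_le: "m \<le> J x" if "x \<in> S" for x
    unfolding m_def using that bdd by (rule cINF_lower[rotated])
  define q where "q n = inverse (real (Suc n))" for n
  have "\<exists>x\<in>S. J x < m + q n" for n
  proof -
    have "m < m + q n" by (simp add: q_def)
    then show ?thesis unfolding m_def using S0 bdd by (subst (asm) cINF_less_iff) auto
  qed
  then obtain X where X: "\<And>n. X n \<in> S" "\<And>n. J (X n) < m + q n" by metis
  \<comment> \<open>Parallelogram law; the contribution of \<open>f\<close> cancels by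
    linearity.\<close>
  have para: "(norm (x - y))\<^sup>2 = 4 * (J x + J y - 2 * J ((1/2) *\<^sub>R (x + y)))" for x y
    by (simp add: J_def power2_norm_eq_inner f.scaleR f.add inner_add_left inner_add_right
        inner_diff_left inner_diff_right inner_commute algebra_simps)
  have diff: "(norm (X i - X j))\<^sup>2 \<le> 4 * (q i + q j)" for i j
  proof -
    have "(1/2) *\<^sub>R (X i + X j) \<in> S" using X S by (simp add: subspace_add subspace_scale)
    from m_le[OF this] X(2)[of i] X(2)[of j]
    have "J (X i) + J (X j) - 2 * J ((1/2) *\<^sub>R (X i + X j)) \<le> q i + q j"
      by linarith
    then show ?thesis unfolding para by simp
  qed
  have "Cauchy X"
  proof (rule metric_CauchyI)
    fix e :: real assume "e > 0"
    then obtain N where N: "q N < e\<^sup>2 / 8"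
      using reals_Archimedean[of "e\<^sup>2 / 8"] by (auto simp: q_def)
    have "dist (X i) (X j) < e" if "i \<ge> N" "j \<ge> N" for i j
    proof -
      have "q i \<le> q N"
        "q j \<le> q N" using that by (auto simp: q_def intro!: le_imp_inverse_le)
      then have "4 * (q i + q j) \<le> 8 * q N" by simp
      also have "\<dots> < e\<^sup>2" using N by simp
      finally have "(norm (X i - X j))\<^sup>2 < e\<^sup>2" using diff[of i j] by simp
      then show ?thesis using \<open>e > 0\<close> by (simp add: dist_norm power_less_imp_less_base)
    qed
    then show "\<exists>M. \<forall>m\<ge>M. \<forall>n\<ge>M. dist (X m) (X n) < e" by blast
  qed
  then obtain z where z: "X \<longlonglongrightarrow> z" using Cauchy_convergent convergent_def by blast
  have zS: "z \<in> S" using closed_sequentially[OF S(2)] X(1) z by blast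
  have "(\<lambda>n. J (X n)) \<longlonglongrightarrow> J z" unfolding J_def by (intro tendsto_intros z f.tendsto) simp_all
  moreover have "(\<lambda>n. m + q n) \<longlonglongrightarrow> m + 0"
    unfolding q_def by (intro tendsto_intros LIMSEQ_inverse_real_of_nat)
  ultimately have Jz: "J z \<le> m" using X(2) by (intro LIMSEQ_le) (auto intro: less_imp_le)
  have "f y = inner z y" if y: "y \<in> S" for y
  proof (rule ccontr)
    assume ne: "f y \<noteq> inner z y"
    define d where "d = f y - inner z y"
    have d: "d \<noteq> 0" using ne by (simp add: d_def)
    have quad: "0 \<le> - t * d + t\<^sup>2 * (norm y)\<^sup>2 / 2" for t
    proof -
      have "z + t *\<^sub>R y \<in> S" using zS y S by (simp add: subspace_add subspace_scale)
      from m_le[OF this] Jz have "J z \<le> J (z + t *\<^sub>R y)" by linarith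
      moreover have "(norm (z + t *\<^sub>R y))\<^sup>2 = (norm z)\<^sup>2 + 2 * t * inner z y + t\<^sup>2 * (norm y)\<^sup>2"
        by (rule norm_add_scaleR_square)
      ultimately show ?thesis unfolding J_def d_def by (simp add: f.scaleR f.add algebra_simps)
    qed
    have y0: "(norm y)\<^sup>2 > 0" using d by (auto simp: d_def f.zero)
    \<comment> \<open>This \<open>t\<close> minimises the quadratic, whose minimum is negative as
      long as \<open>d\<close> is nonzero.\<close>
    from quad[of "d / (norm y)\<^sup>2"] have "0 \<le> - (d / (norm y)\<^sup>2) * d + (d / (norm y)\<^sup>2)\<^sup>2 * (norm y)\<^sup>2 / 2" .
    also have "\<dots> = - (d\<^sup>2 / (norm y)\<^sup>2) / 2"
      using y0 by (simp add: power2_eq_square divide_simps)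
    finally show False using y0 d by (simp add: divide_le_0_iff)
  qed
  with zS show ?thesis using that by blast
qed

text \<open>\<open>P x\<close> represents \<open>y -> inner x y\<close> on \<open>S\<close>;
  linearity follows from uniqueness of the representative.\<close>

lemma orthogonal_projection:
  fixes S :: "'a::{real_inner,complete_space} set"
  assumes S: "subspace S" "closed S"
  obtains P where "bounded_linear P" "\<And>x. P x \<in> S" "\<And>x y. y \<in> S \<Longrightarrow> inner (P x) y = inner x y"
    "\<And>x. x \<in> S \<Longrightarrow> P x = x"
proof -
  have "\<exists>z\<in>S. \<forall>y\<in>S. inner z y = inner x y" for x
    by (rule riesz_subspace[OF S bounded_linear_inner_right[of x]]) auto
  then obtain P where P: "\<And>x. P x \<in> S" "\<And>x y. y \<in> S \<Longrightarrow> inner (P x) y = inner x y" by metis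
  have uniq: "z = P x" if "z \<in> S" "\<And>y. y \<in> S \<Longrightarrow> inner z y = inner x y" for z x
  proof -
    have "z - P x \<in> S" using that P S by (simp add: subspace_diff)
    then have "inner (z - P x) (z - P x) = 0" using that P by (simp add: inner_diff_left)
    then show ?thesis by simp
  qed
  have lin: "P (x + y) = P x + P y" "P (r *\<^sub>R x) = r *\<^sub>R P x" for x y r
    using P S by (intro uniq[symmetric]; simp add: inner_add_left subspace_add subspace_scale)+
  have "norm (P x) \<le> norm x * 1" for x
  proof -
    have "(norm (P x))\<^sup>2 = inner x (P x)" using P by (simp add: power2_norm_eq_inner)
    also have "\<dots> \<le> norm x * norm (P x)" by (rule norm_cauchy_schwarz)
    finally show ?thesis by (cases "norm (P x) = 0") (auto simp: power2_eq_square)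
  qed
  with lin have "bounded_linear P" by (rule bounded_linear_intro)
  then show ?thesis by (rule that) (use P uniq in auto)
qed

section \<open>Compact operators and the Fredholm alternative at eigenvalue 1\<close>

text \<open>The sequential form fits both ends: Rellich's theorem delivers subsequences, and the
  arguments below extract them.\<close>

definition compact_operator :: "('a::real_normed_vector \<Rightarrow> 'b::real_normed_vector) \<Rightarrow> bool" where
  "compact_operator K \<longleftrightarrow> (\<forall>X::nat \<Rightarrow> 'a. bounded (range X) \<longrightarrow>
     (\<exists>r l. strict_mono r \<and> (\<lambda>n. K (X (r n))) \<longlonglongrightarrow> l))"

lemma compact_operatorD:
  fixes X :: "nat \<Rightarrow> 'a::real_normed_vector"
  assumes "compact_operator K" "\<And>n. norm (X n) \<le> C"
  obtains r l where "strict_mono r" "(\<lambda>n. K (X (r n))) \<longlonglongrightarrow> l"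
proof -
  have "bounded (range X)" using assms(2) by (auto simp: bounded_iff)
  then obtain r l where "strict_mono r" "(\<lambda>n. K (X (r n))) \<longlonglongrightarrow> l"
    using assms(1) unfolding compact_operator_def by blast
  then show ?thesis by (rule that)
qed

text \<open>The kernel of \<open>1 - K\<close>. Eigenvalues are scaled into the operator, so the
  eigenspace at 1 is the only one that has to be named.\<close>

definition fixed_space :: "('a \<Rightarrow> 'a) \<Rightarrow> 'a set" where
  "fixed_space K = {x. K x = x}"

lemma fixed_space_subspace:
  assumes "bounded_linear K"
  shows "subspace (fixed_space K)" "closed (fixed_space K)"
proof -
  interpret bounded_linear K by fact
  show "subspace (fixed_space K)"
    unfolding fixed_space_def by (intro subspaceI) (auto simp: zero add scaleR)
  show "closed (fixed_space K)" unfolding fixed_space_def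
    by (intro closed_Collect_eq continuous_intros linear_continuous_on assms)
qed

text \<open>Fixed points equal their images, so the subsequence along which the images converge
  converges itself.\<close>

lemma compact_fixed_sphere:
  fixes K :: "'a::real_normed_vector \<Rightarrow> 'a"
  assumes K: "bounded_linear K" "compact_operator K"
  shows "compact {x \<in> fixed_space K. norm x = 1}"
  unfolding compact_eq_seq_compact_metric
proof (rule seq_compactI)
  fix X :: "nat \<Rightarrow> 'a" assume X: "\<forall>n. X n \<in> {x \<in> fixed_space K. norm x = 1}"
  then obtain r l where r: "strict_mono r" "(\<lambda>n. K (X (r n))) \<longlonglongrightarrow> l"
    using compact_operatorD[OF K(2), of X 1] by auto
  then have lim: "(X \<circ> r) \<longlonglongrightarrow> l" using X by (simp add: fixed_space_def o_def)
  have "closed (fixed_space K \<inter> {x. norm x = 1})"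
    by (intro closed_Int fixed_space_subspace K closed_Collect_eq continuous_intros)
  then have "l \<in> fixed_space K \<inter> {x. norm x = 1}"
    using X lim by (intro closed_sequentially[OF _ _ lim]) auto
  then show "\<exists>l\<in>{x \<in> fixed_space K. norm x = 1}. \<exists>r. strict_mono r \<and> (X \<circ> r) \<longlonglongrightarrow> l"
    using r lim by blast
qed

text \<open>Otherwise there are unit vectors orthogonal to the fixed space with
  \<open>x - K x\<close> tending to 0; by compactness a subsequence converges to a unit fixed point,
  which would be orthogonal to itself.\<close>

lemma fixed_complement_lower_bound:
  fixes K :: "'a::{real_inner,complete_space} \<Rightarrow> 'a"
  assumes K: "bounded_linear K" "compact_operator K"
  obtains \<alpha> where "\<alpha> > 0" "\<And>x. \<forall>v\<in>fixed_space K. inner x v = 0 \<Longrightarrow> \<alpha> * norm x \<le> norm (x - K x)"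
proof -
  interpret K: bounded_linear K by fact
  have "\<exists>\<alpha>>0. \<forall>x. (\<forall>v\<in>fixed_space K. inner x v = 0) \<longrightarrow> \<alpha> * norm x \<le> norm (x - K x)"
  proof (rule ccontr)
    assume neg: "\<not> ?thesis"
    have "\<exists>x. (\<forall>v\<in>fixed_space K. inner x v = 0) \<and> norm x = 1 \<and> norm (x - K x) < inverse (real (Suc n))" for n
    proof -
      have "inverse (real (Suc n)) > 0" by simp
      with neg obtain x where x: "\<forall>v\<in>fixed_space K. inner x v = 0"
          "inverse (real (Suc n)) * norm x > norm (x - K x)" by (meson not_le)
      then have x0: "norm x > 0" by (cases "x = 0") auto
      define y where "y = (1 / norm x) *\<^sub>R x"
      have "y - K y = (1 / norm x) *\<^sub>R (x - K x)" by (simp add: y_def K.scaleR algebra_simps)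
      then have "norm (y - K y) = norm (x - K x) / norm x" by simp
      also have "\<dots> < inverse (real (Suc n))" using x(2) x0 by (simp add: pos_divide_less_eq)
      finally show ?thesis using x x0 by (intro exI[of _ y]) (auto simp: y_def)
    qed
    then obtain X where X: "\<And>n v. v \<in> fixed_space K \<Longrightarrow> inner (X n) v = 0" "\<And>n. norm (X n) = 1"
      "\<And>n. norm (X n - K (X n)) < inverse (real (Suc n))" by metis
    obtain r l where r: "strict_mono r" "(\<lambda>n. K (X (r n))) \<longlonglongrightarrow> l"
      using compact_operatorD[OF K(2), of X 1] X by auto
    have "(\<lambda>n. X n - K (X n)) \<longlonglongrightarrow> 0"
      by (rule Lim_null_comparison[OF _ LIMSEQ_inverse_real_of_nat]) (intro always_eventually allI less_imp_le X(3))
    from LIMSEQ_subseq_LIMSEQ[OF this r(1)] r(2)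
    have "(\<lambda>n. X (r n) - K (X (r n)) + K (X (r n))) \<longlonglongrightarrow> 0 + l" by (intro tendsto_add) (auto simp: o_def)
    then have lim: "(\<lambda>n. X (r n)) \<longlonglongrightarrow> l" by simp
    have "K l = l" using K.tendsto[OF lim] r(2) LIMSEQ_unique by blast
    then have "inner (X (r n)) l = 0" for n using X(1) by (simp add: fixed_space_def)
    moreover have "(\<lambda>n. inner (X (r n)) l) \<longlonglongrightarrow> inner l l" by (intro tendsto_intros lim)
    ultimately have "inner l l = 0" by (simp add: LIMSEQ_const_iff)
    moreover have "(\<lambda>n. norm (X (r n))) \<longlonglongrightarrow> norm l" by (intro tendsto_intros lim)
    then have "norm l = 1" using X(2) by (simp add: LIMSEQ_const_iff)
    ultimately show False by simp
  qed
  then show ?thesis using that by blast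
qed

text \<open>\<open>A\<close> projects onto the range of \<open>1 - K\<close> restricted to the
  complement of the fixed space and inverts there. Self-adjointness keeps this range inside the
  complement and also shows that it fills it. Testing with \<phi> orthogonal to the fixed space
  expresses that \<open>A\<close> inverts \<open>1 - K\<close> modulo fixed vectors, without naming
  a projection.\<close>

lemma fredholm_partial_inverse:
  fixes K :: "'a::{real_inner,complete_space} \<Rightarrow> 'a"
  assumes K: "bounded_linear K" "compact_operator K" and sym: "\<And>x y. inner (K x) y = inner x (K y)"
  obtains A where "bounded_linear A" "\<And>y v. v \<in> fixed_space K \<Longrightarrow> inner (A y) v = 0"
    "\<And>y \<phi>. \<forall>v\<in>fixed_space K. inner \<phi> v = 0 \<Longrightarrow> inner (A y - K (A y)) \<phi> = inner y \<phi>"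
proof -
  interpret K: bounded_linear K by fact
  define W where "W = {x. \<forall>v\<in>fixed_space K. inner x v = 0}"
  obtain \<alpha> where \<alpha>: "\<alpha> > 0" "\<And>x. x \<in> W \<Longrightarrow> \<alpha> * norm x \<le> norm (x - K x)"
    by (rule fixed_complement_lower_bound[OF K]) (simp add: W_def)
  have W: "subspace W" unfolding W_def by (intro subspaceI) (auto simp: inner_add_left)
  have "W = (\<Inter>v\<in>fixed_space K. {x. inner x v = 0})" unfolding W_def by auto
  moreover have "closed \<dots>" by (intro closed_INT ballI closed_Collect_eq continuous_intros)
  ultimately have Wc: "closed W" by simp
  have LW: "x - K x \<in> W" for x
    by (auto simp: W_def fixed_space_def inner_diff_left sym)
  define R where "R = (\<lambda>x. x - K x) ` W"
  have R: "subspace R"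
  proof -
    have "linear (\<lambda>x. x - K x)" by (intro linear_compose_sub linear_ident K.linear_axioms)
    then show ?thesis unfolding R_def by (rule linear_subspace_image[OF _ W])
  qed
  \<comment> \<open>The lower bound turns Cauchy images into Cauchy preimages.\<close>
  have Rc: "closed R"
    unfolding closed_sequential_limits
  proof clarify
    fix Y l assume "\<forall>n. Y n \<in> R" and Y: "Y \<longlonglongrightarrow> l"
    then have "\<forall>n. \<exists>x. x \<in> W \<and> Y n = x - K x" by (auto simp: R_def)
    then obtain X where X: "\<And>n. X n \<in> W" "\<And>n. Y n = X n - K (X n)" by metis
    have "Cauchy X"
    proof (rule metric_CauchyI)
      fix e :: real assume e: "e > 0"
      have "Cauchy Y" using Y by (simp add: LIMSEQ_imp_Cauchy)
      then obtain M where M: "\<forall>m\<ge>M. \<forall>n\<ge>M. dist (Y m) (Y n) < \<alpha> * e"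
        using metric_CauchyD[of Y "\<alpha> * e"] e \<alpha>(1) by auto
      have "dist (X m) (X n) < e" if "m \<ge> M" "n \<ge> M" for m n
      proof -
        have "X m - X n \<in> W" using X W by (simp add: subspace_diff)
        from \<alpha>(2)[OF this] have "\<alpha> * dist (X m) (X n) \<le> dist (Y m) (Y n)"
          by (simp add: X(2) dist_norm K.diff algebra_simps)
        also have "\<dots> < \<alpha> * e" using M that by blast
        finally show ?thesis using \<alpha>(1) by simp
      qed
      then show "\<exists>M. \<forall>m\<ge>M. \<forall>n\<ge>M. dist (X m) (X n) < e" by blast
    qed
    then obtain x where x: "X \<longlonglongrightarrow> x" using Cauchy_convergent convergent_def by blast
    have "x \<in> W" using closed_sequentially[OF Wc] X(1) x by blast
    moreover have "Y \<longlonglongrightarrow> x - K x" unfolding X(2) by (intro tendsto_intros x K.tendsto)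
    then have "l = x - K x" using Y LIMSEQ_unique by blast
    ultimately show "l \<in> R" unfolding R_def by blast
  qed
  obtain P where P: "bounded_linear P" "\<And>x. P x \<in> R" "\<And>x y. y \<in> R \<Longrightarrow> inner (P x) y = inner x y"
    by (rule orthogonal_projection[OF R Rc]) blast
  interpret P: bounded_linear P by fact
  have P_W: "inner (P y) \<phi> = inner y \<phi>" if \<phi>: "\<phi> \<in> W" for y \<phi>
  proof -
    \<comment> \<open>\<open>z\<close> is orthogonal to the range. Moving one factor
      \<open>1 - K\<close> across the inner product gives \<open>z = K z\<close>; being orthogonal
      to fixed vectors as well, \<open>z\<close> vanishes and \<phi> lies in the range.\<close>
    define z where "z = \<phi> - P \<phi>"
    have RW: "R \<subseteq> W" using LW by (auto simp: R_def)
    then have zW: "z \<in> W" using \<phi> P(2) W by (auto simp: z_def intro: subspace_diff)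
    have zR: "inner z x = 0" if "x \<in> R" for x using P(3)[OF that] by (simp add: z_def inner_diff_left)
    have "inner (z - K z) (z - K z) = inner z ((z - K z) - K (z - K z))"
      by (simp add: inner_diff_left sym inner_diff_right K.diff)
    also have "\<dots> = 0" using LW by (intro zR) (auto simp: R_def)
    finally have "z \<in> fixed_space K" by (simp add: fixed_space_def)
    then have "inner z z = 0" using zW by (simp add: W_def)
    then have "\<phi> \<in> R" using P(2)[of \<phi>] by (simp add: z_def)
    then show ?thesis using P(3) by blast
  qed
  have "\<exists>x\<in>W. x - K x = P y" for y using P(2)[of y] unfolding R_def by fastforce
  then obtain A where A: "\<And>y. A y \<in> W" "\<And>y. A y - K (A y) = P y" by metis
  have uniq: "x = A y" if "x \<in> W" "x - K x = P y" for x y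
  proof -
    have "x - A y \<in> W" using that A W by (simp add: subspace_diff)
    from \<alpha>(2)[OF this] have "\<alpha> * norm (x - A y) \<le> norm ((x - K x) - (A y - K (A y)))"
      by (simp add: K.diff algebra_simps)
    also have "\<dots> = 0" using that A(2) by simp
    finally show ?thesis using \<alpha>(1) by (simp add: mult_le_0_iff)
  qed
  have "A (x + y) = A x + A y" for x y
  proof (rule uniq[symmetric])
    have "A x + A y - K (A x + A y) = (A x - K (A x)) + (A y - K (A y))" by (simp add: K.add)
    then show "A x + A y - K (A x + A y) = P (x + y)" unfolding A(2) P.add .
  qed (intro subspace_add W A)
  moreover have "A (r *\<^sub>R y) = r *\<^sub>R A y" for r y
  proof (rule uniq[symmetric])
    have "r *\<^sub>R A y - K (r *\<^sub>R A y) = r *\<^sub>R (A y - K (A y))" by (simp add: K.scaleR scaleR_diff_right)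
    then show "r *\<^sub>R A y - K (r *\<^sub>R A y) = P (r *\<^sub>R y)" unfolding A(2) P.scaleR .
  qed (intro subspace_scale W A)
  moreover have "norm (A y) \<le> norm y * (C / \<alpha>)" if C: "\<And>x. norm (P x) \<le> norm x * C" for y C
  proof -
    have "\<alpha> * norm (A y) \<le> norm y * C" using \<alpha>(2)[OF A(1)[of y]] C[of y] unfolding A(2) by simp
    then show ?thesis using \<alpha>(1) by (simp add: pos_le_divide_eq mult.commute)
  qed
  moreover obtain C where "\<And>x. norm (P x) \<le> norm x * C" using P.bounded by blast
  ultimately have lin: "bounded_linear A" using bounded_linear_intro[of A "C / \<alpha>"] by blast
  show ?thesis
  proof (rule that[OF lin])
    show "inner (A y) v = 0" if "v \<in> fixed_space K" for y v using A(1)[of y] that by (simp add: W_def)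
    show "inner (A y - K (A y)) \<phi> = inner y \<phi>" if "\<forall>v\<in>fixed_space K. inner \<phi> v = 0" for y \<phi>
      using P_W[of \<phi> y] that by (simp add: W_def A(2))
  qed
qed

section \<open>Bifurcation from a product of eigenspaces\<close>

lemma vec_norm_le:
  fixes x :: "'a::real_normed_vector^'m::finite"
  assumes "\<And>i. norm (x $ i) \<le> c"
  shows "norm x \<le> real CARD('m) * c"
proof -
  have "norm x \<le> (\<Sum>i\<in>UNIV. norm (x $ i))"
    unfolding norm_vec_def by (rule L2_set_le_sum) simp
  also have "\<dots> \<le> (\<Sum>i\<in>(UNIV::'m set). c)" by (intro sum_mono assms)
  finally show ?thesis by simp
qed

lemmas norm_vec_nth_le = Finite_Cartesian_Product.norm_nth_le

lemma norm_vec_nth_diff_le: "norm (x $ i - y $ i) \<le> norm (x - y)"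
  using norm_vec_nth_le[of "x - y" i] by simp

text \<open>One subsequence is refined index by index; finitely many refinements make all components
  converge.\<close>

lemma compact_vec:
  fixes A :: "'m::finite \<Rightarrow> 'a::metric_space set"
  assumes "\<And>i. compact (A i)"
  shows "compact {x::'a^'m. \<forall>i. x $ i \<in> A i}"
  unfolding compact_eq_seq_compact_metric
proof (rule seq_compactI)
  fix X :: "nat \<Rightarrow> 'a^'m" assume X: "\<forall>n. X n \<in> {x. \<forall>i. x $ i \<in> A i}"
  have "\<exists>r::nat\<Rightarrow>nat. strict_mono r \<and> (\<forall>i\<in>D. \<exists>l\<in>A i. (\<lambda>n. X (r n) $ i) \<longlonglongrightarrow> l)" if "finite D" for D
    using that
  proof induction
    case empty
    show ?case by (intro exI[of _ id]) (auto simp: strict_mono_def)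
  next
    case (insert i D)
    then obtain r where r: "strict_mono r" "\<forall>i\<in>D. \<exists>l\<in>A i. (\<lambda>n. X (r n) $ i) \<longlonglongrightarrow> l" by blast
    have "seq_compact (A i)" using assms by (simp add: compact_eq_seq_compact_metric)
    then obtain l q where q: "l \<in> A i" "strict_mono q" "((\<lambda>n. X (r n) $ i) \<circ> q) \<longlonglongrightarrow> l"
      using X by (rule_tac seq_compactE[of "A i" "\<lambda>n. X (r n) $ i"]) auto
    have "\<exists>l\<in>A j. (\<lambda>n. X ((r \<circ> q) n) $ j) \<longlonglongrightarrow> l" if "j \<in> insert i D" for j
    proof (cases "j = i")
      case True with q show ?thesis by (auto simp: o_def)
    next
      case False
      with that r(2) obtain l where "l \<in> A j" "(\<lambda>n. X (r n) $ j) \<longlonglongrightarrow> l" by blast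
      with LIMSEQ_subseq_LIMSEQ[OF this(2) q(2)] show ?thesis by (auto simp: o_def)
    qed
    moreover have "strict_mono (r \<circ> q)" using r q by (simp add: strict_mono_o)
    ultimately show ?case by blast
  qed
  from this[of UNIV] obtain r where r: "strict_mono r" "\<forall>i. \<exists>l. l \<in> A i \<and> (\<lambda>n. X (r n) $ i) \<longlonglongrightarrow> l"
    by (auto simp: Bex_def)
  then obtain l where l: "\<And>i. l i \<in> A i" "\<And>i. (\<lambda>n. X (r n) $ i) \<longlonglongrightarrow> l i" by metis
  have "(X \<circ> r) \<longlonglongrightarrow> (\<chi> i. l i)" by (rule vec_tendstoI) (use l in \<open>simp add: o_def\<close>)
  with r l show "\<exists>l\<in>{x. \<forall>i. x $ i \<in> A i}. \<exists>r. strict_mono r \<and> (X \<circ> r) \<longlonglongrightarrow> l"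
    by (intro bexI[of _ "\<chi> i. l i"]) auto
qed

text \<open>Multiply by the conjugate: on this range the two roots add up to at least 1. It makes
  the radial coefficient of the reduction Lipschitz.\<close>

lemma sqrt_one_minus_lipschitz:
  fixes p q :: real
  assumes "p \<le> 1/2" "q \<le> 1/2"
  shows "\<bar>sqrt (1 - p) - sqrt (1 - q)\<bar> \<le> \<bar>p - q\<bar>"
proof -
  have "sqrt (1/4) \<le> sqrt (1 - p)" "sqrt (1/4) \<le> sqrt (1 - q)" using assms by (auto intro!: real_sqrt_le_mono)
  then have half: "1/2 \<le> sqrt (1 - p)" "1/2 \<le> sqrt (1 - q)" by (auto simp: real_sqrt_divide)
  have "(sqrt (1 - p) - sqrt (1 - q)) * (sqrt (1 - p) + sqrt (1 - q)) = q - p"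
    using assms by (simp add: algebra_simps real_sqrt_mult_self abs_if)
  then have "\<bar>sqrt (1 - p) - sqrt (1 - q)\<bar> * (sqrt (1 - p) + sqrt (1 - q)) = \<bar>p - q\<bar>"
    using half by (metis abs_minus_commute abs_mult abs_of_nonneg add_nonneg_nonneg real_sqrt_ge_zero
        order_trans zero_le_divide_1_iff zero_le_numeral)
  moreover have "\<bar>sqrt (1 - p) - sqrt (1 - q)\<bar> * 1 \<le> \<bar>sqrt (1 - p) - sqrt (1 - q)\<bar> * (sqrt (1 - p) + sqrt (1 - q))"
    using half by (intro mult_left_mono) auto
  ultimately show ?thesis by simp
qed

lemma inner_diff_bound:
  fixes a b c d :: "'a::real_inner"
  shows "\<bar>inner a b - inner c d\<bar> \<le> norm (a - c) * norm b + norm c * norm (b - d)"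
proof -
  have "inner a b - inner c d = inner (a - c) b + inner c (b - d)"
    by (simp add: inner_diff_left inner_diff_right)
  also have "\<bar>\<dots>\<bar> \<le> \<bar>inner (a - c) b\<bar> + \<bar>inner c (b - d)\<bar>" by (rule abs_triangle_ineq)
  also have "\<dots> \<le> norm (a - c) * norm b + norm c * norm (b - d)"
    by (intro add_mono Cauchy_Schwarz_ineq2)
  finally show ?thesis .
qed

lemma bounded_linear_common_bound:
  fixes f :: "'m::finite \<Rightarrow> 'a::real_normed_vector \<Rightarrow> 'b::real_normed_vector"
  assumes "\<And>i. bounded_linear (f i)"
  obtains c where "c \<ge> 1" "\<And>i x. norm (f i x) \<le> norm x * c"
proof -
  have "\<forall>i. \<exists>c. \<forall>x. norm (f i x) \<le> norm x * c" using bounded_linear.bounded[OF assms] by blast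
  then obtain g where g: "\<And>i x. norm (f i x) \<le> norm x * g i" by metis
  define c where "c = Max (insert 1 (range g))"
  have c: "c \<ge> 1" "g i \<le> c" for i unfolding c_def by (intro Max_ge; simp)+
  have "norm (f i x) \<le> norm x * c" for i x
    using g[of i x] mult_left_mono[OF c(2)[of i], of "norm x"] by simp
  with c(1) show ?thesis by (rule that)
qed

text \<open>The system at a candidate point. \<open>K i\<close> already contains the factor that
  turns the eigenvalue into 1, and nonzero fixed points are demanded for the active indices
  \<open>I\<close> alone. \<open>N_grad\<close> says that \<open>N\<close> is the gradient of
  \<open>F\<close> through a Taylor estimate uniform on balls, a form that can be composed with maps
  that are merely Lipschitz.\<close>

locale gradient_system =
  fixes K :: "'m::finite \<Rightarrow> 'h::{real_inner,complete_space} \<Rightarrow> 'h"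
    and N :: "'h^'m \<Rightarrow> 'h^'m" and F :: "'h^'m \<Rightarrow> real" and I :: "'m set"
  assumes lin: "\<And>i. bounded_linear (K i)"
    and cpt: "\<And>i. compact_operator (K i)"
    and sym: "\<And>i x y. inner (K i x) y = inner x (K i y)"
    and ker: "\<And>i. i \<in> I \<Longrightarrow> \<exists>v. v \<noteq> 0 \<and> K i v = v"
    and N_lip: "\<And>R. \<exists>C. \<forall>U V. norm U \<le> R \<longrightarrow> norm V \<le> R \<longrightarrow> norm (N U - N V) \<le> C * norm (U - V)"
    and N_grad: "\<And>R. \<exists>C. \<forall>U V. norm U \<le> R \<longrightarrow> norm V \<le> R \<longrightarrow>
       \<bar>F V - F U - inner (N U) (V - U)\<bar> \<le> C * (norm (V - U))\<^sup>2"
begin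

text \<open>On a fixed space <K v, v> = |v|^2, so unit vectors satisfy the normalisation to leading
  order in the reduction. Inactive components are pinned to 0, which lets all choices of
  \<open>I\<close> share one ambient space.\<close>

definition spheres :: "('h^'m) set" where
  "spheres = {v. \<forall>i. v $ i \<in> (if i \<in> I then {x \<in> fixed_space (K i). norm x = 1} else {0})}"

text \<open>Defect of the equation after scaling the unknown by \<rho>: \<open>s\<close> will be
  \<open>\<rho>\<^sup>2\<close>, and \<open>\<tau> i\<close> is the multiplier of the constraint
  <K_i U_i, U_i> = 1.\<close>

definition residual :: "real \<Rightarrow> ('m \<Rightarrow> real) \<Rightarrow> 'h^'m \<Rightarrow> 'm \<Rightarrow> 'h" where
  "residual s \<tau> U i = U $ i - K i (U $ i) - s *\<^sub>R N U $ i - \<tau> i *\<^sub>R K i (U $ i)"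

lemma compact_spheres: "compact spheres"
  unfolding spheres_def by (intro compact_vec) (simp add: compact_fixed_sphere lin cpt)

lemma spheres_nonempty: "spheres \<noteq> {}"
proof -
  have "\<exists>x. x \<in> (if i \<in> I then {x \<in> fixed_space (K i). norm x = 1} else {0})" for i
  proof (cases "i \<in> I")
    case True
    with ker obtain v where v: "v \<noteq> 0" "K i v = v" by blast
    interpret bounded_linear "K i" by (rule lin)
    have "(1 / norm v) *\<^sub>R v \<in> {x \<in> fixed_space (K i). norm x = 1}"
      using v by (simp add: fixed_space_def scaleR)
    then show ?thesis using True by auto
  qed auto
  then obtain f where "\<And>i. f i \<in> (if i \<in> I then {x \<in> fixed_space (K i). norm x = 1} else {0})" by metis
  then have "(\<chi> i. f i) \<in> spheres" unfolding spheres_def by simp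
  then show ?thesis by blast
qed

text \<open>The equation tested with \<open>G v $ i\<close> determines the multiplier \<open>\<tau> v i\<close>. What remains is the part of the
  residual tangent to the spheres, and it vanishes where the energy of \<open>G v\<close> is minimal.\<close>

definition reduced :: "real \<Rightarrow> real \<Rightarrow> ('h^'m \<Rightarrow> 'h^'m) \<Rightarrow> ('h^'m \<Rightarrow> 'm \<Rightarrow> real) \<Rightarrow> bool" where
  "reduced C \<rho> G \<tau> \<longleftrightarrow>
     (\<forall>v\<in>spheres. norm (G v) \<le> C \<and> (\<forall>i. i \<notin> I \<longrightarrow> G v $ i = 0) \<and>
        (\<forall>i\<in>I. inner (K i (G v $ i)) (G v $ i) = 1 \<and> \<bar>\<tau> v i\<bar> \<le> C * \<rho>\<^sup>2 \<and>
          (\<exists>r\<ge>1/2. \<forall>x\<in>fixed_space (K i). inner (G v $ i - r *\<^sub>R v $ i) x = 0) \<and>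
          (\<forall>\<phi>. (\<forall>x\<in>fixed_space (K i). inner \<phi> x = 0) \<longrightarrow> inner (residual (\<rho>\<^sup>2) (\<tau> v) (G v) i) \<phi> = 0) \<and>
          inner (residual (\<rho>\<^sup>2) (\<tau> v) (G v) i) (G v $ i) = 0)) \<and>
     (\<forall>v\<in>spheres. \<forall>v'\<in>spheres. norm (G v - G v') \<le> C * norm (v - v'))"

section \<open>Lyapunov-Schmidt reduction by a contraction\<close>

text \<open>Ansatz \<open>U = r v + w\<close> with \<open>w\<close> orthogonal to the fixed spaces.
  The constraint determines \<open>r\<close>, the equation tested with \<open>U\<close> determines
  the multiplier \<open>t\<close>, and the orthogonal part of the equation becomes the fixed point
  problem \<open>w = \<Psi> v w\<close>. On the ball of radius \<rho> the map \<Psi> has size of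
  order \<open>\<rho>\<^sup>2\<close> and Lipschitz constant of order \<rho>, so a small \<rho>
  yields a contraction uniformly in \<open>v\<close>.\<close>

lemma lyapunov_schmidt_reduction:
  obtains C \<rho>\<^sub>0 where "\<rho>\<^sub>0 > 0" "\<And>\<rho>. 0 < \<rho> \<Longrightarrow> \<rho> < \<rho>\<^sub>0 \<Longrightarrow> \<exists>G \<tau>. reduced C \<rho> G \<tau>"
proof -
  obtain \<kappa> where \<kappa>: "\<kappa> \<ge> 1" "\<And>i x. norm (K i x) \<le> norm x * \<kappa>"
    by (rule bounded_linear_common_bound[of K, OF lin]) blast
  define perp where "perp i = {\<phi>. \<forall>x\<in>fixed_space (K i). inner \<phi> x = 0}" for i
  have "\<exists>A. bounded_linear A \<and> (\<forall>y. A y \<in> perp i) \<and>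
      (\<forall>y. \<forall>\<phi>\<in>perp i. inner (A y - K i (A y)) \<phi> = inner y \<phi>)" for i
    by (rule fredholm_partial_inverse[OF lin[of i] cpt[of i] sym]) (auto simp: perp_def)
  then obtain A where A: "\<And>i. bounded_linear (A i)" "\<And>i y. A i y \<in> perp i"
    "\<And>i y \<phi>. \<phi> \<in> perp i \<Longrightarrow> inner (A i y - K i (A i y)) \<phi> = inner y \<phi>" by metis
  obtain a where a: "a \<ge> 1" "\<And>i x. norm (A i x) \<le> norm x * a"
    by (rule bounded_linear_common_bound[of A, OF A(1)]) blast
  define m where "m = real CARD('m)"
  have m: "m \<ge> 1" unfolding m_def using zero_less_card_finite[where 'a='m] by linarith
  \<comment> \<open>Each component of the ansatz has norm at most 2 * 1 + 1: radial coefficient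
    times unit vector, plus \<open>w\<close>.\<close>
  define R where "R = m * 3"
  obtain L where L: "L \<ge> 1" "\<And>U V. norm U \<le> R \<Longrightarrow> norm V \<le> R \<Longrightarrow> norm (N U - N V) \<le> L * norm (U - V)"
  proof -
    from N_lip[of R] obtain c where c: "\<And>U V. norm U \<le> R \<Longrightarrow> norm V \<le> R \<Longrightarrow> norm (N U - N V) \<le> c * norm (U - V)" by blast
    have "norm (N U - N V) \<le> max 1 c * norm (U - V)" if "norm U \<le> R" "norm V \<le> R" for U V
      by (rule order_trans[OF c[OF that]]) (simp add: mult_right_mono)
    then show ?thesis by (intro that[of "max 1 c"]) auto
  qed
  define M where "M = norm (N 0) + L * R"
  have R: "R \<ge> 1" using m by (simp add: R_def)
  have M: "M \<ge> 1" "norm (N U) \<le> M" if "norm U \<le> R" for U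
  proof -
    have "1 * 1 \<le> L * R" using L R by (intro mult_mono) auto
    then show "M \<ge> 1" by (simp add: M_def add_increasing)
    have "norm (N U) \<le> norm (N 0) + norm (N U - N 0)" by norm
    also have "norm (N U - N 0) \<le> L * norm (U - 0)" using that R by (intro L) auto
    also have "\<dots> \<le> L * R" using that L by (intro mult_left_mono) auto
    finally show "norm (N U) \<le> M" by (simp add: M_def)
  qed
  have M1: "M \<ge> 1" using M(1)[of 0] R by simp
  \<comment> \<open>\<open>T * \<rho>\<^sup>2\<close> bounds the multiplier and
    \<open>T' * \<rho>\<close> is its Lipschitz constant; \<open>B\<^sub>1 * \<rho>\<^sup>2\<close>
    and \<open>B\<^sub>2 * \<rho>\<close> do the same for \<Psi>.\<close>
  define T where "T = 1 + \<kappa> + M * R"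
  define T' where "T' = 2 * (1 + \<kappa>) + 2 * m * (L * R + M)"
  define B\<^sub>1 where "B\<^sub>1 = m * (a * (M + T * \<kappa>))"
  define B\<^sub>2 where "B\<^sub>2 = m * (a * (2 * m * L + T' * \<kappa> + T * \<kappa>))"
  define B where "B = B\<^sub>1 + B\<^sub>2"
  have T: "T \<ge> 1" "T' \<ge> 0" using \<kappa> M1 R L m by (auto simp: T_def T'_def)
  have B12: "B\<^sub>1 \<ge> 1" "B\<^sub>2 \<ge> 0"
  proof -
    have "1 * (1 * (1 + 0)) \<le> m * (a * (M + T * \<kappa>))"
      using m a M1 T \<kappa> by (intro mult_mono add_mono) auto
    then show "B\<^sub>1 \<ge> 1" by (simp add: B\<^sub>1_def)
    show "B\<^sub>2 \<ge> 0" using m a L T \<kappa> by (auto simp: B\<^sub>2_def)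
  qed
  \<comment> \<open>The first bound keeps |<K w, w>| below 1/2, as the square root in
    \<open>r\<close> requires; the second makes \<Psi> a self-map and a contraction with factor
    1/2.\<close>
  define \<rho>\<^sub>0 where "\<rho>\<^sub>0 = min (1 / (2 * \<kappa>)) (1 / (2 * B))"
  \<comment> \<open>One constant for three purposes: \<open>R\<close> bounds the solution,
    \<open>T\<close> the multiplier, and \<open>4 * m\<close> is the Lipschitz constant in
    \<open>v\<close>.\<close>
  define C where "C = R + T + 4 * m"
  have "\<exists>G \<tau>. reduced C \<rho> G \<tau>" if \<rho>: "0 < \<rho>" "\<rho> < \<rho>\<^sub>0" for \<rho>
  proof -
    have \<kappa>\<rho>: "2 * \<kappa> * \<rho> \<le> 1" and B\<rho>: "2 * B * \<rho> \<le> 1"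
      using \<rho> \<kappa> B12 by (auto simp: \<rho>\<^sub>0_def B_def field_simps)
    have "1 * \<rho> \<le> \<kappa> * \<rho>" using \<kappa> \<rho> by (intro mult_right_mono) auto
    then have \<rho>1: "\<rho> \<le> 1" using \<kappa>\<rho> by linarith
    have \<rho>2: "\<rho>\<^sup>2 \<le> \<rho>" "\<rho>\<^sup>2 \<ge> 0" using \<rho> \<rho>1 by (auto simp: power2_eq_square mult_left_le)
    define D where "D = {w::'h^'m. (\<forall>i. w $ i \<in> perp i) \<and> (\<forall>i. i \<notin> I \<longrightarrow> w $ i = 0) \<and> norm w \<le> \<rho>}"
    \<comment> \<open>As \<open>K v = v\<close> and \<open>w\<close> is orthogonal to
      \<open>v\<close>, the mixed terms vanish and <K U, U> = r^2 + <K w, w>; this \<open>r\<close>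
      makes the sum 1.\<close>
    define r where "r w i = sqrt (1 - inner (K i (w $ i)) (w $ i))" for w :: "'h^'m" and i
    define U where "U v w = (\<chi> i. if i \<in> I then r w i *\<^sub>R v $ i + w $ i else 0)" for v w :: "'h^'m"
    define q where "q w i = inner (w $ i - K i (w $ i)) (w $ i)" for w :: "'h^'m" and i
    \<comment> \<open>Because <K U, U> = 1, testing the equation with \<open>U\<close> isolates the
      multiplier.\<close>
    define t where "t v w i = q w i - \<rho>\<^sup>2 * inner (N (U v w) $ i) (U v w $ i)" for v w i
    \<comment> \<open>The part \<open>r v\<close> of \<open>K U\<close> lies in the fixed space and
      is invisible to orthogonal test vectors, so only \<open>K w\<close> accompanies the
      multiplier.\<close>
    define \<Psi> where "\<Psi> v w = (\<chi> i. if i \<in> I then A i (\<rho>\<^sup>2 *\<^sub>R N (U v w) $ i + t v w i *\<^sub>R K i (w $ i)) else 0)" for v w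
    have wi: "norm (w $ i) \<le> \<rho>" if "w \<in> D" for w i
      using that norm_vec_nth_le[of w i] by (simp add: D_def)
    have Kw: "norm (K i (w $ i)) \<le> \<kappa> * \<rho>" if "w \<in> D" for w i
    proof -
      have "norm (w $ i) * \<kappa> \<le> \<rho> * \<kappa>" using wi[OF that] \<kappa>(1) by (intro mult_right_mono) auto
      with \<kappa>(2)[of i "w $ i"] show ?thesis by (simp add: mult.commute)
    qed
    have Kwd: "norm (K i (w $ i) - K i (w' $ i)) \<le> \<kappa> * norm (w - w')" for w w' :: "'h^'m" and i
    proof -
      interpret bounded_linear "K i" by (rule lin)
      have "norm (K i (w $ i) - K i (w' $ i)) \<le> norm ((w - w') $ i) * \<kappa>"
        using \<kappa>(2)[of i "(w - w') $ i"] by (simp add: diff)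
      also have "\<dots> \<le> norm (w - w') * \<kappa>" using \<kappa> norm_vec_nth_diff_le by (intro mult_right_mono) auto
      finally show ?thesis by (simp add: mult.commute)
    qed
    have Kww: "\<bar>inner (K i (w $ i)) (w $ i)\<bar> \<le> 1/2" if "w \<in> D" for w i
    proof -
      have "\<bar>inner (K i (w $ i)) (w $ i)\<bar> \<le> norm (K i (w $ i)) * norm (w $ i)" by (rule Cauchy_Schwarz_ineq2)
      also have "\<dots> \<le> (\<kappa> * \<rho>) * 1" using Kw[OF that] wi[OF that, of i] \<rho>1 \<rho> \<kappa> by (intro mult_mono) auto
      finally show ?thesis using \<kappa>\<rho> by linarith
    qed
    have rb: "1/2 \<le> r w i" "r w i \<le> 2" "(r w i)\<^sup>2 = 1 - inner (K i (w $ i)) (w $ i)" if "w \<in> D" for w i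
    proof -
      have "sqrt (1/4) \<le> r w i" "r w i \<le> sqrt 4"
        unfolding r_def using Kww[OF that, of i] unfolding abs_le_iff by (intro real_sqrt_le_mono; simp)+
      then show "1/2 \<le> r w i" "r w i \<le> 2" by (auto simp: real_sqrt_divide)
      show "(r w i)\<^sup>2 = 1 - inner (K i (w $ i)) (w $ i)"
        unfolding r_def using Kww[OF that, of i] by (intro real_sqrt_pow2) auto
    qed
    have rd: "\<bar>r w i - r w' i\<bar> \<le> norm (w - w')" if "w \<in> D" "w' \<in> D" for w w' i
    proof -
      have "\<bar>r w i - r w' i\<bar> \<le> \<bar>inner (K i (w $ i)) (w $ i) - inner (K i (w' $ i)) (w' $ i)\<bar>"
        unfolding r_def using Kww[OF that(1), of i] Kww[OF that(2), of i] by (intro sqrt_one_minus_lipschitz) auto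
      also have "\<dots> \<le> norm (K i (w $ i) - K i (w' $ i)) * norm (w $ i) + norm (K i (w' $ i)) * norm (w $ i - w' $ i)"
        by (rule inner_diff_bound)
      also have "\<dots> \<le> (\<kappa> * norm (w - w')) * \<rho> + (\<kappa> * \<rho>) * norm (w - w')"
        using Kwd Kw[OF that(2), of i] wi[OF that(1), of i] norm_vec_nth_le[of "w - w'" i] \<kappa> \<rho>
        by (intro add_mono mult_mono) auto
      also have "\<dots> = (2 * \<kappa> * \<rho>) * norm (w - w')" by simp
      also have "\<dots> \<le> 1 * norm (w - w')" using \<kappa>\<rho> by (intro mult_right_mono) auto
      finally show ?thesis by simp
    qed
    have vi: "norm (v $ i) = 1" "v $ i \<in> fixed_space (K i)" if "v \<in> spheres" "i \<in> I" for v i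
      using that by (auto simp: spheres_def dest: spec[of _ i])
    have UR: "norm (U v w $ i) \<le> 3" "norm (U v w) \<le> R" if "v \<in> spheres" "w \<in> D" for v w i
    proof -
      have *: "norm (U v w $ i) \<le> 3" for i
      proof (cases "i \<in> I")
        case True
        have "norm (U v w $ i) \<le> \<bar>r w i\<bar> * norm (v $ i) + norm (w $ i)"
          using True norm_triangle_ineq[of "r w i *\<^sub>R v $ i" "w $ i"] by (simp add: U_def)
        also have "\<dots> \<le> 2 * 1 + 1"
          using rb[OF that(2), of i] vi(1)[OF that(1) True] wi[OF that(2), of i] \<rho>1 by auto
        finally show ?thesis by simp
      qed (simp add: U_def)
      then show "norm (U v w $ i) \<le> 3" by simp
      show "norm (U v w) \<le> R" unfolding R_def m_def by (intro vec_norm_le *)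
    qed
    have Ud: "norm (U v w - U v' w') \<le> 2 * m * (norm (v - v') + norm (w - w'))"
      if "v \<in> spheres" "v' \<in> spheres" "w \<in> D" "w' \<in> D" for v v' w w'
    proof -
      have "norm ((U v w - U v' w') $ i) \<le> 2 * (norm (v - v') + norm (w - w'))" for i
      proof (cases "i \<in> I")
        case True
        have "(U v w - U v' w') $ i = r w i *\<^sub>R (v - v') $ i + (r w i - r w' i) *\<^sub>R v' $ i + (w - w') $ i"
          using True by (simp add: U_def algebra_simps)
        also have "norm \<dots> \<le> \<bar>r w i\<bar> * norm ((v - v') $ i) + \<bar>r w i - r w' i\<bar> * norm (v' $ i) + norm ((w - w') $ i)"
          by (intro norm_triangle_le add_mono) auto
        also have "\<dots> \<le> 2 * norm (v - v') + norm (w - w') * 1 + norm (w - w')"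
          using rb[OF that(3), of i] rd[OF that(3,4), of i] vi(1)[OF that(2) True]
            norm_vec_nth_le[of "v - v'" i] norm_vec_nth_le[of "w - w'" i]
          by (intro add_mono mult_mono) auto
        finally show ?thesis by simp
      next
        case False
        then show ?thesis by (simp add: U_def)
      qed
      from vec_norm_le[of "U v w - U v' w'", OF this] show ?thesis by (simp add: m_def algebra_simps)
    qed
    have Nb: "norm (N (U v w) $ i) \<le> M" if "v \<in> spheres" "w \<in> D" for v w i
      using M(2)[OF UR(2)[OF that]] norm_vec_nth_le[of "N (U v w)" i] by linarith
    have Nd: "norm (N (U v w) $ i - N (U v' w') $ i) \<le> L * (2 * m * (norm (v - v') + norm (w - w')))"
      if "v \<in> spheres" "v' \<in> spheres" "w \<in> D" "w' \<in> D" for v v' w w' i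
    proof -
      have "norm (N (U v w) $ i - N (U v' w') $ i) \<le> norm (N (U v w) - N (U v' w'))"
        using norm_vec_nth_le[of "N (U v w) - N (U v' w')" i] by simp
      also have "\<dots> \<le> L * norm (U v w - U v' w')" using that by (intro L UR)
      also have "\<dots> \<le> L * (2 * m * (norm (v - v') + norm (w - w')))"
        using Ud[OF that] L by (intro mult_left_mono) auto
      finally show ?thesis .
    qed
    have tb: "\<bar>t v w i\<bar> \<le> T * \<rho>\<^sup>2" if "v \<in> spheres" "w \<in> D" for v w i
    proof -
      \<comment> \<open>\<open>q\<close> is quadratic in \<open>w\<close>, hence of order
        \<open>\<rho>\<^sup>2\<close> like the term with \<open>N\<close>.\<close>
      have "\<bar>q w i\<bar> \<le> norm (w $ i - K i (w $ i)) * norm (w $ i)" unfolding q_def by (rule Cauchy_Schwarz_ineq2)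
      also have "\<dots> \<le> (\<rho> + \<kappa> * \<rho>) * \<rho>"
        using wi[OF that(2), of i] Kw[OF that(2), of i] \<rho> \<kappa> norm_triangle_ineq4[of "w $ i" "K i (w $ i)"]
        by (intro mult_mono) auto
      finally have 1: "\<bar>q w i\<bar> \<le> (1 + \<kappa>) * \<rho>\<^sup>2" by (simp add: power2_eq_square algebra_simps)
      have "\<bar>inner (N (U v w) $ i) (U v w $ i)\<bar> \<le> norm (N (U v w) $ i) * norm (U v w $ i)" by (rule Cauchy_Schwarz_ineq2)
      also have "\<dots> \<le> M * R"
        using Nb[OF that, of i] UR(2)[OF that] norm_vec_nth_le[of "U v w" i] M1 by (intro mult_mono) auto
      finally have "\<rho>\<^sup>2 * \<bar>inner (N (U v w) $ i) (U v w $ i)\<bar> \<le> \<rho>\<^sup>2 * (M * R)" by (intro mult_left_mono) auto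
      then have "\<bar>\<rho>\<^sup>2 * inner (N (U v w) $ i) (U v w $ i)\<bar> \<le> \<rho>\<^sup>2 * (M * R)" by (simp add: abs_mult)
      with 1 have "\<bar>t v w i\<bar> \<le> (1 + \<kappa>) * \<rho>\<^sup>2 + \<rho>\<^sup>2 * (M * R)" unfolding t_def by linarith
      then show ?thesis by (simp add: T_def algebra_simps)
    qed
    have td: "\<bar>t v w i - t v' w' i\<bar> \<le> T' * \<rho> * (norm (v - v') + norm (w - w'))"
      if "v \<in> spheres" "v' \<in> spheres" "w \<in> D" "w' \<in> D" for v v' w w' i
    proof -
      define \<Delta> where "\<Delta> = norm (v - v') + norm (w - w')"
      have \<Delta>: "\<Delta> \<ge> 0" "norm (w - w') \<le> \<Delta>" by (auto simp: \<Delta>_def)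
      \<comment> \<open>On a ball of radius \<rho> a quadratic form has Lipschitz constant of order
        \<rho>; this is the smallness that the contraction needs.\<close>
      have "\<bar>q w i - q w' i\<bar> \<le> norm ((w $ i - K i (w $ i)) - (w' $ i - K i (w' $ i))) * norm (w $ i)
          + norm (w' $ i - K i (w' $ i)) * norm (w $ i - w' $ i)" unfolding q_def by (rule inner_diff_bound)
      also have "\<dots> \<le> ((1 + \<kappa>) * \<Delta>) * \<rho> + (\<rho> + \<kappa> * \<rho>) * \<Delta>"
      proof (intro add_mono mult_mono)
        have "norm ((w $ i - K i (w $ i)) - (w' $ i - K i (w' $ i))) \<le> norm ((w - w') $ i) + norm (K i (w $ i) - K i (w' $ i))"
          using norm_triangle_ineq4[of "(w - w') $ i" "K i (w $ i) - K i (w' $ i)"] by (simp add: algebra_simps)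
        also have "\<dots> \<le> norm (w - w') + \<kappa> * norm (w - w')" using Kwd norm_vec_nth_diff_le by (intro add_mono) auto
        also have "\<dots> \<le> \<Delta> + \<kappa> * \<Delta>" using \<Delta> \<kappa> by (intro add_mono mult_left_mono) auto
        finally show "norm ((w $ i - K i (w $ i)) - (w' $ i - K i (w' $ i))) \<le> (1 + \<kappa>) * \<Delta>" by (simp add: algebra_simps)
        show "norm (w' $ i - K i (w' $ i)) \<le> \<rho> + \<kappa> * \<rho>"
          using wi[OF that(4), of i] Kw[OF that(4), of i] norm_triangle_ineq4[of "w' $ i" "K i (w' $ i)"] by linarith
        show "norm (w $ i - w' $ i) \<le> \<Delta>" using norm_vec_nth_le[of "w - w'" i] \<Delta> by simp
      qed (use wi[OF that(3)] \<rho> \<kappa> \<Delta> in auto)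
      finally have 1: "\<bar>q w i - q w' i\<bar> \<le> 2 * (1 + \<kappa>) * (\<rho> * \<Delta>)" by (simp add: algebra_simps)
      have "\<bar>inner (N (U v w) $ i) (U v w $ i) - inner (N (U v' w') $ i) (U v' w' $ i)\<bar>
          \<le> norm (N (U v w) $ i - N (U v' w') $ i) * norm (U v w $ i)
            + norm (N (U v' w') $ i) * norm (U v w $ i - U v' w' $ i)" by (rule inner_diff_bound)
      also have "\<dots> \<le> (L * (2 * m * \<Delta>)) * R + M * (2 * m * \<Delta>)"
        using Nd[OF that, of i] Nb[OF that(2,4), of i] UR(2)[OF that(1,3)] Ud[OF that] L m \<Delta> M1
          norm_vec_nth_le[of "U v w" i] norm_vec_nth_le[of "U v w - U v' w'" i]
        by (intro add_mono mult_mono) (auto simp: \<Delta>_def)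
      also have "\<dots> = 2 * m * (L * R + M) * \<Delta>" by (simp add: algebra_simps)
      finally have "\<rho>\<^sup>2 * \<bar>inner (N (U v w) $ i) (U v w $ i) - inner (N (U v' w') $ i) (U v' w' $ i)\<bar>
          \<le> \<rho> * (2 * m * (L * R + M) * \<Delta>)" using \<rho>2 \<rho> by (intro mult_mono) auto
      then have "\<bar>\<rho>\<^sup>2 * inner (N (U v w) $ i) (U v w $ i) - \<rho>\<^sup>2 * inner (N (U v' w') $ i) (U v' w' $ i)\<bar>
          \<le> 2 * m * (L * R + M) * (\<rho> * \<Delta>)"
        by (simp add: abs_mult right_diff_distrib[symmetric] mult.left_commute)
      with 1 have "\<bar>t v w i - t v' w' i\<bar> \<le> 2 * (1 + \<kappa>) * (\<rho> * \<Delta>) + 2 * m * (L * R + M) * (\<rho> * \<Delta>)"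
        unfolding t_def by linarith
      also have "\<dots> = T' * \<rho> * \<Delta>" unfolding T'_def by (simp only: distrib_right mult.assoc)
      finally show ?thesis by (simp add: \<Delta>_def)
    qed
    have \<Psi>b: "norm (\<Psi> v w) \<le> \<rho>" if "v \<in> spheres" "w \<in> D" for v w
    proof -
      have "norm (\<Psi> v w $ i) \<le> a * (M + T * \<kappa>) * \<rho>\<^sup>2" for i
      proof (cases "i \<in> I")
        case True
        have "norm (\<Psi> v w $ i) \<le> norm (\<rho>\<^sup>2 *\<^sub>R N (U v w) $ i + t v w i *\<^sub>R K i (w $ i)) * a"
          using True a(2) by (simp add: \<Psi>_def)
        also have "\<dots> \<le> (\<rho>\<^sup>2 * M + (T * \<rho>\<^sup>2) * \<kappa>) * a"
        proof (intro mult_right_mono norm_triangle_le add_mono)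
          show "norm (\<rho>\<^sup>2 *\<^sub>R N (U v w) $ i) \<le> \<rho>\<^sup>2 * M" using Nb[OF that, of i] by (simp add: mult_left_mono)
          have "\<kappa> * \<rho> \<le> \<kappa> * 1" using \<kappa> \<rho>1 by (intro mult_left_mono) auto
          then show "norm (t v w i *\<^sub>R K i (w $ i)) \<le> (T * \<rho>\<^sup>2) * \<kappa>"
            using tb[OF that, of i] Kw[OF that(2), of i] T by (auto intro!: mult_mono)
        qed (use a in auto)
        finally show ?thesis by (simp add: algebra_simps)
      next
        case False
        then show ?thesis using a M1 T \<kappa> by (auto simp: \<Psi>_def)
      qed
      from vec_norm_le[of "\<Psi> v w", OF this] have "norm (\<Psi> v w) \<le> B\<^sub>1 * \<rho>\<^sup>2"
        by (simp add: m_def B\<^sub>1_def mult.assoc)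
      also have "\<dots> \<le> (2 * B) * \<rho>\<^sup>2" using B12 by (intro mult_right_mono) (simp_all add: B_def)
      also have "\<dots> = (2 * B * \<rho>) * \<rho>" by (simp add: power2_eq_square)
      also have "\<dots> \<le> 1 * \<rho>" using B\<rho> \<rho> by (intro mult_right_mono) auto
      finally show ?thesis by simp
    qed
    \<comment> \<open>For \<open>v = v'\<close> this is the contraction property; with both
      arguments varying it also controls how the fixed point depends on \<open>v\<close>.\<close>
    have \<Psi>d: "norm (\<Psi> v w - \<Psi> v' w') \<le> 1/2 * (norm (v - v') + norm (w - w'))"
      if "v \<in> spheres" "v' \<in> spheres" "w \<in> D" "w' \<in> D" for v v' w w'
    proof -
      define \<Delta> where "\<Delta> = norm (v - v') + norm (w - w')"
      have \<Delta>: "\<Delta> \<ge> 0" "norm (w - w') \<le> \<Delta>" by (auto simp: \<Delta>_def)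
      have "norm ((\<Psi> v w - \<Psi> v' w') $ i) \<le> a * (2 * m * L + T' * \<kappa> + T * \<kappa>) * (\<rho> * \<Delta>)" for i
      proof (cases "i \<in> I")
        case True
        interpret A: bounded_linear "A i" by (rule A)
        have "(\<Psi> v w - \<Psi> v' w') $ i = A i (\<rho>\<^sup>2 *\<^sub>R (N (U v w) $ i - N (U v' w') $ i)
            + (t v w i - t v' w' i) *\<^sub>R K i (w $ i) + t v' w' i *\<^sub>R (K i (w $ i) - K i (w' $ i)))" (is "_ = A i ?x")
          using True by (simp add: \<Psi>_def A.diff[symmetric] algebra_simps)
        then have "norm ((\<Psi> v w - \<Psi> v' w') $ i) \<le> norm ?x * a" using a(2) by simp
        also have "norm ?x \<le> \<rho> * (L * (2 * m * \<Delta>)) + (T' * \<rho> * \<Delta>) * \<kappa> + (T * \<rho>) * (\<kappa> * \<Delta>)"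
        proof (intro norm_triangle_le add_mono)
          show "norm (\<rho>\<^sup>2 *\<^sub>R (N (U v w) $ i - N (U v' w') $ i)) \<le> \<rho> * (L * (2 * m * \<Delta>))"
            using Nd[OF that, of i] \<rho>2 \<rho> by (auto simp: \<Delta>_def intro!: mult_mono)
          have "\<kappa> * \<rho> \<le> \<kappa> * 1" using \<kappa> \<rho>1 by (intro mult_left_mono) auto
          then show "norm ((t v w i - t v' w' i) *\<^sub>R K i (w $ i)) \<le> (T' * \<rho> * \<Delta>) * \<kappa>"
            using td[OF that, of i] Kw[OF that(3), of i] T \<rho> \<Delta> unfolding norm_scaleR
            by (intro mult_mono) (auto simp: \<Delta>_def)
          have "\<kappa> * norm (w - w') \<le> \<kappa> * \<Delta>" using \<kappa> \<Delta> by (intro mult_left_mono) auto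
          moreover have "T * \<rho>\<^sup>2 \<le> T * \<rho>" using T \<rho>2 by (intro mult_left_mono) auto
          ultimately show "norm (t v' w' i *\<^sub>R (K i (w $ i) - K i (w' $ i))) \<le> (T * \<rho>) * (\<kappa> * \<Delta>)"
            using order_trans[OF tb[OF that(2,4), of i]] order_trans[OF Kwd[of i w w']] T \<rho> unfolding norm_scaleR
            by (intro mult_mono) auto
        qed
        finally have "norm ((\<Psi> v w - \<Psi> v' w') $ i)
            \<le> (\<rho> * (L * (2 * m * \<Delta>)) + (T' * \<rho> * \<Delta>) * \<kappa> + (T * \<rho>) * (\<kappa> * \<Delta>)) * a"
          using a by (simp add: mult_right_mono)
        also have "\<dots> = a * (2 * m * L + T' * \<kappa> + T * \<kappa>) * (\<rho> * \<Delta>)" by algebra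
        finally show ?thesis .
      next
        case False
        then show ?thesis using a m L T \<kappa> \<rho> \<Delta> by (auto simp: \<Psi>_def)
      qed
      from vec_norm_le[of "\<Psi> v w - \<Psi> v' w'", OF this]
      have "norm (\<Psi> v w - \<Psi> v' w') \<le> B\<^sub>2 * (\<rho> * \<Delta>)"
        by (simp add: m_def B\<^sub>2_def mult.assoc)
      also have "\<dots> \<le> B * (\<rho> * \<Delta>)" using B12 \<rho> \<Delta> by (intro mult_right_mono) (auto simp: B_def)
      also have "\<dots> = (2 * B * \<rho>) * (\<Delta> / 2)" by simp
      also have "\<dots> \<le> 1 * (\<Delta> / 2)" using B\<rho> \<Delta> by (intro mult_right_mono) auto
      finally show ?thesis by (simp add: \<Delta>_def)
    qed
    have perp0: "0 \<in> perp i" for i by (simp add: perp_def)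
    have "closed D"
    proof -
      have "D = (\<Inter>i. \<Inter>x\<in>fixed_space (K i). {w. inner (w $ i) x = 0}) \<inter> (\<Inter>i\<in>-I. {w. w $ i = 0}) \<inter> {w. norm w \<le> \<rho>}"
        by (auto simp: D_def perp_def)
      also have "closed \<dots>"
        by (intro closed_Int closed_INT ballI closed_Collect_eq closed_Collect_le continuous_intros)
      finally show ?thesis .
    qed
    then have D_complete: "complete D" by (simp add: complete_eq_closed)
    have D0: "D \<noteq> {}" using perp0 \<rho> by (auto simp: D_def intro!: exI[of _ 0])
    have "\<exists>!w\<in>D. \<Psi> v w = w" if v: "v \<in> spheres" for v
    proof (rule Banach_fix[OF D_complete D0, of "1/2"])
      show "\<Psi> v ` D \<subseteq> D"
      proof
        fix y assume "y \<in> \<Psi> v ` D"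
        then obtain w where "w \<in> D" "y = \<Psi> v w" by blast
        then show "y \<in> D" using \<Psi>b[OF v] A(2) perp0 by (auto simp: D_def \<Psi>_def)
      qed
      show "dist (\<Psi> v x) (\<Psi> v y) \<le> 1/2 * dist x y" if "x \<in> D" "y \<in> D" for x y
        using \<Psi>d[OF v v, of x y] that by (simp add: dist_norm)
    qed auto
    then obtain W where W: "\<And>v. v \<in> spheres \<Longrightarrow> W v \<in> D" "\<And>v. v \<in> spheres \<Longrightarrow> \<Psi> v (W v) = W v" by metis
    \<comment> \<open>At fixed points the distance of the \<open>W\<close> values stands on both
      sides; absorbing half of it leaves Lipschitz constant 1.\<close>
    have Wd: "norm (W v - W v') \<le> norm (v - v')" if "v \<in> spheres" "v' \<in> spheres" for v v'
      using \<Psi>d[OF that W(1)[OF that(1)] W(1)[OF that(2)]] unfolding W(2)[OF that(1)] W(2)[OF that(2)] by simp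
    define G where "G v = U v (W v)" for v
    define \<tau> where "\<tau> v = t v (W v)" for v
    have "norm (G v - G v') \<le> C * norm (v - v')" if "v \<in> spheres" "v' \<in> spheres" for v v'
    proof -
      have "norm (G v - G v') \<le> 2 * m * (norm (v - v') + norm (W v - W v'))"
        unfolding G_def using that by (intro Ud W)
      also have "\<dots> \<le> 2 * m * (norm (v - v') + norm (v - v'))" using Wd[OF that] m by (intro mult_left_mono) auto
      also have "\<dots> = 4 * m * norm (v - v')" by simp
      also have "\<dots> \<le> C * norm (v - v')" using R T by (intro mult_right_mono) (auto simp: C_def)
      finally show ?thesis .
    qed
    moreover have "norm (G v) \<le> C" if "v \<in> spheres" for v
      using UR(2)[OF that W(1)[OF that]] T m by (simp add: G_def C_def)
    moreover have "inner (K i (G v $ i)) (G v $ i) = 1 \<and> \<bar>\<tau> v i\<bar> \<le> C * \<rho>\<^sup>2 \<and>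
          (\<exists>r\<ge>1/2. \<forall>x\<in>fixed_space (K i). inner (G v $ i - r *\<^sub>R v $ i) x = 0) \<and>
          (\<forall>\<phi>. (\<forall>x\<in>fixed_space (K i). inner \<phi> x = 0) \<longrightarrow> inner (residual (\<rho>\<^sup>2) (\<tau> v) (G v) i) \<phi> = 0) \<and>
          inner (residual (\<rho>\<^sup>2) (\<tau> v) (G v) i) (G v $ i) = 0" if v: "v \<in> spheres" and i: "i \<in> I" for v i
    proof -
      interpret K: bounded_linear "K i" by (rule lin)
      define w where "w = W v"
      have w: "w \<in> D" "\<Psi> v w = w" using W v by (auto simp: w_def)
      have Kv: "K i (v $ i) = v $ i" "norm (v $ i) = 1" using vi[OF v i] by (auto simp: fixed_space_def)
      have wperp: "inner (w $ i) x = 0" if "x \<in> fixed_space (K i)" for x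
        using w that by (auto simp: D_def perp_def)
      have wv: "inner (w $ i) (v $ i) = 0" "inner (K i (w $ i)) (v $ i) = 0"
        using wperp[OF vi(2)[OF v i]] by (simp_all add: sym Kv)
      have vv: "inner (v $ i) (v $ i) = 1" using Kv(2) by (simp add: norm_eq_1)
      from wv have vw: "inner (v $ i) (w $ i) = 0" by (simp add: inner_commute)
      have Gi: "G v $ i = r w i *\<^sub>R v $ i + w $ i" using i by (simp add: G_def U_def w_def)
      have KG: "K i (G v $ i) = r w i *\<^sub>R v $ i + K i (w $ i)" by (simp add: Gi K.add K.scaleR Kv)
      have norm1: "inner (K i (G v $ i)) (G v $ i) = 1"
      proof -
        have "inner (K i (G v $ i)) (G v $ i) = (r w i)\<^sup>2 + inner (K i (w $ i)) (w $ i)"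
          unfolding KG unfolding Gi by (simp add: inner_add_left inner_add_right wv vw vv power2_eq_square)
        then show ?thesis using rb(3)[OF w(1), of i] by simp
      qed
      have LG: "G v $ i - K i (G v $ i) = w $ i - K i (w $ i)" unfolding KG unfolding Gi by simp
      have res: "residual (\<rho>\<^sup>2) (\<tau> v) (G v) i = w $ i - K i (w $ i) - \<rho>\<^sup>2 *\<^sub>R N (U v w) $ i - t v w i *\<^sub>R K i (G v $ i)"
        unfolding residual_def LG by (simp add: G_def \<tau>_def w_def)
      have \<tau>b: "\<bar>\<tau> v i\<bar> \<le> C * \<rho>\<^sup>2"
      proof -
        have "\<bar>\<tau> v i\<bar> \<le> T * \<rho>\<^sup>2" unfolding \<tau>_def using tb[OF v W(1)[OF v]] .
        also have "\<dots> \<le> C * \<rho>\<^sup>2" using R m by (intro mult_right_mono) (auto simp: C_def)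
        finally show ?thesis .
      qed
      have split: "\<exists>r\<ge>1/2. \<forall>x\<in>fixed_space (K i). inner (G v $ i - r *\<^sub>R v $ i) x = 0"
        using rb(1)[OF w(1), of i] wperp by (intro exI[of _ "r w i"]) (auto simp: Gi)
      \<comment> \<open>The fixed point equation is inserted under \<open>1 - K\<close>, where
        \<open>A\<close> acts as an inverse against \<phi>; the contribution of \<open>v\<close> is
        orthogonal to \<phi>.\<close>
      have perp_res: "inner (residual (\<rho>\<^sup>2) (\<tau> v) (G v) i) \<phi> = 0" if \<phi>: "\<forall>x\<in>fixed_space (K i). inner \<phi> x = 0" for \<phi>
      proof -
        have w_eq: "w $ i = A i (\<rho>\<^sup>2 *\<^sub>R N (U v w) $ i + t v w i *\<^sub>R K i (w $ i))"
          using i arg_cong[OF w(2), of "\<lambda>x. x $ i"] by (simp add: \<Psi>_def)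
        have "inner (w $ i - K i (w $ i)) \<phi> = inner (\<rho>\<^sup>2 *\<^sub>R N (U v w) $ i + t v w i *\<^sub>R K i (w $ i)) \<phi>"
          by (subst (1 2) w_eq, rule A(3)) (use \<phi> in \<open>simp add: perp_def\<close>)
        moreover have "inner (v $ i) \<phi> = 0" using bspec[OF \<phi> vi(2)[OF v i]] by (subst inner_commute)
        ultimately show ?thesis unfolding res KG by (simp add: inner_diff_left inner_add_left algebra_simps)
      qed
      \<comment> \<open>\<open>t\<close> was defined so that these three terms cancel.\<close>
      have "inner (residual (\<rho>\<^sup>2) (\<tau> v) (G v) i) (G v $ i) = inner (w $ i - K i (w $ i)) (G v $ i)
          - \<rho>\<^sup>2 * inner (N (U v w) $ i) (G v $ i) - t v w i"
        unfolding res by (simp add: inner_diff_left norm1)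
      also have "inner (w $ i - K i (w $ i)) (G v $ i) = q w i"
        unfolding Gi q_def by (simp add: inner_add_right inner_diff_left wv vw)
      finally have "inner (residual (\<rho>\<^sup>2) (\<tau> v) (G v) i) (G v $ i) = 0"
        by (simp add: t_def G_def w_def)
      then show ?thesis using norm1 \<tau>b split perp_res by blast
    qed
    moreover have "G v $ i = 0" if "i \<notin> I" for v i using that by (simp add: G_def U_def)
    ultimately have "reduced C \<rho> G \<tau>" unfolding reduced_def by blast
    then show ?thesis by blast
  qed
  moreover have "\<rho>\<^sub>0 > 0" using \<kappa> B12 by (simp add: \<rho>\<^sub>0_def B_def)
  ultimately show ?thesis by (rule that[rotated])
qed

section \<open>Energy on the reduced manifold and its minimiser\<close>

text \<open>\<open>E\<close> has no multiplier term, yet its first order change along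
  \<open>G\<close> is the pairing with the residual, multiplier included. The reason is that the
  constraint holds at both end points, which makes the multiplier term a quantity of second order.
  Only the Lipschitz bound on \<open>G\<close> enters.\<close>

lemma reduced_energy_expansion:
  assumes red: "reduced C \<rho> G \<tau>" and \<rho>: "0 < \<rho>" "\<rho> \<le> 1"
  defines "E \<equiv> \<lambda>u. (\<Sum>i\<in>I. inner (u $ i - K i (u $ i)) (u $ i)) / 2 - \<rho>\<^sup>2 * F u"
  obtains B where "B \<ge> 0" "\<And>v v'. v \<in> spheres \<Longrightarrow> v' \<in> spheres \<Longrightarrow>
    \<bar>E (G v') - E (G v) - (\<Sum>i\<in>I. inner (residual (\<rho>\<^sup>2) (\<tau> v) (G v) i) ((G v' - G v) $ i))\<bar> \<le> B * (norm (v' - v))\<^sup>2"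
proof -
  obtain \<kappa> where \<kappa>: "\<kappa> \<ge> 1" "\<And>i x. norm (K i x) \<le> norm x * \<kappa>"
    by (rule bounded_linear_common_bound[of K, OF lin]) blast
  obtain C\<^sub>F where CF: "\<And>U V. norm U \<le> C \<Longrightarrow> norm V \<le> C \<Longrightarrow>
       \<bar>F V - F U - inner (N U) (V - U)\<bar> \<le> C\<^sub>F * (norm (V - U))\<^sup>2" using N_grad[of C] by blast
  \<comment> \<open>Half the sum of the bounds for the three terms of the remainder
    \<open>err\<close> below, with |\<tau>| at most \<open>C\<close> and \<open>K i\<close> bounded
    by \<kappa>.\<close>
  define b where "b = (C * \<kappa> + (1 + \<kappa>)) / 2"
  define B where "B = real (card I) * b + \<bar>C\<^sub>F\<bar>"
  have C0: "C \<ge> 0"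
  proof -
    obtain v where "v \<in> spheres" using spheres_nonempty by blast
    then have "norm (G v) \<le> C" using red by (simp add: reduced_def)
    then show ?thesis using norm_ge_zero order_trans by blast
  qed
  have b0: "b \<ge> 0" using C0 \<kappa> by (simp add: b_def)
  have B0: "B \<ge> 0" using b0 by (simp add: B_def)
  have \<rho>2: "\<rho>\<^sup>2 \<le> 1" "\<rho>\<^sup>2 \<ge> 0" using \<rho> by (auto simp: power2_eq_square mult_le_one)
  have "\<bar>E (G v') - E (G v) - (\<Sum>i\<in>I. inner (residual (\<rho>\<^sup>2) (\<tau> v) (G v) i) ((G v' - G v) $ i))\<bar>
      \<le> (B * C\<^sup>2) * (norm (v' - v))\<^sup>2" if v: "v \<in> spheres" and v': "v' \<in> spheres" for v v'
  proof -
    define \<delta> where "\<delta> = G v' - G v"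
    \<comment> \<open>Second order part of the quadratic form together with what remains of the
      multiplier term.\<close>
    define err where "err i = (inner (\<delta> $ i - K i (\<delta> $ i)) (\<delta> $ i) - \<tau> v i * inner (K i (\<delta> $ i)) (\<delta> $ i)) / 2" for i
    have G': "G v' = G v + \<delta>" by (simp add: \<delta>_def)
    have eq: "(inner (G v' $ i - K i (G v' $ i)) (G v' $ i) - inner (G v $ i - K i (G v $ i)) (G v $ i)) / 2
        = inner (residual (\<rho>\<^sup>2) (\<tau> v) (G v) i) (\<delta> $ i) + \<rho>\<^sup>2 * inner (N (G v) $ i) (\<delta> $ i) + err i" if i: "i \<in> I" for i
    proof -
      interpret K: bounded_linear "K i" by (rule lin)
      define x where "x = G v $ i"
      define d where "d = \<delta> $ i"
      have Gx: "G v' $ i = x + d" by (simp add: G' x_def d_def)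
      have comm: "inner d x = inner x d" "inner d (K i x) = inner (K i x) d" "inner (K i d) x = inner (K i x) d"
        by (rule inner_commute, rule inner_commute, subst sym, rule inner_commute)
      have "inner (K i (G v $ i)) (G v $ i) = 1" "inner (K i (G v' $ i)) (G v' $ i) = 1"
        using red v v' i unfolding reduced_def by blast+
      then have "inner (K i x) x = 1" "inner (K i (x + d)) (x + d) = 1" unfolding Gx x_def .
      \<comment> \<open>Subtracting the constraint at \<open>x\<close> from the constraint at
        \<open>x + d\<close> expresses the linear term through a quadratic one.\<close>
      then have half: "2 * inner (K i x) d = - inner (K i d) d"
        by (simp add: K.add inner_add_left inner_add_right comm)
      have "inner (residual (\<rho>\<^sup>2) (\<tau> v) (G v) i) d = inner x d - inner (K i x) d - \<rho>\<^sup>2 * inner (N (G v) $ i) d - \<tau> v i * inner (K i x) d"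
        by (simp add: residual_def inner_diff_left x_def)
      moreover have "err i = (inner d d - inner (K i d) d - \<tau> v i * inner (K i d) d) / 2"
        by (simp add: err_def d_def inner_diff_left)
      moreover have "\<tau> v i * inner (K i d) d = - (2 * (\<tau> v i * inner (K i x) d))" using half by algebra
      moreover have "inner (G v' $ i - K i (G v' $ i)) (G v' $ i) - inner (G v $ i - K i (G v $ i)) (G v $ i)
          = 2 * inner x d + inner d d - 2 * inner (K i x) d - inner (K i d) d"
        unfolding Gx x_def[symmetric] by (simp add: K.add inner_add_left inner_add_right inner_diff_left comm)
      ultimately show ?thesis unfolding d_def[symmetric] by (simp add: field_simps)
    qed
    \<comment> \<open>The increment has no components outside \<open>I\<close>, so the sum over
      \<open>I\<close> recovers the full pairing with the gradient.\<close>
    have sumN: "(\<Sum>i\<in>I. inner (N (G v) $ i) (\<delta> $ i)) = inner (N (G v)) \<delta>"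
    proof -
      have "\<delta> $ i = 0" if "i \<notin> I" for i using red v v' that by (auto simp: reduced_def \<delta>_def)
      then show ?thesis unfolding inner_vec_def by (intro sum.mono_neutral_left) auto
    qed
    define S where "S u = (\<Sum>i\<in>I. inner (u $ i - K i (u $ i)) (u $ i))" for u
    have "(S (G v') - S (G v)) / 2 = (\<Sum>i\<in>I. (inner (G v' $ i - K i (G v' $ i)) (G v' $ i) - inner (G v $ i - K i (G v $ i)) (G v $ i)) / 2)"
      unfolding S_def by (simp only: sum_subtractf sum_divide_distrib[symmetric])
    also have "\<dots> = (\<Sum>i\<in>I. inner (residual (\<rho>\<^sup>2) (\<tau> v) (G v) i) (\<delta> $ i) + \<rho>\<^sup>2 * inner (N (G v) $ i) (\<delta> $ i) + err i)"
      by (rule sum.cong[OF refl eq])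
    also have "\<dots> = (\<Sum>i\<in>I. inner (residual (\<rho>\<^sup>2) (\<tau> v) (G v) i) (\<delta> $ i)) + \<rho>\<^sup>2 * inner (N (G v)) \<delta> + sum err I"
      by (simp only: sum.distrib sum_distrib_left[symmetric] sumN)
    finally have S_eq: "(S (G v') - S (G v)) / 2 = (\<Sum>i\<in>I. inner (residual (\<rho>\<^sup>2) (\<tau> v) (G v) i) (\<delta> $ i)) + \<rho>\<^sup>2 * inner (N (G v)) \<delta> + sum err I" .
    have "E (G v') - E (G v) = (S (G v') - S (G v)) / 2 - \<rho>\<^sup>2 * (F (G v') - F (G v))"
      unfolding E_def S_def[symmetric] by (simp add: diff_divide_distrib right_diff_distrib)
    then have "E (G v') - E (G v) - (\<Sum>i\<in>I. inner (residual (\<rho>\<^sup>2) (\<tau> v) (G v) i) (\<delta> $ i))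
        = sum err I - \<rho>\<^sup>2 * (F (G v') - F (G v) - inner (N (G v)) \<delta>)"
      unfolding S_eq by (simp add: right_diff_distrib)
    also have "\<bar>\<dots>\<bar> \<le> \<bar>sum err I\<bar> + \<rho>\<^sup>2 * \<bar>F (G v') - F (G v) - inner (N (G v)) \<delta>\<bar>"
      using abs_triangle_ineq4[of "sum err I" "\<rho>\<^sup>2 * (F (G v') - F (G v) - inner (N (G v)) \<delta>)"] by (simp add: abs_mult)
    also have "\<dots> \<le> real (card I) * (b * (norm \<delta>)\<^sup>2) + 1 * (\<bar>C\<^sub>F\<bar> * (norm \<delta>)\<^sup>2)"
    proof (intro add_mono mult_mono)
      have "\<bar>err i\<bar> \<le> b * (norm \<delta>)\<^sup>2" if i: "i \<in> I" for i
      proof -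
        define d where "d = \<delta> $ i"
        have d: "norm d \<le> norm \<delta>" unfolding d_def by (rule norm_vec_nth_le)
        have Kd: "norm (K i d) \<le> \<kappa> * norm \<delta>" 
        proof -
          have "norm d * \<kappa> \<le> norm \<delta> * \<kappa>" using d \<kappa>(1) by (intro mult_right_mono) auto
          with \<kappa>(2)[of i d] show ?thesis by (simp add: mult.commute)
        qed
        have 1: "\<bar>inner (K i d) d\<bar> \<le> (\<kappa> * norm \<delta>) * norm \<delta>"
          using Cauchy_Schwarz_ineq2[of "K i d" d] mult_mono[OF Kd d] \<kappa> by fastforce
        have 2: "\<bar>inner d d\<bar> \<le> norm \<delta> * norm \<delta>"
          using Cauchy_Schwarz_ineq2[of d d] mult_mono[OF d d] by fastforce
        have "\<bar>\<tau> v i\<bar> \<le> C * \<rho>\<^sup>2" using red v i by (simp add: reduced_def)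
        also have "\<dots> \<le> C * 1" using C0 \<rho>2 by (intro mult_left_mono) auto
        finally have 3: "\<bar>\<tau> v i * inner (K i d) d\<bar> \<le> C * ((\<kappa> * norm \<delta>) * norm \<delta>)"
          unfolding abs_mult using 1 C0 by (intro mult_mono) auto
        have "\<bar>err i\<bar> \<le> (\<bar>inner d d\<bar> + \<bar>inner (K i d) d\<bar> + \<bar>\<tau> v i * inner (K i d) d\<bar>) / 2"
        proof -
          have "\<bar>(a - b - c) / 2\<bar> \<le> (\<bar>a\<bar> + \<bar>b\<bar> + \<bar>c\<bar>) / 2" for a b c :: real
            using abs_triangle_ineq4[of "a - b" c] abs_triangle_ineq4[of a b] by simp
          then show ?thesis unfolding err_def d_def[symmetric] inner_diff_left .
        qed
        also have "\<dots> \<le> (norm \<delta> * norm \<delta> + (\<kappa> * norm \<delta>) * norm \<delta> + C * ((\<kappa> * norm \<delta>) * norm \<delta>)) / 2"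
          by (intro divide_right_mono add_mono 1 2 3) auto
        also have "\<dots> = b * (norm \<delta>)\<^sup>2" by (simp add: b_def power2_eq_square field_simps)
        finally show ?thesis .
      qed
      then have "(\<Sum>i\<in>I. \<bar>err i\<bar>) \<le> (\<Sum>i\<in>I. b * (norm \<delta>)\<^sup>2)" by (rule sum_mono)
      then show "\<bar>sum err I\<bar> \<le> real (card I) * (b * (norm \<delta>)\<^sup>2)" by (intro order_trans[OF sum_abs]) simp
      have "\<bar>F (G v') - F (G v) - inner (N (G v)) \<delta>\<bar> \<le> C\<^sub>F * (norm \<delta>)\<^sup>2"
        unfolding \<delta>_def using red v v' by (intro CF) (auto simp: reduced_def)
      also have "\<dots> \<le> \<bar>C\<^sub>F\<bar> * (norm \<delta>)\<^sup>2" by (intro mult_right_mono) auto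
      finally show "\<bar>F (G v') - F (G v) - inner (N (G v)) \<delta>\<bar> \<le> \<bar>C\<^sub>F\<bar> * (norm \<delta>)\<^sup>2" .
    qed (use \<rho>2 in auto)
    also have "\<dots> = B * (norm \<delta>)\<^sup>2" by (simp add: B_def algebra_simps)
    also have "\<dots> \<le> B * (C * norm (v' - v))\<^sup>2"
      using red v v' B0 unfolding \<delta>_def reduced_def by (intro mult_left_mono power_mono) auto
    finally show ?thesis by (simp add: \<delta>_def power_mult_distrib mult.assoc)
  qed
  then show ?thesis using B0 by (intro that[of "B * C\<^sup>2"]) auto
qed

text \<open>The residual at a minimiser is tested in three kinds of directions. Against the
  complement of the fixed space and against \<open>G v\<close> it vanishes by construction of the
  reduction. Against tangent vectors of the sphere it vanishes because a renormalised step against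
  it would change the energy at first order, while the expansion error is of second order.\<close>

lemma reduced_minimizer_solves:
  assumes red: "reduced C \<rho> G \<tau>" and \<rho>: "0 < \<rho>" "\<rho> \<le> 1"
  obtains v where "v \<in> spheres" "\<And>i. i \<in> I \<Longrightarrow> residual (\<rho>\<^sup>2) (\<tau> v) (G v) i = 0"
proof -
  define E where "E = (\<lambda>u. (\<Sum>i\<in>I. inner (u $ i - K i (u $ i)) (u $ i)) / 2 - \<rho>\<^sup>2 * F u)"
  define res where "res v i = residual (\<rho>\<^sup>2) (\<tau> v) (G v) i" for v i
  obtain B where B: "B \<ge> 0" "\<And>v v'. v \<in> spheres \<Longrightarrow> v' \<in> spheres \<Longrightarrow>
    \<bar>E (G v') - E (G v) - (\<Sum>i\<in>I. inner (res v i) ((G v' - G v) $ i))\<bar> \<le> B * (norm (v' - v))\<^sup>2"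
    unfolding E_def res_def by (rule reduced_energy_expansion[OF red \<rho>]) blast
  have G_lip: "norm (G v' - G v) \<le> C * norm (v' - v)" if "v \<in> spheres" "v' \<in> spheres" for v v'
    using red that by (simp add: reduced_def)
  \<comment> \<open>Continuity is read off from the expansion, which bounds every increment of the
    energy.\<close>
  have "continuous_on spheres (\<lambda>v. E (G v))"
    unfolding continuous_on_def
  proof
    fix v assume v: "v \<in> spheres"
    define A where "A = (\<Sum>i\<in>I. norm (res v i)) * C"
    have "\<bar>E (G v') - E (G v)\<bar> \<le> A * norm (v' - v) + B * (norm (v' - v))\<^sup>2" if v': "v' \<in> spheres" for v'
    proof -
      have "\<bar>\<Sum>i\<in>I. inner (res v i) ((G v' - G v) $ i)\<bar> \<le> (\<Sum>i\<in>I. norm (res v i) * (C * norm (v' - v)))"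
      proof (rule order_trans[OF sum_abs sum_mono])
        fix i
        have "norm ((G v' - G v) $ i) \<le> C * norm (v' - v)"
          using G_lip[OF v v'] norm_vec_nth_le order_trans by blast
        then show "\<bar>inner (res v i) ((G v' - G v) $ i)\<bar> \<le> norm (res v i) * (C * norm (v' - v))"
          by (intro order_trans[OF Cauchy_Schwarz_ineq2] mult_left_mono) auto
      qed
      also have "\<dots> = A * norm (v' - v)" by (simp add: A_def sum_distrib_right mult.assoc)
      finally show ?thesis using B(2)[OF v v'] by linarith
    qed
    then have "\<forall>\<^sub>F v' in at v within spheres. norm (E (G v') - E (G v)) \<le> A * norm (v' - v) + B * (norm (v' - v))\<^sup>2"
      unfolding eventually_at_filter by (intro always_eventually) auto
    moreover have "((\<lambda>v'. A * norm (v' - v) + B * (norm (v' - v))\<^sup>2) \<longlongrightarrow> A * norm (v - v) + B * (norm (v - v))\<^sup>2) (at v within spheres)"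
      by (intro tendsto_intros)
    then have "((\<lambda>v'. A * norm (v' - v) + B * (norm (v' - v))\<^sup>2) \<longlongrightarrow> 0) (at v within spheres)" by simp
    ultimately have "((\<lambda>v'. E (G v') - E (G v)) \<longlongrightarrow> 0) (at v within spheres)" by (rule Lim_null_comparison)
    then show "((\<lambda>v'. E (G v')) \<longlongrightarrow> E (G v)) (at v within spheres)" by (simp add: LIM_zero_iff)
  qed
  then obtain v where v: "v \<in> spheres" "\<And>v'. v' \<in> spheres \<Longrightarrow> E (G v) \<le> E (G v')"
    using continuous_attains_inf[OF compact_spheres spheres_nonempty] by blast
  have res_perp: "inner (res v i) \<phi> = 0" if "i \<in> I" "\<forall>x\<in>fixed_space (K i). inner \<phi> x = 0" for i \<phi>
    using red v(1) that unfolding reduced_def res_def by blast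
  \<comment> \<open>\<open>G v'\<close> differs from a multiple of \<open>v'\<close> by a vector
    that the residual at \<open>v\<close> does not see. This is needed at points \<open>v'\<close>
    other than the minimiser, with a multiple bounded away from 0.\<close>
  have split: "\<exists>r\<ge>1/2. inner (res v i) (G v' $ i) = r * inner (res v i) (v' $ i)" if v': "v' \<in> spheres" and i: "i \<in> I" for v' i
  proof -
    obtain r where r: "r \<ge> 1/2" "\<forall>x\<in>fixed_space (K i). inner (G v' $ i - r *\<^sub>R v' $ i) x = 0"
      using red v' i unfolding reduced_def by blast
    from res_perp[OF i r(2)] r(1) show ?thesis by (auto simp: inner_diff_right)
  qed
  have resG: "inner (res v i) (G v $ i) = 0" if "i \<in> I" for i
    using red v(1) that unfolding reduced_def res_def by blast
  have res_v: "inner (res v i) (v $ i) = 0" if i: "i \<in> I" for i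
    using split[OF v(1) i] resG[OF i] by auto
  have "res v i = 0" if i: "i \<in> I" for i
  proof -
    interpret K: bounded_linear "K i" by (rule lin)
    have vi: "norm (v $ i) = 1" "K i (v $ i) = v $ i"
      using v(1) i by (auto simp: spheres_def fixed_space_def dest: spec[of _ i])
    have tangent: "inner (res v i) \<xi> = 0" if \<xi>: "K i \<xi> = \<xi>" "inner (v $ i) \<xi> = 0" for \<xi>
    proof (rule ccontr)
      define a where "a = inner (res v i) \<xi>"
      assume "inner (res v i) \<xi> \<noteq> 0"
      then have a: "a \<noteq> 0" by (simp add: a_def)
      \<comment> \<open>The expansion constant times the squared rate at which the perturbed point
        below moves with \<open>t\<close>.\<close>
      define B' where "B' = B * (real CARD('m) * (2 * norm \<xi>))\<^sup>2"
      have B': "B' \<ge> 0" using B by (simp add: B'_def)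
      \<comment> \<open>The first bound gives |t| |\<xi>| at most 1 and hence
        \<open>n \<le> 2\<close>; the second keeps the quadratic error below a quarter of
        \<open>\<sigma> * a\<^sup>2\<close>, which the linear term exceeds.\<close>
      define \<sigma> where "\<sigma> = min (1 / (\<bar>a\<bar> * norm \<xi> + 1)) (1 / (8 * (B' + 1)))"
      have den: "\<bar>a\<bar> * norm \<xi> + 1 > 0" by (intro add_nonneg_pos) auto
      have \<sigma>: "\<sigma> > 0" "\<sigma> \<le> 1 / (\<bar>a\<bar> * norm \<xi> + 1)" "\<sigma> \<le> 1 / (8 * (B' + 1))"
        using den B' by (auto simp: \<sigma>_def)
      define t where "t = - (\<sigma> * a)"
      define x where "x = v $ i + t *\<^sub>R \<xi>"
      define n where "n = norm x"
      have "n\<^sup>2 = 1 + t\<^sup>2 * (norm \<xi>)\<^sup>2"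
        unfolding n_def x_def norm_add_scaleR_square using vi \<xi> by simp
      then have "1\<^sup>2 \<le> n\<^sup>2" by simp
      then have n1: "n \<ge> 1" by (rule power2_le_imp_le) (simp add: n_def)
      have t\<xi>: "\<bar>t\<bar> * norm \<xi> \<le> 1"
      proof -
        have "\<bar>t\<bar> * norm \<xi> = \<sigma> * (\<bar>a\<bar> * norm \<xi>)" using \<sigma>(1) by (simp add: t_def abs_mult)
        also have "\<dots> \<le> \<sigma> * (\<bar>a\<bar> * norm \<xi> + 1)" using \<sigma>(1) by (intro mult_left_mono) auto
        also have "\<dots> \<le> 1" using \<sigma>(2) den by (simp add: pos_le_divide_eq)
        finally show ?thesis .
      qed
      have n_le: "n \<le> 1 + \<bar>t\<bar> * norm \<xi>"
        using norm_triangle_ineq[of "v $ i" "t *\<^sub>R \<xi>"] vi by (simp add: n_def x_def)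
      define v' where "v' = (\<chi> j. if j = i then (1 / n) *\<^sub>R x else v $ j)"
      have "K i x = x" using vi \<xi> by (simp add: x_def K.add K.scaleR)
      moreover have x0: "x \<noteq> 0" using n1 by (auto simp: n_def)
      ultimately have "(1 / n) *\<^sub>R x \<in> {x \<in> fixed_space (K i). norm x = 1}"
        using n1 by (auto simp: fixed_space_def K.scaleR n_def)
      then have "v' $ j \<in> (if j \<in> I then {x \<in> fixed_space (K j). norm x = 1} else {0})" for j
        using v(1) i x0 by (cases "j = i") (simp_all add: spheres_def v'_def)
      then have v': "v' \<in> spheres" by (simp add: spheres_def)
      have "norm ((v' - v) $ j) \<le> 2 * (\<bar>t\<bar> * norm \<xi>)" for j
      proof (cases "j = i")
        case True
        have "norm ((1 / n) *\<^sub>R x - x) = n - 1"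
        proof -
          have "(1 / n) *\<^sub>R x - x = (1 / n - 1) *\<^sub>R x" by (simp add: algebra_simps)
          then have "norm ((1 / n) *\<^sub>R x - x) = \<bar>1 / n - 1\<bar> * n" by (simp add: n_def)
          also have "\<dots> = n - 1" using n1 by (simp add: abs_if field_simps)
          finally show ?thesis .
        qed
        moreover have "norm (x - v $ i) = \<bar>t\<bar> * norm \<xi>" by (simp add: x_def)
        moreover have "norm ((1 / n) *\<^sub>R x - v $ i) \<le> norm ((1 / n) *\<^sub>R x - x) + norm (x - v $ i)"
          using norm_triangle_ineq[of "(1 / n) *\<^sub>R x - x" "x - v $ i"] by simp
        ultimately show ?thesis using True n_le by (simp add: v'_def)
      next
        case False
        then show ?thesis by (simp add: v'_def)
      qed
      then have dist: "norm (v' - v) \<le> real CARD('m) * (2 * (\<bar>t\<bar> * norm \<xi>))" by (rule vec_norm_le)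
      obtain r where r: "r \<ge> 1/2" "inner (res v i) (G v' $ i) = r * inner (res v i) (v' $ i)"
        using split[OF v' i] by blast
      \<comment> \<open>For \<open>j\<close> different from \<open>i\<close> the component of
        \<open>v'\<close> is that of \<open>v\<close>, and the residual is orthogonal to it; only
        the moved component contributes.\<close>
      have "(\<Sum>j\<in>I. inner (res v j) ((G v' - G v) $ j)) = (\<Sum>j\<in>I. if j = i then r * (t * a / n) else 0)"
      proof (rule sum.cong[OF refl])
        fix j assume j: "j \<in> I"
        have "inner (res v j) ((G v' - G v) $ j) = inner (res v j) (G v' $ j)"
          using resG[OF j] by (simp add: inner_diff_right)
        also have "\<dots> = (if j = i then r * (t * a / n) else 0)"
        proof (cases "j = i")
          case True
          have "inner (res v i) (v' $ i) = t * a / n"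
            using res_v[OF i] by (simp add: v'_def x_def inner_add_right a_def)
          then show ?thesis using r True by simp
        next
          case False
          then show ?thesis using split[OF v' j] res_v[OF j] by (auto simp: v'_def)
        qed
        finally show "inner (res v j) ((G v' - G v) $ j) = (if j = i then r * (t * a / n) else 0)" .
      qed
      also have "\<dots> = r * (t * a / n)" using i by simp
      finally have sum_eq: "(\<Sum>j\<in>I. inner (res v j) ((G v' - G v) $ j)) = r * (t * a / n)" .
      have "E (G v') - E (G v) - r * (t * a / n) \<le> B * (norm (v' - v))\<^sup>2"
        using B(2)[OF v(1) v'] unfolding sum_eq by (rule order_trans[OF abs_ge_self])
      then have "0 \<le> r * (t * a / n) + B * (norm (v' - v))\<^sup>2" using v(2)[OF v'] by simp
      also have "B * (norm (v' - v))\<^sup>2 \<le> B * (real CARD('m) * (2 * (\<bar>t\<bar> * norm \<xi>)))\<^sup>2"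
        using dist B by (intro mult_left_mono power_mono) auto
      also have "\<dots> = B' * t\<^sup>2" by (simp add: B'_def power_mult_distrib)
      finally have upper: "(r / n) * (\<sigma> * a\<^sup>2) \<le> B' * (\<sigma> * (\<sigma> * a\<^sup>2))"
        by (simp add: t_def power2_eq_square algebra_simps)
      have "(1/4) * (\<sigma> * a\<^sup>2) \<le> (r / n) * (\<sigma> * a\<^sup>2)"
      proof (intro mult_right_mono)
        have "n \<le> 2" using n_le t\<xi> by linarith
        then show "1/4 \<le> r / n" using r(1) n1 by (simp add: field_simps)
      qed (use \<sigma> in auto)
      from order_trans[OF this upper] have "(\<sigma> * a\<^sup>2) * (1/4) \<le> (\<sigma> * a\<^sup>2) * (B' * \<sigma>)"
        by (simp only: ac_simps)
      then have "1/4 \<le> B' * \<sigma>" using \<sigma>(1) a by (subst (asm) mult_le_cancel_left_pos) auto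
      also have "\<dots> \<le> B' * (1 / (8 * (B' + 1)))" using \<sigma>(3) B' by (intro mult_left_mono) auto
      also have "\<dots> < 1/4" using B' by (simp add: field_simps)
      finally show False by simp
    qed
    obtain P where P: "\<And>x. P x \<in> fixed_space (K i)" "\<And>x y. y \<in> fixed_space (K i) \<Longrightarrow> inner (P x) y = inner x y"
      by (rule orthogonal_projection[OF fixed_space_subspace[OF lin[of i]]]) blast
    define R where "R = res v i"
    \<comment> \<open>Tangential part of the projection of the residual onto the fixed space; the
      radial part removed here is already known to pair to 0.\<close>
    define \<xi> where "\<xi> = P R - inner (v $ i) (P R) *\<^sub>R v $ i"
    have "inner R \<xi> = 0" unfolding R_def
    proof (rule tangent)
      show "K i \<xi> = \<xi>" using P(1)[of R] vi by (simp add: \<xi>_def fixed_space_def K.diff K.scaleR)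
      show "inner (v $ i) \<xi> = 0" using vi by (simp add: \<xi>_def inner_diff_right dot_square_norm)
    qed
    then have "inner R (P R) = 0" using res_v[OF i] by (simp add: \<xi>_def R_def inner_diff_right)
    moreover have "inner R (R - P R) = 0"
      unfolding R_def by (rule res_perp[OF i]) (use P in \<open>auto simp: inner_diff_left\<close>)
    ultimately have "inner R R = 0" by (simp add: inner_diff_right)
    then show ?thesis by (simp add: R_def)
  qed
  then show ?thesis using v(1) by (intro that[of v]) (auto simp: res_def)
qed

text \<open>The constraint <K_i U_i, U_i> = 1 excludes vanishing active components. Shrinking the
  range to \<rho> below 1 serves the energy expansion.\<close>

theorem small_solutions:
  obtains C \<rho>\<^sub>0 where "\<rho>\<^sub>0 > 0" "\<And>\<rho>. 0 < \<rho> \<Longrightarrow> \<rho> < \<rho>\<^sub>0 \<Longrightarrow> \<exists>U \<tau>. norm U \<le> C \<and> (\<forall>i. i \<notin> I \<longrightarrow> U $ i = 0) \<and>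
     (\<forall>i\<in>I. U $ i \<noteq> 0 \<and> \<bar>\<tau> i\<bar> \<le> C * \<rho>\<^sup>2 \<and> U $ i - K i (U $ i) = \<rho>\<^sup>2 *\<^sub>R N U $ i + \<tau> i *\<^sub>R K i (U $ i))"
proof -
  obtain C \<rho>\<^sub>0 where \<rho>0: "\<rho>\<^sub>0 > 0" and red: "\<And>\<rho>. 0 < \<rho> \<Longrightarrow> \<rho> < \<rho>\<^sub>0 \<Longrightarrow> \<exists>G \<tau>. reduced C \<rho> G \<tau>"
    by (rule lyapunov_schmidt_reduction) blast
  have "\<exists>U \<tau>. norm U \<le> C \<and> (\<forall>i. i \<notin> I \<longrightarrow> U $ i = 0) \<and>
     (\<forall>i\<in>I. U $ i \<noteq> 0 \<and> \<bar>\<tau> i\<bar> \<le> C * \<rho>\<^sup>2 \<and> U $ i - K i (U $ i) = \<rho>\<^sup>2 *\<^sub>R N U $ i + \<tau> i *\<^sub>R K i (U $ i))"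
    if \<rho>: "0 < \<rho>" "\<rho> < min \<rho>\<^sub>0 1" for \<rho>
  proof -
    obtain G \<tau> where G: "reduced C \<rho> G \<tau>" using red[of \<rho>] \<rho> by auto
    obtain v where v: "v \<in> spheres" "\<And>i. i \<in> I \<Longrightarrow> residual (\<rho>\<^sup>2) (\<tau> v) (G v) i = 0"
      by (rule reduced_minimizer_solves[OF G]) (use \<rho> in auto)
    have "G v $ i \<noteq> 0" if "i \<in> I" for i
    proof
      assume "G v $ i = 0"
      moreover have "inner (K i (G v $ i)) (G v $ i) = 1" using G v(1) that by (simp add: reduced_def)
      ultimately show False by simp
    qed
    moreover have "G v $ i - K i (G v $ i) = \<rho>\<^sup>2 *\<^sub>R N (G v) $ i + \<tau> v i *\<^sub>R K i (G v $ i)" if "i \<in> I" for i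
      using v(2)[OF that] by (simp add: residual_def algebra_simps)
    ultimately show ?thesis using G v(1) unfolding reduced_def
      by (intro exI[of _ "G v"] exI[of _ "\<tau> v"]) auto
  qed
  then show ?thesis using \<rho>0 by (intro that[of "min \<rho>\<^sub>0 1" C]) auto
qed

end

section \<open>Quartic energies\<close>

text \<open>\<open>B a b c\<close> models the Riesz representative of
  \<open>d -> \<integral> a b c d\<close>. The three symmetries exchange adjacent arguments and
  therefore generate all permutations of the four. \<gamma> gathers the self-interactions on its
  diagonal and the couplings off it.\<close>

locale quartic_form =
  fixes B :: "'h::{real_inner,complete_space} \<Rightarrow> 'h \<Rightarrow> 'h \<Rightarrow> 'h" and C :: real
    and \<gamma> :: "real^'m::finite^'m"
  assumes add: "B (a + a') b c = B a b c + B a' b c"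
    and scale: "B (r *\<^sub>R a) b c = r *\<^sub>R B a b c"
    and sym: "B a b c = B b a c" "B a b c = B a c b" "inner (B a b c) d = inner (B a b d) c"
    and bound: "norm (B a b c) \<le> C * norm a * norm b * norm c"
    and \<gamma>_sym: "\<gamma> $ i $ k = \<gamma> $ k $ i"
begin

definition q :: "'h \<Rightarrow> 'h \<Rightarrow> 'h \<Rightarrow> 'h \<Rightarrow> real" where "q a b c d = inner (B a b c) d"

definition nonlinearity :: "'h^'m \<Rightarrow> 'h^'m" where
  "nonlinearity U = (\<chi> i. \<Sum>k\<in>UNIV. \<gamma> $ k $ i *\<^sub>R B (U $ k) (U $ k) (U $ i))"

text \<open>Varying \<open>U\<close> in the summand of a pair gives two terms with factor 2 each;
  they coincide after exchanging the indices because \<gamma> is symmetric, and the factor 1/4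
  leaves exactly \<open>nonlinearity\<close> as gradient.\<close>

definition energy :: "'h^'m \<Rightarrow> real" where
  "energy U = (\<Sum>i\<in>UNIV. \<Sum>k\<in>UNIV. \<gamma> $ k $ i * q (U $ k) (U $ k) (U $ i) (U $ i)) / 4"

lemma add2: "B a (b + b') c = B a b c + B a b' c" using sym(1) add by metis
lemma add3: "B a b (c + c') = B a b c + B a b c'" using sym(2) add2 by metis

lemma diff1: "B (a - a') b c = B a b c - B a' b c"
  using add[of "a - a'" a' b c] by simp
lemma diff2: "B a (b - b') c = B a b c - B a b' c" using sym(1) diff1 by metis
lemma diff3: "B a b (c - c') = B a b c - B a b c'" using sym(2) diff2 by metis

lemma scale2: "B a (r *\<^sub>R b) c = r *\<^sub>R B a b c" using sym(1) scale by metis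
lemma scale3: "B a b (r *\<^sub>R c) = r *\<^sub>R B a b c" using sym(2) scale2 by metis

lemma zero3: "B a b 0 = 0" using add3[of a b 0 0] by simp

lemma q_sym: "q a b c d = q b a c d" "q a b c d = q a c b d" "q a b c d = q a b d c"
  using sym by (simp_all add: q_def)

lemma q_add: "q (a + a') b c d = q a b c d + q a' b c d" "q a (b + b') c d = q a b c d + q a b' c d"
  "q a b (c + c') d = q a b c d + q a b c' d" "q a b c (d + d') = q a b c d + q a b c d'"
  by (simp_all add: q_def add add2 add3 inner_add_left inner_add_right)

lemma q_bound: "\<bar>q a b c d\<bar> \<le> C * norm a * norm b * norm c * norm d"
  using Cauchy_Schwarz_ineq2[of "B a b c" d] mult_right_mono[OF bound[of a b c] norm_ge_zero[of d]]
  unfolding q_def by linarith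

lemma q_bound_le:
  assumes "norm a \<le> x" "norm b \<le> y" "norm c \<le> z" "norm d \<le> w"
  shows "\<bar>q a b c d\<bar> \<le> \<bar>C\<bar> * (x * y * z * w)"
proof -
  have "\<bar>q a b c d\<bar> \<le> C * (norm a * norm b * norm c * norm d)" using q_bound[of a b c d] by (simp add: mult.assoc)
  also have "\<dots> \<le> \<bar>C\<bar> * (norm a * norm b * norm c * norm d)" by (intro mult_right_mono) auto
  also have "\<dots> \<le> \<bar>C\<bar> * (x * y * z * w)"
    using assms norm_ge_zero[THEN order_trans] by (intro mult_left_mono mult_mono mult_nonneg_nonneg) auto
  finally show ?thesis .
qed

lemma B_bound_le:
  assumes "norm a \<le> x" "norm b \<le> y" "norm c \<le> z"
  shows "norm (B a b c) \<le> \<bar>C\<bar> * (x * y * z)"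
proof -
  have "norm (B a b c) \<le> C * (norm a * norm b * norm c)" using bound[of a b c] by (simp add: mult.assoc)
  also have "\<dots> \<le> \<bar>C\<bar> * (norm a * norm b * norm c)" by (intro mult_right_mono) auto
  also have "\<dots> \<le> \<bar>C\<bar> * (x * y * z)"
    using assms norm_ge_zero[THEN order_trans] by (intro mult_left_mono mult_mono mult_nonneg_nonneg) auto
  finally show ?thesis .
qed

text \<open>Every summand of component \<open>i\<close> contains \<open>U $ i\<close>. Division by
  the norm of that component therefore still leaves a term that tends to 0 with \<open>U\<close>,
  however small the component is compared with the others.\<close>

lemma nonlinearity_component_bound:
  obtains C' where "C' \<ge> 0" "\<And>U i. norm (nonlinearity U $ i) \<le> C' * (norm U)\<^sup>2 * norm (U $ i)"
proof (rule that[of "\<Sum>i\<in>UNIV. \<Sum>k\<in>UNIV. \<bar>\<gamma> $ k $ i\<bar> * \<bar>C\<bar>"])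
  fix U i
  have "norm (nonlinearity U $ i) \<le> (\<Sum>k\<in>UNIV. norm (\<gamma> $ k $ i *\<^sub>R B (U $ k) (U $ k) (U $ i)))"
    unfolding nonlinearity_def vec_lambda_beta by (rule norm_sum)
  also have "\<dots> \<le> (\<Sum>k\<in>UNIV. \<bar>\<gamma> $ k $ i\<bar> * (\<bar>C\<bar> * (norm U * norm U * norm (U $ i))))"
    unfolding norm_scaleR by (intro sum_mono mult_left_mono B_bound_le norm_vec_nth_le) auto
  also have "\<dots> = (\<Sum>k\<in>UNIV. \<bar>\<gamma> $ k $ i\<bar> * \<bar>C\<bar>) * ((norm U)\<^sup>2 * norm (U $ i))"
    by (simp add: sum_distrib_right power2_eq_square mult.assoc)
  also have "\<dots> \<le> (\<Sum>i\<in>UNIV. \<Sum>k\<in>UNIV. \<bar>\<gamma> $ k $ i\<bar> * \<bar>C\<bar>) * ((norm U)\<^sup>2 * norm (U $ i))"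
    by (intro mult_right_mono member_le_sum sum_nonneg) auto
  finally show "norm (nonlinearity U $ i) \<le> (\<Sum>i\<in>UNIV. \<Sum>k\<in>UNIV. \<bar>\<gamma> $ k $ i\<bar> * \<bar>C\<bar>) * (norm U)\<^sup>2 * norm (U $ i)"
    by (simp add: mult.assoc)
qed (intro sum_nonneg mult_nonneg_nonneg; simp)

lemma nonlinearity_scale: "nonlinearity (r *\<^sub>R U) = r^3 *\<^sub>R nonlinearity U"
  by (simp add: nonlinearity_def vec_eq_iff scale scale2 scale3 scaleR_sum_right power3_eq_cube mult_ac)

text \<open>The three arguments of \<open>B\<close> are exchanged one at a time, each exchange
  costing \<open>R * R\<close> times the distance.\<close>

lemma nonlinearity_lipschitz:
  "\<exists>L. \<forall>U V. norm U \<le> R \<longrightarrow> norm V \<le> R \<longrightarrow> norm (nonlinearity U - nonlinearity V) \<le> L * norm (U - V)"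
proof -
  define G where "G = (\<Sum>i\<in>UNIV. \<Sum>k\<in>UNIV. \<bar>\<gamma> $ k $ i\<bar>)"
  have "norm (nonlinearity U - nonlinearity V) \<le> (real CARD('m) * (G * (\<bar>C\<bar> * (3 * (R * R))))) * norm (U - V)"
    if U: "norm U \<le> R" and V: "norm V \<le> R" for U V
  proof -
    have R0: "R \<ge> 0" using U norm_ge_zero order_trans by blast
    define \<delta> where "\<delta> = norm (U - V)"
    have b: "norm (U $ k) \<le> R" "norm (V $ k) \<le> R" "norm (U $ k - V $ k) \<le> \<delta>" for k
      using U V norm_vec_nth_le[of U k] norm_vec_nth_le[of V k] norm_vec_nth_diff_le[of U k V] by (auto simp: \<delta>_def)
    have "norm ((nonlinearity U - nonlinearity V) $ i) \<le> (G * (\<bar>C\<bar> * (3 * (R * R)))) * \<delta>" for i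
    proof -
      have "norm (B (U $ k) (U $ k) (U $ i) - B (V $ k) (V $ k) (V $ i)) \<le> \<bar>C\<bar> * (3 * (R * R) * \<delta>)" for k
      proof -
        have "B (U $ k) (U $ k) (U $ i) - B (V $ k) (V $ k) (V $ i)
            = B (U $ k - V $ k) (U $ k) (U $ i) + B (V $ k) (U $ k - V $ k) (U $ i) + B (V $ k) (V $ k) (U $ i - V $ i)"
          by (simp add: diff1 diff2 diff3)
        also have "norm \<dots> \<le> \<bar>C\<bar> * (\<delta> * R * R) + \<bar>C\<bar> * (R * \<delta> * R) + \<bar>C\<bar> * (R * R * \<delta>)"
          by (intro norm_triangle_le add_mono B_bound_le b)
        finally show ?thesis by (simp add: algebra_simps)
      qed
      moreover have "(nonlinearity U - nonlinearity V) $ i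
          = (\<Sum>k\<in>UNIV. \<gamma> $ k $ i *\<^sub>R (B (U $ k) (U $ k) (U $ i) - B (V $ k) (V $ k) (V $ i)))"
        by (simp add: nonlinearity_def scaleR_diff_right sum_subtractf)
      ultimately have "norm ((nonlinearity U - nonlinearity V) $ i) \<le> (\<Sum>k\<in>UNIV. \<bar>\<gamma> $ k $ i\<bar> * (\<bar>C\<bar> * (3 * (R * R) * \<delta>)))"
        by (auto intro!: order_trans[OF norm_sum] sum_mono mult_left_mono)
      also have "\<dots> = (\<Sum>k\<in>UNIV. \<bar>\<gamma> $ k $ i\<bar>) * (\<bar>C\<bar> * (3 * (R * R) * \<delta>))" by (simp add: sum_distrib_right)
      also have "\<dots> \<le> G * (\<bar>C\<bar> * (3 * (R * R) * \<delta>))"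
        unfolding G_def using R0 by (intro mult_right_mono member_le_sum sum_nonneg) (auto simp: \<delta>_def)
      finally show ?thesis by (simp add: mult.assoc)
    qed
    from vec_norm_le[OF this] show ?thesis by (simp add: \<delta>_def mult.assoc)
  qed
  then show ?thesis by blast
qed

text \<open>Everything beyond first order is collected: six terms with weights 1 + 4 + 2 + 1 + 2 + 1
  = 11, each at most |C| (2 R)^2 \<epsilon>^2, which gives 44. Terms with more than two small
  factors are covered by \<open>\<epsilon> \<le> 2 * R\<close>.\<close>

lemma q_expansion:
  assumes b: "norm x \<le> R" "norm y \<le> R" "norm d \<le> \<epsilon>" "norm e \<le> \<epsilon>" "\<epsilon> \<le> 2 * R"
  shows "\<bar>q (x + d) (x + d) (y + e) (y + e) - q x x y y - 2 * q x x y e - 2 * q y y x d\<bar> \<le> 44 * \<bar>C\<bar> * R\<^sup>2 * \<epsilon>\<^sup>2"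
proof -
  have R0: "R \<ge> 0" and \<epsilon>0: "\<epsilon> \<ge> 0" using b norm_ge_zero order_trans by blast+
  have b': "norm x \<le> 2 * R" "norm y \<le> 2 * R" "norm d \<le> 2 * R" "norm e \<le> 2 * R" using b R0 by auto
  have s: "q d x y y = q y y x d" "q x d y y = q y y x d" "q x x e y = q x x y e"
    "q x d y e = q x y d e" "q d x y e = q x y d e" "q x d e y = q x y d e" "q d x e y = q x y d e"
    "q d x e e = q x d e e" "q d d e y = q d d y e"
    by (metis q_sym)+
  have "q (x + d) (x + d) (y + e) (y + e) - q x x y y - 2 * q x x y e - 2 * q y y x d
      = q x x e e + 4 * q x y d e + 2 * q x d e e + q d d y y + 2 * q d d y e + q d d e e"
    by (simp add: q_add s)
  moreover define M where "M = \<bar>C\<bar> * (2 * R * (2 * R) * \<epsilon> * \<epsilon>)"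
  have M': "\<bar>C\<bar> * (\<epsilon> * \<epsilon> * (2 * R) * (2 * R)) = M" by (simp add: M_def mult_ac)
  have "\<bar>q x x e e\<bar> \<le> M" unfolding M_def by (rule q_bound_le[OF b'(1) b'(1) b(4) b(4)])
  moreover have "\<bar>q x y d e\<bar> \<le> M" unfolding M_def by (rule q_bound_le[OF b'(1) b'(2) b(3) b(4)])
  moreover have "\<bar>q x d e e\<bar> \<le> M" unfolding M_def by (rule q_bound_le[OF b'(1) b'(3) b(4) b(4)])
  moreover have "\<bar>q d d y y\<bar> \<le> M" unfolding M'[symmetric] by (rule q_bound_le[OF b(3) b(3) b'(2) b'(2)])
  moreover have "\<bar>q d d y e\<bar> \<le> M" unfolding M'[symmetric] by (rule q_bound_le[OF b(3) b(3) b'(2) b'(4)])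
  moreover have "\<bar>q d d e e\<bar> \<le> M" unfolding M'[symmetric] by (rule q_bound_le[OF b(3) b(3) b'(4) b'(4)])
  ultimately have "\<bar>q (x + d) (x + d) (y + e) (y + e) - q x x y y - 2 * q x x y e - 2 * q y y x d\<bar> \<le> 11 * M"
    by (simp only: abs_le_iff) linarith
  also have "11 * M = 44 * \<bar>C\<bar> * R\<^sup>2 * \<epsilon>\<^sup>2" by (simp add: M_def power2_eq_square)
  finally show ?thesis .
qed

text \<open>Summing the expansion of \<open>q\<close> over all pairs; symmetry of \<gamma>
  identifies the two families of first order terms.\<close>

lemma energy_expansion:
  "\<exists>L. \<forall>U V. norm U \<le> R \<longrightarrow> norm V \<le> R \<longrightarrow>
     \<bar>energy V - energy U - inner (nonlinearity U) (V - U)\<bar> \<le> L * (norm (V - U))\<^sup>2"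
proof -
  define G where "G = (\<Sum>i\<in>UNIV. \<Sum>k\<in>UNIV. \<bar>\<gamma> $ k $ i\<bar>)"
  have "\<bar>energy V - energy U - inner (nonlinearity U) (V - U)\<bar> \<le> (G * (44 * \<bar>C\<bar> * R\<^sup>2) / 4) * (norm (V - U))\<^sup>2"
    if U: "norm U \<le> R" and V: "norm V \<le> R" for U V
  proof -
    define D where "D = V - U"
    define \<epsilon> where "\<epsilon> = norm D"
    have VU: "V = U + D" by (simp add: D_def)
    have b: "norm (U $ k) \<le> R" "norm (D $ k) \<le> \<epsilon>" for k
      using U norm_vec_nth_le[of U k] norm_vec_nth_le[of D k] by (auto simp: \<epsilon>_def)
    have \<epsilon>2: "\<epsilon> \<le> 2 * R" using norm_triangle_ineq4[of V U] U V by (simp add: \<epsilon>_def D_def)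
    define e where "e i k = q (V $ k) (V $ k) (V $ i) (V $ i) - q (U $ k) (U $ k) (U $ i) (U $ i)
        - 2 * q (U $ k) (U $ k) (U $ i) (D $ i) - 2 * q (U $ i) (U $ i) (U $ k) (D $ k)" for i k
    have e: "\<bar>e i k\<bar> \<le> 44 * \<bar>C\<bar> * R\<^sup>2 * \<epsilon>\<^sup>2" for i k
      unfolding e_def VU vector_add_component by (rule q_expansion[OF b(1) b(1) b(2) b(2) \<epsilon>2])
    define T where "T = (\<Sum>i\<in>UNIV. \<Sum>k\<in>UNIV. \<gamma> $ k $ i * q (U $ k) (U $ k) (U $ i) (D $ i))"
    have T': "(\<Sum>i\<in>UNIV. \<Sum>k\<in>UNIV. \<gamma> $ k $ i * q (U $ i) (U $ i) (U $ k) (D $ k)) = T"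
      unfolding T_def by (subst sum.swap) (simp add: \<gamma>_sym)
    have inner_T: "inner (nonlinearity U) D = T"
      by (simp add: inner_vec_def nonlinearity_def T_def q_def inner_sum_left)
    have "4 * (energy V - energy U - T) = (\<Sum>i\<in>UNIV. \<Sum>k\<in>UNIV. \<gamma> $ k $ i * e i k)"
    proof -
      have "(\<Sum>i\<in>UNIV. \<Sum>k\<in>UNIV. \<gamma> $ k $ i * e i k)
          = (\<Sum>i\<in>UNIV. \<Sum>k\<in>UNIV. \<gamma> $ k $ i * q (V $ k) (V $ k) (V $ i) (V $ i))
          - (\<Sum>i\<in>UNIV. \<Sum>k\<in>UNIV. \<gamma> $ k $ i * q (U $ k) (U $ k) (U $ i) (U $ i))
          - 2 * T - 2 * (\<Sum>i\<in>UNIV. \<Sum>k\<in>UNIV. \<gamma> $ k $ i * q (U $ i) (U $ i) (U $ k) (D $ k))"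
        unfolding T_def sum_distrib_left sum_subtractf[symmetric] e_def
        by (intro sum.cong refl) (simp add: algebra_simps)
      then show ?thesis by (simp add: T' energy_def)
    qed
    moreover have "\<bar>\<Sum>i\<in>UNIV. \<Sum>k\<in>UNIV. \<gamma> $ k $ i * e i k\<bar> \<le> (\<Sum>i\<in>UNIV. \<Sum>k\<in>UNIV. \<bar>\<gamma> $ k $ i\<bar> * (44 * \<bar>C\<bar> * R\<^sup>2 * \<epsilon>\<^sup>2))"
      by (intro order_trans[OF sum_abs] sum_mono) (simp add: abs_mult e mult_left_mono)
    moreover have "(\<Sum>i\<in>UNIV. \<Sum>k\<in>UNIV. \<bar>\<gamma> $ k $ i\<bar> * (44 * \<bar>C\<bar> * R\<^sup>2 * \<epsilon>\<^sup>2)) = G * (44 * \<bar>C\<bar> * R\<^sup>2 * \<epsilon>\<^sup>2)"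
      by (simp add: G_def sum_distrib_right)
    ultimately have "\<bar>4 * (energy V - energy U - T)\<bar> \<le> G * (44 * \<bar>C\<bar> * R\<^sup>2 * \<epsilon>\<^sup>2)" by simp
    then show ?thesis unfolding D_def[symmetric] inner_T \<epsilon>_def by (simp add: abs_mult field_simps)
  qed
  then show ?thesis by blast
qed

end

section \<open>The Hilbert space of square integrable functions\<close>

definition square_integrable :: "('a::euclidean_space \<Rightarrow> real) \<Rightarrow> bool" where
  "square_integrable f \<longleftrightarrow> f \<in> borel_measurable lebesgue \<and> integrable lebesgue (\<lambda>x. (f x)\<^sup>2)"

lemma square_integrable_measurable [measurable_dest]:
  "square_integrable f \<Longrightarrow> f \<in> borel_measurable lebesgue"
  by (simp add: square_integrable_def)

lemma square_integrable_mult: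
  assumes "square_integrable f" "square_integrable g"
  shows "integrable lebesgue (\<lambda>x. f x * g x)"
proof (rule Bochner_Integration.integrable_bound)
  show "integrable lebesgue (\<lambda>x. (f x)\<^sup>2 + (g x)\<^sup>2)" using assms by (simp add: square_integrable_def)
  show "(\<lambda>x. f x * g x) \<in> borel_measurable lebesgue" using assms by (auto simp: square_integrable_def)
  have "\<bar>a * b\<bar> \<le> a\<^sup>2 + b\<^sup>2" for a b :: real
  proof -
    have "2 * (\<bar>a\<bar> * \<bar>b\<bar>) \<le> a\<^sup>2 + b\<^sup>2" using sum_squares_bound[of "\<bar>a\<bar>" "\<bar>b\<bar>"] by simp
    then show ?thesis unfolding abs_mult using mult_nonneg_nonneg[OF abs_ge_zero[of a] abs_ge_zero[of b]] by linarith
  qed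
  then show "AE x in lebesgue. norm (f x * g x) \<le> norm ((f x)\<^sup>2 + (g x)\<^sup>2)" by (intro AE_I2) simp
qed

lemma square_integrable_zero [simp]: "square_integrable (\<lambda>x. 0)"
  by (simp add: square_integrable_def)

lemma square_integrable_add:
  assumes "square_integrable f" "square_integrable g"
  shows "square_integrable (\<lambda>x. f x + g x)"
proof -
  have "integrable lebesgue (\<lambda>x. (f x)\<^sup>2 + (g x)\<^sup>2 + 2 * (f x * g x))"
    using assms square_integrable_mult[OF assms] by (simp add: square_integrable_def)
  then have "integrable lebesgue (\<lambda>x. (f x + g x)\<^sup>2)" by (simp add: power2_sum mult.assoc)
  moreover have "(\<lambda>x. f x + g x) \<in> borel_measurable lebesgue"
    using assms by (intro borel_measurable_add square_integrable_measurable)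
  ultimately show ?thesis by (simp add: square_integrable_def)
qed

lemma square_integrable_scale:
  "square_integrable f \<Longrightarrow> square_integrable (\<lambda>x. c * f x)"
  unfolding square_integrable_def power_mult_distrib
  by (intro conjI borel_measurable_times integrable_mult_right) auto

lemma square_integrable_uminus:
  "square_integrable f \<Longrightarrow> square_integrable (\<lambda>x. - f x)"
  by (simp add: square_integrable_def)

lemma square_integrable_diff:
  "square_integrable f \<Longrightarrow> square_integrable g \<Longrightarrow> square_integrable (\<lambda>x. f x - g x)"
  using square_integrable_add[of f "\<lambda>x. - g x"] square_integrable_uminus[of g] by simp

lemma square_integrable_cong_AE:
  assumes "square_integrable f" "AE x in lebesgue. f x = g x"
  shows "square_integrable g"
proof -
  have g: "g \<in> borel_measurable lebesgue"
    using borel_measurable_AE[of f g] assms by (simp add: square_integrable_def)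
  moreover have "integrable lebesgue (\<lambda>x. (g x)\<^sup>2)"
    using assms g by (subst integrable_cong_AE[of _ _ "\<lambda>x. (f x)\<^sup>2"]) (auto simp: square_integrable_def)
  ultimately show ?thesis by (simp add: square_integrable_def)
qed

\<comment> \<open>The quotient by equality almost everywhere\<close>
\<comment> \<open>A partial quotient: only square integrable functions are related to themselves, so
  cutting out the carrier and dividing by null functions is one step. Functions on a domain enter
  through extension by zero.\<close>
quotient_type (overloaded) 'a lsq = "'a::euclidean_space \<Rightarrow> real" /
  partial: "\<lambda>f g. square_integrable f \<and> square_integrable g \<and> (AE x in lebesgue. f x = g x)"
proof (rule part_equivpI)
  show "\<exists>f. square_integrable (f::'a \<Rightarrow> real) \<and> square_integrable f \<and> (AE x in lebesgue. f x = f x)"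
    by (intro exI[of _ "\<lambda>x. 0"]) simp
  show "symp (\<lambda>f g. square_integrable f \<and> square_integrable g \<and> (AE x in lebesgue. f x = g x))"
    by (auto intro!: sympI simp: eq_commute)
  show "transp (\<lambda>f g. square_integrable f \<and> square_integrable g \<and> (AE x in lebesgue. f x = g x))"
    by (auto intro!: transpI)
qed

instantiation lsq :: (euclidean_space) real_vector
begin

lift_definition zero_lsq :: "'a lsq" is "\<lambda>x. 0" by simp
lift_definition plus_lsq :: "'a lsq \<Rightarrow> 'a lsq \<Rightarrow> 'a lsq" is "\<lambda>f g x. f x + g x"
  by (auto intro: square_integrable_add)
lift_definition minus_lsq :: "'a lsq \<Rightarrow> 'a lsq \<Rightarrow> 'a lsq" is "\<lambda>f g x. f x - g x"
  by (auto intro: square_integrable_diff)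
lift_definition uminus_lsq :: "'a lsq \<Rightarrow> 'a lsq" is "\<lambda>f x. - f x"
  by (auto intro: square_integrable_uminus)
lift_definition scaleR_lsq :: "real \<Rightarrow> 'a lsq \<Rightarrow> 'a lsq" is "\<lambda>c f x. c * f x"
  by (auto intro: square_integrable_scale)
instance
proof
  fix f g h :: "'a lsq" and a b :: real
  show "f + g + h = f + (g + h)" by transfer (auto intro!: square_integrable_add simp: add.assoc)
  show "f + g = g + f" by transfer (auto intro!: square_integrable_add simp: add.commute)
  show "0 + f = f" by transfer auto
  show "- f + f = 0" by transfer auto
  show "f - g = f + - g" by transfer (auto intro!: square_integrable_diff)
  show "a *\<^sub>R (f + g) = a *\<^sub>R f + a *\<^sub>R g"
    by transfer (auto intro!: square_integrable_add square_integrable_scale simp: distrib_left)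
  show "(a + b) *\<^sub>R f = a *\<^sub>R f + b *\<^sub>R f"
    by transfer (auto intro!: square_integrable_add square_integrable_scale simp: distrib_right)
  show "a *\<^sub>R b *\<^sub>R f = (a * b) *\<^sub>R f"
    by transfer (auto intro!: square_integrable_scale simp: mult.assoc)
  show "1 *\<^sub>R f = f" by transfer auto
qed

end

instantiation lsq :: (euclidean_space) real_inner
begin

lift_definition inner_lsq :: "'a lsq \<Rightarrow> 'a lsq \<Rightarrow> real" is "\<lambda>f g. integral\<^sup>L lebesgue (\<lambda>x. f x * g x)"
  by (intro integral_cong_AE) (auto simp: square_integrable_def)

definition norm_lsq :: "'a lsq \<Rightarrow> real" where "norm_lsq f = sqrt (inner f f)"
definition sgn_lsq :: "'a lsq \<Rightarrow> 'a lsq" where "sgn_lsq f = f /\<^sub>R norm f"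
definition dist_lsq :: "'a lsq \<Rightarrow> 'a lsq \<Rightarrow> real" where "dist_lsq f g = norm (f - g)"
definition uniformity_lsq :: "('a lsq \<times> 'a lsq) filter" where
  "uniformity_lsq = (INF e\<in>{0<..}. principal {(x, y). dist x y < e})"
definition open_lsq :: "'a lsq set \<Rightarrow> bool" where
  "open_lsq U \<longleftrightarrow> (\<forall>x\<in>U. eventually (\<lambda>(x', y). x' = x \<longrightarrow> y \<in> U) uniformity)"

instance
proof
  fix f g h :: "'a lsq" and a :: real
  show "inner f g = inner g f" by transfer (simp add: mult.commute)
  show "inner (f + g) h = inner f h + inner g h"
    by transfer (auto simp: distrib_right intro!: Bochner_Integration.integral_add square_integrable_mult)
  show "inner (a *\<^sub>R f) g = a * inner f g" by transfer (simp add: mult.assoc)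
  show "0 \<le> inner f f" by transfer simp
  show "(inner f f = 0) = (f = 0)"
  proof transfer
    fix f :: "'a \<Rightarrow> real" assume "square_integrable f \<and> square_integrable f \<and> (AE x in lebesgue. f x = f x)"
    then have f: "square_integrable f" "integrable lebesgue (\<lambda>x. f x * f x)" using square_integrable_mult[of f f] by auto
    have "(integral\<^sup>L lebesgue (\<lambda>x. f x * f x) = 0) = (AE x in lebesgue. f x * f x = 0)"
      by (rule integral_nonneg_eq_0_iff_AE[OF f(2)]) simp
    then show "(integral\<^sup>L lebesgue (\<lambda>x. f x * f x) = 0)
        = (square_integrable f \<and> square_integrable (\<lambda>x::'a. 0) \<and> (AE x in lebesgue. f x = 0))"
      using f by simp
  qed
  show "norm f = sqrt (inner f f)" by (rule norm_lsq_def)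
  show "sgn f = f /\<^sub>R norm f" by (rule sgn_lsq_def)
  show "dist f g = norm (f - g)" by (rule dist_lsq_def)
  show "(uniformity :: ('a lsq \<times> 'a lsq) filter) = (INF e\<in>{0<..}. principal {(x, y). dist x y < e})"
    by (rule uniformity_lsq_def)
  show "open U = (\<forall>x\<in>U. \<forall>\<^sub>F (x', y) in uniformity. x' = x \<longrightarrow> y \<in> U)" for U :: "'a lsq set"
    by (rule open_lsq_def)
qed

end

abbreviation cls :: "('a::euclidean_space \<Rightarrow> real) \<Rightarrow> 'a lsq" where "cls \<equiv> abs_lsq"
abbreviation rep :: "'a::euclidean_space lsq \<Rightarrow> 'a \<Rightarrow> real" where "rep \<equiv> rep_lsq"

lemma cls_rep [simp]: "cls (rep f) = f"
  by (rule Quotient3_abs_rep[OF Quotient3_lsq])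

lemma square_integrable_rep [simp, intro]: "square_integrable (rep f)"
  using Quotient3_rep_reflp[OF Quotient3_lsq, of f] by simp

lemma rep_measurable [measurable]: "rep f \<in> borel_measurable lebesgue"
  using square_integrable_rep by (rule square_integrable_measurable)

lemma cls_eq_iff:
  assumes "square_integrable f" "square_integrable g"
  shows "cls f = cls g \<longleftrightarrow> (AE x in lebesgue. f x = g x)"
  using Quotient3_rel[OF Quotient3_lsq, of f g] assms by simp

lemma rep_cls:
  assumes "square_integrable f"
  shows "AE x in lebesgue. rep (cls f) x = f x"
  using cls_eq_iff[of "rep (cls f)" f] assms by simp

lemma cls_add: "square_integrable f \<Longrightarrow> square_integrable g \<Longrightarrow> cls f + cls g = cls (\<lambda>x. f x + g x)"
  by (rule plus_lsq.abs_eq) auto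
lemma cls_diff: "square_integrable f \<Longrightarrow> square_integrable g \<Longrightarrow> cls f - cls g = cls (\<lambda>x. f x - g x)"
  by (rule minus_lsq.abs_eq) auto
lemma cls_scale: "square_integrable f \<Longrightarrow> c *\<^sub>R cls f = cls (\<lambda>x. c * f x)"
  by (rule scaleR_lsq.abs_eq) auto
lemma cls_inner: "square_integrable f \<Longrightarrow> square_integrable g \<Longrightarrow>
    inner (cls f) (cls g) = integral\<^sup>L lebesgue (\<lambda>x. f x * g x)"
  by (rule inner_lsq.abs_eq) auto
lemma cls_zero: "cls (\<lambda>x. 0) = 0" by (simp add: zero_lsq_def)

lemma rep_add: "AE x in lebesgue. rep (f + g) x = rep f x + rep g x"
  using rep_cls[OF square_integrable_add[OF square_integrable_rep[of f] square_integrable_rep[of g]]]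
  by (simp add: cls_add[symmetric])
lemma rep_scale: "AE x in lebesgue. rep (c *\<^sub>R f) x = c * rep f x"
  using rep_cls[OF square_integrable_scale[OF square_integrable_rep[of f], of c]]
  by (simp add: cls_scale[symmetric])

lemma norm_cls:
  assumes "square_integrable f"
  shows "(norm (cls f))\<^sup>2 = integral\<^sup>L lebesgue (\<lambda>x. (f x)\<^sup>2)"
  unfolding power2_norm_eq_inner cls_inner[OF assms assms] power2_eq_square[of "f _"] by (rule refl)

lemma nn_integral_norm_cls:
  "square_integrable f \<Longrightarrow> (\<integral>\<^sup>+x. ennreal ((f x)\<^sup>2) \<partial>lebesgue) = ennreal ((norm (cls f))\<^sup>2)"
  by (simp add: norm_cls nn_integral_eq_integral square_integrable_def)

lemma square_integrable_nn_integral: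
  assumes "f \<in> borel_measurable lebesgue" "(\<integral>\<^sup>+x. ennreal ((f x)\<^sup>2) \<partial>lebesgue) < \<infinity>"
  shows "square_integrable f"
  using assms by (auto simp: square_integrable_def intro!: integrableI_nonneg)

section \<open>Completeness\<close>

text \<open>Norm convergence is L^1 convergence of the squared differences, which holds almost
  everywhere along a subsequence.\<close>

lemma lsq_tendsto_AE_subseq:
  assumes "X \<longlonglongrightarrow> (l :: 'a::euclidean_space lsq)"
  obtains r where "strict_mono r" "AE x in lebesgue. (\<lambda>n. rep (X (r n)) x) \<longlonglongrightarrow> rep l x"
proof -
  define u where "u n x = (rep (X n) x - rep l x)\<^sup>2" for n x
  have sq: "square_integrable (\<lambda>x. rep (X n) x - rep l x)" for n
    by (intro square_integrable_diff square_integrable_rep)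
  have norm_eq: "(\<integral>x. norm (u n x) \<partial>lebesgue) = (norm (X n - l))\<^sup>2" for n
    using norm_cls[OF sq[of n]] by (simp add: u_def cls_diff[symmetric])
  have "(\<lambda>n. norm (X n - l)) \<longlonglongrightarrow> 0" using assms by (simp add: LIM_zero tendsto_norm_zero)
  then have "(\<lambda>n. (norm (X n - l))\<^sup>2) \<longlonglongrightarrow> 0\<^sup>2" by (intro tendsto_power)
  then have "(\<lambda>n. \<integral>x. norm (u n x) \<partial>lebesgue) \<longlonglongrightarrow> 0" unfolding norm_eq by simp
  moreover have "integrable lebesgue (u n)" for n using sq[of n] by (simp add: square_integrable_def u_def[abs_def])
  ultimately obtain r where r: "strict_mono r" "AE x in lebesgue. (\<lambda>n. u (r n) x) \<longlonglongrightarrow> 0"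
    using tendsto_L1_AE_subseq[of lebesgue u] by blast
  from r(2) have "AE x in lebesgue. (\<lambda>n. rep (X (r n)) x) \<longlonglongrightarrow> rep l x"
  proof eventually_elim
    case (elim x)
    then have "(\<lambda>n. sqrt (u (r n) x)) \<longlonglongrightarrow> sqrt 0" by (intro tendsto_real_sqrt)
    then have "(\<lambda>n. \<bar>rep (X (r n)) x - rep l x\<bar>) \<longlonglongrightarrow> 0" by (simp add: u_def)
    then show ?case by (simp add: tendsto_rabs_zero_iff LIM_zero_iff)
  qed
  with r(1) show ?thesis by (rule that)
qed

text \<open>Absolute values leave every norm unchanged, so this is the triangle inequality for their
  classes. It supplies the uniform bound in the Riesz-Fischer argument.\<close>

lemma norm_cls_sum_le:
  fixes f :: "nat \<Rightarrow> 'a::euclidean_space lsq"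
  shows "(\<integral>\<^sup>+x. (\<Sum>k<n. ennreal \<bar>rep (f k) x\<bar>)\<^sup>2 \<partial>lebesgue) \<le> ennreal ((\<Sum>k<n. norm (f k))\<^sup>2)"
proof -
  define g where "g k = cls (\<lambda>x. \<bar>rep (f k) x\<bar>)" for k
  have sq: "square_integrable (\<lambda>x. \<bar>rep (f k) x\<bar>)" for k
    using square_integrable_rep[of "f k"] by (simp add: square_integrable_def)
  have ng: "norm (g k) = norm (f k)" for k
  proof -
    have "(norm (g k))\<^sup>2 = (norm (f k))\<^sup>2"
      unfolding g_def norm_cls[OF sq] using norm_cls[OF square_integrable_rep[of "f k"]] by simp
    then show ?thesis by (simp add: power2_eq_iff_nonneg)
  qed
  have sum: "square_integrable (\<lambda>x. \<Sum>k<n. \<bar>rep (f k) x\<bar>) \<and> cls (\<lambda>x. \<Sum>k<n. \<bar>rep (f k) x\<bar>) = (\<Sum>k<n. g k)"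
  proof (induction n)
    case (Suc n)
    then show ?case using cls_add[OF conjunct1[OF Suc.IH] sq[of n]] square_integrable_add[OF conjunct1[OF Suc.IH] sq[of n]]
      by (simp add: g_def)
  qed (simp add: cls_zero)
  have "(\<integral>\<^sup>+x. (\<Sum>k<n. ennreal \<bar>rep (f k) x\<bar>)\<^sup>2 \<partial>lebesgue) = (\<integral>\<^sup>+x. ennreal ((\<Sum>k<n. \<bar>rep (f k) x\<bar>)\<^sup>2) \<partial>lebesgue)"
    by (intro nn_integral_cong) (simp add: ennreal_power sum_nonneg)
  also have "\<dots> = ennreal ((norm (\<Sum>k<n. g k))\<^sup>2)" using sum nn_integral_norm_cls by metis
  also have "\<dots> \<le> ennreal ((\<Sum>k<n. norm (f k))\<^sup>2)"
    using norm_sum[of g "{..<n}"] by (intro ennreal_leI power_mono) (auto simp: ng)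
  finally show ?thesis .
qed

text \<open>Riesz-Fischer: Fatou's lemma for the sums of absolute values gives absolute convergence
  almost everywhere, and Fatou's lemma for the tails gives norm convergence to the pointwise
  sum.\<close>

lemma lsq_series_convergent:
  fixes f :: "nat \<Rightarrow> 'a::euclidean_space lsq"
  assumes "\<And>k. norm (f k) \<le> (1/2)^k"
  shows "convergent (\<lambda>n. \<Sum>k<n. f k)"
proof -
  \<comment> \<open>In \<open>ennreal\<close> the sum exists before its finiteness is known.\<close>
  define S where "S x = (\<Sum>k. ennreal \<bar>rep (f k) x\<bar>)" for x
  have geo: "(\<Sum>k<n. norm (f k)) \<le> 2" for n
  proof -
    have "(\<Sum>k<n. norm (f k)) \<le> (\<Sum>k<n. (1/2)^k)" by (intro sum_mono assms)
    also have "\<dots> \<le> 2" by (simp add: geometric_sum)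
    finally show ?thesis .
  qed
  have lim: "(\<lambda>n. (\<Sum>k<n. ennreal \<bar>rep (f k) x\<bar>)\<^sup>2) \<longlonglongrightarrow> (S x)\<^sup>2" for x
    unfolding S_def power2_eq_square by (intro tendsto_mult_ennreal summable_LIMSEQ) auto
  have "(\<integral>\<^sup>+x. (S x)\<^sup>2 \<partial>lebesgue) = (\<integral>\<^sup>+x. liminf (\<lambda>n. (\<Sum>k<n. ennreal \<bar>rep (f k) x\<bar>)\<^sup>2) \<partial>lebesgue)"
    by (intro nn_integral_cong lim_imp_Liminf[symmetric] lim) simp
  also have "\<dots> \<le> liminf (\<lambda>n. \<integral>\<^sup>+x. (\<Sum>k<n. ennreal \<bar>rep (f k) x\<bar>)\<^sup>2 \<partial>lebesgue)"
    by (intro nn_integral_liminf) measurable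
  also have "\<dots> \<le> liminf (\<lambda>n. ennreal 4)"
  proof (intro Liminf_mono always_eventually allI order_trans[OF norm_cls_sum_le] ennreal_leI)
    fix n
    have "(\<Sum>k<n. norm (f k))\<^sup>2 \<le> 2\<^sup>2" using geo by (intro power_mono sum_nonneg) auto
    then show "(\<Sum>k<n. norm (f k))\<^sup>2 \<le> 4" by simp
  qed
  also have "\<dots> = 4" by (simp add: Liminf_const)
  finally have S4: "(\<integral>\<^sup>+x. (S x)\<^sup>2 \<partial>lebesgue) \<le> 4" .
  have S_meas [measurable]: "S \<in> borel_measurable lebesgue" unfolding S_def by measurable
  have "AE x in lebesgue. (S x)\<^sup>2 \<noteq> \<infinity>" by (rule nn_integral_noteq_infinite) (use S4 in \<open>auto simp: top_unique\<close>)
  then have AE_sum: "AE x in lebesgue. summable (\<lambda>k. \<bar>rep (f k) x\<bar>)"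
  proof eventually_elim
    case (elim x)
    then have "S x \<noteq> top" by (auto simp: power2_eq_square)
    then show ?case unfolding S_def by (intro summable_suminf_not_top) auto
  qed
  define F where "F x = (\<Sum>k. rep (f k) x)" for x
  have F_meas [measurable]: "F \<in> borel_measurable lebesgue" unfolding F_def by measurable
  have F_bound: "AE x in lebesgue. ennreal ((F x)\<^sup>2) \<le> (S x)\<^sup>2"
    using AE_sum
  proof eventually_elim
    case (elim x)
    then have "ennreal \<bar>F x\<bar> \<le> S x"
      unfolding F_def S_def by (subst suminf_ennreal2) (auto intro!: ennreal_leI summable_rabs)
    then have "(ennreal \<bar>F x\<bar>)\<^sup>2 \<le> (S x)\<^sup>2" by (intro power_mono) auto
    then show ?case by (simp add: ennreal_power)
  qed
  have Fsq: "square_integrable F"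
  proof (rule square_integrable_nn_integral[OF F_meas])
    have "(\<integral>\<^sup>+x. ennreal ((F x)\<^sup>2) \<partial>lebesgue) \<le> 4" using nn_integral_mono_AE[OF F_bound] S4 by order
    then show "(\<integral>\<^sup>+x. ennreal ((F x)\<^sup>2) \<partial>lebesgue) < \<infinity>" by (auto simp: le_less_trans)
  qed
  have partial: "AE x in lebesgue. rep (\<Sum>k<n. f k) x = (\<Sum>k<n. rep (f k) x)" for n
  proof (induction n)
    case 0
    have "AE x in lebesgue. rep (cls (\<lambda>x. 0)) x = 0" by (rule rep_cls) simp
    then show ?case by (simp add: cls_zero)
  next
    case (Suc n)
    with rep_add[of "\<Sum>k<n. f k" "f n"] show ?case by eventually_elim simp
  qed
  have tail: "norm (cls F - (\<Sum>k<n. f k)) \<le> 2 * (1/2)^n" for n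
  proof -
    have tail_j: "norm ((\<Sum>k<j. f k) - (\<Sum>k<n. f k)) \<le> 2 * (1/2)^n" if "n \<le> j" for j
    proof -
      have "(\<Sum>k<j. f k) - (\<Sum>k<n. f k) = (\<Sum>k\<in>{n..<j}. f k)"
        using sum_diff_nat_ivl[of 0 n j f] that by (simp add: lessThan_atLeast0)
      also have "norm \<dots> \<le> (\<Sum>k\<in>{n..<j}. (1/2)^k)" by (rule order_trans[OF norm_sum sum_mono]) (rule assms)
      also have "\<dots> = (\<Sum>k<j-n. (1/2)^(k+n))"
        using that by (intro sum.reindex_bij_witness[of _ "\<lambda>k. k + n" "\<lambda>k. k - n"]) auto
      also have "\<dots> = (1/2)^n * (\<Sum>k<j-n. (1/2)^k)" by (simp add: power_add sum_distrib_left mult.commute)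
      also have "\<dots> \<le> (1/2)^n * 2" by (intro mult_left_mono) (simp_all add: geometric_sum)
      finally show ?thesis by simp
    qed
    define g where "g j x = (rep (\<Sum>k<j. f k) x - rep (\<Sum>k<n. f k) x)\<^sup>2" for j x
    have sqd: "square_integrable (\<lambda>x. rep a x - rep b x)" for a b :: "'a lsq"
      by (intro square_integrable_diff square_integrable_rep)
    have Fd: "square_integrable (\<lambda>x. F x - rep (\<Sum>k<n. f k) x)"
      by (intro square_integrable_diff square_integrable_rep Fsq)
    have "AE x in lebesgue. \<forall>j. rep (\<Sum>k<j. f k) x = (\<Sum>k<j. rep (f k) x)"
      using partial by (simp add: AE_all_countable)
    with AE_sum have "AE x in lebesgue. (\<lambda>j. g j x) \<longlonglongrightarrow> (F x - rep (\<Sum>k<n. f k) x)\<^sup>2"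
    proof eventually_elim
      case (elim x)
      have "(\<lambda>j. \<Sum>k<j. rep (f k) x) \<longlonglongrightarrow> F x"
        unfolding F_def using summable_rabs_cancel[OF elim(1)] by (rule summable_LIMSEQ)
      then show ?case unfolding g_def using elim(2) by (auto intro!: tendsto_intros)
    qed
    then have AE_lim: "AE x in lebesgue. ennreal ((F x - rep (\<Sum>k<n. f k) x)\<^sup>2) = liminf (\<lambda>j. ennreal (g j x))"
      by eventually_elim (auto intro!: lim_imp_Liminf[symmetric] tendsto_ennrealI)
    have "ennreal ((norm (cls F - (\<Sum>k<n. f k)))\<^sup>2) = (\<integral>\<^sup>+x. ennreal ((F x - rep (\<Sum>k<n. f k) x)\<^sup>2) \<partial>lebesgue)"
      using nn_integral_norm_cls[OF Fd] cls_diff[OF Fsq square_integrable_rep] by simp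
    also have "\<dots> = (\<integral>\<^sup>+x. liminf (\<lambda>j. ennreal (g j x)) \<partial>lebesgue)" by (intro nn_integral_cong_AE AE_lim)
    also have "\<dots> \<le> liminf (\<lambda>j. \<integral>\<^sup>+x. ennreal (g j x) \<partial>lebesgue)"
      unfolding g_def by (intro nn_integral_liminf) measurable
    also have "\<dots> = liminf (\<lambda>j. ennreal ((norm ((\<Sum>k<j. f k) - (\<Sum>k<n. f k)))\<^sup>2))"
      unfolding g_def nn_integral_norm_cls[OF sqd] by (simp add: cls_diff[symmetric])
    also have "\<dots> \<le> liminf (\<lambda>j. ennreal ((2 * (1/2)^n)\<^sup>2))"
      by (intro Liminf_mono eventually_sequentiallyI[of n] ennreal_leI power_mono tail_j) auto
    also have "\<dots> = ennreal ((2 * (1/2)^n)\<^sup>2)" by (simp add: Liminf_const)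
    finally have "(norm (cls F - (\<Sum>k<n. f k)))\<^sup>2 \<le> (2 * (1/2)^n)\<^sup>2" by (subst (asm) ennreal_le_iff) auto
    then show ?thesis by (rule power2_le_imp_le) simp
  qed
  have "(\<lambda>n. 2 * (1/2::real)^n) \<longlonglongrightarrow> 2 * 0" by (intro tendsto_intros LIMSEQ_power_zero) auto
  then have "(\<lambda>n. 2 * (1/2::real)^n) \<longlonglongrightarrow> 0" by simp
  moreover have "\<forall>\<^sub>F n in sequentially. norm (cls F - (\<Sum>k<n. f k)) \<le> 2 * (1/2)^n"
    by (intro always_eventually allI tail)
  ultimately have "(\<lambda>n. cls F - (\<Sum>k<n. f k)) \<longlonglongrightarrow> 0" by (rule Lim_null_comparison[rotated])
  from tendsto_diff[OF tendsto_const[of "cls F"] this] have "(\<lambda>n. \<Sum>k<n. f k) \<longlonglongrightarrow> cls F" by simp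
  then show ?thesis by (rule convergentI)
qed

text \<open>A Cauchy sequence converges as soon as a subsequence does; one with gaps below
  \<open>(1/2)^k\<close> telescopes into a series of the kind just summed.\<close>

instance lsq :: (euclidean_space) complete_space
proof
  fix X :: "nat \<Rightarrow> 'a lsq" assume X: "Cauchy X"
  have "\<exists>N. \<forall>m\<ge>N. \<forall>n\<ge>N. dist (X m) (X n) < (1/2)^k" for k :: nat
    using metric_CauchyD[OF X, of "(1/2)^k"] by simp
  then obtain N where N: "\<And>k m n. m \<ge> N k \<Longrightarrow> n \<ge> N k \<Longrightarrow> dist (X m) (X n) < (1/2)^k" by metis
  \<comment> \<open>\<open>Suc m\<close> keeps the indices strictly increasing,
    \<open>N (Suc k)\<close> keeps the gaps geometric.\<close>
  define r where "r = rec_nat (N 0) (\<lambda>k m. max (Suc m) (N (Suc k)))"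
  have r: "r (Suc k) > r k" "r k \<ge> N k" for k
    by (simp add: r_def, cases k) (auto simp: r_def)
  then have mono: "strict_mono r" by (simp add: strict_mono_Suc_iff)
  define f where "f k = X (r (Suc k)) - X (r k)" for k
  have "norm (f k) \<le> (1/2)^k" for k
    using N[of k "r (Suc k)" "r k"] r[of k] by (simp add: f_def dist_norm)
  then obtain l where l: "(\<lambda>n. \<Sum>k<n. f k) \<longlonglongrightarrow> l"
    using lsq_series_convergent[of f] by (auto simp: convergent_def)
  have "(\<Sum>k<n. f k) = X (r n) - X (r 0)" for n
    unfolding f_def by (rule sum_lessThan_telescope)
  with tendsto_add[OF l tendsto_const[of "X (r 0)"]] have "(\<lambda>n. X (r n)) \<longlonglongrightarrow> l + X (r 0)" by simp
  then have "X \<longlonglongrightarrow> l + X (r 0)" using Cauchy_converges_subseq[OF X mono] by (simp add: o_def)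
  then show "convergent X" by (rule convergentI)
qed

section \<open>Test functions\<close>

lemma Ck_on_Suc_imp: "Ck_on (Suc k) U f \<Longrightarrow> Ck_on k U f"
proof (induction k arbitrary: f)
  case 0
  then show ?case by (auto intro!: continuous_at_imp_continuous_on differentiable_imp_continuous_within)
next
  case (Suc k)
  then show ?case by (metis Ck_on.simps(2))
qed

definition smooth :: "(real^'n::finite \<Rightarrow> real) \<Rightarrow> bool" where
  "smooth f \<longleftrightarrow> (\<forall>k. Ck_on k UNIV f)"

lemma smooth_differentiable: "smooth f \<Longrightarrow> f differentiable (at x)"
  unfolding smooth_def by (metis Ck_on.simps(2) UNIV_I)

lemma smooth_partial_deriv: "smooth f \<Longrightarrow> smooth (partial_deriv j f)"
  unfolding smooth_def by (metis Ck_on.simps(2))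

lemma smooth_continuous: "smooth f \<Longrightarrow> continuous_on S f"
  unfolding smooth_def by (metis Ck_on.simps(1) continuous_on_subset subset_UNIV)

lemma smooth_measurable: "smooth f \<Longrightarrow> f \<in> borel_measurable borel"
  by (intro borel_measurable_continuous_onI smooth_continuous)

lemma partial_deriv_eqI:
  assumes "(f has_derivative f') (at x)"
  shows "partial_deriv j f x = f' (axis j 1)"
  using frechet_derivative_at[OF assms] by (simp add: partial_deriv_def)

lemma has_derivative_partial:
  assumes "f differentiable (at x)"
  shows "(f has_derivative (\<lambda>h. \<Sum>j\<in>UNIV. h $ j * partial_deriv j f x)) (at x)"
proof -
  have f: "(f has_derivative frechet_derivative f (at x)) (at x)"
    using assms frechet_derivative_works by blast
  interpret bounded_linear "frechet_derivative f (at x)" using f by (rule has_derivative_bounded_linear)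
  have "frechet_derivative f (at x) h = (\<Sum>j\<in>UNIV. h $ j * partial_deriv j f x)" for h
  proof -
    have "h = (\<Sum>j\<in>UNIV. h $ j *\<^sub>R axis j 1)" by (simp add: basis_expansion scalar_mult_eq_scaleR[symmetric])
    then have "frechet_derivative f (at x) h = frechet_derivative f (at x) (\<Sum>j\<in>UNIV. h $ j *\<^sub>R axis j 1)" by simp
    then show ?thesis by (simp add: sum scaleR partial_deriv_def)
  qed
  then have "frechet_derivative f (at x) = (\<lambda>h. \<Sum>j\<in>UNIV. h $ j * partial_deriv j f x)" by blast
  with f show ?thesis by simp
qed

lemma partial_deriv_along_line:
  assumes "f differentiable (at (x + t *\<^sub>R v))"
  shows "((\<lambda>s. f (x + s *\<^sub>R v)) has_real_derivative (\<Sum>j\<in>UNIV. v $ j * partial_deriv j f (x + t *\<^sub>R v))) (at t)"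
proof -
  have "((\<lambda>s. x + s *\<^sub>R v) has_derivative (\<lambda>s. s *\<^sub>R v)) (at t)" by (auto intro!: derivative_eq_intros)
  from has_derivative_compose[OF this has_derivative_partial[OF assms]]
  show ?thesis unfolding has_field_derivative_def
    by (rule has_derivative_eq_rhs) (auto simp: fun_eq_iff sum_distrib_left sum_distrib_right mult_ac)
qed

lemma partial_deriv_add:
  assumes "f differentiable (at x)" "g differentiable (at x)"
  shows "partial_deriv j (\<lambda>x. f x + g x) x = partial_deriv j f x + partial_deriv j g x"
  by (rule partial_deriv_eqI[THEN trans])
     (auto intro!: has_derivative_add assms[THEN frechet_derivative_works[THEN iffD1]] simp: partial_deriv_def)

lemma partial_deriv_mult:
  assumes "f differentiable (at x)" "g differentiable (at x)"
  shows "partial_deriv j (\<lambda>x. f x * g x) x = f x * partial_deriv j g x + partial_deriv j f x * g x"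
  by (rule partial_deriv_eqI[THEN trans])
     (auto intro!: has_derivative_mult assms[THEN frechet_derivative_works[THEN iffD1]] simp: partial_deriv_def)

lemma Ck_on_const: "Ck_on k UNIV (\<lambda>x::real^'n::finite. c)"
proof (induction k arbitrary: c)
  case (Suc k)
  have "partial_deriv j (\<lambda>x::real^'n. c) = (\<lambda>x. 0)" for j
    by (rule ext) (auto intro!: partial_deriv_eqI[THEN trans])
  with Suc show ?case by simp
qed simp

lemma Ck_on_add:
  "Ck_on k UNIV f \<Longrightarrow> Ck_on k UNIV g \<Longrightarrow> Ck_on k UNIV (\<lambda>x. f x + g x)"
proof (induction k arbitrary: f g)
  case 0
  then show ?case by (auto intro: continuous_on_add)
next
  case (Suc k)
  then have "partial_deriv j (\<lambda>x. f x + g x) = (\<lambda>x. partial_deriv j f x + partial_deriv j g x)" for j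
    by (intro ext partial_deriv_add) auto
  with Suc show ?case by (auto intro!: derivative_intros)
qed

lemma Ck_on_mult:
  "Ck_on k UNIV f \<Longrightarrow> Ck_on k UNIV g \<Longrightarrow> Ck_on k UNIV (\<lambda>x. f x * g x)"
proof (induction k arbitrary: f g)
  case 0
  then show ?case by (auto intro: continuous_on_mult)
next
  case (Suc k)
  then have "partial_deriv j (\<lambda>x. f x * g x) = (\<lambda>x. f x * partial_deriv j g x + partial_deriv j f x * g x)" for j
    by (intro ext partial_deriv_mult) auto
  moreover have "Ck_on k UNIV f" "Ck_on k UNIV g" using Suc.prems by (auto intro: Ck_on_Suc_imp)
  ultimately show ?case using Suc by (auto intro!: derivative_intros Ck_on_add)
qed

lemma smooth_const: "smooth (\<lambda>x. c)" by (simp add: smooth_def Ck_on_const)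
lemma smooth_add: "smooth f \<Longrightarrow> smooth g \<Longrightarrow> smooth (\<lambda>x. f x + g x)" by (simp add: smooth_def Ck_on_add)
lemma smooth_mult: "smooth f \<Longrightarrow> smooth g \<Longrightarrow> smooth (\<lambda>x. f x * g x)" by (simp add: smooth_def Ck_on_mult)
lemma smooth_prod: "(\<And>i. i \<in> A \<Longrightarrow> smooth (f i)) \<Longrightarrow> smooth (\<lambda>x. \<Prod>i\<in>A. f i x)"
  by (induction A rule: infinite_finite_induct) (auto intro: smooth_mult smooth_const)

section \<open>Test functions and integration by parts\<close>

text \<open>Any compact set off which the function vanishes will do, so supports of sums and
  products need not be computed.\<close>

lemma test_functionsI:
  assumes "smooth \<phi>" "compact S" "S \<subseteq> \<Omega>" "\<And>x. x \<notin> S \<Longrightarrow> \<phi> x = 0"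
  shows "\<phi> \<in> test_functions \<Omega>"
proof -
  have "closure {x. \<phi> x \<noteq> 0} \<subseteq> S"
    by (rule closure_minimal) (use assms in \<open>auto intro: compact_imp_closed\<close>)
  moreover from this have "compact (closure {x. \<phi> x \<noteq> 0})"
    using assms(2) closed_closure compact_Int_closed[of S "closure {x. \<phi> x \<noteq> 0}"] by (simp add: Int_absorb1)
  ultimately show ?thesis using assms unfolding test_functions_def smooth_def by blast
qed

text \<open>Off the closed support the function is locally 0, so one compact set serves the function
  and its partial derivatives.\<close>

lemma test_functions_support:
  assumes "\<phi> \<in> test_functions \<Omega>"
  shows "\<exists>S. compact S \<and> S \<subseteq> \<Omega> \<and> (\<forall>x. x \<notin> S \<longrightarrow> \<phi> x = 0 \<and> (\<forall>j. partial_deriv j \<phi> x = 0))"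
proof (intro exI conjI allI impI)
  let ?S = "closure {x. \<phi> x \<noteq> 0}"
  show "compact ?S" "?S \<subseteq> \<Omega>" using assms by (auto simp: test_functions_def)
  show "\<phi> x = 0" if "x \<notin> ?S" for x using that closure_subset[of "{x. \<phi> x \<noteq> 0}"] by auto
  show "partial_deriv j \<phi> x = 0" if "x \<notin> ?S" for x j
  proof -
    have "((\<lambda>x. 0) has_derivative (\<lambda>h. 0)) (at x)" by simp
    then have "(\<phi> has_derivative (\<lambda>h. 0)) (at x)"
      by (rule has_derivative_transform_within_open[where s = "- ?S"])
         (use that closure_subset[of "{x. \<phi> x \<noteq> 0}"] in auto)
    then show ?thesis by (rule partial_deriv_eqI)
  qed
qed

lemma test_smooth: "\<phi> \<in> test_functions \<Omega> \<Longrightarrow> smooth \<phi>"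
  by (simp add: test_functions_def smooth_def)

lemma test_partial_deriv:
  assumes "\<phi> \<in> test_functions \<Omega>" shows "partial_deriv j \<phi> \<in> test_functions \<Omega>"
proof -
  obtain S where "compact S" "S \<subseteq> \<Omega>" "\<And>x. x \<notin> S \<Longrightarrow> partial_deriv j \<phi> x = 0"
    using test_functions_support[OF assms] by blast
  then show ?thesis using test_smooth[OF assms] by (intro test_functionsI[of _ S] smooth_partial_deriv)
qed

lemma test_mult_smooth:
  assumes "\<phi> \<in> test_functions \<Omega>" "smooth \<psi>" shows "(\<lambda>x. \<phi> x * \<psi> x) \<in> test_functions \<Omega>"
proof -
  obtain S where "compact S" "S \<subseteq> \<Omega>" "\<And>x. x \<notin> S \<Longrightarrow> \<phi> x = 0"
    using test_functions_support[OF assms(1)] by blast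
  then show ?thesis using test_smooth[OF assms(1)] assms(2) by (intro test_functionsI[of _ S] smooth_mult) auto
qed

lemma test_scale: "\<phi> \<in> test_functions \<Omega> \<Longrightarrow> (\<lambda>x. c * \<phi> x) \<in> test_functions \<Omega>"
  using test_mult_smooth[OF _ smooth_const, of \<phi> \<Omega> c] by (simp add: mult.commute)

lemma test_add:
  assumes "\<phi> \<in> test_functions \<Omega>" "\<psi> \<in> test_functions \<Omega>"
  shows "(\<lambda>x. \<phi> x + \<psi> x) \<in> test_functions \<Omega>"
proof -
  obtain S where S: "compact S" "S \<subseteq> \<Omega>" "\<And>x. x \<notin> S \<Longrightarrow> \<phi> x = 0"
    using test_functions_support[OF assms(1)] by blast
  obtain T where T: "compact T" "T \<subseteq> \<Omega>" "\<And>x. x \<notin> T \<Longrightarrow> \<psi> x = 0"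
    using test_functions_support[OF assms(2)] by blast
  show ?thesis using test_smooth[OF assms(1)] test_smooth[OF assms(2)] S T
    by (intro test_functionsI[of _ "S \<union> T"] smooth_add) auto
qed

lemma test_zero: "(\<lambda>x. 0) \<in> test_functions \<Omega>"
  by (rule test_functionsI[of _ "{}"]) (auto intro: smooth_const)

lemma test_bounded:
  assumes "\<phi> \<in> test_functions \<Omega>"
  obtains B where "B \<ge> 0" "\<And>x. \<bar>\<phi> x\<bar> \<le> B"
proof -
  obtain S where S: "compact S" "\<And>x. x \<notin> S \<Longrightarrow> \<phi> x = 0"
    using test_functions_support[OF assms] by blast
  have "compact (\<phi> ` S)" using S smooth_continuous[OF test_smooth[OF assms]] by (intro compact_continuous_image)
  from compact_imp_bounded[OF this] obtain B where "\<forall>y\<in>\<phi> ` S. norm y \<le> B" unfolding bounded_iff by blast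
  then have "\<bar>\<phi> x\<bar> \<le> max B 0" for x using S(2)[of x] by (cases "x \<in> S") (auto simp: le_max_iff_disj)
  then show ?thesis by (intro that[of "max B 0"]) auto
qed

lemma test_integrable:
  assumes "\<phi> \<in> test_functions \<Omega>"
  shows "integrable lborel \<phi>" "integrable lebesgue \<phi>"
proof -
  obtain S where S: "compact S" "\<And>x. x \<notin> S \<Longrightarrow> \<phi> x = 0"
    using test_functions_support[OF assms] by blast
  have "integrable lborel (\<lambda>x. indicator S x *\<^sub>R \<phi> x)"
    using S smooth_continuous[OF test_smooth[OF assms]] by (intro borel_integrable_compact)
  moreover have "(\<lambda>x. indicator S x *\<^sub>R \<phi> x) = \<phi>" by (rule ext) (use S(2) in \<open>auto simp: indicator_def\<close>)
  ultimately show *: "integrable lborel \<phi>" by simp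
  then show "integrable lebesgue \<phi>" by (subst integrable_completion) auto
qed

lemma test_measurable: "\<phi> \<in> test_functions \<Omega> \<Longrightarrow> \<phi> \<in> borel_measurable lborel"
  using smooth_measurable[OF test_smooth] by simp

lemma test_square_integrable:
  assumes "\<phi> \<in> test_functions \<Omega>" shows "square_integrable \<phi>"
proof -
  have "integrable lebesgue (\<lambda>x. \<phi> x * \<phi> x)"
    by (rule test_integrable[OF test_mult_smooth[OF assms test_smooth[OF assms]]])
  then show ?thesis using test_measurable[OF assms] by (simp add: square_integrable_def power2_eq_square measurable_completion)
qed

lemma partial_deriv_along_axis:
  assumes "smooth f"
  shows "((\<lambda>s. f (x + s *\<^sub>R axis j 1)) has_real_derivative partial_deriv j f (x + t *\<^sub>R axis j 1)) (at t)"
proof -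
  have "(\<Sum>i\<in>UNIV. axis j 1 $ i * partial_deriv i f (x + t *\<^sub>R axis j 1)) = partial_deriv j f (x + t *\<^sub>R axis j 1)"
    by (simp add: axis_def if_distrib[of "\<lambda>y. y * _"] cong: if_cong)
  with partial_deriv_along_line[OF smooth_differentiable[OF assms], where x = x and t = t and v = "axis j 1"] show ?thesis by simp
qed

lemma smooth_line_mvt:
  assumes "smooth f"
  obtains s where "0 \<le> s" "s \<le> t" "f (x + t *\<^sub>R axis j 1) - f x = t * partial_deriv j f (x + s *\<^sub>R axis j 1)" | "t \<le> 0"
proof (cases "t > 0")
  case True
  have "\<exists>s>0. s < t \<and> f (x + t *\<^sub>R axis j 1) - f (x + 0 *\<^sub>R axis j 1) = (t - 0) * partial_deriv j f (x + s *\<^sub>R axis j 1)"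
    by (rule MVT2[OF True]) (rule partial_deriv_along_axis[OF assms])
  then show ?thesis using that(1) by (auto dest: less_imp_le)
qed (use that in auto)

text \<open>Translation invariance kills the integrals of the difference quotients.\<close>

lemma test_integral_partial_deriv:
  assumes "\<phi> \<in> test_functions (\<Omega> :: (real^'n::finite) set)"
  shows "integral\<^sup>L lebesgue (partial_deriv j \<phi>) = 0"
proof -
  define e where "e = (axis j 1 :: real^'n)"
  define t where "t n = inverse (real (Suc n))" for n
  have t: "0 < t n" "t n \<le> 1" for n by (auto simp: t_def inverse_le_1_iff)
  have t0: "t \<longlonglongrightarrow> 0" unfolding t_def by (rule LIMSEQ_inverse_real_of_nat)
  define g where "g n x = (\<phi> (x + t n *\<^sub>R e) - \<phi> x) / t n" for n x
  have sm: "smooth \<phi>" by (rule test_smooth[OF assms])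
  have pd: "partial_deriv j \<phi> \<in> test_functions \<Omega>" by (rule test_partial_deriv[OF assms])
  obtain B where B: "B \<ge> 0" "\<And>x. \<bar>partial_deriv j \<phi> x\<bar> \<le> B" by (rule test_bounded[OF pd]) blast
  obtain S where S: "compact S" "\<And>x. x \<notin> S \<Longrightarrow> partial_deriv j \<phi> x = 0"
    using test_functions_support[OF assms] by blast
  obtain R where R: "\<And>x. x \<in> S \<Longrightarrow> norm x \<le> R" using compact_imp_bounded[OF S(1)] bounded_iff by blast
  have [measurable]: "\<phi> \<in> borel_measurable borel" "partial_deriv j \<phi> \<in> borel_measurable borel"
    using smooth_measurable sm smooth_partial_deriv by auto
  have shift: "integrable lborel (\<lambda>x. \<phi> (x + c))" "integral\<^sup>L lborel (\<lambda>x. \<phi> (x + c)) = integral\<^sup>L lborel \<phi>" for c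
  proof -
    have "integrable (distr lborel borel ((+) c)) \<phi>" using test_integrable(1)[OF assms] by (simp add: lborel_distr_plus)
    then show "integrable lborel (\<lambda>x. \<phi> (x + c))" by (subst (asm) integrable_distr_eq) (auto simp: add.commute)
    have "integral\<^sup>L lborel \<phi> = integral\<^sup>L (distr lborel borel ((+) c)) \<phi>" by (simp add: lborel_distr_plus)
    also have "\<dots> = integral\<^sup>L lborel (\<lambda>x. \<phi> (x + c))" by (subst integral_distr) (auto simp: add.commute)
    finally show "integral\<^sup>L lborel (\<lambda>x. \<phi> (x + c)) = integral\<^sup>L lborel \<phi>" by simp
  qed
  have g0: "integral\<^sup>L lborel (g n) = 0" for n
    unfolding g_def using shift test_integrable(1)[OF assms] by simp
  have "(\<lambda>n. integral\<^sup>L lborel (g n)) \<longlonglongrightarrow> integral\<^sup>L lborel (partial_deriv j \<phi>)"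
  proof (rule integral_dominated_convergence)
    show "partial_deriv j \<phi> \<in> borel_measurable lborel" by simp
    show "g n \<in> borel_measurable lborel" for n unfolding g_def by measurable
    \<comment> \<open>By the mean value theorem each quotient is a value of the partial derivative
      at distance at most 1, hence bounded by \<open>B\<close> and zero outside the ball of radius
      \<open>R + 1\<close>.\<close>
    show "integrable lborel (\<lambda>x. B * indicator (cball 0 (R + 1)) x :: real)"
      by (intro integrable_mult_right integrable_real_indicator emeasure_bounded_finite[OF bounded_cball]) simp
    show "AE x in lborel. (\<lambda>n. g n x) \<longlonglongrightarrow> partial_deriv j \<phi> x"
    proof (rule AE_I2)
      fix x
      have "((\<lambda>s. \<phi> (x + s *\<^sub>R e)) has_real_derivative (\<Sum>i\<in>UNIV. e $ i * partial_deriv i \<phi> (x + 0 *\<^sub>R e))) (at 0)"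
        by (rule partial_deriv_along_line[OF smooth_differentiable[OF sm]])
      moreover have "(\<Sum>i\<in>UNIV. e $ i * partial_deriv i \<phi> (x + 0 *\<^sub>R e)) = partial_deriv j \<phi> x"
        by (simp add: e_def axis_def if_distrib[of "\<lambda>y. y * _"] cong: if_cong)
      ultimately have "((\<lambda>h. (\<phi> (x + h *\<^sub>R e) - \<phi> x) / h) \<longlongrightarrow> partial_deriv j \<phi> x) (at 0)"
        by (simp add: DERIV_def)
      then show "(\<lambda>n. g n x) \<longlonglongrightarrow> partial_deriv j \<phi> x"
        unfolding g_def by (rule filterlim_compose) (use t t0 in \<open>auto simp: filterlim_at intro!: always_eventually less_imp_neq[symmetric]\<close>)
    qed
    show "AE x in lborel. norm (g n x) \<le> B * indicator (cball 0 (R + 1)) x" for n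
    proof (rule AE_I2)
      fix x
      consider s where "0 \<le> s" "s \<le> t n" "\<phi> (x + t n *\<^sub>R axis j 1) - \<phi> x = t n * partial_deriv j \<phi> (x + s *\<^sub>R axis j 1)"
        | "t n \<le> 0" by (rule smooth_line_mvt[OF sm])
      then show "norm (g n x) \<le> B * indicator (cball 0 (R + 1)) x"
      proof cases
        case 1
        have gx: "g n x = partial_deriv j \<phi> (x + s *\<^sub>R e)" using 1 t[of n] by (simp add: g_def e_def)
        show ?thesis
        proof (cases "x + s *\<^sub>R e \<in> S")
          case True
          have "norm x \<le> norm (x + s *\<^sub>R e) + norm (s *\<^sub>R e)" using norm_triangle_ineq4[of "x + s *\<^sub>R e" "s *\<^sub>R e"] by simp
          also have "\<dots> \<le> R + 1" using R[OF True] 1 t[of n] by (auto simp: e_def)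
          finally show ?thesis using B gx by simp
        next
          case False
          then show ?thesis using gx S(2) B by simp
        qed
      qed (use t[of n] in auto)
    qed
  qed
  then have "integral\<^sup>L lborel (partial_deriv j \<phi>) = 0" by (simp add: g0 LIMSEQ_const_iff)
  then show ?thesis by (simp add: integral_completion)
qed

text \<open>The product is again a test function, so the integral of its partial derivative
  vanishes.\<close>

lemma test_integration_by_parts:
  assumes "\<phi> \<in> test_functions \<Omega>" "\<psi> \<in> test_functions \<Omega>"
  shows "integral\<^sup>L lebesgue (\<lambda>x. \<phi> x * partial_deriv j \<psi> x) = - integral\<^sup>L lebesgue (\<lambda>x. partial_deriv j \<phi> x * \<psi> x)"
proof -
  have "0 = integral\<^sup>L lebesgue (partial_deriv j (\<lambda>x. \<phi> x * \<psi> x))"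
    using test_integral_partial_deriv[OF test_mult_smooth[OF assms(1) test_smooth[OF assms(2)]]] by simp
  also have "partial_deriv j (\<lambda>x. \<phi> x * \<psi> x) = (\<lambda>x. \<phi> x * partial_deriv j \<psi> x + partial_deriv j \<phi> x * \<psi> x)"
    using assms by (intro ext partial_deriv_mult smooth_differentiable) (auto intro: test_smooth)
  also have "integral\<^sup>L lebesgue \<dots> = integral\<^sup>L lebesgue (\<lambda>x. \<phi> x * partial_deriv j \<psi> x) + integral\<^sup>L lebesgue (\<lambda>x. partial_deriv j \<phi> x * \<psi> x)"
    using square_integrable_mult[OF test_square_integrable[OF assms(1)] test_square_integrable[OF test_partial_deriv[OF assms(2)]]]
      square_integrable_mult[OF test_square_integrable[OF test_partial_deriv[OF assms(1)]] test_square_integrable[OF assms(2)]]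
    by (intro Bochner_Integration.integral_add)
  finally show ?thesis by simp
qed

section \<open>Bump functions and the fundamental lemma\<close>

text \<open>The functions t^(-n) exp(-1/t), extended by 0. The whole family is taken because
  derivatives are linear combinations of its members, which makes smoothness an induction with
  \<open>n\<close> arbitrary.\<close>

definition flat :: "nat \<Rightarrow> real \<Rightarrow> real" where
  "flat n t = (if t > 0 then (1/t)^n * exp (- (1/t)) else 0)"

lemma flat_tendsto_0: "(flat n \<longlongrightarrow> 0) (at 0)"
proof -
  have "((\<lambda>t. (1/t)^n / exp (1/t)) \<longlongrightarrow> 0) (at_right (0::real))"
    by (rule filterlim_compose[OF tendsto_power_div_exp_0])
       (simp add: filterlim_inverse_at_top_right divide_inverse)
  then have "(flat n \<longlongrightarrow> 0) (at_right 0)"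
    by (rule Lim_transform_eventually) (auto simp: flat_def exp_minus field_simps eventually_at_right_less intro: eventually_mono[OF eventually_at_right_less])
  moreover have "(flat n \<longlongrightarrow> 0) (at_left 0)"
    by (rule tendsto_eventually) (auto simp: flat_def eventually_at_filter)
  ultimately show ?thesis by (simp add: filterlim_at_split)
qed

lemma flat_deriv: "(flat n has_real_derivative (flat (n+2) t - real n * flat (n+1) t)) (at t)"
proof -
  consider "t > 0" | "t < 0" | "t = 0" by linarith
  then show ?thesis
  proof cases
    case 1
    define y where "y = 1 / t"
    have "((\<lambda>y. y^n * exp (- y)) has_real_derivative (real n * y^(n-1) * exp (- y) - y^n * exp (- y))) (at (1 / t))"
      unfolding y_def by (auto intro!: derivative_eq_intros)
    moreover have "((\<lambda>t. 1 / t) has_real_derivative - (y\<^sup>2)) (at t)"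
      using 1 by (auto intro!: derivative_eq_intros simp: y_def power2_eq_square)
    ultimately have "((\<lambda>t. (1/t)^n * exp (- (1/t))) has_real_derivative
       (real n * y^(n-1) * exp (- y) - y^n * exp (- y)) * - (y\<^sup>2)) (at t)"
      by (rule DERIV_chain2)
    also have "(real n * y^(n-1) * exp (- y) - y^n * exp (- y)) * - (y\<^sup>2) = flat (n+2) t - real n * flat (n+1) t"
    proof -
      have "real n * y^(n-1) * y\<^sup>2 = real n * y^(n+1)" by (cases n) (simp_all add: power2_eq_square)
      moreover have "(real n * y^(n-1) * exp (- y) - y^n * exp (- y)) * - (y\<^sup>2)
          = y^(n+2) * exp (- y) - (real n * y^(n-1) * y\<^sup>2) * exp (- y)"
        by (simp add: power_add power2_eq_square algebra_simps)
      ultimately show ?thesis using 1 by (simp add: flat_def y_def)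
    qed
    finally have "((\<lambda>t. (1/t)^n * exp (- (1/t))) has_real_derivative (flat (n+2) t - real n * flat (n+1) t)) (at t)" .
    then show ?thesis
      by (rule has_field_derivative_transform_within_open[where S="{0<..}"]) (use 1 in \<open>auto simp: flat_def\<close>)
  next
    case 2
    have "((\<lambda>t. 0) has_real_derivative (flat (n+2) t - real n * flat (n+1) t)) (at t)"
      using 2 by (simp add: flat_def)
    then show ?thesis
      by (rule has_field_derivative_transform_within_open[where S="{..<0}"]) (use 2 in \<open>auto simp: flat_def\<close>)
  next
    case 3
    \<comment> \<open>At 0 the difference quotient of \<open>flat n\<close> is
      \<open>flat (n+1)\<close>, which tends to 0.\<close>
    have "((\<lambda>h. (flat n h - flat n 0) / (h - 0)) \<longlongrightarrow> 0) (at 0)"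
      by (rule Lim_transform_eventually[OF flat_tendsto_0[of "n+1"]])
         (auto simp: flat_def eventually_at_filter field_simps)
    then show ?thesis using 3 by (simp add: has_field_derivative_iff flat_def)
  qed
qed

lemma smooth_flat_coordinate:
  "smooth (\<lambda>x::real^'n::finite. flat n (\<alpha> * x $ i + \<gamma>))"
proof -
  have der: "((\<lambda>x::real^'n. flat n (\<alpha> * x $ i + \<gamma>)) has_derivative
     (\<lambda>h. (flat (n+2) (\<alpha> * x $ i + \<gamma>) - real n * flat (n+1) (\<alpha> * x $ i + \<gamma>)) * (\<alpha> * h $ i))) (at x)" for n x
  proof -
    have "((\<lambda>x::real^'n. \<alpha> * x $ i + \<gamma>) has_derivative (\<lambda>h. \<alpha> * h $ i)) (at x)"
      by (auto intro!: derivative_eq_intros bounded_linear.has_derivative[OF bounded_linear_vec_nth])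
    from has_derivative_compose[OF this flat_deriv[unfolded has_field_derivative_def]] show ?thesis .
  qed
  have "Ck_on k UNIV (\<lambda>x::real^'n. flat n (\<alpha> * x $ i + \<gamma>))" for k
  proof (induction k arbitrary: n)
    case 0
    then show ?case
      using has_derivative_continuous[OF der] by (auto intro!: continuous_at_imp_continuous_on)
  next
    case (Suc k)
    have "partial_deriv j (\<lambda>x::real^'n. flat n (\<alpha> * x $ i + \<gamma>)) =
       (\<lambda>x. (\<alpha> * axis j 1 $ i) * flat (n+2) (\<alpha> * x $ i + \<gamma>) + (- (\<alpha> * axis j 1 $ i) * real n) * flat (n+1) (\<alpha> * x $ i + \<gamma>))" for j
      by (rule ext, rule trans[OF partial_deriv_eqI[OF der]]) (simp add: algebra_simps)
    moreover have "(\<lambda>x::real^'n. flat n (\<alpha> * x $ i + \<gamma>)) differentiable (at x)" for x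
      using der by (rule differentiableI)
    moreover have "Ck_on k UNIV (\<lambda>x. (\<alpha> * axis j 1 $ i) * flat (n+2) (\<alpha> * x $ i + \<gamma>)
        + (- (\<alpha> * axis j 1 $ i) * real n) * flat (n+1) (\<alpha> * x $ i + \<gamma>))" for j :: 'n
      by (intro Ck_on_add Ck_on_mult Ck_on_const Suc)
    ultimately show ?case by (simp only: Ck_on.simps) blast
  qed
  then show ?thesis by (simp add: smooth_def)
qed

lemma flat0_bounds: "0 \<le> flat 0 t" "flat 0 t \<le> 1" "flat 0 t = 0 \<longleftrightarrow> t \<le> 0"
  by (auto simp: flat_def)

lemma flat0_limit: "(\<lambda>n. flat 0 (real (Suc n) * t)) \<longlonglongrightarrow> indicator {0<..} t"
proof (cases "t > 0")
  case True
  have "(\<lambda>n. exp (- (inverse (real (Suc n)) * (1/t)))) \<longlonglongrightarrow> exp (- (0 * (1/t)))"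
    by (intro tendsto_intros LIMSEQ_inverse_real_of_nat)
  moreover have "flat 0 (real (Suc n) * t) = exp (- (inverse (real (Suc n)) * (1/t)))" for n
    using True by (simp add: flat_def inverse_eq_divide)
  ultimately show ?thesis using True by simp
next
  case False
  then have "flat 0 (real (Suc n) * t) = 0" for n by (simp add: flat0_bounds mult_le_0_iff not_less)
  then show ?thesis using False by simp
qed

text \<open>A product of one-sided bumps at all faces, evaluated at \<open>n + 1\<close> times the
  distance: exp(-1 / ((n + 1) t)) tends to 1 for positive \<open>t\<close>, and the bump is 0
  otherwise. The closed box carries the support and must therefore lie in the domain.\<close>

lemma box_approximation:
  fixes a b :: "real^'n::finite"
  obtains \<psi> :: "nat \<Rightarrow> real^'n \<Rightarrow> real"
  where "\<And>n \<Omega>. cbox a b \<subseteq> \<Omega> \<Longrightarrow> \<psi> n \<in> test_functions \<Omega>" "\<And>n x. \<bar>\<psi> n x\<bar> \<le> indicator (box a b) x"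
    "\<And>x. (\<lambda>n. \<psi> n x) \<longlonglongrightarrow> indicator (box a b) x"
proof -
  define \<psi> where "\<psi> n x = (\<Prod>i\<in>UNIV. flat 0 (real (Suc n) * (x $ i - a $ i)) * flat 0 (real (Suc n) * (b $ i - x $ i)))"
    for n and x :: "real^'n"
  have sm: "smooth (\<psi> n)" for n
  proof -
    have "\<psi> n = (\<lambda>x. \<Prod>i\<in>UNIV. flat 0 (real (Suc n) * x $ i + (- real (Suc n) * a $ i)) *
        flat 0 ((- real (Suc n)) * x $ i + real (Suc n) * b $ i))"
      by (rule ext) (simp add: \<psi>_def algebra_simps)
    moreover have "smooth \<dots>" by (intro smooth_prod smooth_mult smooth_flat_coordinate)
    ultimately show ?thesis by simp
  qed
  have mem: "x \<in> box a b \<longleftrightarrow> (\<forall>i. a $ i < x $ i \<and> x $ i < b $ i)" for x by (simp add: mem_box_cart)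
  have zero: "\<psi> n x = 0" if "x \<notin> box a b" for n x
  proof -
    have "\<not> (\<forall>i. a $ i < x $ i \<and> x $ i < b $ i)" using that mem by blast
    then obtain i where "x $ i \<le> a $ i \<or> b $ i \<le> x $ i" by (meson not_less)
    then have "flat 0 (real (Suc n) * (x $ i - a $ i)) * flat 0 (real (Suc n) * (b $ i - x $ i)) = 0"
      by (auto simp: flat0_bounds mult_le_0_iff)
    then show ?thesis unfolding \<psi>_def by (intro prod_zero bexI[of _ i]) auto
  qed
  have "\<psi> n \<in> test_functions \<Omega>" if "cbox a b \<subseteq> \<Omega>" for n \<Omega>
    by (intro test_functionsI[of _ "cbox a b"] sm compact_cbox that zero) (use box_subset_cbox[of a b] in blast)
  moreover have "\<bar>\<psi> n x\<bar> \<le> indicator (box a b) x" for n x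
  proof (cases "x \<in> box a b")
    case True
    have "0 \<le> \<psi> n x \<and> \<psi> n x \<le> 1" unfolding \<psi>_def
      by (intro conjI prod_nonneg prod_le_1 mult_nonneg_nonneg mult_le_one flat0_bounds ballI)
    then show ?thesis using True by simp
  qed (simp add: zero)
  moreover have "(\<lambda>n. \<psi> n x) \<longlonglongrightarrow> indicator (box a b) x" for x
  proof -
    have "(\<lambda>n. \<psi> n x) \<longlonglongrightarrow> (\<Prod>i\<in>UNIV. indicator {0<..} (x $ i - a $ i) * indicator {0<..} (b $ i - x $ i))"
      unfolding \<psi>_def by (intro tendsto_prod tendsto_mult flat0_limit)
    also have "(\<Prod>i\<in>UNIV. indicator {0<..} (x $ i - a $ i) * indicator {0<..} (b $ i - x $ i)) = (indicator (box a b) x :: real)"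
    proof (cases "x \<in> box a b")
      case True
      then show ?thesis by (simp add: mem)
    next
      case False
      then have "\<not> (\<forall>i. a $ i < x $ i \<and> x $ i < b $ i)" using mem by blast
      then obtain i where "x $ i \<le> a $ i \<or> b $ i \<le> x $ i" by (meson not_less)
      then have "(\<Prod>i\<in>UNIV. indicator {0<..} (x $ i - a $ i) * indicator {0<..} (b $ i - x $ i)) = (0::real)"
        by (intro prod_zero bexI[of _ i]) auto
      with False show ?thesis by simp
    qed
    finally show ?thesis .
  qed
  ultimately show ?thesis by (rule that)
qed

text \<open>Vanishing integrals pass from test functions to boxes by dominated convergence, from
  boxes to Borel sets because boxes are stable under intersection, and then to the function by
  uniqueness of densities.\<close>

lemma fundamental_lemma:
  fixes g :: "real^'n::finite \<Rightarrow> real"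
  assumes \<Omega>: "open \<Omega>" and g: "square_integrable g"
    and zero: "\<And>\<phi>. \<phi> \<in> test_functions \<Omega> \<Longrightarrow> integral\<^sup>L lebesgue (\<lambda>x. g x * \<phi> x) = 0"
  shows "AE x in lebesgue. x \<in> \<Omega> \<longrightarrow> g x = 0"
proof -
  have int_box: "integrable lebesgue (\<lambda>x. g x * indicator A x)" if "A \<subseteq> cbox a b" "A \<in> sets lebesgue" for A a b
  proof (rule square_integrable_mult[OF g])
    have "emeasure lebesgue A \<le> emeasure lebesgue (cbox a b)" using that by (intro emeasure_mono) auto
    then have "emeasure lebesgue A < \<infinity>" using emeasure_lborel_cbox_finite[of a b] by (simp add: order_le_less_trans)
    then show "square_integrable (indicator A :: _ \<Rightarrow> real)"
    proof -
      have "(\<lambda>x. (indicator A x :: real)\<^sup>2) = indicator A" by (auto simp: indicator_def fun_eq_iff)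
      then show ?thesis using that \<open>emeasure lebesgue A < \<infinity>\<close> by (simp add: square_integrable_def)
    qed
  qed
  have box0: "integral\<^sup>L lebesgue (\<lambda>x. g x * indicator (box a b) x) = 0" if "cbox a b \<subseteq> \<Omega>" for a b
  proof -
    obtain \<psi> :: "nat \<Rightarrow> real^'n \<Rightarrow> real" where \<psi>: "\<And>n \<Omega>. cbox a b \<subseteq> \<Omega> \<Longrightarrow> \<psi> n \<in> test_functions \<Omega>"
      "\<And>n x. \<bar>\<psi> n x\<bar> \<le> indicator (box a b) x" "\<And>x. (\<lambda>n. \<psi> n x) \<longlonglongrightarrow> indicator (box a b) x"
      by (rule box_approximation[of a b]) blast
    have "(\<lambda>n. integral\<^sup>L lebesgue (\<lambda>x. g x * \<psi> n x)) \<longlonglongrightarrow> integral\<^sup>L lebesgue (\<lambda>x. g x * indicator (box a b) x)"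
    proof (rule integral_dominated_convergence)
      have int: "integrable lebesgue (\<lambda>x. g x * indicator (box a b) x)"
        by (rule int_box[of _ a b]) (auto simp: box_subset_cbox)
      show "integrable lebesgue (\<lambda>x. \<bar>g x * indicator (box a b) x\<bar>)" using integrable_abs[OF int] .
      show "(\<lambda>x. g x * indicator (box a b) x) \<in> borel_measurable lebesgue" using int by auto
      show "(\<lambda>x. g x * \<psi> n x) \<in> borel_measurable lebesgue" for n
        by (intro borel_measurable_times square_integrable_measurable g test_square_integrable[OF \<psi>(1)[OF that]])
      show "AE x in lebesgue. (\<lambda>n. g x * \<psi> n x) \<longlonglongrightarrow> g x * indicator (box a b) x"
        by (intro AE_I2 tendsto_intros \<psi>(3))
      show "AE x in lebesgue. norm (g x * \<psi> n x) \<le> \<bar>g x * indicator (box a b) x\<bar>" for n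
        by (intro AE_I2) (auto simp: abs_mult intro!: mult_left_mono \<psi>(2))
    qed
    then show ?thesis using zero[OF \<psi>(1)[OF that]] by (simp add: LIMSEQ_const_iff)
  qed
  have AE_box: "AE x in lebesgue. x \<in> cbox a b \<longrightarrow> g x = 0" if ab: "cbox a b \<subseteq> \<Omega>" for a b
  proof -
    \<comment> \<open>Cut down to a box, \<open>g\<close> becomes integrable; on the whole space it
      is only known to be square integrable.\<close>
    define h where "h x = g x * indicator (box a b) x" for x
    have h: "integrable lebesgue h" unfolding h_def by (rule int_box[of _ a b]) (auto simp: box_subset_cbox)
    \<comment> \<open>Uniqueness of densities is applied on \<open>lborel\<close>, hence the Borel
      version.\<close>
    obtain h' where h': "h' \<in> borel_measurable lborel" "AE x in lborel. h x = h' x"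
      using completion_ex_borel_measurable_real[OF borel_measurable_integrable[OF h]] by blast
    have AEh: "AE x in lebesgue. h x = h' x" using h'(2) by (rule AE_completion)
    have "integrable lebesgue h'"
      using h h' AEh by (subst integrable_cong_AE[of h' lebesgue h]) (auto intro: measurable_completion)
    then have h'_int: "integrable lborel h'" using h'(1) by (simp add: integrable_completion)
    have eq: "(LINT x:A|lborel. h' x) = integral\<^sup>L lebesgue (\<lambda>x. h x * indicator A x)" if A: "A \<in> sets borel" for A
    proof -
      have "(LINT x:A|lborel. h' x) = integral\<^sup>L lebesgue (\<lambda>x. indicator A x *\<^sub>R h' x)"
        unfolding set_lebesgue_integral_def using h'(1) A by (subst integral_completion) auto
      also have "\<dots> = integral\<^sup>L lebesgue (\<lambda>x. h x * indicator A x)"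
      proof (rule integral_cong_AE)
        show "(\<lambda>x. indicator A x *\<^sub>R h' x) \<in> borel_measurable lebesgue"
          using h'(1) A by (intro measurable_completion) auto
        show "(\<lambda>x. h x * indicator A x) \<in> borel_measurable lebesgue"
          using A borel_measurable_integrable[OF h] by (intro borel_measurable_times borel_measurable_indicator) auto
        show "AE x in lebesgue. indicator A x *\<^sub>R h' x = h x * indicator A x"
          using AEh by eventually_elim simp
      qed
      finally show ?thesis .
    qed
    have total: "integral\<^sup>L lborel h' = 0"
      using eq[of UNIV] box0[OF ab] by (simp add: h_def[abs_def] set_lebesgue_integral_def)
    have "(LINT x:A|lborel. h' x) = 0" if "A \<in> sigma_sets UNIV (range (\<lambda>(a, b). box a b :: (real^'n) set))" for A
    proof -
      have "Int_stable (range (\<lambda>(a, b). box a b :: (real^'n) set))"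
        by (auto simp: Int_stable_def box_Int_box)
      moreover have "range (\<lambda>(a, b). box a b :: (real^'n) set) \<subseteq> Pow UNIV" by auto
      ultimately show ?thesis using that
    proof (induction A rule: sigma_sets_induct_disjoint)
      case (basic A)
      then obtain c d where A: "A = box c d" by auto
      define p where "p = (\<Sum>i\<in>Basis. max (a\<bullet>i) (c\<bullet>i) *\<^sub>R i)"
      define q where "q = (\<Sum>i\<in>Basis. min (b\<bullet>i) (d\<bullet>i) *\<^sub>R i)"
      have "cbox p q \<subseteq> \<Omega>" using ab Int_interval[of a b c d] unfolding p_def q_def by auto
      moreover have "(\<lambda>x. h x * indicator A x) = (\<lambda>x. g x * indicator (box p q) x)"
        using box_Int_box[of a b c d] by (auto simp: h_def A p_def q_def indicator_def fun_eq_iff)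
      ultimately show ?case using box0[of p q] eq[of A] by (simp add: A)
    next
      case empty
      show ?case by (simp add: set_lebesgue_integral_def)
    next
      case (compl A)
      then have A: "A \<in> sets borel" by (simp add: borel_eq_box)
      have "(LINT x:(UNIV - A)|lborel. h' x) = integral\<^sup>L lborel (\<lambda>x. h' x - indicator A x *\<^sub>R h' x)"
        unfolding set_lebesgue_integral_def by (intro Bochner_Integration.integral_cong) (auto simp: indicator_def)
      also have "\<dots> = integral\<^sup>L lborel h' - (LINT x:A|lborel. h' x)"
        unfolding set_lebesgue_integral_def
        using h'_int A by (intro Bochner_Integration.integral_diff integrable_mult_indicator) auto
      finally show ?case using compl total by simp
    next
      case (union A)
      then have A: "A i \<in> sets borel" for i by (auto simp: borel_eq_box)
      have "(LINT x:(\<Union>i. A i)|lborel. h' x) = (\<Sum>i. (LINT x:(A i)|lborel. h' x))"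
      proof (rule lebesgue_integral_countable_add)
        show "set_integrable lborel (\<Union>i. A i) h'" unfolding set_integrable_def
          using h'_int A by (intro integrable_mult_indicator) auto
      qed (use A union in \<open>auto simp: disjoint_family_on_def\<close>)
      then show ?case using union by simp
    qed
    qed
    then have "AE x in lborel. h' x = 0"
      by (intro sigma_finite_measure.density_unique_banach[OF sigma_finite_lborel] h'_int) (auto simp: borel_eq_box set_lebesgue_integral_def)
    then have "AE x in lebesgue. h' x = 0" by (rule AE_completion)
    moreover have "cbox a b - box a b \<in> null_sets lebesgue"
      using negligible_frontier_interval[of a b] by (simp add: negligible_iff_null_sets)
    then have "AE x in lebesgue. x \<notin> cbox a b - box a b" by (rule AE_not_in)
    ultimately show ?thesis using AEh by eventually_elim (auto simp: h_def indicator_def)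
  qed
  \<comment> \<open>Countably many closed boxes exhaust the domain, so the exceptional null sets can
    be united.\<close>
  obtain D where D: "countable D" "D \<subseteq> Pow \<Omega>" "\<And>X. X \<in> D \<Longrightarrow> \<exists>a b. X = cbox a b" "\<Union>D = \<Omega>"
    using open_countable_Union_open_cbox[OF \<Omega>] by metis
  have "\<forall>X\<in>D. AE x in lebesgue. x \<in> X \<longrightarrow> g x = 0"
  proof
    fix X assume X: "X \<in> D"
    then obtain a b where "X = cbox a b" using D(3) by blast
    with X D(2) AE_box[of a b] show "AE x in lebesgue. x \<in> X \<longrightarrow> g x = 0" by blast
  qed
  then have "AE x in lebesgue. \<forall>X\<in>D. x \<in> X \<longrightarrow> g x = 0" unfolding AE_ball_countable[OF D(1)] .
  then show ?thesis by eventually_elim (use D(4) in auto)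
qed

section \<open>The Sobolev embedding into \<open>L\<^sup>4\<close>\<close>

lemma amgm3:
  fixes x y z :: real
  assumes "x \<ge> 0" "y \<ge> 0" "z \<ge> 0"
  shows "x * y * z \<le> ((x + y + z) / 3)^3"
proof -
  have "(x + y + z)^3 - 27 * (x * y * z) = (x + y + z) / 2 * ((x - y)\<^sup>2 + (y - z)\<^sup>2 + (z - x)\<^sup>2)
      + 3 * (x * (y - z)\<^sup>2 + y * (z - x)\<^sup>2 + z * (x - y)\<^sup>2)"
    by (simp add: power2_eq_square power3_eq_cube field_simps)
  also have "\<dots> \<ge> 0" using assms by (intro add_nonneg_nonneg mult_nonneg_nonneg) auto
  finally show ?thesis by (simp add: power_divide)
qed

lemma ennreal_linear3:
  assumes "p \<ge> 0" "q \<ge> 0" "r \<ge> 0" "x \<ge> 0" "y \<ge> 0" "z \<ge> 0"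
  shows "ennreal (p * x + q * y + r * z) = ennreal p * ennreal x + ennreal q * ennreal y + ennreal r * ennreal z"
proof -
  have "ennreal (p * x + q * y + r * z) = ennreal (p * x) + ennreal (q * y) + ennreal (r * z)"
    using assms by simp
  then show ?thesis using assms by (simp only: ennreal_mult)
qed

lemma ennreal_mult4:
  assumes "p \<ge> 0" "q \<ge> 0" "r \<ge> 0" "x \<ge> 0"
  shows "ennreal (p * q * r * x) = ennreal p * ennreal q * ennreal r * ennreal x"
  using assms by (simp add: ennreal_mult)

lemma nn_integral_lborel_pair:
  fixes f :: "'a::euclidean_space \<times> 'b::euclidean_space \<Rightarrow> ennreal"
  assumes "f \<in> borel_measurable borel"
  shows "(\<integral>\<^sup>+x. f x \<partial>lborel) = (\<integral>\<^sup>+a. \<integral>\<^sup>+b. f (a, b) \<partial>lborel \<partial>lborel)"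
  unfolding lborel_prod[symmetric]
  by (rule lborel.nn_integral_fst[symmetric]) (use assms in \<open>simp add: lborel_prod\<close>)

lemma borel_measurable_section:
  fixes f :: "'a::euclidean_space \<times> 'b::euclidean_space \<Rightarrow> ennreal"
  assumes "f \<in> borel_measurable borel"
  shows "(\<lambda>y. f (a, y)) \<in> borel_measurable borel"
  by (rule measurable_compose[OF _ assms]) (intro borel_measurable_continuous_onI continuous_intros)

text \<open>Hoelder's inequality with three exponents \<open>3\<close>, phrased without roots.\<close>

lemma nn_integral_holder3:
  fixes w f g h :: "'a \<Rightarrow> ennreal"
  assumes [measurable]: "w \<in> borel_measurable M" "f \<in> borel_measurable M" "g \<in> borel_measurable M" "h \<in> borel_measurable M"
    and le: "\<And>x. w x ^ 3 \<le> K * f x * g x * h x"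
  shows "(\<integral>\<^sup>+x. w x \<partial>M) ^ 3 \<le> K * (\<integral>\<^sup>+x. f x \<partial>M) * (\<integral>\<^sup>+x. g x \<partial>M) * (\<integral>\<^sup>+x. h x \<partial>M)"
proof -
  define A where "A = (\<integral>\<^sup>+x. f x \<partial>M)"
  define B where "B = (\<integral>\<^sup>+x. g x \<partial>M)"
  define C where "C = (\<integral>\<^sup>+x. h x \<partial>M)"
  have zero: ?thesis if "AE x in M. K * f x * g x * h x = 0"
  proof -
    have "AE x in M. w x = 0" using that
    proof eventually_elim
      case (elim x)
      with le[of x] have "w x ^ 3 = 0" by simp
      then show ?case by simp
    qed
    then have "(\<integral>\<^sup>+x. w x \<partial>M) = 0" by (simp add: nn_integral_0_iff_AE)
    then show ?thesis by simp
  qed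
  \<comment> \<open>The root and the divisions below need positive finite integrals. A vanishing
    factor forces \<open>w\<close> to vanish almost everywhere, and an infinite factor among nonzero
    ones makes the right-hand side infinite.\<close>
  consider "K = 0 \<or> A = 0 \<or> B = 0 \<or> C = 0" | "K \<noteq> 0" "A \<noteq> 0" "B \<noteq> 0" "C \<noteq> 0" "K = top \<or> A = top \<or> B = top \<or> C = top"
    | "K \<noteq> 0" "A \<noteq> 0" "B \<noteq> 0" "C \<noteq> 0" "K \<noteq> top" "A \<noteq> top" "B \<noteq> top" "C \<noteq> top"
    by blast
  then show ?thesis
  proof cases
    case 1
    have "AE x in M. K * f x * g x * h x = 0"
      using 1
    proof (elim disjE)
      assume "A = 0"
      then have "AE x in M. f x = 0" by (simp add: A_def nn_integral_0_iff_AE)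
      then show ?thesis by eventually_elim simp
    next
      assume "B = 0"
      then have "AE x in M. g x = 0" by (simp add: B_def nn_integral_0_iff_AE)
      then show ?thesis by eventually_elim simp
    next
      assume "C = 0"
      then have "AE x in M. h x = 0" by (simp add: C_def nn_integral_0_iff_AE)
      then show ?thesis by eventually_elim simp
    qed simp
    then show ?thesis by (rule zero)
  next
    case 2
    then have "K * A * B * C = top" by (auto simp: ennreal_mult_eq_top_iff)
    then show ?thesis unfolding A_def B_def C_def by simp
  next
    case 3
    obtain k where k: "K = ennreal k" "k > 0" using 3(1,5) by (cases K) auto
    obtain a where a: "A = ennreal a" "a > 0" using 3(2,6) by (cases A) auto
    obtain b where b: "B = ennreal b" "b > 0" using 3(3,7) by (cases B) auto
    obtain c where c: "C = ennreal c" "c > 0" using 3(4,8) by (cases C) auto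
    \<comment> \<open>The bound to be reached. Each factor is divided by its own integral before the
      arithmetic-geometric mean inequality, so that the resulting majorant integrates exactly to
      \<open>q\<close>.\<close>
    define q where "q = root 3 (k * a * b * c)"
    have kabc: "k * a * b * c > 0" using k a b c by simp
    have q: "q > 0" "q ^ 3 = k * a * b * c" unfolding q_def using kabc by (auto intro: real_root_pow_pos)
    have "AE x in M. f x \<noteq> \<infinity>" using 3 by (intro nn_integral_noteq_infinite) (auto simp: A_def)
    moreover have "AE x in M. g x \<noteq> \<infinity>" using 3 by (intro nn_integral_noteq_infinite) (auto simp: B_def)
    moreover have "AE x in M. h x \<noteq> \<infinity>" using 3 by (intro nn_integral_noteq_infinite) (auto simp: C_def)
    ultimately have "AE x in M. w x \<le> ennreal (q / (3 * a)) * f x + ennreal (q / (3 * b)) * g x + ennreal (q / (3 * c)) * h x"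
    proof eventually_elim
      case (elim x)
      obtain u where u: "f x = ennreal u" "u \<ge> 0" using elim by (cases "f x") auto
      obtain v where v: "g x = ennreal v" "v \<ge> 0" using elim by (cases "g x") auto
      obtain y where y: "h x = ennreal y" "y \<ge> 0" using elim by (cases "h x") auto
      have le': "w x ^ 3 \<le> ennreal (k * u * v * y)" using le[of x] k u v y by (simp add: ennreal_mult)
      then have "w x \<noteq> top" by (auto simp: top_unique)
      then obtain s where s: "w x = ennreal s" "s \<ge> 0" by (cases "w x") auto
      have "s ^ 3 \<le> k * u * v * y" using le' s k u v y by (simp add: ennreal_power)
      also have "\<dots> = q ^ 3 * ((u / a) * (v / b) * (y / c))" using a b c by (simp add: q(2))
      also have "\<dots> \<le> q ^ 3 * ((u / a + v / b + y / c) / 3) ^ 3"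
        using q(1) u v y a b c by (intro mult_left_mono amgm3 zero_le_power) auto
      also have "\<dots> = (q * ((u / a + v / b + y / c) / 3)) ^ 3" by (rule power_mult_distrib[symmetric])
      finally have "s \<le> q * ((u / a + v / b + y / c) / 3)"
        by (rule power_le_imp_le_base[of _ 2, simplified numeral_3_eq_3[symmetric] numeral_2_eq_2]) (use q u v y a b c in auto)
      also have "\<dots> = q / (3 * a) * u + q / (3 * b) * v + q / (3 * c) * y" using a b c by (simp add: field_simps)
      finally have "w x \<le> ennreal (q / (3 * a) * u + q / (3 * b) * v + q / (3 * c) * y)" unfolding s by (rule ennreal_leI)
      also have "\<dots> = ennreal (q / (3 * a)) * f x + ennreal (q / (3 * b)) * g x + ennreal (q / (3 * c)) * h x"
        unfolding u v y using q(1) a b c u v y by (intro ennreal_linear3) auto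
      finally show ?case .
    qed
    then have "(\<integral>\<^sup>+x. w x \<partial>M) \<le> (\<integral>\<^sup>+x. ennreal (q / (3 * a)) * f x + ennreal (q / (3 * b)) * g x + ennreal (q / (3 * c)) * h x \<partial>M)"
      by (rule nn_integral_mono_AE)
    also have "\<dots> = ennreal (q / (3 * a)) * A + ennreal (q / (3 * b)) * B + ennreal (q / (3 * c)) * C"
      by (simp add: nn_integral_add nn_integral_cmult A_def B_def C_def)
    also have "\<dots> = ennreal (q / (3 * a) * a + q / (3 * b) * b + q / (3 * c) * c)"
      unfolding a b c using q(1) a b c by (intro ennreal_linear3[symmetric]) auto
    also have "q / (3 * a) * a + q / (3 * b) * b + q / (3 * c) * c = q" using a b c by simp
    finally have "(\<integral>\<^sup>+x. w x \<partial>M) ^ 3 \<le> ennreal q ^ 3" by (intro power_mono) auto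
    also have "\<dots> = K * A * B * C" using q k a b c by (simp add: ennreal_power ennreal_mult)
    finally show ?thesis by (simp add: A_def B_def C_def)
  qed
qed

abbreviation B4 :: "(real \<times> real \<times> real \<times> real) measure" where
  "B4 \<equiv> borel \<Otimes>\<^sub>M borel \<Otimes>\<^sub>M borel \<Otimes>\<^sub>M borel"

text \<open>One variable is integrated at a time. The factor already integrated over that variable
  does not depend on it and serves as the constant \<open>K\<close> of Hoelder's inequality; the
  other three are its functions. Tonelli finally restores a common order of integration.\<close>

lemma loomis_whitney4:
  fixes w f\<^sub>1 f\<^sub>2 f\<^sub>3 f\<^sub>4 :: "real \<times> real \<times> real \<times> real \<Rightarrow> ennreal"
  assumes [measurable]: "w \<in> borel_measurable B4" "f\<^sub>1 \<in> borel_measurable B4" "f\<^sub>2 \<in> borel_measurable B4"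
      "f\<^sub>3 \<in> borel_measurable B4" "f\<^sub>4 \<in> borel_measurable B4"
    and le: "\<And>d c b a. w (d, c, b, a) ^ 3 \<le> (\<integral>\<^sup>+a. f\<^sub>1 (d, c, b, a) \<partial>lborel) * (\<integral>\<^sup>+b. f\<^sub>2 (d, c, b, a) \<partial>lborel)
        * (\<integral>\<^sup>+c. f\<^sub>3 (d, c, b, a) \<partial>lborel) * (\<integral>\<^sup>+d. f\<^sub>4 (d, c, b, a) \<partial>lborel)"
  shows "(\<integral>\<^sup>+x. w x \<partial>lborel) ^ 3 \<le> (\<integral>\<^sup>+x. f\<^sub>1 x \<partial>lborel) * (\<integral>\<^sup>+x. f\<^sub>2 x \<partial>lborel) * (\<integral>\<^sup>+x. f\<^sub>3 x \<partial>lborel) * (\<integral>\<^sup>+x. f\<^sub>4 x \<partial>lborel)"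
proof -
  have tonelli: "(\<integral>\<^sup>+x. f x \<partial>lborel) = (\<integral>\<^sup>+d. \<integral>\<^sup>+c. \<integral>\<^sup>+b. \<integral>\<^sup>+a. f (d, c, b, a) \<partial>lborel \<partial>lborel \<partial>lborel \<partial>lborel)"
    if [measurable]: "f \<in> borel_measurable B4" for f :: "real \<times> real \<times> real \<times> real \<Rightarrow> ennreal"
  proof -
    have f: "f \<in> borel_measurable borel" using that by (simp add: borel_prod)
    show ?thesis
      by (subst nn_integral_lborel_pair[OF f] | intro nn_integral_cong |
          subst nn_integral_lborel_pair[OF borel_measurable_section[OF f]] |
          rule nn_integral_lborel_pair[OF borel_measurable_section[OF borel_measurable_section[OF f]]])+
  qed
  define g\<^sub>1 where "g\<^sub>1 d c b = (\<integral>\<^sup>+a. f\<^sub>1 (d, c, b, a) \<partial>lborel)" for d c b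
  define g\<^sub>2 where "g\<^sub>2 d c a = (\<integral>\<^sup>+b. f\<^sub>2 (d, c, b, a) \<partial>lborel)" for d c a
  define g\<^sub>3 where "g\<^sub>3 d b a = (\<integral>\<^sup>+c. f\<^sub>3 (d, c, b, a) \<partial>lborel)" for d b a
  define g\<^sub>4 where "g\<^sub>4 c b a = (\<integral>\<^sup>+d. f\<^sub>4 (d, c, b, a) \<partial>lborel)" for c b a
  note g_defs = g\<^sub>1_def g\<^sub>2_def g\<^sub>3_def g\<^sub>4_def
  have s1: "(\<integral>\<^sup>+a. w (d, c, b, a) \<partial>lborel) ^ 3
      \<le> g\<^sub>1 d c b * (\<integral>\<^sup>+a. g\<^sub>2 d c a \<partial>lborel) * (\<integral>\<^sup>+a. g\<^sub>3 d b a \<partial>lborel) * (\<integral>\<^sup>+a. g\<^sub>4 c b a \<partial>lborel)" for d c b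
    unfolding g_defs by (rule nn_integral_holder3) (measurable, rule le)
  have s2: "(\<integral>\<^sup>+b. \<integral>\<^sup>+a. w (d, c, b, a) \<partial>lborel \<partial>lborel) ^ 3
      \<le> (\<integral>\<^sup>+a. g\<^sub>2 d c a \<partial>lborel) * (\<integral>\<^sup>+b. g\<^sub>1 d c b \<partial>lborel) * (\<integral>\<^sup>+b. \<integral>\<^sup>+a. g\<^sub>3 d b a \<partial>lborel \<partial>lborel)
        * (\<integral>\<^sup>+b. \<integral>\<^sup>+a. g\<^sub>4 c b a \<partial>lborel \<partial>lborel)" for d c
  proof (rule nn_integral_holder3)
    show "(\<integral>\<^sup>+a. w (d, c, b, a) \<partial>lborel) ^ 3 \<le> (\<integral>\<^sup>+a. g\<^sub>2 d c a \<partial>lborel) * g\<^sub>1 d c b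
        * (\<integral>\<^sup>+a. g\<^sub>3 d b a \<partial>lborel) * (\<integral>\<^sup>+a. g\<^sub>4 c b a \<partial>lborel)" for b
      using s1[of d c b] by (simp add: mult_ac)
  qed (unfold g_defs, measurable)
  have s3: "(\<integral>\<^sup>+c. \<integral>\<^sup>+b. \<integral>\<^sup>+a. w (d, c, b, a) \<partial>lborel \<partial>lborel \<partial>lborel) ^ 3
      \<le> (\<integral>\<^sup>+b. \<integral>\<^sup>+a. g\<^sub>3 d b a \<partial>lborel \<partial>lborel) * (\<integral>\<^sup>+c. \<integral>\<^sup>+b. g\<^sub>1 d c b \<partial>lborel \<partial>lborel)
        * (\<integral>\<^sup>+c. \<integral>\<^sup>+a. g\<^sub>2 d c a \<partial>lborel \<partial>lborel) * (\<integral>\<^sup>+c. \<integral>\<^sup>+b. \<integral>\<^sup>+a. g\<^sub>4 c b a \<partial>lborel \<partial>lborel \<partial>lborel)" for d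
  proof (rule nn_integral_holder3)
    show "(\<integral>\<^sup>+b. \<integral>\<^sup>+a. w (d, c, b, a) \<partial>lborel \<partial>lborel) ^ 3 \<le> (\<integral>\<^sup>+b. \<integral>\<^sup>+a. g\<^sub>3 d b a \<partial>lborel \<partial>lborel)
        * (\<integral>\<^sup>+b. g\<^sub>1 d c b \<partial>lborel) * (\<integral>\<^sup>+a. g\<^sub>2 d c a \<partial>lborel) * (\<integral>\<^sup>+b. \<integral>\<^sup>+a. g\<^sub>4 c b a \<partial>lborel \<partial>lborel)" for c
      using s2[of d c] by (simp add: mult_ac)
  qed (unfold g_defs, measurable)
  have main: "(\<integral>\<^sup>+d. \<integral>\<^sup>+c. \<integral>\<^sup>+b. \<integral>\<^sup>+a. w (d, c, b, a) \<partial>lborel \<partial>lborel \<partial>lborel \<partial>lborel) ^ 3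
      \<le> (\<integral>\<^sup>+c. \<integral>\<^sup>+b. \<integral>\<^sup>+a. g\<^sub>4 c b a \<partial>lborel \<partial>lborel \<partial>lborel) * (\<integral>\<^sup>+d. \<integral>\<^sup>+c. \<integral>\<^sup>+b. g\<^sub>1 d c b \<partial>lborel \<partial>lborel \<partial>lborel)
        * (\<integral>\<^sup>+d. \<integral>\<^sup>+c. \<integral>\<^sup>+a. g\<^sub>2 d c a \<partial>lborel \<partial>lborel \<partial>lborel) * (\<integral>\<^sup>+d. \<integral>\<^sup>+b. \<integral>\<^sup>+a. g\<^sub>3 d b a \<partial>lborel \<partial>lborel \<partial>lborel)"
  proof (rule nn_integral_holder3)
    show "(\<integral>\<^sup>+c. \<integral>\<^sup>+b. \<integral>\<^sup>+a. w (d, c, b, a) \<partial>lborel \<partial>lborel \<partial>lborel) ^ 3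
      \<le> (\<integral>\<^sup>+c. \<integral>\<^sup>+b. \<integral>\<^sup>+a. g\<^sub>4 c b a \<partial>lborel \<partial>lborel \<partial>lborel) * (\<integral>\<^sup>+c. \<integral>\<^sup>+b. g\<^sub>1 d c b \<partial>lborel \<partial>lborel)
        * (\<integral>\<^sup>+c. \<integral>\<^sup>+a. g\<^sub>2 d c a \<partial>lborel \<partial>lborel) * (\<integral>\<^sup>+b. \<integral>\<^sup>+a. g\<^sub>3 d b a \<partial>lborel \<partial>lborel)" for d
      using s3[of d] by (simp add: mult_ac)
  qed (unfold g_defs, measurable)
  have swap: "(\<integral>\<^sup>+y. \<integral>\<^sup>+x. f x y \<partial>lborel \<partial>lborel) = (\<integral>\<^sup>+x. \<integral>\<^sup>+y. f x y \<partial>lborel \<partial>lborel)"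
    if "(\<lambda>(x, y). f x y) \<in> borel_measurable (borel \<Otimes>\<^sub>M borel)" for f :: "real \<Rightarrow> real \<Rightarrow> ennreal"
    using that by (intro lborel_pair.Fubini') simp
  have 1: "(\<integral>\<^sup>+d. \<integral>\<^sup>+c. \<integral>\<^sup>+b. g\<^sub>1 d c b \<partial>lborel \<partial>lborel \<partial>lborel) = (\<integral>\<^sup>+x. f\<^sub>1 x \<partial>lborel)"
    by (simp add: tonelli g\<^sub>1_def)
  have 2: "(\<integral>\<^sup>+d. \<integral>\<^sup>+c. \<integral>\<^sup>+a. g\<^sub>2 d c a \<partial>lborel \<partial>lborel \<partial>lborel) = (\<integral>\<^sup>+x. f\<^sub>2 x \<partial>lborel)"
    unfolding tonelli[OF assms(3)] g\<^sub>2_def by (intro nn_integral_cong swap) measurable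
  have 3: "(\<integral>\<^sup>+d. \<integral>\<^sup>+b. \<integral>\<^sup>+a. g\<^sub>3 d b a \<partial>lborel \<partial>lborel \<partial>lborel) = (\<integral>\<^sup>+x. f\<^sub>3 x \<partial>lborel)"
  proof -
    have "(\<integral>\<^sup>+d. \<integral>\<^sup>+b. \<integral>\<^sup>+a. g\<^sub>3 d b a \<partial>lborel \<partial>lborel \<partial>lborel)
        = (\<integral>\<^sup>+d. \<integral>\<^sup>+b. \<integral>\<^sup>+c. \<integral>\<^sup>+a. f\<^sub>3 (d, c, b, a) \<partial>lborel \<partial>lborel \<partial>lborel \<partial>lborel)"
      unfolding g\<^sub>3_def by (intro nn_integral_cong swap) measurable
    also have "\<dots> = (\<integral>\<^sup>+d. \<integral>\<^sup>+c. \<integral>\<^sup>+b. \<integral>\<^sup>+a. f\<^sub>3 (d, c, b, a) \<partial>lborel \<partial>lborel \<partial>lborel \<partial>lborel)"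
      by (intro nn_integral_cong swap) measurable
    finally show ?thesis by (simp add: tonelli)
  qed
  have 4: "(\<integral>\<^sup>+c. \<integral>\<^sup>+b. \<integral>\<^sup>+a. g\<^sub>4 c b a \<partial>lborel \<partial>lborel \<partial>lborel) = (\<integral>\<^sup>+x. f\<^sub>4 x \<partial>lborel)"
  proof -
    have "(\<integral>\<^sup>+c. \<integral>\<^sup>+b. \<integral>\<^sup>+a. g\<^sub>4 c b a \<partial>lborel \<partial>lborel \<partial>lborel)
        = (\<integral>\<^sup>+c. \<integral>\<^sup>+b. \<integral>\<^sup>+d. \<integral>\<^sup>+a. f\<^sub>4 (d, c, b, a) \<partial>lborel \<partial>lborel \<partial>lborel \<partial>lborel)"
      unfolding g\<^sub>4_def by (intro nn_integral_cong swap) measurable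
    also have "\<dots> = (\<integral>\<^sup>+c. \<integral>\<^sup>+d. \<integral>\<^sup>+b. \<integral>\<^sup>+a. f\<^sub>4 (d, c, b, a) \<partial>lborel \<partial>lborel \<partial>lborel \<partial>lborel)"
      by (intro nn_integral_cong swap) measurable
    also have "\<dots> = (\<integral>\<^sup>+d. \<integral>\<^sup>+c. \<integral>\<^sup>+b. \<integral>\<^sup>+a. f\<^sub>4 (d, c, b, a) \<partial>lborel \<partial>lborel \<partial>lborel \<partial>lborel)"
      by (intro swap) measurable
    finally show ?thesis by (simp add: tonelli)
  qed
  show ?thesis using main unfolding 1 2 3 4 tonelli[OF assms(1), symmetric] by (simp add: mult_ac)
qed

text \<open>The fundamental theorem of calculus for \<open>u^3\<close>, whose derivative is
  \<open>3 u^2 u'\<close>, started at a point left of the support.\<close>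

lemma cube_le_line_integral:
  fixes u u' :: "real \<Rightarrow> real"
  assumes deriv: "\<And>t. (u has_real_derivative u' t) (at t)" and cont: "continuous_on UNIV u'"
    and supp: "\<And>t. \<bar>t\<bar> > R \<Longrightarrow> u t = 0"
  shows "ennreal (\<bar>u s\<bar> ^ 3) \<le> (\<integral>\<^sup>+t. ennreal (3 * (u t)\<^sup>2 * \<bar>u' t\<bar>) \<partial>lborel)"
proof (cases "\<bar>s\<bar> > R")
  case True
  then show ?thesis using supp by simp
next
  case False
  define l where "l = - R - 1"
  have l: "l \<le> s" "u l = 0" using False by (auto simp: l_def intro!: supp)
  have ucont: "continuous_on S u" for S
    by (rule DERIV_continuous_on) (rule has_field_derivative_at_within[OF deriv])
  have fcont: "continuous_on {l..s} (\<lambda>t. 3 * (u t)\<^sup>2 * u' t)"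
    by (intro continuous_intros ucont continuous_on_subset[OF cont]) auto
  have ftc: "integral\<^sup>L lborel (\<lambda>x. indicator {l..s} x *\<^sub>R (3 * (u x)\<^sup>2 * u' x)) = u s ^ 3 - u l ^ 3"
  proof (rule integral_FTC_atLeastAtMost[OF l(1) _ fcont])
    fix x
    have "((\<lambda>x. u x ^ 3) has_real_derivative 3 * (u x)\<^sup>2 * u' x) (at x)"
      using deriv[of x] by (auto intro!: derivative_eq_intros simp: power2_eq_square)
    then show "((\<lambda>x. u x ^ 3) has_vector_derivative 3 * (u x)\<^sup>2 * u' x) (at x within {l..s})"
      by (simp add: has_real_derivative_iff_has_vector_derivative[symmetric] has_field_derivative_at_within)
  qed
  have "ennreal (\<bar>u s\<bar> ^ 3) = ennreal (norm (integral\<^sup>L lborel (\<lambda>x. indicator {l..s} x *\<^sub>R (3 * (u x)\<^sup>2 * u' x))))"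
    unfolding ftc using l by (simp add: power_abs)
  also have "\<dots> \<le> (\<integral>\<^sup>+x. ennreal (norm (indicator {l..s} x *\<^sub>R (3 * (u x)\<^sup>2 * u' x))) \<partial>lborel)"
    using borel_integrable_atLeastAtMost'[OF fcont] by (intro integral_norm_bound_ennreal) (simp add: set_integrable_def)
  also have "\<dots> \<le> (\<integral>\<^sup>+t. ennreal (3 * (u t)\<^sup>2 * \<bar>u' t\<bar>) \<partial>lborel)"
    by (intro nn_integral_mono ennreal_leI) (auto simp: indicator_def abs_mult)
  finally show ?thesis .
qed

lemma power4_cube_abs: "(x ^ 4) ^ 3 = \<bar>x\<bar> ^ 3 * \<bar>x\<bar> ^ 3 * \<bar>x\<bar> ^ 3 * \<bar>x\<bar> ^ 3" for x :: real
proof -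
  have "x ^ 4 = \<bar>x\<bar> ^ 4" by (simp add: power_even_abs)
  then show ?thesis by (simp only: power_mult[symmetric] power_add[symmetric]) simp
qed

text \<open>The Loomis--Whitney inequality for \<open>\<bar>F\<bar>\<^sup>3\<close>, whose partial derivatives are bounded by
  \<open>3 F\<^sup>2 \<bar>D\<^sub>j\<bar>\<close>.\<close>

lemma gagliardo_nirenberg4:
  fixes F D\<^sub>1 D\<^sub>2 D\<^sub>3 D\<^sub>4 :: "real \<times> real \<times> real \<times> real \<Rightarrow> real"
  assumes cont: "continuous_on UNIV F" "continuous_on UNIV D\<^sub>1" "continuous_on UNIV D\<^sub>2" "continuous_on UNIV D\<^sub>3" "continuous_on UNIV D\<^sub>4"
    and deriv: "\<And>d c b a. ((\<lambda>a. F (d, c, b, a)) has_real_derivative D\<^sub>1 (d, c, b, a)) (at a)"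
      "\<And>d c b a. ((\<lambda>b. F (d, c, b, a)) has_real_derivative D\<^sub>2 (d, c, b, a)) (at b)"
      "\<And>d c b a. ((\<lambda>c. F (d, c, b, a)) has_real_derivative D\<^sub>3 (d, c, b, a)) (at c)"
      "\<And>d c b a. ((\<lambda>d. F (d, c, b, a)) has_real_derivative D\<^sub>4 (d, c, b, a)) (at d)"
    and supp: "\<And>d c b a. \<bar>a\<bar> > R \<or> \<bar>b\<bar> > R \<or> \<bar>c\<bar> > R \<or> \<bar>d\<bar> > R \<Longrightarrow> F (d, c, b, a) = 0"
    and E: "(\<integral>\<^sup>+x. ennreal ((D\<^sub>1 x)\<^sup>2) \<partial>lborel) \<le> E" "(\<integral>\<^sup>+x. ennreal ((D\<^sub>2 x)\<^sup>2) \<partial>lborel) \<le> E"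
      "(\<integral>\<^sup>+x. ennreal ((D\<^sub>3 x)\<^sup>2) \<partial>lborel) \<le> E" "(\<integral>\<^sup>+x. ennreal ((D\<^sub>4 x)\<^sup>2) \<partial>lborel) \<le> E"
  shows "(\<integral>\<^sup>+x. ennreal (F x ^ 4) \<partial>lborel) \<le> 81 * E\<^sup>2"
proof -
  define Y where "Y = (\<integral>\<^sup>+x. ennreal (F x ^ 4) \<partial>lborel)"
  have B4: "B4 = borel" by (simp add: borel_prod)
  have [measurable]: "F \<in> borel_measurable B4" "D\<^sub>1 \<in> borel_measurable B4" "D\<^sub>2 \<in> borel_measurable B4"
      "D\<^sub>3 \<in> borel_measurable B4" "D\<^sub>4 \<in> borel_measurable B4"
    unfolding B4 using cont by (auto intro: borel_measurable_continuous_onI)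
  have sect: "continuous_on UNIV (\<lambda>a. G (d, c, b, a))" "continuous_on UNIV (\<lambda>b. G (d, c, b, a))"
      "continuous_on UNIV (\<lambda>c. G (d, c, b, a))" "continuous_on UNIV (\<lambda>d. G (d, c, b, a))"
    if "continuous_on UNIV G" for G :: "real \<times> real \<times> real \<times> real \<Rightarrow> real" and a b c d
    by (intro continuous_on_compose2[OF that] continuous_intros; simp)+
  define X where "X D = (\<integral>\<^sup>+x. ennreal (3 * (F x)\<^sup>2 * \<bar>D x\<bar>) \<partial>lborel)" for D
  have "Y ^ 3 \<le> X D\<^sub>1 * X D\<^sub>2 * X D\<^sub>3 * X D\<^sub>4"
    unfolding Y_def X_def
  proof (rule loomis_whitney4)
    fix d c b a
    have "ennreal (F (d, c, b, a) ^ 4) ^ 3 = ennreal ((F (d, c, b, a) ^ 4) ^ 3)"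
      by (simp add: ennreal_power)
    also have "(F (d, c, b, a) ^ 4) ^ 3 = \<bar>F (d, c, b, a)\<bar> ^ 3 * \<bar>F (d, c, b, a)\<bar> ^ 3 * \<bar>F (d, c, b, a)\<bar> ^ 3 * \<bar>F (d, c, b, a)\<bar> ^ 3"
      by (rule power4_cube_abs)
    also have "ennreal \<dots> = ennreal (\<bar>F (d, c, b, a)\<bar> ^ 3) * ennreal (\<bar>F (d, c, b, a)\<bar> ^ 3) * ennreal (\<bar>F (d, c, b, a)\<bar> ^ 3) * ennreal (\<bar>F (d, c, b, a)\<bar> ^ 3)"
      by (rule ennreal_mult4) auto
    also have "\<dots> \<le> (\<integral>\<^sup>+a. ennreal (3 * (F (d, c, b, a))\<^sup>2 * \<bar>D\<^sub>1 (d, c, b, a)\<bar>) \<partial>lborel)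
        * (\<integral>\<^sup>+b. ennreal (3 * (F (d, c, b, a))\<^sup>2 * \<bar>D\<^sub>2 (d, c, b, a)\<bar>) \<partial>lborel)
        * (\<integral>\<^sup>+c. ennreal (3 * (F (d, c, b, a))\<^sup>2 * \<bar>D\<^sub>3 (d, c, b, a)\<bar>) \<partial>lborel)
        * (\<integral>\<^sup>+d. ennreal (3 * (F (d, c, b, a))\<^sup>2 * \<bar>D\<^sub>4 (d, c, b, a)\<bar>) \<partial>lborel)"
    proof -
      have "ennreal (\<bar>F (d, c, b, a)\<bar> ^ 3) \<le> (\<integral>\<^sup>+a. ennreal (3 * (F (d, c, b, a))\<^sup>2 * \<bar>D\<^sub>1 (d, c, b, a)\<bar>) \<partial>lborel)"
        by (rule cube_le_line_integral[where u = "\<lambda>a. F (d, c, b, a)" and R = R, OF deriv(1) sect(1)[OF cont(2)]]) (simp add: supp)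
      moreover have "ennreal (\<bar>F (d, c, b, a)\<bar> ^ 3) \<le> (\<integral>\<^sup>+b. ennreal (3 * (F (d, c, b, a))\<^sup>2 * \<bar>D\<^sub>2 (d, c, b, a)\<bar>) \<partial>lborel)"
        by (rule cube_le_line_integral[where u = "\<lambda>b. F (d, c, b, a)" and R = R, OF deriv(2) sect(2)[OF cont(3)]]) (simp add: supp)
      moreover have "ennreal (\<bar>F (d, c, b, a)\<bar> ^ 3) \<le> (\<integral>\<^sup>+c. ennreal (3 * (F (d, c, b, a))\<^sup>2 * \<bar>D\<^sub>3 (d, c, b, a)\<bar>) \<partial>lborel)"
        by (rule cube_le_line_integral[where u = "\<lambda>c. F (d, c, b, a)" and R = R, OF deriv(3) sect(3)[OF cont(4)]]) (simp add: supp)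
      moreover have "ennreal (\<bar>F (d, c, b, a)\<bar> ^ 3) \<le> (\<integral>\<^sup>+d. ennreal (3 * (F (d, c, b, a))\<^sup>2 * \<bar>D\<^sub>4 (d, c, b, a)\<bar>) \<partial>lborel)"
        by (rule cube_le_line_integral[where u = "\<lambda>d. F (d, c, b, a)" and R = R, OF deriv(4) sect(4)[OF cont(5)]]) (simp add: supp)
      ultimately show ?thesis by (intro mult_mono) auto
    qed
    finally show "ennreal (F (d, c, b, a) ^ 4) ^ 3 \<le> (\<integral>\<^sup>+a. ennreal (3 * (F (d, c, b, a))\<^sup>2 * \<bar>D\<^sub>1 (d, c, b, a)\<bar>) \<partial>lborel)
        * (\<integral>\<^sup>+b. ennreal (3 * (F (d, c, b, a))\<^sup>2 * \<bar>D\<^sub>2 (d, c, b, a)\<bar>) \<partial>lborel)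
        * (\<integral>\<^sup>+c. ennreal (3 * (F (d, c, b, a))\<^sup>2 * \<bar>D\<^sub>3 (d, c, b, a)\<bar>) \<partial>lborel)
        * (\<integral>\<^sup>+d. ennreal (3 * (F (d, c, b, a))\<^sup>2 * \<bar>D\<^sub>4 (d, c, b, a)\<bar>) \<partial>lborel)" .
  qed measurable
  \<comment> \<open>Cauchy-Schwarz splits \<open>3 F^2 |D|\<close> into the unknown \<open>Y\<close>
    and the energy.\<close>
  moreover have X2: "(X D)\<^sup>2 \<le> 9 * (Y * E)" if [measurable]: "D \<in> borel_measurable B4"
      and DE: "(\<integral>\<^sup>+x. ennreal ((D x)\<^sup>2) \<partial>lborel) \<le> E" for D
  proof -
    have [measurable]: "F \<in> borel_measurable borel" "D \<in> borel_measurable borel" unfolding B4[symmetric] by measurable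
    have "X D = (\<integral>\<^sup>+x. 3 * (ennreal ((F x)\<^sup>2) * ennreal \<bar>D x\<bar>) \<partial>lborel)"
      unfolding X_def by (intro nn_integral_cong) (simp add: ennreal_mult mult.assoc)
    also have "\<dots> = 3 * (\<integral>\<^sup>+x. ennreal ((F x)\<^sup>2) * ennreal \<bar>D x\<bar> \<partial>lborel)" by (rule nn_integral_cmult) measurable
    finally have "(X D)\<^sup>2 = 9 * (\<integral>\<^sup>+x. ennreal ((F x)\<^sup>2) * ennreal \<bar>D x\<bar> \<partial>lborel)\<^sup>2"
      by (simp add: power_mult_distrib)
    also have "\<dots> \<le> 9 * ((\<integral>\<^sup>+x. ennreal ((F x)\<^sup>2) ^ 2 \<partial>lborel) * (\<integral>\<^sup>+x. ennreal \<bar>D x\<bar> ^ 2 \<partial>lborel))"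
      by (intro mult_left_mono Cauchy_Schwarz_nn_integral) measurable
    also have "(\<integral>\<^sup>+x. ennreal ((F x)\<^sup>2) ^ 2 \<partial>lborel) = Y"
      unfolding Y_def by (intro nn_integral_cong) (simp add: ennreal_power power_mult[symmetric])
    also have "(\<integral>\<^sup>+x. ennreal \<bar>D x\<bar> ^ 2 \<partial>lborel) = (\<integral>\<^sup>+x. ennreal ((D x)\<^sup>2) \<partial>lborel)"
      by (intro nn_integral_cong) (simp add: ennreal_power)
    also have "9 * (Y * (\<integral>\<^sup>+x. ennreal ((D x)\<^sup>2) \<partial>lborel)) \<le> 9 * (Y * E)" using DE by (intro mult_left_mono) auto
    finally show ?thesis .
  qed
  ultimately have "(Y ^ 3)\<^sup>2 \<le> (X D\<^sub>1 * X D\<^sub>2 * X D\<^sub>3 * X D\<^sub>4)\<^sup>2" by (intro power_mono) auto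
  also have "\<dots> = (X D\<^sub>1)\<^sup>2 * (X D\<^sub>2)\<^sup>2 * (X D\<^sub>3)\<^sup>2 * (X D\<^sub>4)\<^sup>2" by (simp add: power_mult_distrib)
  also have "\<dots> \<le> (9 * (Y * E)) * (9 * (Y * E)) * (9 * (Y * E)) * (9 * (Y * E))"
  proof -
    have "(X D\<^sub>1)\<^sup>2 \<le> 9 * (Y * E)" by (rule X2[OF _ E(1)]) measurable
    moreover have "(X D\<^sub>2)\<^sup>2 \<le> 9 * (Y * E)" by (rule X2[OF _ E(2)]) measurable
    moreover have "(X D\<^sub>3)\<^sup>2 \<le> 9 * (Y * E)" by (rule X2[OF _ E(3)]) measurable
    moreover have "(X D\<^sub>4)\<^sup>2 \<le> 9 * (Y * E)" by (rule X2[OF _ E(4)]) measurable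
    ultimately show ?thesis by (intro mult_mono) simp_all
  qed
  finally have *: "(Y ^ 3)\<^sup>2 \<le> (9 * (Y * E)) ^ 4" by (simp add: power4_eq_xxxx mult.assoc)
  \<comment> \<open>The inequality just obtained says Y^6 \<le> 9^4 Y^4 E^4; cancelling Y^4 and
    taking a square root gives the constant 81.\<close>
  have "Y \<le> 81 * E\<^sup>2"
  proof (cases "E = top \<or> Y = 0")
    case True
    then show ?thesis by (auto simp: power2_eq_square ennreal_mult_top ennreal_top_mult)
  next
    case False
    \<comment> \<open>Cancelling Y^4 needs \<open>Y\<close> finite, which the bounded support
      provides.\<close>
    have Yfin: "Y < top"
    proof -
      define K where "K = cbox (-R,-R,-R,-R) (R,R,R,R)"
      have "integrable lborel (\<lambda>x. indicator K x *\<^sub>R (F x ^ 4))"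
        unfolding K_def by (intro borel_integrable_compact compact_cbox continuous_intros continuous_on_subset[OF cont(1)]) auto
      then have "(\<integral>\<^sup>+x. ennreal (norm (indicator K x *\<^sub>R (F x ^ 4))) \<partial>lborel) < \<infinity>" by (simp add: integrable_iff_bounded)
      also have "(\<integral>\<^sup>+x. ennreal (norm (indicator K x *\<^sub>R (F x ^ 4))) \<partial>lborel) = Y"
        unfolding Y_def
      proof (intro nn_integral_cong)
        fix x :: "real \<times> real \<times> real \<times> real"
        obtain d c b a where x: "x = (d, c, b, a)" by (cases x)
        show "ennreal (norm (indicator K x *\<^sub>R (F x ^ 4))) = ennreal (F x ^ 4)"
        proof (cases "x \<in> K")
          case False
          then have "\<bar>a\<bar> > R \<or> \<bar>b\<bar> > R \<or> \<bar>c\<bar> > R \<or> \<bar>d\<bar> > R"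
            unfolding K_def x cbox_Pair_eq by (auto simp: abs_le_iff not_le)
          then show ?thesis using supp by (simp add: x)
        qed simp
      qed
      finally show ?thesis by simp
    qed
    then obtain y where y: "Y = ennreal y" "y > 0" using False by (cases Y) (auto simp: less_le)
    obtain e where e: "E = ennreal e" "e \<ge> 0" using False by (cases E) auto
    have "ennreal ((y ^ 3)\<^sup>2) \<le> ennreal ((9 * (y * e)) ^ 4)"
      using * y e by (simp add: ennreal_power ennreal_mult[symmetric] ennreal_numeral[symmetric] del: ennreal_numeral)
    then have "(y ^ 3)\<^sup>2 \<le> (9 * (y * e)) ^ 4" using y e by (subst (asm) ennreal_le_iff) auto
    then have "y ^ 4 * y\<^sup>2 \<le> y ^ 4 * (81 * e\<^sup>2)\<^sup>2" by (simp add: power_mult_distrib power_mult[symmetric] power_add[symmetric] mult_ac)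
    then have "y\<^sup>2 \<le> (81 * e\<^sup>2)\<^sup>2" using y by (subst (asm) mult_le_cancel_left_pos) auto
    then have "y \<le> 81 * e\<^sup>2" by (rule power2_le_imp_le) simp
    then show ?thesis using y e by (simp add: ennreal_power ennreal_mult[symmetric] ennreal_numeral[symmetric] del: ennreal_numeral)
  qed
  then show ?thesis by (simp add: Y_def)
qed

section \<open>The Sobolev inequality in dimensions four and three\<close>

lemma emeasure_lborel_Times:
  fixes A :: "'a::euclidean_space set" and B :: "'b::euclidean_space set"
  assumes "A \<in> sets borel" "B \<in> sets borel"
  shows "emeasure lborel (A \<times> B) = emeasure lborel A * emeasure lborel B"
  unfolding lborel_prod[symmetric] using assms by (intro lborel.emeasure_pair_measure_Times) auto

text \<open>Lebesgue measure is determined on boxes. This carries iterated integrals over tuples to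
  vectors indexed by an arbitrary finite type.\<close>

lemma lborel_coordinates:
  fixes T :: "'a::euclidean_space \<Rightarrow> real^'n::finite"
  assumes T: "continuous_on UNIV T"
    and box: "\<And>l u. (\<And>i. l $ i \<le> u $ i) \<Longrightarrow> emeasure lborel (T -` box l u) = ennreal (\<Prod>i\<in>UNIV. u $ i - l $ i)"
  shows "distr lborel borel T = lborel"
proof (rule lborel_eqI[symmetric])
  have [measurable]: "T \<in> borel_measurable borel" by (rule borel_measurable_continuous_onI[OF T])
  fix l u :: "real^'n" assume le: "\<And>b. b \<in> Basis \<Longrightarrow> l \<bullet> b \<le> u \<bullet> b"
  have "l $ i \<le> u $ i" for i using le[of "axis i 1"] by (auto simp: Basis_vec_def inner_axis)
  then have "emeasure (distr lborel borel T) (box l u) = ennreal (\<Prod>i\<in>UNIV. u $ i - l $ i)"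
    by (simp add: emeasure_distr box)
  also have "(\<Prod>i\<in>UNIV. u $ i - l $ i) = (\<Prod>b\<in>Basis. (u - l) \<bullet> b)"
    by (simp add: Basis_vec_def cart_eq_inner_axis axis_eq_axis prod.UNION_disjoint inner_diff_left)
  finally show "emeasure (distr lborel borel T) (box l u) = (\<Prod>b\<in>Basis. (u - l) \<bullet> b)" .
qed simp

lemma nn_integral_coordinates:
  fixes T :: "'a::euclidean_space \<Rightarrow> real^'n::finite"
  assumes T: "continuous_on UNIV T" and d: "distr lborel borel T = lborel" and f: "f \<in> borel_measurable borel"
  shows "(\<integral>\<^sup>+x. f (T x) \<partial>lborel) = (\<integral>\<^sup>+x. f x \<partial>lborel)"
proof -
  have [measurable]: "T \<in> borel_measurable borel" by (rule borel_measurable_continuous_onI[OF T])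
  have "(\<integral>\<^sup>+x. f x \<partial>lborel) = (\<integral>\<^sup>+x. f x \<partial>distr lborel borel T)" by (simp only: d)
  also have "\<dots> = (\<integral>\<^sup>+x. f (T x) \<partial>lborel)" using f by (intro nn_integral_distr) auto
  finally show ?thesis by simp
qed

text \<open>The squared H^1 norm, kept in \<open>ennreal\<close> so that Tonelli and monotonicity
  apply without integrability conditions.\<close>

definition gradient_energy :: "(real^'n::finite \<Rightarrow> real) \<Rightarrow> ennreal" where
  "gradient_energy \<phi> = (\<integral>\<^sup>+x. ennreal ((\<phi> x)\<^sup>2) \<partial>lborel) + (\<Sum>j\<in>UNIV. \<integral>\<^sup>+x. ennreal ((partial_deriv j \<phi> x)\<^sup>2) \<partial>lborel)"

lemma gradient_energy_ge:
  "(\<integral>\<^sup>+x. ennreal ((\<phi> x)\<^sup>2) \<partial>lborel) \<le> gradient_energy \<phi>"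
  "(\<integral>\<^sup>+x. ennreal ((partial_deriv j \<phi> x)\<^sup>2) \<partial>lborel) \<le> gradient_energy \<phi>"
proof -
  have "(\<integral>\<^sup>+x. ennreal ((partial_deriv j \<phi> x)\<^sup>2) \<partial>lborel) \<le> (\<Sum>j\<in>UNIV. \<integral>\<^sup>+x. ennreal ((partial_deriv j \<phi> x)\<^sup>2) \<partial>lborel)"
    by (rule member_le_sum) auto
  then show "(\<integral>\<^sup>+x. ennreal ((partial_deriv j \<phi> x)\<^sup>2) \<partial>lborel) \<le> gradient_energy \<phi>"
    unfolding gradient_energy_def by (rule order_trans) simp
qed (simp add: gradient_energy_def)

lemma test_bounded_support:
  assumes "\<phi> \<in> test_functions \<Omega>"
  obtains R where "\<And>x i. \<bar>x $ i\<bar> > R \<Longrightarrow> \<phi> x = 0"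
proof -
  obtain S where S: "compact S" "\<And>x. x \<notin> S \<Longrightarrow> \<phi> x = 0"
    using test_functions_support[OF assms] by blast
  from compact_imp_bounded[OF S(1)] obtain R where R: "\<forall>x\<in>S. norm x \<le> R" unfolding bounded_iff by blast
  have "\<phi> x = 0" if "\<bar>x $ i\<bar> > R" for x i
  proof -
    have "\<bar>x $ i\<bar> \<le> norm x" using component_le_norm_cart .
    with that R have "x \<notin> S" by force
    then show ?thesis by (rule S(2))
  qed
  then show ?thesis by (rule that)
qed

lemma continuous_on_tensor:
  fixes h :: "'a::topological_space \<Rightarrow> real" and g :: "'b::topological_space \<Rightarrow> real"
  assumes "continuous_on UNIV h" "continuous_on UNIV g"
  shows "continuous_on UNIV (\<lambda>x. h (fst x) * g (snd x))"
  by (intro continuous_on_mult continuous_on_compose2[OF assms(1), of UNIV fst]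
      continuous_on_compose2[OF assms(2), of UNIV snd] continuous_on_fst continuous_on_snd continuous_on_id) auto

lemma smooth_nn_measurable:
  "smooth f \<Longrightarrow> (\<lambda>x. ennreal ((f x) ^ k)) \<in> borel_measurable borel"
  using smooth_measurable by measurable

text \<open>Enumerating the four indices identifies vectors with quadruples; the derivatives in the
  four slots become partial derivatives.\<close>

lemma sobolev_dim4:
  assumes card: "CARD('n::finite) = 4" and \<phi>: "\<phi> \<in> test_functions (\<Omega> :: (real^'n) set)"
  shows "(\<integral>\<^sup>+x. ennreal (\<phi> x ^ 4) \<partial>lborel) \<le> 81 * (gradient_energy \<phi>)\<^sup>2"
proof -
  obtain i\<^sub>1 i\<^sub>2 i\<^sub>3 i\<^sub>4 where U: "(UNIV :: 'n set) = {i\<^sub>1, i\<^sub>2, i\<^sub>3, i\<^sub>4}"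
      and dist: "distinct [i\<^sub>1, i\<^sub>2, i\<^sub>3, i\<^sub>4]"
  proof -
    obtain xs :: "'n list" where xs: "set xs = UNIV" "distinct xs" using finite_distinct_list[OF finite] by blast
    then have "length xs = 4" using card distinct_card by fastforce
    then obtain a b c d where "xs = [a, b, c, d]" by (auto simp: length_Suc_conv numeral_eq_Suc)
    with xs show ?thesis by (intro that[of a b c d]) auto
  qed
  have ne: "i\<^sub>1 \<noteq> i\<^sub>2" "i\<^sub>1 \<noteq> i\<^sub>3" "i\<^sub>1 \<noteq> i\<^sub>4" "i\<^sub>2 \<noteq> i\<^sub>3" "i\<^sub>2 \<noteq> i\<^sub>4" "i\<^sub>3 \<noteq> i\<^sub>4"
    "i\<^sub>2 \<noteq> i\<^sub>1" "i\<^sub>3 \<noteq> i\<^sub>1" "i\<^sub>4 \<noteq> i\<^sub>1" "i\<^sub>3 \<noteq> i\<^sub>2" "i\<^sub>4 \<noteq> i\<^sub>2" "i\<^sub>4 \<noteq> i\<^sub>3"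
    using dist by auto
  define T :: "real \<times> real \<times> real \<times> real \<Rightarrow> real^'n" where
    "T = (\<lambda>(d, c, b, a). a *\<^sub>R axis i\<^sub>1 1 + b *\<^sub>R axis i\<^sub>2 1 + c *\<^sub>R axis i\<^sub>3 1 + d *\<^sub>R axis i\<^sub>4 1)"
  have T: "T (d, c, b, a) = a *\<^sub>R axis i\<^sub>1 1 + b *\<^sub>R axis i\<^sub>2 1 + c *\<^sub>R axis i\<^sub>3 1 + d *\<^sub>R axis i\<^sub>4 1" for a b c d
    by (simp add: T_def)
  have Ti: "T (d, c, b, a) $ i\<^sub>1 = a" "T (d, c, b, a) $ i\<^sub>2 = b" "T (d, c, b, a) $ i\<^sub>3 = c" "T (d, c, b, a) $ i\<^sub>4 = d" for a b c d
    by (simp_all add: T axis_def ne)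
  have Tc: "continuous_on UNIV T" unfolding T_def case_prod_unfold by (intro continuous_intros)
  have distr: "distr lborel borel T = lborel"
  proof (rule lborel_coordinates[OF Tc])
    fix l u :: "real^'n" assume le: "\<And>i. l $ i \<le> u $ i"
    have "T -` box l u = {l $ i\<^sub>4<..<u $ i\<^sub>4} \<times> {l $ i\<^sub>3<..<u $ i\<^sub>3} \<times> {l $ i\<^sub>2<..<u $ i\<^sub>2} \<times> {l $ i\<^sub>1<..<u $ i\<^sub>1}"
    proof -
      have "T x \<in> box l u \<longleftrightarrow> (\<forall>i\<in>{i\<^sub>1, i\<^sub>2, i\<^sub>3, i\<^sub>4}. l $ i < T x $ i \<and> T x $ i < u $ i)" for x
        unfolding U[symmetric] by (simp add: mem_box_cart)
      then show ?thesis by (auto simp: Ti)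
    qed
    also have "emeasure lborel \<dots> = ennreal (u $ i\<^sub>4 - l $ i\<^sub>4) * (ennreal (u $ i\<^sub>3 - l $ i\<^sub>3) * (ennreal (u $ i\<^sub>2 - l $ i\<^sub>2) * ennreal (u $ i\<^sub>1 - l $ i\<^sub>1)))"
      using le by (simp add: emeasure_lborel_Times borel_open open_Times)
    also have "\<dots> = ennreal (\<Prod>i\<in>UNIV. u $ i - l $ i)"
      unfolding U using le ne by (simp add: ennreal_mult[symmetric] mult_ac)
    finally show "emeasure lborel (T -` box l u) = ennreal (\<Prod>i\<in>UNIV. u $ i - l $ i)" .
  qed
  have sm: "smooth \<phi>" by (rule test_smooth[OF \<phi>])
  obtain R where R: "\<And>x i. \<bar>x $ i\<bar> > R \<Longrightarrow> \<phi> x = 0" using test_bounded_support[OF \<phi>] by blast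
  have cont: "continuous_on UNIV (\<lambda>x. f (T x))" if "smooth f" for f
    using smooth_continuous[OF that, of UNIV] Tc by (rule continuous_on_compose2) auto
  have energy: "(\<integral>\<^sup>+x. ennreal ((partial_deriv j \<phi> (T x))\<^sup>2) \<partial>lborel) \<le> gradient_energy \<phi>" for j
    using nn_integral_coordinates[OF Tc distr smooth_nn_measurable[OF smooth_partial_deriv[OF sm, of j], of 2]] gradient_energy_ge(2)[of j \<phi>]
    by simp
  have "(\<integral>\<^sup>+x. ennreal (\<phi> x ^ 4) \<partial>lborel) = (\<integral>\<^sup>+x. ennreal (\<phi> (T x) ^ 4) \<partial>lborel)"
    by (rule nn_integral_coordinates[OF Tc distr smooth_nn_measurable[OF sm], symmetric])
  also have "\<dots> \<le> 81 * (gradient_energy \<phi>)\<^sup>2"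
  proof (rule gagliardo_nirenberg4[where R = R, OF _ _ _ _ _ _ _ _ _ _ energy energy energy energy])
    fix d c b a :: real
    show "((\<lambda>a. \<phi> (T (d, c, b, a))) has_real_derivative partial_deriv i\<^sub>1 \<phi> (T (d, c, b, a))) (at a)"
      using partial_deriv_along_axis[OF sm, of "b *\<^sub>R axis i\<^sub>2 1 + c *\<^sub>R axis i\<^sub>3 1 + d *\<^sub>R axis i\<^sub>4 1" i\<^sub>1 a] by (simp add: T add_ac)
    show "((\<lambda>b. \<phi> (T (d, c, b, a))) has_real_derivative partial_deriv i\<^sub>2 \<phi> (T (d, c, b, a))) (at b)"
      using partial_deriv_along_axis[OF sm, of "a *\<^sub>R axis i\<^sub>1 1 + c *\<^sub>R axis i\<^sub>3 1 + d *\<^sub>R axis i\<^sub>4 1" i\<^sub>2 b] by (simp add: T add_ac)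
    show "((\<lambda>c. \<phi> (T (d, c, b, a))) has_real_derivative partial_deriv i\<^sub>3 \<phi> (T (d, c, b, a))) (at c)"
      using partial_deriv_along_axis[OF sm, of "a *\<^sub>R axis i\<^sub>1 1 + b *\<^sub>R axis i\<^sub>2 1 + d *\<^sub>R axis i\<^sub>4 1" i\<^sub>3 c] by (simp add: T add_ac)
    show "((\<lambda>d. \<phi> (T (d, c, b, a))) has_real_derivative partial_deriv i\<^sub>4 \<phi> (T (d, c, b, a))) (at d)"
      using partial_deriv_along_axis[OF sm, of "a *\<^sub>R axis i\<^sub>1 1 + b *\<^sub>R axis i\<^sub>2 1 + c *\<^sub>R axis i\<^sub>3 1" i\<^sub>4 d] by (simp add: T add_ac)
    show "\<phi> (T (d, c, b, a)) = 0" if "\<bar>a\<bar> > R \<or> \<bar>b\<bar> > R \<or> \<bar>c\<bar> > R \<or> \<bar>d\<bar> > R"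
      using that R[of "T (d, c, b, a)" i\<^sub>1] R[of "T (d, c, b, a)" i\<^sub>2] R[of "T (d, c, b, a)" i\<^sub>3] R[of "T (d, c, b, a)" i\<^sub>4]
      by (auto simp: Ti)
  qed (intro cont sm smooth_partial_deriv)+
  finally show ?thesis .
qed

text \<open>Multiplying by a cutoff in an auxiliary fourth variable reduces dimension three to dimension four.\<close>

definition cutoff :: "real \<Rightarrow> real" where "cutoff t = flat 0 (1 + t) * flat 0 (1 - t)"
definition cutoff' :: "real \<Rightarrow> real" where
  "cutoff' t = flat 2 (1 + t) * flat 0 (1 - t) - flat 0 (1 + t) * flat 2 (1 - t)"

lemma flat_continuous: "continuous_on S (flat n)"
  by (rule DERIV_continuous_on) (rule has_field_derivative_at_within[OF flat_deriv])

lemma cutoff_deriv: "(cutoff has_real_derivative cutoff' t) (at t)"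
proof -
  have flat0: "(flat 0 has_real_derivative flat 2 t) (at t)" for t
    using flat_deriv[of 0 t] by (simp add: numeral_2_eq_2)
  have "((\<lambda>t. flat 0 (1 + t)) has_real_derivative flat 2 (1 + t) * 1) (at t)"
    by (rule DERIV_chain2[OF flat0]) (auto intro!: derivative_eq_intros)
  moreover have "((\<lambda>t. flat 0 (1 - t)) has_real_derivative flat 2 (1 - t) * - 1) (at t)"
    by (rule DERIV_chain2[OF flat0]) (auto intro!: derivative_eq_intros)
  ultimately have "((\<lambda>t. flat 0 (1 + t) * flat 0 (1 - t)) has_real_derivative
     (flat 2 (1 + t) * 1) * flat 0 (1 - t) + (flat 2 (1 - t) * - 1) * flat 0 (1 + t)) (at t)" by (rule DERIV_mult)
  then show ?thesis unfolding cutoff_def[abs_def] cutoff'_def by (simp add: mult_ac)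
qed

lemma cutoff_continuous: "continuous_on S cutoff" "continuous_on S cutoff'"
  unfolding cutoff_def[abs_def] cutoff'_def[abs_def]
  by (intro continuous_intros continuous_on_compose2[OF flat_continuous[of UNIV]]; simp)+

lemma cutoff_support: "\<bar>t\<bar> > 1 \<Longrightarrow> cutoff t = 0" "\<bar>t\<bar> > 1 \<Longrightarrow> cutoff' t = 0"
  by (auto simp: cutoff_def cutoff'_def flat_def abs_if split: if_splits)

lemma cutoff_integral_finite:
  fixes f :: "real \<Rightarrow> real"
  assumes "continuous_on UNIV f" "\<And>t. \<bar>t\<bar> > 1 \<Longrightarrow> f t = 0" "k > 0" "even k"
  shows "(\<integral>\<^sup>+t. ennreal (f t ^ k) \<partial>lborel) < top"
proof -
  have "t \<in> {-1..1}" if "f t \<noteq> 0" for t 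
  proof -
    have "\<not> 1 < \<bar>t\<bar>" using assms(2) that by blast
    then show ?thesis by auto
  qed
  then have supp: "f t = 0" if "t \<notin> {-1..1}" for t using that by blast
  have "integrable lborel (\<lambda>t. indicator {-1..1} t *\<^sub>R (f t ^ k))"
    by (intro borel_integrable_compact compact_Icc continuous_intros continuous_on_subset[OF assms(1)]) auto
  also have "(\<lambda>t. indicator {-1..1} t *\<^sub>R (f t ^ k)) = (\<lambda>t. f t ^ k)"
    using supp assms(3) by (auto simp: indicator_def fun_eq_iff)
  finally show ?thesis using assms(4) by (simp add: integrable_iff_bounded zero_le_even_power)
qed

text \<open>Division by this integral removes the auxiliary variable again in dimension
  three.\<close>

lemma cutoff_integral_pos: "(\<integral>\<^sup>+t. ennreal (cutoff t ^ 4) \<partial>lborel) \<noteq> 0"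
proof
  assume "(\<integral>\<^sup>+t. ennreal (cutoff t ^ 4) \<partial>lborel) = 0"
  moreover have [measurable]: "cutoff \<in> borel_measurable borel" by (intro borel_measurable_continuous_onI cutoff_continuous)
  ultimately have "AE t in lborel. ennreal (cutoff t ^ 4) = 0" by (simp add: nn_integral_0_iff_AE)
  then have "AE t in lborel. t \<notin> {-1<..<1::real}"
  proof eventually_elim
    case (elim t)
    show ?case
    proof
      assume "t \<in> {-1<..<1}"
      then have "cutoff t > 0" by (auto simp: cutoff_def flat_def)
      then have "cutoff t ^ 4 > 0" by simp
      with elim show False by (simp add: ennreal_eq_0_iff)
    qed
  qed
  then have "{-1<..<1::real} \<in> null_sets lborel" by (subst (asm) AE_iff_null_sets[symmetric]) auto
  then show False by (simp add: null_sets_def)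
qed

lemma sobolev_dim3:
  assumes card: "CARD('n::finite) = 3"
  obtains C where "C \<ge> 0" "\<And>\<phi> (\<Omega> :: (real^'n) set). \<phi> \<in> test_functions \<Omega> \<Longrightarrow>
    (\<integral>\<^sup>+x. ennreal (\<phi> x ^ 4) \<partial>lborel) \<le> ennreal C * (gradient_energy \<phi>)\<^sup>2"
proof -
  obtain i\<^sub>1 i\<^sub>2 i\<^sub>3 where U: "(UNIV :: 'n set) = {i\<^sub>1, i\<^sub>2, i\<^sub>3}" and dist: "distinct [i\<^sub>1, i\<^sub>2, i\<^sub>3]"
  proof -
    obtain xs :: "'n list" where xs: "set xs = UNIV" "distinct xs" using finite_distinct_list[OF finite] by blast
    then have "length xs = 3" using card distinct_card by fastforce
    then obtain a b c where "xs = [a, b, c]" by (auto simp: length_Suc_conv numeral_eq_Suc)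
    with xs show ?thesis by (intro that[of a b c]) auto
  qed
  have ne: "i\<^sub>1 \<noteq> i\<^sub>2" "i\<^sub>1 \<noteq> i\<^sub>3" "i\<^sub>2 \<noteq> i\<^sub>3" "i\<^sub>2 \<noteq> i\<^sub>1" "i\<^sub>3 \<noteq> i\<^sub>1" "i\<^sub>3 \<noteq> i\<^sub>2"
    using dist by auto
  define T :: "real \<times> real \<times> real \<Rightarrow> real^'n" where
    "T = (\<lambda>(c, b, a). a *\<^sub>R axis i\<^sub>1 1 + b *\<^sub>R axis i\<^sub>2 1 + c *\<^sub>R axis i\<^sub>3 1)"
  have T: "T (c, b, a) = a *\<^sub>R axis i\<^sub>1 1 + b *\<^sub>R axis i\<^sub>2 1 + c *\<^sub>R axis i\<^sub>3 1" for a b c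
    by (simp add: T_def)
  have Ti: "T (c, b, a) $ i\<^sub>1 = a" "T (c, b, a) $ i\<^sub>2 = b" "T (c, b, a) $ i\<^sub>3 = c" for a b c
    by (simp_all add: T axis_def ne)
  have Tc: "continuous_on UNIV T" unfolding T_def case_prod_unfold by (intro continuous_intros)
  have distr: "distr lborel borel T = lborel"
  proof (rule lborel_coordinates[OF Tc])
    fix l u :: "real^'n" assume le: "\<And>i. l $ i \<le> u $ i"
    have "T -` box l u = {l $ i\<^sub>3<..<u $ i\<^sub>3} \<times> {l $ i\<^sub>2<..<u $ i\<^sub>2} \<times> {l $ i\<^sub>1<..<u $ i\<^sub>1}"
    proof -
      have "T x \<in> box l u \<longleftrightarrow> (\<forall>i\<in>{i\<^sub>1, i\<^sub>2, i\<^sub>3}. l $ i < T x $ i \<and> T x $ i < u $ i)" for x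
        unfolding U[symmetric] by (simp add: mem_box_cart)
      then show ?thesis by (auto simp: Ti)
    qed
    also have "emeasure lborel \<dots> = ennreal (u $ i\<^sub>3 - l $ i\<^sub>3) * (ennreal (u $ i\<^sub>2 - l $ i\<^sub>2) * ennreal (u $ i\<^sub>1 - l $ i\<^sub>1))"
      using le by (simp add: emeasure_lborel_Times borel_open open_Times)
    also have "\<dots> = ennreal (\<Prod>i\<in>UNIV. u $ i - l $ i)"
      unfolding U using le ne by (simp add: ennreal_mult[symmetric] mult_ac)
    finally show "emeasure lborel (T -` box l u) = ennreal (\<Prod>i\<in>UNIV. u $ i - l $ i)" .
  qed
  have fin: "(\<integral>\<^sup>+t. ennreal (cutoff t ^ 2) \<partial>lborel) < top" "(\<integral>\<^sup>+t. ennreal (cutoff' t ^ 2) \<partial>lborel) < top"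
    "(\<integral>\<^sup>+t. ennreal (cutoff t ^ 4) \<partial>lborel) < top"
    by (intro cutoff_integral_finite cutoff_continuous cutoff_support; simp)+
  \<comment> \<open>Dominates the integrals of the squared cutoff and of its squared derivative at
    once, so all four partial derivatives of the tensor product obey one energy bound.\<close>
  define \<kappa> where "\<kappa> = (\<integral>\<^sup>+t. ennreal (cutoff t ^ 2) \<partial>lborel) + (\<integral>\<^sup>+t. ennreal (cutoff' t ^ 2) \<partial>lborel)"
  define \<kappa>\<^sub>4 where "\<kappa>\<^sub>4 = (\<integral>\<^sup>+t. ennreal (cutoff t ^ 4) \<partial>lborel)"
  have "\<kappa> < top" using fin by (simp add: \<kappa>_def)
  then obtain k where k: "\<kappa> = ennreal k" "k \<ge> 0" by (cases \<kappa>) auto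
  obtain k\<^sub>4 where k4: "\<kappa>\<^sub>4 = ennreal k\<^sub>4" "k\<^sub>4 > 0"
    using fin(3) cutoff_integral_pos unfolding \<kappa>\<^sub>4_def[symmetric] by (cases \<kappa>\<^sub>4) (auto simp: less_le)
  have [measurable]: "cutoff \<in> borel_measurable borel" "cutoff' \<in> borel_measurable borel"
    by (intro borel_measurable_continuous_onI cutoff_continuous)+
  \<comment> \<open>Even powers keep both factors nonnegative, so that \<open>ennreal\<close>
    respects their product.\<close>
  have tensor: "(\<integral>\<^sup>+x. ennreal ((h (fst x) * f (T (snd x))) ^ p) \<partial>lborel)
      = (\<integral>\<^sup>+t. ennreal (h t ^ p) \<partial>lborel) * (\<integral>\<^sup>+x. ennreal (f x ^ p) \<partial>lborel)"
    if h: "continuous_on UNIV h" and f: "smooth f" and p: "even p" for h f p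
  proof -
    have fT: "continuous_on UNIV (\<lambda>x. f (T x))"
      using smooth_continuous[OF f, of UNIV] Tc by (rule continuous_on_compose2) auto
    have [measurable]: "h \<in> borel_measurable borel" "(\<lambda>x. f (T x)) \<in> borel_measurable borel"
      using h fT by (auto intro: borel_measurable_continuous_onI)
    have "continuous_on UNIV (\<lambda>x. (h (fst x) * f (T (snd x))) ^ p)"
      by (intro continuous_on_power continuous_on_tensor[OF h fT])
    then have "(\<lambda>x. (h (fst x) * f (T (snd x))) ^ p) \<in> borel_measurable borel" by (rule borel_measurable_continuous_onI)
    then have "(\<lambda>x. ennreal ((h (fst x) * f (T (snd x))) ^ p)) \<in> borel_measurable borel" by measurable
    from nn_integral_lborel_pair[OF this]
    have "(\<integral>\<^sup>+x. ennreal ((h (fst x) * f (T (snd x))) ^ p) \<partial>lborel)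
       = (\<integral>\<^sup>+t. \<integral>\<^sup>+x. ennreal (h t ^ p) * ennreal (f (T x) ^ p) \<partial>lborel \<partial>lborel)"
      using p by (simp add: power_mult_distrib ennreal_mult zero_le_even_power)
    also have "\<dots> = (\<integral>\<^sup>+t. ennreal (h t ^ p) \<partial>lborel) * (\<integral>\<^sup>+x. ennreal (f (T x) ^ p) \<partial>lborel)"
      by (simp add: nn_integral_cmult nn_integral_multc)
    also have "(\<integral>\<^sup>+x. ennreal (f (T x) ^ p) \<partial>lborel) = (\<integral>\<^sup>+x. ennreal (f x ^ p) \<partial>lborel)"
      by (rule nn_integral_coordinates[OF Tc distr smooth_nn_measurable[OF f]])
    finally show ?thesis .
  qed
  have main: "(\<integral>\<^sup>+x. ennreal (\<phi> x ^ 4) \<partial>lborel) \<le> ennreal (81 * k\<^sup>2 / k\<^sub>4) * (gradient_energy \<phi>)\<^sup>2"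
    if \<phi>: "\<phi> \<in> test_functions \<Omega>" for \<phi> and \<Omega> :: "(real^'n) set"
  proof -
    have sm: "smooth \<phi>" by (rule test_smooth[OF \<phi>])
    obtain R where R: "\<And>x i. \<bar>x $ i\<bar> > R \<Longrightarrow> \<phi> x = 0" using test_bounded_support[OF \<phi>] by blast
    have cont: "continuous_on UNIV (\<lambda>x. h (fst x) * f (T (snd x)))"
      if f: "smooth f" and h: "continuous_on UNIV h" for f and h :: "real \<Rightarrow> real"
    proof -
      have "continuous_on UNIV (\<lambda>x. f (T x))"
        using smooth_continuous[OF f, of UNIV] Tc by (rule continuous_on_compose2) auto
      then show ?thesis by (rule continuous_on_tensor[OF h])
    qed
    define E where "E = \<kappa> * gradient_energy \<phi>"
    have e1: "(\<integral>\<^sup>+x. ennreal ((cutoff (fst x) * partial_deriv j \<phi> (T (snd x)))\<^sup>2) \<partial>lborel) \<le> E" for j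
      unfolding tensor[OF cutoff_continuous(1) smooth_partial_deriv[OF sm], of 2, simplified] E_def \<kappa>_def
      by (intro mult_mono gradient_energy_ge) auto
    have e2: "(\<integral>\<^sup>+x. ennreal ((cutoff' (fst x) * \<phi> (T (snd x)))\<^sup>2) \<partial>lborel) \<le> E"
      unfolding tensor[OF cutoff_continuous(2) sm, of 2, simplified] E_def \<kappa>_def
      by (intro mult_mono gradient_energy_ge) auto
    have "\<kappa>\<^sub>4 * (\<integral>\<^sup>+x. ennreal (\<phi> x ^ 4) \<partial>lborel) = (\<integral>\<^sup>+x. ennreal ((cutoff (fst x) * \<phi> (T (snd x))) ^ 4) \<partial>lborel)"
      using tensor[OF cutoff_continuous(1) sm, of 4] by (simp add: \<kappa>\<^sub>4_def)
    also have "\<dots> \<le> 81 * E\<^sup>2"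
    proof (rule gagliardo_nirenberg4[where R = "max R 1", OF _ _ _ _ _ _ _ _ _ _ e1[of i\<^sub>1] e1[of i\<^sub>2] e1[of i\<^sub>3] e2])
      fix d c b a :: real
      have "((\<lambda>a. \<phi> (T (c, b, a))) has_real_derivative partial_deriv i\<^sub>1 \<phi> (T (c, b, a))) (at a)"
        using partial_deriv_along_axis[OF sm, of "b *\<^sub>R axis i\<^sub>2 1 + c *\<^sub>R axis i\<^sub>3 1" i\<^sub>1 a] by (simp add: T add_ac)
      then show "((\<lambda>a. cutoff (fst (d, c, b, a)) * \<phi> (T (snd (d, c, b, a)))) has_real_derivative
          cutoff (fst (d, c, b, a)) * partial_deriv i\<^sub>1 \<phi> (T (snd (d, c, b, a)))) (at a)"
        by (simp add: DERIV_cmult)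
      have "((\<lambda>b. \<phi> (T (c, b, a))) has_real_derivative partial_deriv i\<^sub>2 \<phi> (T (c, b, a))) (at b)"
        using partial_deriv_along_axis[OF sm, of "a *\<^sub>R axis i\<^sub>1 1 + c *\<^sub>R axis i\<^sub>3 1" i\<^sub>2 b] by (simp add: T add_ac)
      then show "((\<lambda>b. cutoff (fst (d, c, b, a)) * \<phi> (T (snd (d, c, b, a)))) has_real_derivative
          cutoff (fst (d, c, b, a)) * partial_deriv i\<^sub>2 \<phi> (T (snd (d, c, b, a)))) (at b)"
        by (simp add: DERIV_cmult)
      have "((\<lambda>c. \<phi> (T (c, b, a))) has_real_derivative partial_deriv i\<^sub>3 \<phi> (T (c, b, a))) (at c)"
        using partial_deriv_along_axis[OF sm, of "a *\<^sub>R axis i\<^sub>1 1 + b *\<^sub>R axis i\<^sub>2 1" i\<^sub>3 c] by (simp add: T add_ac)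
      then show "((\<lambda>c. cutoff (fst (d, c, b, a)) * \<phi> (T (snd (d, c, b, a)))) has_real_derivative
          cutoff (fst (d, c, b, a)) * partial_deriv i\<^sub>3 \<phi> (T (snd (d, c, b, a)))) (at c)"
        by (simp add: DERIV_cmult)
      show "((\<lambda>d. cutoff (fst (d, c, b, a)) * \<phi> (T (snd (d, c, b, a)))) has_real_derivative
          cutoff' (fst (d, c, b, a)) * \<phi> (T (snd (d, c, b, a)))) (at d)"
        using DERIV_cmult_right[OF cutoff_deriv[of d], of "\<phi> (T (c, b, a))"] by simp
      show "cutoff (fst (d, c, b, a)) * \<phi> (T (snd (d, c, b, a))) = 0"
        if "\<bar>a\<bar> > max R 1 \<or> \<bar>b\<bar> > max R 1 \<or> \<bar>c\<bar> > max R 1 \<or> \<bar>d\<bar> > max R 1"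
        using that R[of "T (c, b, a)" i\<^sub>1] R[of "T (c, b, a)" i\<^sub>2] R[of "T (c, b, a)" i\<^sub>3] cutoff_support(1)[of d]
        by (auto simp: Ti)
    qed (intro cont sm smooth_partial_deriv cutoff_continuous)+
    finally have le: "\<kappa>\<^sub>4 * (\<integral>\<^sup>+x. ennreal (\<phi> x ^ 4) \<partial>lborel) \<le> 81 * (\<kappa> * gradient_energy \<phi>)\<^sup>2" by (simp add: E_def)
    have "(\<integral>\<^sup>+x. ennreal (\<phi> x ^ 4) \<partial>lborel) = ennreal (1 / k\<^sub>4) * (\<kappa>\<^sub>4 * (\<integral>\<^sup>+x. ennreal (\<phi> x ^ 4) \<partial>lborel))"
      using k4 by (simp add: mult.assoc[symmetric] ennreal_mult[symmetric])
    also have "\<dots> \<le> ennreal (1 / k\<^sub>4) * (81 * (\<kappa> * gradient_energy \<phi>)\<^sup>2)" by (intro mult_left_mono le) simp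
    also have "\<dots> = ennreal (1 / k\<^sub>4) * ennreal 81 * ennreal (k\<^sup>2) * (gradient_energy \<phi>)\<^sup>2"
      using k by (simp add: power_mult_distrib ennreal_power mult_ac)
    also have "ennreal (1 / k\<^sub>4) * ennreal 81 * ennreal (k\<^sup>2) = ennreal (81 * k\<^sup>2 / k\<^sub>4)"
    proof -
      have "ennreal (1 / k\<^sub>4) * ennreal 81 * ennreal (k\<^sup>2) = ennreal (1 / k\<^sub>4 * 81 * k\<^sup>2)"
        using k4 by (simp only: ennreal_mult zero_le_power2 zero_le_numeral zero_le_divide_1_iff mult_nonneg_nonneg less_imp_le)
      then show ?thesis by (simp add: mult_ac)
    qed
    finally show ?thesis .
  qed
  show ?thesis by (rule that[of "81 * k\<^sup>2 / k\<^sub>4"]) (use k4 main in auto)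
qed

text \<open>In dimension four the exponent is critical, and only boundedness of the embedding is
  claimed. The form with a fourth power against a squared energy passes to limits by Fatou's
  lemma.\<close>

theorem sobolev_L4:
  assumes "CARD('n::finite) \<in> {3, 4}"
  shows "\<exists>C\<ge>0. \<forall>\<phi>\<in>test_functions (\<Omega> :: (real^'n) set).
    (\<integral>\<^sup>+x. ennreal (\<phi> x ^ 4) \<partial>lborel) \<le> ennreal C * (gradient_energy \<phi>)\<^sup>2"
proof -
  consider "CARD('n) = 3" | "CARD('n) = 4" using assms by auto
  then show ?thesis
  proof cases
    case 1
    show ?thesis by (rule sobolev_dim3[OF 1]) blast
  next
    case 2
    show ?thesis using sobolev_dim4[OF 2] by (intro exI[of _ 81]) auto
  qed
qed

section \<open>Rellich compactness\<close>

lemma nn_integral_lborel_shift: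
  fixes f :: "'a::euclidean_space \<Rightarrow> ennreal"
  assumes [measurable]: "f \<in> borel_measurable borel"
  shows "(\<integral>\<^sup>+x. f (x + c) \<partial>lborel) = (\<integral>\<^sup>+x. f x \<partial>lborel)"
proof -
  have "(\<integral>\<^sup>+x. f x \<partial>lborel) = (\<integral>\<^sup>+x. f x \<partial>distr lborel borel ((+) c))" by (simp only: lborel_distr_plus)
  also have "\<dots> = (\<integral>\<^sup>+x. f (x + c) \<partial>lborel)" by (subst nn_integral_distr) (auto simp: add.commute)
  finally show ?thesis by simp
qed

text \<open>The increment is the integral of the directional derivative along the segment;
  Cauchy-Schwarz on the unit interval moves the square inside.\<close>

lemma smooth_increment_le:
  fixes t :: "real^'n::finite"
  assumes \<phi>: "smooth \<phi>"
  defines "g \<equiv> \<lambda>x. \<Sum>j\<in>UNIV. t $ j * partial_deriv j \<phi> x"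
  shows "ennreal ((\<phi> (x + t) - \<phi> x)\<^sup>2) \<le> (\<integral>\<^sup>+\<sigma>. ennreal ((g (x + \<sigma> *\<^sub>R t))\<^sup>2) * indicator {0..1} \<sigma> \<partial>lborel)"
proof -
  have g: "continuous_on UNIV g"
    unfolding g_def by (intro continuous_intros smooth_continuous smooth_partial_deriv \<phi>)
  have gl: "continuous_on S (\<lambda>\<sigma>. g (x + \<sigma> *\<^sub>R t))" for S
    by (rule continuous_on_compose2[OF g]) (auto intro!: continuous_intros)
  have [measurable]: "(\<lambda>\<sigma>. g (x + \<sigma> *\<^sub>R t)) \<in> borel_measurable borel"
    by (rule borel_measurable_continuous_onI[OF gl])
  have "integral\<^sup>L lborel (\<lambda>\<sigma>. indicator {0..1} \<sigma> *\<^sub>R g (x + \<sigma> *\<^sub>R t)) = \<phi> (x + 1 *\<^sub>R t) - \<phi> (x + 0 *\<^sub>R t)"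
  proof (rule integral_FTC_atLeastAtMost[OF _ _ gl])
    fix \<sigma>
    show "((\<lambda>\<sigma>. \<phi> (x + \<sigma> *\<^sub>R t)) has_vector_derivative g (x + \<sigma> *\<^sub>R t)) (at \<sigma> within {0..1})"
      using partial_deriv_along_line[OF smooth_differentiable[OF \<phi>], where x = x and t = \<sigma> and v = t]
      unfolding g_def has_real_derivative_iff_has_vector_derivative[symmetric] by (rule has_field_derivative_at_within)
  qed simp
  then have "ennreal \<bar>\<phi> (x + t) - \<phi> x\<bar> = ennreal (norm (integral\<^sup>L lborel (\<lambda>\<sigma>. indicator {0..1} \<sigma> *\<^sub>R g (x + \<sigma> *\<^sub>R t))))"
    by simp
  also have "\<dots> \<le> (\<integral>\<^sup>+\<sigma>. ennreal (norm (indicator {0..1} \<sigma> *\<^sub>R g (x + \<sigma> *\<^sub>R t))) \<partial>lborel)"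
    using borel_integrable_atLeastAtMost'[OF gl] by (intro integral_norm_bound_ennreal) (simp add: set_integrable_def)
  also have "\<dots> = (\<integral>\<^sup>+\<sigma>. (ennreal \<bar>g (x + \<sigma> *\<^sub>R t)\<bar> * indicator {0..1} \<sigma>) * indicator {0..1} \<sigma> \<partial>lborel)"
    by (intro nn_integral_cong) (auto simp: indicator_def)
  finally have "(ennreal \<bar>\<phi> (x + t) - \<phi> x\<bar>)\<^sup>2 \<le> \<dots>\<^sup>2" by (intro power_mono) auto
  also have "\<dots> \<le> (\<integral>\<^sup>+\<sigma>. (ennreal \<bar>g (x + \<sigma> *\<^sub>R t)\<bar> * indicator {0..1} \<sigma>)\<^sup>2 \<partial>lborel) * (\<integral>\<^sup>+\<sigma>. (indicator {0..1::real} \<sigma>)\<^sup>2 \<partial>lborel)"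
    by (rule Cauchy_Schwarz_nn_integral) measurable
  also have "(\<integral>\<^sup>+\<sigma>. (indicator {0..1::real} \<sigma>)\<^sup>2 \<partial>lborel) = (\<integral>\<^sup>+\<sigma>. indicator {0..1::real} \<sigma> \<partial>lborel)"
    by (intro nn_integral_cong) (auto simp: indicator_def)
  also have "\<dots> = 1" by simp
  also have "(\<integral>\<^sup>+\<sigma>. (ennreal \<bar>g (x + \<sigma> *\<^sub>R t)\<bar> * indicator {0..1} \<sigma>)\<^sup>2 \<partial>lborel)
      = (\<integral>\<^sup>+\<sigma>. ennreal ((g (x + \<sigma> *\<^sub>R t))\<^sup>2) * indicator {0..1} \<sigma> \<partial>lborel)"
    by (intro nn_integral_cong) (auto simp: indicator_def ennreal_power)
  finally show ?thesis by (simp add: ennreal_power)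
qed

text \<open>After integration over \<open>x\<close>, Tonelli and translation invariance let every
  point of the segment contribute the same integral.\<close>

lemma translation_bound:
  fixes t :: "real^'n::finite"
  assumes \<phi>: "smooth \<phi>"
  shows "(\<integral>\<^sup>+x. ennreal ((\<phi> (x + t) - \<phi> x)\<^sup>2) \<partial>lborel) \<le> ennreal ((norm t)\<^sup>2) * gradient_energy \<phi>"
proof -
  define g where "g x = (\<Sum>j\<in>UNIV. t $ j * partial_deriv j \<phi> x)" for x
  have "continuous_on UNIV g"
    unfolding g_def by (intro continuous_intros smooth_continuous smooth_partial_deriv \<phi>)
  then have [measurable]: "g \<in> borel_measurable borel" by (rule borel_measurable_continuous_onI)
  have [measurable]: "partial_deriv j \<phi> \<in> borel_measurable borel" for j
    by (intro smooth_measurable smooth_partial_deriv \<phi>)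
  have g2: "(g x)\<^sup>2 \<le> (norm t)\<^sup>2 * (\<Sum>j\<in>UNIV. (partial_deriv j \<phi> x)\<^sup>2)" for x
  proof -
    have "(g x)\<^sup>2 \<le> (\<Sum>j\<in>UNIV. (t $ j)\<^sup>2) * (\<Sum>j\<in>UNIV. (partial_deriv j \<phi> x)\<^sup>2)"
      unfolding g_def by (rule Cauchy_Schwarz_ineq_sum)
    also have "(\<Sum>j\<in>UNIV. (t $ j)\<^sup>2) = (norm t)\<^sup>2" by (simp add: norm_vec_def L2_set_def sum_nonneg)
    finally show ?thesis .
  qed
  have "(\<integral>\<^sup>+x. ennreal ((\<phi> (x + t) - \<phi> x)\<^sup>2) \<partial>lborel)
      \<le> (\<integral>\<^sup>+x. \<integral>\<^sup>+\<sigma>. ennreal ((g (x + \<sigma> *\<^sub>R t))\<^sup>2) * indicator {0..1} \<sigma> \<partial>lborel \<partial>lborel)"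
    unfolding g_def by (intro nn_integral_mono smooth_increment_le \<phi>)
  also have "\<dots> = (\<integral>\<^sup>+\<sigma>. \<integral>\<^sup>+x. ennreal ((g (x + \<sigma> *\<^sub>R t))\<^sup>2) * indicator {0..1} \<sigma> \<partial>lborel \<partial>lborel)"
    by (rule lborel_pair.Fubini'[symmetric]) measurable
  also have "\<dots> = (\<integral>\<^sup>+\<sigma>. (\<integral>\<^sup>+x. ennreal ((g x)\<^sup>2) \<partial>lborel) * indicator {0..1::real} \<sigma> \<partial>lborel)"
  proof (intro nn_integral_cong)
    fix \<sigma> :: real
    have "(\<integral>\<^sup>+x. ennreal ((g (x + \<sigma> *\<^sub>R t))\<^sup>2) * indicator {0..1} \<sigma> \<partial>lborel) = (\<integral>\<^sup>+x. ennreal ((g (x + \<sigma> *\<^sub>R t))\<^sup>2) \<partial>lborel) * indicator {0..1} \<sigma>"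
      by (rule nn_integral_multc) measurable
    also have "(\<integral>\<^sup>+x. ennreal ((g (x + \<sigma> *\<^sub>R t))\<^sup>2) \<partial>lborel) = (\<integral>\<^sup>+x. ennreal ((g x)\<^sup>2) \<partial>lborel)"
      by (rule nn_integral_lborel_shift) measurable
    finally show "(\<integral>\<^sup>+x. ennreal ((g (x + \<sigma> *\<^sub>R t))\<^sup>2) * indicator {0..1} \<sigma> \<partial>lborel) = (\<integral>\<^sup>+x. ennreal ((g x)\<^sup>2) \<partial>lborel) * indicator {0..1} \<sigma>" .
  qed
  also have "\<dots> = (\<integral>\<^sup>+x. ennreal ((g x)\<^sup>2) \<partial>lborel)" by (simp add: nn_integral_cmult)
  also have "\<dots> \<le> (\<integral>\<^sup>+x. ennreal ((norm t)\<^sup>2) * (\<Sum>j\<in>UNIV. ennreal ((partial_deriv j \<phi> x)\<^sup>2)) \<partial>lborel)"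
  proof (intro nn_integral_mono)
    fix x
    have "ennreal ((g x)\<^sup>2) \<le> ennreal ((norm t)\<^sup>2 * (\<Sum>j\<in>UNIV. (partial_deriv j \<phi> x)\<^sup>2))" using g2 by (rule ennreal_leI)
    then show "ennreal ((g x)\<^sup>2) \<le> ennreal ((norm t)\<^sup>2) * (\<Sum>j\<in>UNIV. ennreal ((partial_deriv j \<phi> x)\<^sup>2))"
      by (simp add: ennreal_mult sum_nonneg)
  qed
  also have "\<dots> = ennreal ((norm t)\<^sup>2) * (\<Sum>j\<in>UNIV. \<integral>\<^sup>+x. ennreal ((partial_deriv j \<phi> x)\<^sup>2) \<partial>lborel)"
  proof -
    have "(\<integral>\<^sup>+x. ennreal ((norm t)\<^sup>2) * (\<Sum>j\<in>UNIV. ennreal ((partial_deriv j \<phi> x)\<^sup>2)) \<partial>lborel)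
        = ennreal ((norm t)\<^sup>2) * (\<integral>\<^sup>+x. (\<Sum>j\<in>UNIV. ennreal ((partial_deriv j \<phi> x)\<^sup>2)) \<partial>lborel)"
      by (rule nn_integral_cmult) measurable
    also have "(\<integral>\<^sup>+x. (\<Sum>j\<in>UNIV. ennreal ((partial_deriv j \<phi> x)\<^sup>2)) \<partial>lborel)
        = (\<Sum>j\<in>UNIV. \<integral>\<^sup>+x. ennreal ((partial_deriv j \<phi> x)\<^sup>2) \<partial>lborel)"
      by (rule nn_integral_sum) measurable
    finally show ?thesis .
  qed
  also have "\<dots> \<le> ennreal ((norm t)\<^sup>2) * gradient_energy \<phi>"
    unfolding gradient_energy_def by (intro mult_left_mono) auto
  finally show ?thesis .
qed

section \<open>Averaging over a grid of cubes\<close>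

text \<open>Half-open, so that for positive \<open>h\<close> the cubes tile space without overlap
  and floors give the index of a point.\<close>

definition cell :: "real \<Rightarrow> int^'n \<Rightarrow> (real^'n::finite) set" where
  "cell h k = {x. \<forall>i. h * k $ i \<le> x $ i \<and> x $ i < h * (k $ i + 1)}"

lemma cell_iff: "h > 0 \<Longrightarrow> x \<in> cell h k \<longleftrightarrow> k = (\<chi> i. \<lfloor>x $ i / h\<rfloor>)"
  by (simp add: cell_def vec_eq_iff eq_commute[of "k $ _"] floor_eq_iff pos_le_divide_eq pos_divide_less_eq mult.commute)

lemma cell_measurable [measurable]: "cell h k \<in> sets borel"
proof -
  have "cell h k = (\<Inter>i\<in>UNIV. {x. h * k $ i \<le> x $ i} \<inter> {x. x $ i < h * (k $ i + 1)})" by (auto simp: cell_def)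
  also have "\<dots> \<in> sets borel"
    by (intro sets.finite_INT sets.Int borel_closed borel_open closed_Collect_le open_Collect_less continuous_intros) auto
  finally show ?thesis .
qed

lemma emeasure_cell:
  fixes k :: "int^'n::finite"
  assumes h: "h > 0"
  shows "emeasure lborel (cell h k) = ennreal (h ^ CARD('n))"
proof -
  define l where "l = (\<chi> i. h * real_of_int (k $ i))"
  define u where "u = (\<chi> i. h * (real_of_int (k $ i) + 1))"
  have prod: "(\<Prod>b\<in>Basis. (u - l) \<bullet> b) = h ^ CARD('n)"
  proof -
    have "(\<Prod>b\<in>Basis. (u - l) \<bullet> b) = (\<Prod>i\<in>UNIV. u $ i - l $ i)"
      by (simp add: Basis_vec_def cart_eq_inner_axis axis_eq_axis prod.UNION_disjoint inner_diff_left)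
    also have "\<dots> = h ^ CARD('n)" by (simp add: u_def l_def algebra_simps)
    finally show ?thesis .
  qed
  have le: "l \<bullet> b \<le> u \<bullet> b" if "b \<in> Basis" for b
    using that h by (auto simp: Basis_vec_def inner_axis l_def u_def)
  have "emeasure lborel (box l u) \<le> emeasure lborel (cell h k)" "emeasure lborel (cell h k) \<le> emeasure lborel (cbox l u)"
    by (intro emeasure_mono; auto simp: cell_def mem_box_cart l_def u_def less_imp_le)+
  moreover have "emeasure lborel (box l u) = ennreal (h ^ CARD('n))" using le prod by (simp add: emeasure_lborel_box)
  moreover have "emeasure lborel (cbox l u) = ennreal (h ^ CARD('n))" using le prod by (simp add: emeasure_lborel_cbox)
  ultimately show ?thesis by simp
qed

lemma cell_diff:
  fixes x y :: "real^'n::finite"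
  assumes "x \<in> cell h k" "y \<in> cell h k"
  shows "y - x \<in> cbox (\<chi> i. - h) (\<chi> i. h)"
proof -
  have "- h \<le> (y - x) $ i \<and> (y - x) $ i \<le> h" for i
  proof -
    have "h * k $ i \<le> x $ i" "x $ i < h * (k $ i + 1)" "h * k $ i \<le> y $ i" "y $ i < h * (k $ i + 1)"
      using assms by (auto simp: cell_def)
    then show ?thesis by (simp add: distrib_left)
  qed
  then show ?thesis by (simp add: mem_box_cart)
qed

text \<open>The deviation from the mean is a mean of increments, estimated by Cauchy-Schwarz. Two
  points of a cell differ by a vector in the cube [-h, h]^n; integrating over that cube frees the
  domain of integration from \<open>x\<close> and prepares Tonelli.\<close>

lemma cell_average_error:
  fixes \<phi> :: "real^'n::finite \<Rightarrow> real"
  assumes h: "h > 0" and \<phi>: "\<phi> \<in> test_functions \<Omega>" and x: "x \<in> cell h k"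
  defines "c \<equiv> integral\<^sup>L lborel (\<lambda>y. indicator (cell h k) y * \<phi> y) / h ^ CARD('n)"
  shows "ennreal (h ^ CARD('n)) * ennreal ((\<phi> x - c)\<^sup>2)
    \<le> (\<integral>\<^sup>+t. ennreal ((\<phi> (x + t) - \<phi> x)\<^sup>2) * indicator (cbox (\<chi> i. - h) (\<chi> i. h)) t \<partial>lborel)"
proof -
  define Q where "Q = cell h k"
  define m where "m = h ^ CARD('n)"
  have m: "m > 0" using h by (simp add: m_def)
  have Qm: "emeasure lborel Q = ennreal m" unfolding Q_def m_def by (rule emeasure_cell[OF h])
  have [measurable]: "Q \<in> sets borel" by (simp add: Q_def)
  have [measurable]: "\<phi> \<in> borel_measurable borel" using test_measurable[OF \<phi>] by simp
  have intQ: "integrable lborel (indicator Q :: _ \<Rightarrow> real)" using Qm by (intro integrable_real_indicator) auto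
  have int\<phi>: "integrable lborel (\<lambda>y. indicator Q y * \<phi> y)"
    using integrable_mult_indicator[OF _ test_integrable(1)[OF \<phi>], of Q] by simp
  have diff: "integrable lborel (\<lambda>y. indicator Q y * (\<phi> x - \<phi> y))"
    using Bochner_Integration.integrable_diff[OF integrable_mult_left[OF intQ, of "\<phi> x"] int\<phi>] by (simp add: right_diff_distrib)
  have "integral\<^sup>L lborel (\<lambda>y. indicator Q y * (\<phi> x - \<phi> y)) = measure lborel Q * \<phi> x - integral\<^sup>L lborel (\<lambda>y. indicator Q y * \<phi> y)"
    using Bochner_Integration.integral_diff[OF integrable_mult_left[OF intQ, of "\<phi> x"] int\<phi>] by (simp add: right_diff_distrib)
  also have "\<dots> = m * (\<phi> x - c)" using Qm m by (simp add: measure_def c_def Q_def[symmetric] m_def[symmetric] right_diff_distrib)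
  finally have avg: "m * (\<phi> x - c) = integral\<^sup>L lborel (\<lambda>y. indicator Q y * (\<phi> x - \<phi> y))" by simp
  have "ennreal \<bar>m * (\<phi> x - c)\<bar> \<le> (\<integral>\<^sup>+y. ennreal (norm (indicator Q y * (\<phi> x - \<phi> y))) \<partial>lborel)"
    using integral_norm_bound_ennreal[OF diff] by (simp add: avg)
  also have "\<dots> = (\<integral>\<^sup>+y. (ennreal \<bar>\<phi> x - \<phi> y\<bar> * indicator Q y) * indicator Q y \<partial>lborel)"
    by (intro nn_integral_cong) (auto simp: indicator_def)
  finally have "(ennreal \<bar>m * (\<phi> x - c)\<bar>)\<^sup>2 \<le> \<dots>\<^sup>2" by (intro power_mono) auto
  also have "\<dots> \<le> (\<integral>\<^sup>+y. (ennreal \<bar>\<phi> x - \<phi> y\<bar> * indicator Q y)\<^sup>2 \<partial>lborel) * (\<integral>\<^sup>+y. (indicator Q y)\<^sup>2 \<partial>lborel)"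
    by (rule Cauchy_Schwarz_nn_integral) measurable
  also have "(\<integral>\<^sup>+y. (indicator Q y)\<^sup>2 \<partial>lborel) = (\<integral>\<^sup>+y. indicator Q y \<partial>lborel)"
    by (intro nn_integral_cong) (auto simp: indicator_def)
  also have "\<dots> = ennreal m" using Qm by simp
  also have "(\<integral>\<^sup>+y. (ennreal \<bar>\<phi> x - \<phi> y\<bar> * indicator Q y)\<^sup>2 \<partial>lborel)
      \<le> (\<integral>\<^sup>+y. ennreal ((\<phi> y - \<phi> x)\<^sup>2) * indicator (cbox (\<chi> i. - h) (\<chi> i. h)) (y - x) \<partial>lborel)"
  proof (intro nn_integral_mono)
    fix y
    show "(ennreal \<bar>\<phi> x - \<phi> y\<bar> * indicator Q y)\<^sup>2 \<le> ennreal ((\<phi> y - \<phi> x)\<^sup>2) * indicator (cbox (\<chi> i. - h) (\<chi> i. h)) (y - x)"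
    proof (cases "y \<in> Q")
      case True
      then have "y - x \<in> cbox (\<chi> i. - h) (\<chi> i. h)" using cell_diff[OF x] by (simp add: Q_def)
      then show ?thesis using True by (simp add: ennreal_power power2_commute)
    qed simp
  qed
  also have "\<dots> = (\<integral>\<^sup>+t. ennreal ((\<phi> (t + x) - \<phi> x)\<^sup>2) * indicator (cbox (\<chi> i. - h) (\<chi> i. h)) ((t + x) - x) \<partial>lborel)"
    by (rule nn_integral_lborel_shift[symmetric]) measurable
  finally have "(ennreal \<bar>m * (\<phi> x - c)\<bar>)\<^sup>2 \<le> (\<integral>\<^sup>+t. ennreal ((\<phi> (x + t) - \<phi> x)\<^sup>2) * indicator (cbox (\<chi> i. - h) (\<chi> i. h)) t \<partial>lborel) * ennreal m"
    (is "_ \<le> ?I * _") by (simp add: add.commute mult_right_mono)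
  also have "(ennreal \<bar>m * (\<phi> x - c)\<bar>)\<^sup>2 = (ennreal m * ennreal ((\<phi> x - c)\<^sup>2)) * ennreal m"
  proof -
    have "(ennreal \<bar>m * (\<phi> x - c)\<bar>)\<^sup>2 = ennreal ((m * (\<phi> x - c)\<^sup>2) * m)"
    proof -
      have "(ennreal \<bar>m * (\<phi> x - c)\<bar>)\<^sup>2 = ennreal ((m * (\<phi> x - c))\<^sup>2)" by (simp add: ennreal_power)
      then show ?thesis by (simp add: power2_eq_square mult_ac)
    qed
    then show ?thesis using m by (simp add: ennreal_mult)
  qed
  finally have "(ennreal m * ennreal ((\<phi> x - c)\<^sup>2)) * ennreal m \<le> ?I * ennreal m" .
  then have "(ennreal m * ennreal ((\<phi> x - c)\<^sup>2)) * ennreal m * ennreal (1 / m) \<le> ?I * ennreal m * ennreal (1 / m)"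
    by (rule mult_right_mono) simp
  moreover have "ennreal m * ennreal (1 / m) = 1" using m by (simp add: ennreal_mult[symmetric])
  ultimately show ?thesis by (simp add: mult.assoc m_def)
qed

lemma finite_int_vec_box: "finite {k::int^'n::finite. \<forall>i. \<bar>k $ i\<bar> \<le> M}"
proof -
  have "{k::int^'n. \<forall>i. \<bar>k $ i\<bar> \<le> M} \<subseteq> (\<lambda>f. \<chi> i. f i) ` (UNIV \<rightarrow>\<^sub>E {-M..M})"
  proof
    fix k :: "int^'n" assume "k \<in> {k. \<forall>i. \<bar>k $ i\<bar> \<le> M}"
    then have "vec_nth k \<in> UNIV \<rightarrow>\<^sub>E {-M..M}" by (auto simp: abs_le_iff minus_le_iff)
    then show "k \<in> (\<lambda>f. \<chi> i. f i) ` (UNIV \<rightarrow>\<^sub>E {-M..M})" by (intro image_eqI[of _ _ "vec_nth k"]) auto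
  qed
  then show ?thesis by (rule finite_subset) (intro finite_imageI finite_PiE; simp)
qed

lemma cell_square_integrable: "square_integrable (indicator (cell h k) :: (real^'n::finite) \<Rightarrow> real)" if "h > 0"
proof -
  have sq: "(\<lambda>x. (indicator (cell h k) x :: real)\<^sup>2) = indicator (cell h k)" by (auto simp: indicator_def fun_eq_iff)
  have "emeasure lebesgue (cell h k) < \<infinity>" using emeasure_cell[OF that, of k] by simp
  moreover have "cell h k \<in> sets lebesgue" by simp
  ultimately show ?thesis unfolding square_integrable_def sq
    by (intro conjI borel_measurable_indicator integrable_real_indicator)
qed

text \<open>For positive \<open>h\<close> and finite \<open>A\<close>, the orthogonal projection
  onto step functions on the cells of \<open>A\<close>: distinct indicators are orthogonal, with
  squared norm \<open>h ^ CARD('n)\<close>.\<close>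

definition cell_average :: "real \<Rightarrow> (int^'n::finite) set \<Rightarrow> (real^'n) lsq \<Rightarrow> (real^'n) lsq" where
  "cell_average h A u = (\<Sum>k\<in>A. (inner (cls (indicator (cell h k))) u / h ^ CARD('n)) *\<^sub>R cls (indicator (cell h k)))"

text \<open>Integrating the pointwise error over \<open>x\<close> leaves the translation bound
  averaged over [-h, h]^n, whose volume is \<open>2 ^ CARD('n)\<close> cells and whose vectors have
  norm at most \<open>CARD('n) * h\<close>. Cells with index outside \<open>A\<close> do not meet
  the ball containing the support.\<close>

lemma cell_average_approx:
  fixes \<phi> :: "real^'n::finite \<Rightarrow> real"
  assumes h: "h > 0" and \<phi>: "\<phi> \<in> test_functions \<Omega>" and \<Omega>: "\<Omega> \<subseteq> ball 0 R" and A: "finite A"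
    and cover: "\<And>x k. norm x < R \<Longrightarrow> x \<in> cell h k \<Longrightarrow> k \<in> A"
  shows "ennreal ((norm (cls \<phi> - cell_average h A (cls \<phi>)))\<^sup>2)
    \<le> ennreal (2 ^ CARD('n) * (real CARD('n) * h)\<^sup>2) * gradient_energy \<phi>"
proof -
  define m where "m = h ^ CARD('n)"
  have m: "m > 0" using h by (simp add: m_def)
  define c where "c k = integral\<^sup>L lborel (\<lambda>y. indicator (cell h k) y * \<phi> y) / m" for k
  define \<psi> where "\<psi> x = (\<Sum>k\<in>A. c k * indicator (cell h k) x)" for x
  have [measurable]: "\<phi> \<in> borel_measurable borel" using test_measurable[OF \<phi>] by simp
  have [measurable]: "\<psi> \<in> borel_measurable borel" unfolding \<psi>_def by measurable
  note sq\<phi> = test_square_integrable[OF \<phi>]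
  have c_inner: "inner (cls (indicator (cell h k))) (cls \<phi>) / h ^ CARD('n) = c k" for k
    unfolding cls_inner[OF cell_square_integrable[OF h] sq\<phi>] c_def m_def by (subst integral_completion) auto
  have cls_sum: "square_integrable (\<lambda>x. \<Sum>k\<in>A. c k * indicator (cell h k) x) \<and>
      cls (\<lambda>x. \<Sum>k\<in>A. c k * indicator (cell h k) x) = (\<Sum>k\<in>A. c k *\<^sub>R cls (indicator (cell h k)))"
    using A
  proof (induction A rule: finite_induct)
    case empty
    show ?case by (simp add: cls_zero)
  next
    case (insert k B)
    have s: "square_integrable (\<lambda>x. c k * indicator (cell h k) x)" by (intro square_integrable_scale cell_square_integrable h)
    note IH = insert.IH
    show ?case
      unfolding sum.insert[OF insert.hyps(1,2)]
      by (simp only: square_integrable_add[OF s conjunct1[OF IH]] cls_add[OF s conjunct1[OF IH], symmetric]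
          cls_scale[OF cell_square_integrable[OF h], symmetric] conjunct2[OF IH] simp_thms)
  qed
  then have \<psi>: "square_integrable \<psi>" "cell_average h A (cls \<phi>) = cls \<psi>"
    by (simp_all add: \<psi>_def[abs_def] cell_average_def c_inner)
  define B where "B = (cbox (\<chi> i. - h) (\<chi> i. h) :: (real^'n) set)"
  have point: "ennreal m * ennreal ((\<phi> x - \<psi> x)\<^sup>2) \<le> (\<integral>\<^sup>+t. ennreal ((\<phi> (x + t) - \<phi> x)\<^sup>2) * indicator B t \<partial>lborel)" for x
  proof -
    define k where "k = (\<chi> i. \<lfloor>x $ i / h\<rfloor>)"
    have xk: "x \<in> cell h k" using cell_iff[OF h, of x k] by (simp add: k_def)
    have uniq: "k' = k" if "x \<in> cell h k'" for k' using that unfolding cell_iff[OF h] k_def .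
    have \<psi>x: "\<psi> x = (if k \<in> A then c k else 0)"
    proof -
      have "\<psi> x = (\<Sum>k'\<in>A. if k' = k then c k else 0)"
        unfolding \<psi>_def
      proof (rule sum.cong[OF refl])
        fix k'
        show "c k' * indicator (cell h k') x = (if k' = k then c k else 0)"
          by (cases "k' = k") (use xk uniq[of k'] in \<open>auto simp: indicator_def\<close>)
      qed
      then show ?thesis using A by simp
    qed
    show ?thesis
    proof (cases "k \<in> A")
      case True
      then show ?thesis using cell_average_error[OF h \<phi> xk] by (simp add: \<psi>x c_def m_def B_def)
    next
      case False
      have "norm x \<ge> R" using cover[OF _ xk] False by force
      then have "x \<notin> \<Omega>" using \<Omega> by auto
      then have "\<phi> x = 0" using test_functions_support[OF \<phi>] by blast
      then show ?thesis using False by (simp add: \<psi>x)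
    qed
  qed
  have normB: "norm t \<le> real CARD('n) * h" if "t \<in> B" for t
    using that by (intro vec_norm_le) (auto simp: B_def mem_box_cart abs_le_iff minus_le_iff)
  have emB: "emeasure lborel B = ennreal (2 ^ CARD('n) * m)"
  proof -
    define u where "u = ((\<chi> i. h) :: real^'n)"
    define l where "l = ((\<chi> i. - h) :: real^'n)"
    have "emeasure lborel B = ennreal (\<Prod>b\<in>Basis. (u - l) \<bullet> b)"
      unfolding B_def u_def[symmetric] l_def[symmetric]
      by (rule emeasure_lborel_cbox) (use h in \<open>auto simp: Basis_vec_def inner_axis u_def l_def\<close>)
    also have "(\<Prod>b\<in>Basis. (u - l) \<bullet> b) = (\<Prod>i\<in>(UNIV :: 'n set). 2 * h)"
      by (simp add: Basis_vec_def axis_eq_axis prod.UNION_disjoint inner_axis u_def l_def)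
    also have "\<dots> = 2 ^ CARD('n) * m" by (simp add: power_mult_distrib m_def)
    finally show ?thesis .
  qed
  have "ennreal m * ennreal ((norm (cls \<phi> - cell_average h A (cls \<phi>)))\<^sup>2) = ennreal m * (\<integral>\<^sup>+x. ennreal ((\<phi> x - \<psi> x)\<^sup>2) \<partial>lborel)"
    using nn_integral_norm_cls[OF square_integrable_diff[OF sq\<phi> \<psi>(1)]] cls_diff[OF sq\<phi> \<psi>(1)]
    by (simp add: \<psi>(2) nn_integral_completion)
  also have "\<dots> = (\<integral>\<^sup>+x. ennreal m * ennreal ((\<phi> x - \<psi> x)\<^sup>2) \<partial>lborel)" by (rule nn_integral_cmult[symmetric]) measurable
  also have "\<dots> \<le> (\<integral>\<^sup>+x. \<integral>\<^sup>+t. ennreal ((\<phi> (x + t) - \<phi> x)\<^sup>2) * indicator B t \<partial>lborel \<partial>lborel)"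
    by (intro nn_integral_mono point)
  also have "\<dots> = (\<integral>\<^sup>+t. \<integral>\<^sup>+x. ennreal ((\<phi> (x + t) - \<phi> x)\<^sup>2) * indicator B t \<partial>lborel \<partial>lborel)"
    by (rule lborel_pair.Fubini'[symmetric]) (measurable, simp add: B_def)
  also have "\<dots> \<le> (\<integral>\<^sup>+t. (ennreal ((real CARD('n) * h)\<^sup>2) * gradient_energy \<phi>) * indicator B t \<partial>lborel)"
  proof (intro nn_integral_mono)
    fix t
    have "(\<integral>\<^sup>+x. ennreal ((\<phi> (x + t) - \<phi> x)\<^sup>2) * indicator B t \<partial>lborel) = (\<integral>\<^sup>+x. ennreal ((\<phi> (x + t) - \<phi> x)\<^sup>2) \<partial>lborel) * indicator B t"
      by (rule nn_integral_multc) measurable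
    also have "\<dots> \<le> (ennreal ((norm t)\<^sup>2) * gradient_energy \<phi>) * indicator B t"
      by (intro mult_right_mono translation_bound test_smooth[OF \<phi>]) simp
    also have "\<dots> \<le> (ennreal ((real CARD('n) * h)\<^sup>2) * gradient_energy \<phi>) * indicator B t"
      using normB[of t] by (cases "t \<in> B") (auto intro!: mult_right_mono ennreal_leI power_mono)
    finally show "(\<integral>\<^sup>+x. ennreal ((\<phi> (x + t) - \<phi> x)\<^sup>2) * indicator B t \<partial>lborel) \<le> \<dots>" .
  qed
  also have "\<dots> = (ennreal ((real CARD('n) * h)\<^sup>2) * gradient_energy \<phi>) * ennreal (2 ^ CARD('n) * m)"
    using emB by (subst nn_integral_cmult_indicator) (auto simp: B_def)
  also have "\<dots> = ennreal m * (ennreal (2 ^ CARD('n) * (real CARD('n) * h)\<^sup>2) * gradient_energy \<phi>)"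
  proof -
    have "ennreal ((real CARD('n) * h)\<^sup>2) * ennreal (2 ^ CARD('n) * m) = ennreal m * ennreal (2 ^ CARD('n) * (real CARD('n) * h)\<^sup>2)"
      using m h by (simp add: ennreal_mult[symmetric] mult_ac)
    moreover have "(ennreal ((real CARD('n) * h)\<^sup>2) * gradient_energy \<phi>) * ennreal (2 ^ CARD('n) * m)
        = (ennreal ((real CARD('n) * h)\<^sup>2) * ennreal (2 ^ CARD('n) * m)) * gradient_energy \<phi>"
      by (simp only: mult_ac)
    ultimately show ?thesis by (simp only: mult.assoc)
  qed
  finally have "ennreal m * ennreal ((norm (cls \<phi> - cell_average h A (cls \<phi>)))\<^sup>2)
     \<le> ennreal m * (ennreal (2 ^ CARD('n) * (real CARD('n) * h)\<^sup>2) * gradient_energy \<phi>)" (is "_ * ?x \<le> _ * ?y") .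
  then have "ennreal (1 / m) * (ennreal m * ?x) \<le> ennreal (1 / m) * (ennreal m * ?y)" by (rule mult_left_mono) simp
  moreover have "ennreal (1 / m) * ennreal m = 1" using m by (simp add: ennreal_mult[symmetric])
  ultimately show ?thesis by (simp add: mult.assoc[symmetric])
qed

section \<open>Compactness of bounded energy sets\<close>

text \<open>Inductively the sum of a compact segment and a compact set.\<close>

lemma compact_bounded_combinations:
  fixes e :: "'k \<Rightarrow> 'a::real_normed_vector"
  assumes "finite A"
  shows "compact {(\<Sum>k\<in>A. c k *\<^sub>R e k) | c. \<forall>k\<in>A. \<bar>c k\<bar> \<le> M}"
  using assms
proof induction
  case empty
  show ?case by simp
next
  case (insert k A)
  have "compact ((\<lambda>t. t *\<^sub>R e k) ` {-M..M})" by (intro compact_continuous_image continuous_intros compact_Icc)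
  then have "compact {x + y | x y. x \<in> (\<lambda>t. t *\<^sub>R e k) ` {-M..M} \<and> y \<in> {(\<Sum>k\<in>A. c k *\<^sub>R e k) | c. \<forall>k\<in>A. \<bar>c k\<bar> \<le> M}}"
    using insert.IH by (rule compact_sums)
  also have "{x + y | x y. x \<in> (\<lambda>t. t *\<^sub>R e k) ` {-M..M} \<and> y \<in> {(\<Sum>k\<in>A. c k *\<^sub>R e k) | c. \<forall>k\<in>A. \<bar>c k\<bar> \<le> M}}
      = {(\<Sum>k\<in>insert k A. c k *\<^sub>R e k) | c. \<forall>k\<in>insert k A. \<bar>c k\<bar> \<le> M}" (is "?L = ?R")
  proof
    show "?L \<subseteq> ?R"
    proof clarify
      fix t c assume t: "t \<in> {-M..M}" and c: "\<forall>k\<in>A. \<bar>c k\<bar> \<le> M"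
      have "(\<Sum>j\<in>A. (c(k := t)) j *\<^sub>R e j) = (\<Sum>j\<in>A. c j *\<^sub>R e j)" using insert.hyps by (intro sum.cong) auto
      then show "\<exists>c'. t *\<^sub>R e k + (\<Sum>k\<in>A. c k *\<^sub>R e k) = (\<Sum>k\<in>insert k A. c' k *\<^sub>R e k) \<and> (\<forall>k\<in>insert k A. \<bar>c' k\<bar> \<le> M)"
        using insert.hyps t c by (intro exI[of _ "c(k := t)"]) auto
    qed
    show "?R \<subseteq> ?L"
    proof clarify
      fix c assume c: "\<forall>k\<in>insert k A. \<bar>c k\<bar> \<le> M"
      then have "c k \<in> {-M..M}" by auto
      then show "\<exists>x y. (\<Sum>k\<in>insert k A. c k *\<^sub>R e k) = x + y \<and> x \<in> (\<lambda>t. t *\<^sub>R e k) ` {-M..M} \<and> y \<in> {(\<Sum>k\<in>A. c k *\<^sub>R e k) | c. \<forall>k\<in>A. \<bar>c k\<bar> \<le> M}"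
        using insert.hyps c by (intro exI[of _ "c k *\<^sub>R e k"] exI[of _ "\<Sum>k\<in>A. c k *\<^sub>R e k"]) auto
    qed
  qed
  finally show ?case .
qed

text \<open>A finite net of the approximating compact set is also a net of the closure; the error
  splits into three thirds.\<close>

lemma compact_closure_approx:
  fixes A :: "'a::complete_space set"
  assumes "\<And>\<epsilon>. \<epsilon> > 0 \<Longrightarrow> \<exists>B. compact B \<and> (\<forall>a\<in>A. \<exists>b\<in>B. dist a b < \<epsilon>)"
  shows "compact (closure A)"
  unfolding compact_eq_totally_bounded
proof (intro conjI allI impI)
  show "complete (closure A)" by (simp add: complete_eq_closed)
  fix e :: real assume e: "e > 0"
  then obtain B where B: "compact B" "\<forall>a\<in>A. \<exists>b\<in>B. dist a b < e / 3" using assms[of "e / 3"] by auto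
  obtain k where k: "finite k" "B \<subseteq> (\<Union>x\<in>k. ball x (e / 3))"
    using B(1) e unfolding compact_eq_totally_bounded by (metis divide_pos_pos zero_less_numeral)
  have "closure A \<subseteq> (\<Union>x\<in>k. ball x e)"
  proof
    fix x assume "x \<in> closure A"
    then obtain a where a: "a \<in> A" "dist a x < e / 3" using closure_approachable e by (metis divide_pos_pos zero_less_numeral)
    obtain b where b: "b \<in> B" "dist a b < e / 3" using B(2) a(1) by blast
    obtain y where y: "y \<in> k" "dist y b < e / 3" using k(2) b(1) by auto
    have "dist y x \<le> dist y b + (dist a b + dist a x)"
      using dist_triangle[of y x b] dist_triangle[of b x a] by (simp add: dist_commute)
    with a b y have "dist y x < e" by linarith
    with y(1) show "x \<in> (\<Union>x\<in>k. ball x e)" by auto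
  qed
  then show "\<exists>k. finite k \<and> closure A \<subseteq> (\<Union>x\<in>k. ball x e)" using k(1) by blast
qed

text \<open>Averaging over a fine grid moves the set by little, uniformly, into a bounded part of a
  finite-dimensional space. A bounded domain meets finitely many cells, and test functions extend by
  zero, so translates may leave the domain.\<close>

theorem rellich:
  fixes \<Omega> :: "(real^'n::finite) set"
  assumes "bounded \<Omega>"
  shows "compact (closure {cls \<phi> | \<phi>. \<phi> \<in> test_functions \<Omega> \<and> gradient_energy \<phi> \<le> ennreal C})"
proof (rule compact_closure_approx)
  fix \<epsilon> :: real assume \<epsilon>: "\<epsilon> > 0"
  obtain R where R: "\<Omega> \<subseteq> ball 0 R" using assms bounded_subset_ballD by blast
  define n where "n = real CARD('n)"
  \<comment> \<open>\<open>D * h\<^sup>2\<close> is the squared averaging error.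
    \<open>ennreal C\<close> is 0 for negative \<open>C\<close>, hence the absolute value; the
    summand 1 in the denominator of \<open>h\<close> covers \<open>D = 0\<close>.\<close>
  define D where "D = 2 ^ CARD('n) * n\<^sup>2 * \<bar>C\<bar>"
  have D: "D \<ge> 0" by (simp add: D_def)
  define h where "h = \<epsilon> / (sqrt D + 1)"
  have den: "sqrt D + 1 > 0" using D by (simp add: add_nonneg_pos)
  have h: "h > 0" unfolding h_def using \<epsilon> den by simp
  have hD: "D * h\<^sup>2 < \<epsilon>\<^sup>2"
  proof -
    have "sqrt D * h < (sqrt D + 1) * h" using h by simp
    also have "\<dots> = \<epsilon>" using den by (simp add: h_def)
    finally have "(sqrt D * h)\<^sup>2 < \<epsilon>\<^sup>2" using D h by (intro power_strict_mono) auto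
    then show ?thesis using D by (simp add: power_mult_distrib)
  qed
  \<comment> \<open>A finite box of indices that contains all cells meeting the ball.\<close>
  define A where "A = {k::int^'n. \<forall>i. \<bar>k $ i\<bar> \<le> \<lceil>\<bar>R\<bar> / h\<rceil> + 1}"
  have A: "finite A" unfolding A_def by (rule finite_int_vec_box)
  have cover: "k \<in> A" if x: "norm x < R" "x \<in> cell h k" for x k
  proof -
    have "\<bar>k $ i\<bar> \<le> \<lceil>\<bar>R\<bar> / h\<rceil> + 1" for i
    proof -
      have k: "k $ i = \<lfloor>x $ i / h\<rfloor>" using x(2) h by (simp add: cell_iff)
      have "\<bar>x $ i\<bar> \<le> \<bar>R\<bar>" using component_le_norm_cart[of x i] x(1) by linarith
      then have "\<bar>x $ i / h\<bar> \<le> \<bar>R\<bar> / h" using h by (simp add: abs_divide divide_right_mono)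
      then show ?thesis unfolding k by linarith
    qed
    then show ?thesis by (simp add: A_def)
  qed
  \<comment> \<open>Bounds all coefficients of averages by Cauchy-Schwarz, since the L^2 norms are
    at most \<open>sqrt \<bar>C\<bar>\<close>.\<close>
  define M where "M = Max (insert 0 ((\<lambda>k. norm (cls (indicator (cell h k) :: _ \<Rightarrow> real)) * sqrt \<bar>C\<bar> / h ^ CARD('n)) ` A))"
  define B where "B = {(\<Sum>k\<in>A. c k *\<^sub>R cls (indicator (cell h k))) | c. \<forall>k\<in>A. \<bar>c k\<bar> \<le> M}"
  have "compact B" unfolding B_def by (rule compact_bounded_combinations[OF A])
  moreover have "\<exists>b\<in>B. dist a b < \<epsilon>" if a: "a \<in> {cls \<phi> | \<phi>. \<phi> \<in> test_functions \<Omega> \<and> gradient_energy \<phi> \<le> ennreal C}" for a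
  proof -
    obtain \<phi> where \<phi>: "\<phi> \<in> test_functions \<Omega>" "gradient_energy \<phi> \<le> ennreal C" "a = cls \<phi>" using a by blast
    have "gradient_energy \<phi> \<le> ennreal \<bar>C\<bar>" using \<phi>(2) by (rule order_trans) (simp add: ennreal_leI)
    have norm_a: "norm a \<le> sqrt \<bar>C\<bar>"
    proof -
      have "ennreal ((norm a)\<^sup>2) = (\<integral>\<^sup>+x. ennreal ((\<phi> x)\<^sup>2) \<partial>lborel)"
        using nn_integral_norm_cls[OF test_square_integrable[OF \<phi>(1)]] by (simp add: \<phi>(3) nn_integral_completion)
      also have "\<dots> \<le> ennreal \<bar>C\<bar>" using gradient_energy_ge(1) \<open>gradient_energy \<phi> \<le> ennreal \<bar>C\<bar>\<close> by (rule order_trans)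
      finally have "(norm a)\<^sup>2 \<le> \<bar>C\<bar>" by (subst (asm) ennreal_le_iff) auto
      then show ?thesis by (rule real_le_rsqrt)
    qed
    have coeff: "\<bar>inner (cls (indicator (cell h k))) a / h ^ CARD('n)\<bar> \<le> M" if k: "k \<in> A" for k
    proof -
      have "\<bar>inner (cls (indicator (cell h k))) a / h ^ CARD('n)\<bar> \<le> norm (cls (indicator (cell h k) :: _ \<Rightarrow> real)) * norm a / h ^ CARD('n)"
        using Cauchy_Schwarz_ineq2[of "cls (indicator (cell h k))" a] h by (simp add: abs_divide divide_right_mono)
      also have "\<dots> \<le> norm (cls (indicator (cell h k) :: _ \<Rightarrow> real)) * sqrt \<bar>C\<bar> / h ^ CARD('n)"
        using norm_a h by (intro divide_right_mono mult_left_mono) auto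
      also have "\<dots> \<le> M" unfolding M_def using A k by (intro Max_ge) auto
      finally show ?thesis .
    qed
    have inB: "cell_average h A a \<in> B" unfolding B_def cell_average_def using coeff
      by (intro CollectI exI[of _ "\<lambda>k. inner (cls (indicator (cell h k))) a / h ^ CARD('n)"]) auto
    have "ennreal ((norm (a - cell_average h A a))\<^sup>2) \<le> ennreal (2 ^ CARD('n) * (real CARD('n) * h)\<^sup>2) * gradient_energy \<phi>"
      unfolding \<phi>(3) by (rule cell_average_approx[OF h \<phi>(1) R A cover])
    also have "\<dots> \<le> ennreal (2 ^ CARD('n) * (real CARD('n) * h)\<^sup>2) * ennreal \<bar>C\<bar>"
      by (intro mult_left_mono) (auto simp: \<open>gradient_energy \<phi> \<le> ennreal \<bar>C\<bar>\<close>)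
    also have "\<dots> = ennreal (D * h\<^sup>2)" by (simp add: ennreal_mult[symmetric] D_def n_def power_mult_distrib mult_ac)
    finally have "(norm (a - cell_average h A a))\<^sup>2 \<le> D * h\<^sup>2" using D by (subst (asm) ennreal_le_iff) auto
    also have "\<dots> < \<epsilon>\<^sup>2" by (rule hD)
    finally have "norm (a - cell_average h A a) < \<epsilon>" by (rule power_less_imp_less_base) (use \<epsilon> in simp)
    then show ?thesis using inB by (auto simp: dist_norm)
  qed
  ultimately show "\<exists>B. compact B \<and> (\<forall>a\<in>{cls \<phi> | \<phi>. \<phi> \<in> test_functions \<Omega> \<and> gradient_energy \<phi> \<le> ennreal C}. \<exists>b\<in>B. dist a b < \<epsilon>)"
    by blast
qed

section \<open>\<open>H\<^sub>0\<^sup>1(\<Omega>)\<close> as a closed subspace of a Hilbert space\<close>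

lemma subspace_closure:
  fixes S :: "'a::real_normed_vector set"
  assumes "subspace S" shows "subspace (closure S)"
proof (rule subspaceI)
  show "0 \<in> closure S" using subspace_0[OF assms] closure_subset by blast
  fix x y assume "x \<in> closure S" "y \<in> closure S"
  then obtain X Y where XY: "\<forall>n. X n \<in> S" "X \<longlonglongrightarrow> x" "\<forall>n. Y n \<in> S" "Y \<longlonglongrightarrow> y" unfolding closure_sequential by blast
  then have "(\<lambda>n. X n + Y n) \<longlonglongrightarrow> x + y" "\<forall>n. X n + Y n \<in> S"
    using assms by (auto intro: tendsto_add subspace_add)
  then show "x + y \<in> closure S" unfolding closure_sequential by (intro exI[of _ "\<lambda>n. X n + Y n"] conjI)
next
  fix c x assume "x \<in> closure S"
  then obtain X where X: "\<forall>n. X n \<in> S" "X \<longlonglongrightarrow> x" unfolding closure_sequential by blast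
  then have "(\<lambda>n. c *\<^sub>R X n) \<longlonglongrightarrow> c *\<^sub>R x" "\<forall>n. c *\<^sub>R X n \<in> S"
    using assms by (auto intro: tendsto_scaleR subspace_scale)
  then show "c *\<^sub>R x \<in> closure S" unfolding closure_sequential by (intro exI[of _ "\<lambda>n. c *\<^sub>R X n"] conjI)
qed

section \<open>Zero extension and weak gradients\<close>

text \<open>Brings functions on a domain into \<open>lsq\<close>, so that one Hilbert space serves
  every domain.\<close>

definition zext :: "(real^'n::finite) set \<Rightarrow> (real^'n \<Rightarrow> real) \<Rightarrow> real^'n \<Rightarrow> real" where
  "zext \<Omega> u x = (if x \<in> \<Omega> then u x else 0)"

lemma zext_indicator: "zext \<Omega> u = (\<lambda>x. indicator \<Omega> x *\<^sub>R u x)"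
  by (auto simp: zext_def indicator_def)

lemma zext_simps:
  "zext \<Omega> (\<lambda>x. u x + v x) = (\<lambda>x. zext \<Omega> u x + zext \<Omega> v x)"
  "zext \<Omega> (\<lambda>x. u x - v x) = (\<lambda>x. zext \<Omega> u x - zext \<Omega> v x)"
  "zext \<Omega> (\<lambda>x. c * u x) = (\<lambda>x. c * zext \<Omega> u x)"
  "zext \<Omega> (\<lambda>x. u x * v x) = (\<lambda>x. zext \<Omega> u x * zext \<Omega> v x)"
  "zext \<Omega> (\<lambda>x. 0) = (\<lambda>x. 0)"
  by (auto simp: zext_def)

lemma zext_power2: "(zext \<Omega> u x)\<^sup>2 = zext \<Omega> (\<lambda>x. (u x)\<^sup>2) x"
  by (simp add: zext_def)

lemma zext_test: "\<phi> \<in> test_functions \<Omega> \<Longrightarrow> zext \<Omega> \<phi> = \<phi>"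
  using test_functions_support[of \<phi> \<Omega>] by (auto simp: zext_def fun_eq_iff)

context
  fixes \<Omega> :: "(real^'n::finite) set"
  assumes \<Omega>: "open \<Omega>"
begin

lemma dom_sets: "\<Omega> \<in> sets lebesgue" "\<Omega> \<inter> space lebesgue \<in> sets lebesgue"
  using \<Omega> by auto

lemma integral_zext: "integral\<^sup>L (lebesgue_on \<Omega>) f = integral\<^sup>L lebesgue (zext \<Omega> f)" for f :: "real^'n \<Rightarrow> real"
  unfolding zext_indicator by (rule integral_restrict_space[OF dom_sets(2)])

lemma integrable_zext: "integrable (lebesgue_on \<Omega>) f \<longleftrightarrow> integrable lebesgue (zext \<Omega> f)" for f :: "real^'n \<Rightarrow> real"
  unfolding zext_indicator by (rule integrable_restrict_space[OF dom_sets(2)])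

lemma measurable_zext: "f \<in> borel_measurable (lebesgue_on \<Omega>) \<longleftrightarrow> zext \<Omega> f \<in> borel_measurable lebesgue" for f :: "real^'n \<Rightarrow> real"
  unfolding zext_indicator by (rule borel_measurable_restrict_space_iff[OF dom_sets(2)])

lemma AE_zext: "(AE x in lebesgue_on \<Omega>. P x) \<longleftrightarrow> (AE x in lebesgue. x \<in> \<Omega> \<longrightarrow> P x)"
  by (rule AE_restrict_space_iff[OF dom_sets(2)])

lemma L2_zext: "u \<in> L2 \<Omega> \<longleftrightarrow> square_integrable (zext \<Omega> u)"
  by (simp add: L2_def square_integrable_def measurable_zext integrable_zext zext_power2)

lemma cls_zext_eq_iff:
  assumes "u \<in> L2 \<Omega>" "v \<in> L2 \<Omega>"
  shows "cls (zext \<Omega> u) = cls (zext \<Omega> v) \<longleftrightarrow> (AE x in lebesgue_on \<Omega>. u x = v x)"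
  using assms unfolding L2_zext AE_zext by (subst cls_eq_iff) (auto simp: zext_def intro!: AE_cong)

lemma integral_prod_zext:
  assumes "u \<in> L2 \<Omega>" "v \<in> L2 \<Omega>"
  shows "integral\<^sup>L (lebesgue_on \<Omega>) (\<lambda>x. u x * v x) = inner (cls (zext \<Omega> u)) (cls (zext \<Omega> v))"
  using assms by (simp add: integral_zext zext_simps cls_inner L2_zext)

lemma integrable_prod_zext:
  assumes "u \<in> L2 \<Omega>" "v \<in> L2 \<Omega>"
  shows "integrable (lebesgue_on \<Omega>) (\<lambda>x. u x * v x)"
  using assms by (simp add: integrable_zext zext_simps square_integrable_mult L2_zext)

lemma test_L2: "\<phi> \<in> test_functions \<Omega> \<Longrightarrow> \<phi> \<in> L2 \<Omega>"
  by (simp add: L2_zext zext_test test_square_integrable)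

text \<open>Written with inner products, the defining identity is visibly stable under linear
  combinations and norm limits.\<close>

lemma weak_grad_iff:
  assumes "u \<in> L2 \<Omega>"
  shows "is_weak_grad \<Omega> u g \<longleftrightarrow> (\<forall>j. (\<lambda>x. g x $ j) \<in> L2 \<Omega>) \<and>
    (\<forall>\<phi>\<in>test_functions \<Omega>. \<forall>j. inner (cls (zext \<Omega> u)) (cls (partial_deriv j \<phi>)) = - inner (cls (zext \<Omega> (\<lambda>x. g x $ j))) (cls \<phi>))"
proof -
  have "integral\<^sup>L (lebesgue_on \<Omega>) (\<lambda>x. u x * partial_deriv j \<phi> x) = inner (cls (zext \<Omega> u)) (cls (partial_deriv j \<phi>))"
    if "\<phi> \<in> test_functions \<Omega>" for \<phi> j
    using integral_prod_zext[OF assms test_L2[OF test_partial_deriv[OF that]], of j] zext_test[OF test_partial_deriv[OF that]] by simp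
  moreover have "integral\<^sup>L (lebesgue_on \<Omega>) (\<lambda>x. g x $ j * \<phi> x) = inner (cls (zext \<Omega> (\<lambda>x. g x $ j))) (cls \<phi>)"
    if "\<phi> \<in> test_functions \<Omega>" "(\<lambda>x. g x $ j) \<in> L2 \<Omega>" for \<phi> j
    using integral_prod_zext[OF that(2) test_L2[OF that(1)]] zext_test[OF that(1)] by simp
  ultimately show ?thesis unfolding is_weak_grad_def by auto
qed

text \<open>The difference of two weak gradients is orthogonal to all test functions, and zero
  extension makes it vanish off the domain.\<close>

lemma weak_grad_unique:
  assumes u: "u \<in> L2 \<Omega>" and g: "is_weak_grad \<Omega> u g" "is_weak_grad \<Omega> u g'"
  shows "cls (zext \<Omega> (\<lambda>x. g x $ j)) = cls (zext \<Omega> (\<lambda>x. g' x $ j))"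
proof -
  have L: "(\<lambda>x. g x $ j) \<in> L2 \<Omega>" "(\<lambda>x. g' x $ j) \<in> L2 \<Omega>" using g by (auto simp: is_weak_grad_def)
  define d where "d x = zext \<Omega> (\<lambda>x. g x $ j) x - zext \<Omega> (\<lambda>x. g' x $ j) x" for x
  have d: "square_integrable d" unfolding d_def using L by (intro square_integrable_diff) (auto simp: L2_zext)
  have cls_d: "cls d = cls (zext \<Omega> (\<lambda>x. g x $ j)) - cls (zext \<Omega> (\<lambda>x. g' x $ j))"
    unfolding d_def using L by (intro cls_diff[symmetric]) (auto simp: L2_zext)
  have "AE x in lebesgue. x \<in> \<Omega> \<longrightarrow> d x = 0"
  proof (rule fundamental_lemma[OF \<Omega> d])
    fix \<phi> assume \<phi>: "\<phi> \<in> test_functions \<Omega>"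
    have "inner (cls (zext \<Omega> (\<lambda>x. g x $ j))) (cls \<phi>) = inner (cls (zext \<Omega> (\<lambda>x. g' x $ j))) (cls \<phi>)"
      using g \<phi> unfolding weak_grad_iff[OF u] by (metis neg_equal_iff_equal)
    then have "inner (cls d) (cls \<phi>) = 0" by (simp add: cls_d inner_diff_left)
    then show "integral\<^sup>L lebesgue (\<lambda>x. d x * \<phi> x) = 0" by (simp add: cls_inner d test_square_integrable[OF \<phi>])
  qed
  then have "AE x in lebesgue. d x = 0" by eventually_elim (auto simp: d_def zext_def)
  then have "cls d = cls (\<lambda>x. 0)" using d by (simp add: cls_eq_iff)
  then show ?thesis by (simp add: cls_d cls_zero)
qed

section \<open>The graph embedding and its closed image\<close>

text \<open>The graph of the weak gradient. The product norm is the H^1 norm on \<open>H1\<close>,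
  so the Hilbert space structure is inherited from \<open>lsq\<close>.\<close>

definition emb :: "(real^'n \<Rightarrow> real) \<Rightarrow> (real^'n) lsq \<times> ((real^'n) lsq^'n)" where
  "emb u = (cls (zext \<Omega> u), \<chi> j. cls (zext \<Omega> (\<lambda>x. weak_grad \<Omega> u x $ j)))"

lemma H1_weak_grad:
  assumes "u \<in> H1 \<Omega>" shows "u \<in> L2 \<Omega>" "is_weak_grad \<Omega> u (weak_grad \<Omega> u)" "(\<lambda>x. weak_grad \<Omega> u x $ j) \<in> L2 \<Omega>"
proof -
  show "u \<in> L2 \<Omega>" using assms by (simp add: H1_def)
  show *: "is_weak_grad \<Omega> u (weak_grad \<Omega> u)"
    unfolding weak_grad_def using assms by (intro someI_ex[of "is_weak_grad \<Omega> u"]) (simp add: H1_def)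
  show "(\<lambda>x. weak_grad \<Omega> u x $ j) \<in> L2 \<Omega>" using * by (simp add: is_weak_grad_def)
qed

lemma emb_eq:
  assumes "u \<in> L2 \<Omega>" "is_weak_grad \<Omega> u g"
  shows "u \<in> H1 \<Omega>" "emb u = (cls (zext \<Omega> u), \<chi> j. cls (zext \<Omega> (\<lambda>x. g x $ j)))"
proof -
  show u: "u \<in> H1 \<Omega>" using assms by (auto simp: H1_def)
  show "emb u = (cls (zext \<Omega> u), \<chi> j. cls (zext \<Omega> (\<lambda>x. g x $ j)))"
    unfolding emb_def using weak_grad_unique[OF assms(1) H1_weak_grad(2)[OF u] assms(2)] by simp
qed

lemma emb_weak_identity:
  assumes "u \<in> H1 \<Omega>" "\<phi> \<in> test_functions \<Omega>"
  shows "inner (fst (emb u)) (cls (partial_deriv j \<phi>)) = - inner (snd (emb u) $ j) (cls \<phi>)"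
  using H1_weak_grad(1,2)[OF assms(1)] assms(2) by (auto simp: weak_grad_iff emb_def)

text \<open>\<open>weak_grad\<close> is chosen by \<open>SOME\<close> and need not be linear
  pointwise; uniqueness makes it linear on classes.\<close>

lemma emb_linear_aux:
  assumes u: "u \<in> H1 \<Omega>" and v: "v \<in> H1 \<Omega>"
  shows "(\<lambda>x. a * u x + b * v x) \<in> H1 \<Omega> \<and> emb (\<lambda>x. a * u x + b * v x) = a *\<^sub>R emb u + b *\<^sub>R emb v"
proof -
  define g where "g x = a *\<^sub>R weak_grad \<Omega> u x + b *\<^sub>R weak_grad \<Omega> v x" for x
  have sq: "square_integrable (zext \<Omega> u)" "square_integrable (zext \<Omega> v)"
    "square_integrable (zext \<Omega> (\<lambda>x. weak_grad \<Omega> u x $ j))" "square_integrable (zext \<Omega> (\<lambda>x. weak_grad \<Omega> v x $ j))" for j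
    using H1_weak_grad[OF u] H1_weak_grad[OF v] by (auto simp: L2_zext)
  have comb: "square_integrable (\<lambda>x. a * p x + b * q x) \<and> cls (\<lambda>x. a * p x + b * q x) = a *\<^sub>R cls p + b *\<^sub>R cls q"
    if "square_integrable p" "square_integrable q" for p q :: "real^'n \<Rightarrow> real"
    using cls_add[OF square_integrable_scale[OF that(1), of a] square_integrable_scale[OF that(2), of b]]
      square_integrable_add[OF square_integrable_scale[OF that(1), of a] square_integrable_scale[OF that(2), of b]]
      cls_scale[OF that(1), of a] cls_scale[OF that(2), of b] by simp
  have L: "(\<lambda>x. a * u x + b * v x) \<in> L2 \<Omega>" using comb[OF sq(1,2)] by (simp add: L2_zext zext_simps)
  have cu: "cls (zext \<Omega> (\<lambda>x. a * u x + b * v x)) = a *\<^sub>R cls (zext \<Omega> u) + b *\<^sub>R cls (zext \<Omega> v)"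
    using comb[OF sq(1,2)] by (simp add: zext_simps)
  have cg: "(\<lambda>x. g x $ j) \<in> L2 \<Omega>" "cls (zext \<Omega> (\<lambda>x. g x $ j)) = a *\<^sub>R snd (emb u) $ j + b *\<^sub>R snd (emb v) $ j" for j
    using comb[OF sq(3,4)[of j]] by (simp_all add: L2_zext zext_simps g_def emb_def)
  have "is_weak_grad \<Omega> (\<lambda>x. a * u x + b * v x) g"
    unfolding weak_grad_iff[OF L] cu cg(2)
    using cg(1) emb_weak_identity[OF u] emb_weak_identity[OF v] by (simp add: inner_add_left emb_def)
  from emb_eq[OF L this] show ?thesis unfolding cu cg(2) by (simp add: emb_def prod_eq_iff vec_eq_iff)
qed

lemma emb_scale: "u \<in> H1 \<Omega> \<Longrightarrow> (\<lambda>x. a * u x) \<in> H1 \<Omega>" "u \<in> H1 \<Omega> \<Longrightarrow> emb (\<lambda>x. a * u x) = a *\<^sub>R emb u"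
  using emb_linear_aux[of u u a 0] by auto
lemma emb_add: "u \<in> H1 \<Omega> \<Longrightarrow> v \<in> H1 \<Omega> \<Longrightarrow> emb (\<lambda>x. u x + v x) = emb u + emb v"
  using emb_linear_aux[of u v 1 1] by auto
lemma emb_diff: "u \<in> H1 \<Omega> \<Longrightarrow> v \<in> H1 \<Omega> \<Longrightarrow> (\<lambda>x. u x - v x) \<in> H1 \<Omega>"
    "u \<in> H1 \<Omega> \<Longrightarrow> v \<in> H1 \<Omega> \<Longrightarrow> emb (\<lambda>x. u x - v x) = emb u - emb v"
  using emb_linear_aux[of u v 1 "-1"] by auto

text \<open>Integration by parts makes the classical gradient a weak one, and uniqueness identifies
  the classes.\<close>

lemma emb_test:
  assumes \<phi>: "\<phi> \<in> test_functions \<Omega>"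
  shows "\<phi> \<in> H1 \<Omega>" "emb \<phi> = (cls \<phi>, \<chi> j. cls (partial_deriv j \<phi>))"
proof -
  define g where "g x = (\<chi> j. partial_deriv j \<phi> x)" for x
  note pd = test_partial_deriv[OF \<phi>]
  have "is_weak_grad \<Omega> \<phi> g"
    unfolding weak_grad_iff[OF test_L2[OF \<phi>]]
  proof (intro conjI allI ballI)
    fix j show "(\<lambda>x. g x $ j) \<in> L2 \<Omega>" using test_L2[OF pd] by (simp add: g_def)
  next
    fix \<psi> j assume \<psi>: "\<psi> \<in> test_functions \<Omega>"
    show "inner (cls (zext \<Omega> \<phi>)) (cls (partial_deriv j \<psi>)) = - inner (cls (zext \<Omega> (\<lambda>x. g x $ j))) (cls \<psi>)"
      using test_integration_by_parts[OF \<phi> \<psi>, of j]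
      by (simp add: g_def zext_test \<phi> pd cls_inner test_square_integrable[OF \<phi>] test_square_integrable[OF \<psi>]
          test_square_integrable[OF pd] test_square_integrable[OF test_partial_deriv[OF \<psi>]])
  qed
  from emb_eq[OF test_L2[OF \<phi>] this] show "\<phi> \<in> H1 \<Omega>" "emb \<phi> = (cls \<phi>, \<chi> j. cls (partial_deriv j \<phi>))"
    by (simp_all add: g_def zext_test \<phi> pd)
qed

lemma gradient_energy_emb:
  assumes \<phi>: "\<phi> \<in> test_functions \<Omega>"
  shows "gradient_energy \<phi> = ennreal ((norm (emb \<phi>))\<^sup>2)"
proof -
  have "(\<integral>\<^sup>+x. ennreal ((\<psi> x)\<^sup>2) \<partial>lborel) = ennreal ((norm (cls \<psi>))\<^sup>2)" if "\<psi> \<in> test_functions \<Omega>" for \<psi>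
    using nn_integral_norm_cls[OF test_square_integrable[OF that]] by (simp add: nn_integral_completion)
  then have "gradient_energy \<phi> = ennreal ((norm (cls \<phi>))\<^sup>2) + (\<Sum>j\<in>UNIV. ennreal ((norm (cls (partial_deriv j \<phi>)))\<^sup>2))"
    using \<phi> test_partial_deriv[OF \<phi>] by (simp add: gradient_energy_def)
  also have "\<dots> = ennreal ((norm (cls \<phi>))\<^sup>2 + (\<Sum>j\<in>UNIV. (norm (cls (partial_deriv j \<phi>)))\<^sup>2))"
    by (simp add: sum_nonneg)
  also have "(norm (cls \<phi>))\<^sup>2 + (\<Sum>j\<in>UNIV. (norm (cls (partial_deriv j \<phi>)))\<^sup>2) = (norm (emb \<phi>))\<^sup>2"
    by (simp add: emb_test[OF \<phi>] norm_prod_def norm_vec_def L2_set_def sum_nonneg)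
  finally show ?thesis .
qed

lemma inner_emb:
  assumes u: "u \<in> H1 \<Omega>" and v: "v \<in> H1 \<Omega>"
  shows "inner (fst (emb u)) (fst (emb v)) = integral\<^sup>L (lebesgue_on \<Omega>) (\<lambda>x. u x * v x)"
    "inner (snd (emb u)) (snd (emb v)) = integral\<^sup>L (lebesgue_on \<Omega>) (\<lambda>x. weak_grad \<Omega> u x \<bullet> weak_grad \<Omega> v x)"
proof -
  show "inner (fst (emb u)) (fst (emb v)) = integral\<^sup>L (lebesgue_on \<Omega>) (\<lambda>x. u x * v x)"
    using H1_weak_grad(1)[OF u] H1_weak_grad(1)[OF v] by (simp add: emb_def integral_prod_zext)
  have "integral\<^sup>L (lebesgue_on \<Omega>) (\<lambda>x. weak_grad \<Omega> u x \<bullet> weak_grad \<Omega> v x)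
      = (\<Sum>j\<in>UNIV. integral\<^sup>L (lebesgue_on \<Omega>) (\<lambda>x. weak_grad \<Omega> u x $ j * weak_grad \<Omega> v x $ j))"
    unfolding inner_vec_def inner_real_def
    by (intro Bochner_Integration.integral_sum integrable_prod_zext H1_weak_grad(3) u v)
  also have "\<dots> = inner (snd (emb u)) (snd (emb v))"
    using H1_weak_grad(3)[OF u] H1_weak_grad(3)[OF v] by (simp add: emb_def inner_vec_def integral_prod_zext)
  finally show "inner (snd (emb u)) (snd (emb v)) = integral\<^sup>L (lebesgue_on \<Omega>) (\<lambda>x. weak_grad \<Omega> u x \<bullet> weak_grad \<Omega> v x)" by simp
qed

lemma H1_norm_emb:
  assumes "u \<in> H1 \<Omega>" shows "H1_norm \<Omega> u = norm (emb u)"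
proof -
  have "(norm (emb u))\<^sup>2 = inner (fst (emb u)) (fst (emb u)) + inner (snd (emb u)) (snd (emb u))"
    by (simp add: power2_norm_eq_inner inner_prod_def)
  also have "\<dots> = integral\<^sup>L (lebesgue_on \<Omega>) (\<lambda>x. (norm (weak_grad \<Omega> u x))\<^sup>2) + integral\<^sup>L (lebesgue_on \<Omega>) (\<lambda>x. (u x)\<^sup>2)"
    unfolding inner_emb[OF assms assms] by (simp add: power2_norm_eq_inner power2_eq_square[of "u _"])
  finally show ?thesis unfolding H1_norm_def by (metis norm_ge_zero real_sqrt_unique)
qed

text \<open>If \<open>u\<close> has class 0, then 0 is a weak gradient of it, and uniqueness forces
  the second component to vanish too.\<close>

lemma vanishes_emb:
  assumes "u \<in> H1 \<Omega>" shows "vanishes \<Omega> u \<longleftrightarrow> emb u = 0"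
proof -
  have u: "u \<in> L2 \<Omega>" using H1_weak_grad[OF assms] by simp
  have zero_L2: "(\<lambda>x. 0) \<in> L2 \<Omega>" by (simp add: L2_zext zext_simps)
  have "vanishes \<Omega> u \<longleftrightarrow> cls (zext \<Omega> u) = 0"
    using cls_zext_eq_iff[OF u zero_L2] by (simp add: vanishes_def zext_simps cls_zero)
  moreover have "emb u = 0" if "cls (zext \<Omega> u) = 0"
  proof -
    have "is_weak_grad \<Omega> u (\<lambda>x. 0)"
      unfolding weak_grad_iff[OF u] that using zero_L2 by (simp add: zext_simps cls_zero)
    from emb_eq(2)[OF u this] that show ?thesis by (simp add: zext_simps cls_zero prod_eq_iff vec_eq_iff)
  qed
  moreover have "cls (zext \<Omega> u) = 0" if "emb u = 0" using that by (simp add: emb_def prod_eq_iff)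
  ultimately show ?thesis by blast
qed

text \<open>The Hilbert space model of \<open>H10\<close>: it is the image of \<open>H10\<close>
  under \<open>emb\<close>, as \<open>H10_emb\<close> and \<open>hspace_represent\<close> show, and
  as a closure it is closed from the start, so that projections onto it exist.\<close>

definition hspace :: "((real^'n) lsq \<times> ((real^'n) lsq^'n)) set" where
  "hspace = closure (emb ` test_functions \<Omega>)"

lemma hspace_closed: "closed hspace" by (simp add: hspace_def)

lemma hspace_subspace: "subspace hspace"
  unfolding hspace_def
proof (intro subspace_closure subspaceI)
  have "emb (\<lambda>x. 0) = 0 *\<^sub>R emb (\<lambda>x. 0)" using emb_scale(2)[OF emb_test(1)[OF test_zero], of 0] by simp
  then show "0 \<in> emb ` test_functions \<Omega>" using test_zero[of \<Omega>] by (metis image_eqI scaleR_zero_left)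
  fix x y assume "x \<in> emb ` test_functions \<Omega>" "y \<in> emb ` test_functions \<Omega>"
  then obtain \<phi> \<psi> where *: "\<phi> \<in> test_functions \<Omega>" "x = emb \<phi>" "\<psi> \<in> test_functions \<Omega>" "y = emb \<psi>" by blast
  then have "x + y = emb (\<lambda>x. \<phi> x + \<psi> x)" by (simp add: emb_add emb_test)
  then show "x + y \<in> emb ` test_functions \<Omega>" using test_add[OF *(1,3)] by blast
next
  fix c x assume "x \<in> emb ` test_functions \<Omega>"
  then obtain \<phi> where *: "\<phi> \<in> test_functions \<Omega>" "x = emb \<phi>" by blast
  then have "c *\<^sub>R x = emb (\<lambda>x. c * \<phi> x)" by (simp add: emb_scale emb_test)
  then show "c *\<^sub>R x \<in> emb ` test_functions \<Omega>" using test_scale[OF *(1)] by blast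
qed

lemma hspace_approx:
  assumes "h \<in> hspace"
  obtains \<phi> where "\<And>n. \<phi> n \<in> test_functions \<Omega>" "(\<lambda>n. emb (\<phi> n)) \<longlonglongrightarrow> h"
proof -
  obtain X where X: "\<forall>n. X n \<in> emb ` test_functions \<Omega>" "X \<longlonglongrightarrow> h"
    using assms unfolding hspace_def closure_sequential by blast
  then have "\<forall>n. \<exists>\<phi>. \<phi> \<in> test_functions \<Omega> \<and> X n = emb \<phi>" by blast
  then obtain \<phi> where \<phi>: "\<And>n. \<phi> n \<in> test_functions \<Omega>" "\<And>n. X n = emb (\<phi> n)" by metis
  have "X = (\<lambda>n. emb (\<phi> n))" using \<phi>(2) by blast
  with X(2) \<phi>(1) show ?thesis by (intro that[of \<phi>]) simp_all
qed

lemma H10_emb: "u \<in> H10 \<Omega> \<longleftrightarrow> u \<in> H1 \<Omega> \<and> emb u \<in> hspace"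
proof
  assume u: "u \<in> H10 \<Omega>"
  then have u1: "u \<in> H1 \<Omega>" by (simp add: H10_def)
  obtain \<phi> :: "nat \<Rightarrow> real^'n \<Rightarrow> real" where \<phi>: "\<And>n. \<phi> n \<in> test_functions \<Omega>" "(\<lambda>n. H1_norm \<Omega> (\<lambda>x. u x - \<phi> n x)) \<longlonglongrightarrow> 0"
    using u unfolding H10_def by blast
  have "H1_norm \<Omega> (\<lambda>x. u x - \<phi> n x) = norm (emb u - emb (\<phi> n))" for n
    using H1_norm_emb[OF emb_diff(1)[OF u1 emb_test(1)[OF \<phi>(1)]]] emb_diff(2)[OF u1 emb_test(1)[OF \<phi>(1)]] by simp
  then have "(\<lambda>n. norm (emb u - emb (\<phi> n))) \<longlonglongrightarrow> 0" using \<phi>(2) by simp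
  then have "(\<lambda>n. emb u - emb (\<phi> n)) \<longlonglongrightarrow> 0" by (rule tendsto_norm_zero_cancel)
  from tendsto_diff[OF tendsto_const[of "emb u"] this] have "(\<lambda>n. emb (\<phi> n)) \<longlonglongrightarrow> emb u" by simp
  then have "emb u \<in> hspace" unfolding hspace_def closure_sequential
    using \<phi>(1) by (intro exI[of _ "\<lambda>n. emb (\<phi> n)"]) auto
  with u1 show "u \<in> H1 \<Omega> \<and> emb u \<in> hspace" by blast
next
  assume u: "u \<in> H1 \<Omega> \<and> emb u \<in> hspace"
  obtain \<phi> where \<phi>: "\<And>n. \<phi> n \<in> test_functions \<Omega>" "(\<lambda>n. emb (\<phi> n)) \<longlonglongrightarrow> emb u"
    by (rule hspace_approx[OF conjunct2[OF u]]) blast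
  have "H1_norm \<Omega> (\<lambda>x. u x - \<phi> n x) = norm (emb u - emb (\<phi> n))" for n
    using H1_norm_emb[OF emb_diff(1)[OF _ emb_test(1)[OF \<phi>(1)]]] emb_diff(2)[OF _ emb_test(1)[OF \<phi>(1)]] u by simp
  moreover have "(\<lambda>n. norm (emb u - emb (\<phi> n))) \<longlonglongrightarrow> norm (emb u - emb u)" by (intro tendsto_intros \<phi>(2))
  ultimately have "(\<lambda>n. H1_norm \<Omega> (\<lambda>x. u x - \<phi> n x)) \<longlonglongrightarrow> 0" by simp
  then show "u \<in> H10 \<Omega>" unfolding H10_def using u \<phi>(1) by blast
qed

text \<open>A representative of the first component is the required function: the weak gradient
  identity passes to limits of test functions. This turns vectors found by Hilbert space arguments
  back into functions.\<close>

lemma hspace_represent: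
  assumes h: "h \<in> hspace"
  obtains u where "u \<in> H10 \<Omega>" "emb u = h" "AE x in lebesgue. zext \<Omega> u x = rep (fst h) x"
proof -
  obtain \<phi> where \<phi>: "\<And>n. \<phi> n \<in> test_functions \<Omega>" "(\<lambda>n. emb (\<phi> n)) \<longlonglongrightarrow> h" by (rule hspace_approx[OF h]) blast
  \<comment> \<open>Limits of test functions vanish almost everywhere off the domain, so cutting the
    representative there keeps its class.\<close>
  have off: "cls (zext \<Omega> (rep l)) = l" if X: "X \<longlonglongrightarrow> l" "\<And>n. \<exists>\<psi>\<in>test_functions \<Omega>. X n = cls \<psi>" for X and l :: "(real^'n) lsq"
  proof -
    obtain r where r: "strict_mono r" "AE x in lebesgue. (\<lambda>n. rep (X (r n)) x) \<longlonglongrightarrow> rep l x"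
      by (rule lsq_tendsto_AE_subseq[OF X(1)]) blast
    have "AE x in lebesgue. x \<notin> \<Omega> \<longrightarrow> rep (X n) x = 0" for n
    proof -
      obtain \<psi> where \<psi>: "\<psi> \<in> test_functions \<Omega>" "X n = cls \<psi>" using X(2) by blast
      have "AE x in lebesgue. rep (X n) x = \<psi> x" unfolding \<psi>(2) by (rule rep_cls[OF test_square_integrable[OF \<psi>(1)]])
      moreover have zero: "\<psi> x = 0" if "x \<notin> \<Omega>" for x
        using fun_cong[OF zext_test[OF \<psi>(1)], of x] that by (simp add: zext_def)
      ultimately show ?thesis by (auto elim: eventually_mono simp: zero)
    qed
    then have "AE x in lebesgue. \<forall>n. x \<notin> \<Omega> \<longrightarrow> rep (X n) x = 0" unfolding AE_all_countable by blast
    with r(2) have "AE x in lebesgue. zext \<Omega> (rep l) x = rep l x"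
    proof eventually_elim
      case (elim x)
      show ?case
      proof (cases "x \<in> \<Omega>")
        case False
        with elim have "(\<lambda>n. 0) \<longlonglongrightarrow> rep l x" by simp
        then show ?thesis using False by (simp add: zext_def LIMSEQ_const_iff)
      qed (simp add: zext_def)
    qed
    then have ae: "AE x in lebesgue. rep l x = zext \<Omega> (rep l) x" by eventually_elim simp
    then have "square_integrable (zext \<Omega> (rep l))" by (rule square_integrable_cong_AE[OF square_integrable_rep])
    with ae show ?thesis using cls_eq_iff[OF square_integrable_rep, of "zext \<Omega> (rep l)" l] by simp
  qed
  define u where "u = rep (fst h)"
  define g where "g x = (\<chi> j. rep (snd h $ j) x)" for x
  have fst_lim: "(\<lambda>n. cls (\<phi> n)) \<longlonglongrightarrow> fst h" using tendsto_fst[OF \<phi>(2)] by (simp add: emb_test \<phi>(1))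
  have snd_lim: "(\<lambda>n. cls (partial_deriv j (\<phi> n))) \<longlonglongrightarrow> snd h $ j" for j
    using tendsto_vec_nth[OF tendsto_snd[OF \<phi>(2)], of j] by (simp add: emb_test \<phi>(1))
  have cu: "cls (zext \<Omega> u) = fst h" unfolding u_def by (rule off[OF fst_lim]) (use \<phi>(1) in blast)
  have cg: "cls (zext \<Omega> (\<lambda>x. g x $ j)) = snd h $ j" for j
    unfolding g_def vec_lambda_beta by (rule off[OF snd_lim]) (use test_partial_deriv[OF \<phi>(1)] in blast)
  have sq: "square_integrable (zext \<Omega> (rep l))" for l :: "(real^'n) lsq"
  proof -
    have "integrable lebesgue (\<lambda>x. indicator \<Omega> x *\<^sub>R (rep l x)\<^sup>2)"
      using square_integrable_rep[of l] dom_sets by (intro integrable_mult_indicator) (auto simp: square_integrable_def)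
    moreover have "zext \<Omega> (rep l) \<in> borel_measurable lebesgue" unfolding zext_indicator using dom_sets by measurable
    ultimately show ?thesis unfolding square_integrable_def zext_power2 by (simp add: zext_indicator)
  qed
  have uL: "u \<in> L2 \<Omega>" using sq by (simp add: L2_zext u_def)
  have "is_weak_grad \<Omega> u g"
    unfolding weak_grad_iff[OF uL] cu cg
  proof (intro conjI allI ballI)
    fix j show "(\<lambda>x. g x $ j) \<in> L2 \<Omega>" using sq by (simp add: L2_zext g_def)
  next
    fix \<psi> j assume \<psi>: "\<psi> \<in> test_functions \<Omega>"
    have "(\<lambda>n. inner (cls (\<phi> n)) (cls (partial_deriv j \<psi>))) \<longlonglongrightarrow> inner (fst h) (cls (partial_deriv j \<psi>))"
      by (intro tendsto_intros fst_lim)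
    moreover have "inner (cls (\<phi> n)) (cls (partial_deriv j \<psi>)) = - inner (cls (partial_deriv j (\<phi> n))) (cls \<psi>)" for n
      using emb_weak_identity[OF emb_test(1)[OF \<phi>(1)[of n]] \<psi>, of j] by (simp add: emb_test \<phi>(1))
    moreover have "(\<lambda>n. - inner (cls (partial_deriv j (\<phi> n))) (cls \<psi>)) \<longlonglongrightarrow> - inner (snd h $ j) (cls \<psi>)"
      by (intro tendsto_intros snd_lim)
    ultimately show "inner (fst h) (cls (partial_deriv j \<psi>)) = - inner (snd h $ j) (cls \<psi>)"
      using LIMSEQ_unique by simp
  qed
  from emb_eq[OF uL this] have u: "u \<in> H1 \<Omega>" "emb u = h" by (simp_all add: cu cg prod_eq_iff vec_eq_iff)
  have "AE x in lebesgue. rep (fst h) x = zext \<Omega> u x"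
    using rep_cls[of "zext \<Omega> u"] sq cu by (simp add: u_def)
  then have "AE x in lebesgue. zext \<Omega> u x = rep (fst h) x" by eventually_elim simp
  with u h show ?thesis by (intro that[of u]) (auto simp: H10_emb)
qed

lemma rep_emb:
  assumes "u \<in> H1 \<Omega>" shows "AE x in lebesgue. rep (fst (emb u)) x = zext \<Omega> u x"
  using rep_cls[of "zext \<Omega> u"] H1_weak_grad(1)[OF assms] by (simp add: emb_def L2_zext)

text \<open>Fatou's lemma along an almost everywhere convergent subsequence carries the Sobolev
  bound from test functions to their closure.\<close>

lemma hspace_L4:
  assumes card: "CARD('n) \<in> {3, 4}"
  obtains C where "C \<ge> 0" "\<And>h. h \<in> hspace \<Longrightarrow> (\<integral>\<^sup>+x. ennreal (rep (fst h) x ^ 4) \<partial>lebesgue) \<le> ennreal (C * norm h ^ 4)"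
proof -
  obtain C where C: "C \<ge> 0" "\<forall>\<phi>\<in>test_functions \<Omega>. (\<integral>\<^sup>+x. ennreal (\<phi> x ^ 4) \<partial>lborel) \<le> ennreal C * (gradient_energy \<phi>)\<^sup>2"
    using sobolev_L4[OF card, of \<Omega>] by blast
  have "(\<integral>\<^sup>+x. ennreal (rep (fst h) x ^ 4) \<partial>lebesgue) \<le> ennreal (C * norm h ^ 4)" if h: "h \<in> hspace" for h
  proof -
    obtain \<phi> where \<phi>: "\<And>n. \<phi> n \<in> test_functions \<Omega>" "(\<lambda>n. emb (\<phi> n)) \<longlonglongrightarrow> h" by (rule hspace_approx[OF h]) blast
    have "(\<lambda>n. cls (\<phi> n)) \<longlonglongrightarrow> fst h" using tendsto_fst[OF \<phi>(2)] by (simp add: emb_test \<phi>(1))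
    then obtain r where r: "strict_mono r" "AE x in lebesgue. (\<lambda>n. rep (cls (\<phi> (r n))) x) \<longlonglongrightarrow> rep (fst h) x"
      by (rule lsq_tendsto_AE_subseq) blast
    have bound: "(\<integral>\<^sup>+x. ennreal (rep (cls (\<phi> n)) x ^ 4) \<partial>lebesgue) \<le> ennreal (C * norm (emb (\<phi> n)) ^ 4)" for n
    proof -
      have "(\<integral>\<^sup>+x. ennreal (rep (cls (\<phi> n)) x ^ 4) \<partial>lebesgue) = (\<integral>\<^sup>+x. ennreal (\<phi> n x ^ 4) \<partial>lebesgue)"
      proof (rule nn_integral_cong_AE)
        show "AE x in lebesgue. ennreal (rep (cls (\<phi> n)) x ^ 4) = ennreal (\<phi> n x ^ 4)"
          using rep_cls[OF test_square_integrable[OF \<phi>(1)[of n]]] by eventually_elim simp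
      qed
      also have "\<dots> \<le> ennreal C * (gradient_energy (\<phi> n))\<^sup>2"
        using C(2) \<phi>(1) by (simp add: nn_integral_completion)
      also have "\<dots> = ennreal (C * norm (emb (\<phi> n)) ^ 4)"
        using C(1) by (simp add: gradient_energy_emb[OF \<phi>(1)] ennreal_power ennreal_mult power_mult[symmetric])
      finally show ?thesis .
    qed
    have "(\<integral>\<^sup>+x. ennreal (rep (fst h) x ^ 4) \<partial>lebesgue) = (\<integral>\<^sup>+x. liminf (\<lambda>n. ennreal (rep (cls (\<phi> (r n))) x ^ 4)) \<partial>lebesgue)"
    proof (intro nn_integral_cong_AE)
      show "AE x in lebesgue. ennreal (rep (fst h) x ^ 4) = liminf (\<lambda>n. ennreal (rep (cls (\<phi> (r n))) x ^ 4))"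
        using r(2)
      proof eventually_elim
        case (elim x)
        then have "(\<lambda>n. ennreal (rep (cls (\<phi> (r n))) x ^ 4)) \<longlonglongrightarrow> ennreal (rep (fst h) x ^ 4)"
          by (intro tendsto_ennrealI tendsto_power)
        then show ?case by (intro lim_imp_Liminf[symmetric]) simp_all
      qed
    qed
    also have "\<dots> \<le> liminf (\<lambda>n. \<integral>\<^sup>+x. ennreal (rep (cls (\<phi> (r n))) x ^ 4) \<partial>lebesgue)"
      by (intro nn_integral_liminf) measurable
    also have "\<dots> \<le> liminf (\<lambda>n. ennreal (C * norm (emb (\<phi> (r n))) ^ 4))"
      by (intro Liminf_mono always_eventually allI bound)
    also have "\<dots> = ennreal (C * norm h ^ 4)"
    proof -
      have "(\<lambda>n. emb (\<phi> (r n))) \<longlonglongrightarrow> h" using LIMSEQ_subseq_LIMSEQ[OF \<phi>(2) r(1)] by (simp add: o_def)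
      then have "(\<lambda>n. ennreal (C * norm (emb (\<phi> (r n))) ^ 4)) \<longlonglongrightarrow> ennreal (C * norm h ^ 4)"
        by (intro tendsto_ennrealI tendsto_intros)
      then show ?thesis by (intro lim_imp_Liminf) simp_all
    qed
    finally show ?thesis .
  qed
  with C(1) show ?thesis by (rule that)
qed

text \<open>Each vector is replaced by a test function at distance below 1 / (k + 1). This keeps the
  limit, bounds the energy by \<open>(M + 1)\<^sup>2\<close>, and makes Rellich's theorem
  applicable.\<close>

lemma hspace_compact:
  assumes bdd: "bounded \<Omega>" and X: "\<And>k. X k \<in> hspace" "\<And>k. norm (X k) \<le> M"
  obtains r l where "strict_mono (r :: nat \<Rightarrow> nat)" "(\<lambda>k. fst (X (r k))) \<longlonglongrightarrow> l"
proof -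
  have "\<exists>\<phi>. \<phi> \<in> test_functions \<Omega> \<and> dist (emb \<phi>) (X k) < inverse (real (Suc k))" for k
    using X(1)[of k] unfolding hspace_def closure_approachable by (auto dest!: spec[of _ "inverse (real (Suc k))"])
  then obtain \<phi> where \<phi>: "\<And>k. \<phi> k \<in> test_functions \<Omega>" "\<And>k. dist (emb (\<phi> k)) (X k) < inverse (real (Suc k))" by metis
  have en: "gradient_energy (\<phi> k) \<le> ennreal ((M + 1)\<^sup>2)" for k
  proof -
    have "inverse (real (Suc k)) \<le> 1" by (simp add: inverse_le_1_iff)
    then have "norm (emb (\<phi> k)) \<le> M + 1"
      using norm_triangle_ineq[of "emb (\<phi> k) - X k" "X k"] \<phi>(2)[of k] X(2)[of k] by (simp add: dist_norm)
    then show ?thesis unfolding gradient_energy_emb[OF \<phi>(1)] by (intro ennreal_leI power_mono) auto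
  qed
  define S where "S = closure {cls \<phi> | \<phi>. \<phi> \<in> test_functions \<Omega> \<and> gradient_energy \<phi> \<le> ennreal ((M + 1)\<^sup>2)}"
  have "seq_compact S" using rellich[OF bdd] by (simp add: S_def compact_eq_seq_compact_metric)
  moreover have "cls (\<phi> k) \<in> S" for k unfolding S_def using \<phi>(1) en by (intro closure_subset[THEN subsetD]) blast
  ultimately obtain l r where r: "strict_mono (r :: nat \<Rightarrow> nat)" "((\<lambda>k. cls (\<phi> k)) \<circ> r) \<longlonglongrightarrow> l"
    by (rule_tac seq_compactE[of S "\<lambda>k. cls (\<phi> k)"]) auto
  have "(\<lambda>k. cls (\<phi> k) - fst (X k)) \<longlonglongrightarrow> 0"
  proof (rule Lim_null_comparison[OF _ LIMSEQ_inverse_real_of_nat], intro always_eventually allI)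
    fix k
    have "norm (fst (emb (\<phi> k) - X k)) \<le> norm (emb (\<phi> k) - X k)" by (metis norm_fst_le prod.collapse)
    then show "norm (cls (\<phi> k) - fst (X k)) \<le> inverse (real (Suc k))"
      using \<phi>(2)[of k] by (simp add: emb_test[OF \<phi>(1)] dist_norm)
  qed
  from LIMSEQ_subseq_LIMSEQ[OF this r(1)] r(2)
  have "(\<lambda>k. cls (\<phi> (r k)) - (cls (\<phi> (r k)) - fst (X (r k)))) \<longlonglongrightarrow> l - 0" by (intro tendsto_diff) (auto simp: o_def)
  then show ?thesis using r(1) by (intro that[of r l]) simp_all
qed

end

section \<open>The system as an operator equation\<close>

text \<open>Composition with the projection \<open>P\<close> onto \<open>H\<^sub>0\<^sup>1(\<Omega>)\<close> extends all operators to the ambient Hilbert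
  space, so that no type of Sobolev functions is needed.\<close>

locale dirichlet_setting =
  fixes \<Omega> :: "(real^'n::finite) set" and P :: "(real^'n) lsq \<times> ((real^'n) lsq^'n) \<Rightarrow> (real^'n) lsq \<times> ((real^'n) lsq^'n)"
  assumes \<Omega>: "open \<Omega>" and bdd: "bounded \<Omega>" and card: "CARD('n) \<in> {3, 4}"
    and P_lin: "bounded_linear P" and P_range: "P x \<in> hspace \<Omega>"
    and P_inner: "y \<in> hspace \<Omega> \<Longrightarrow> inner (P x) y = inner x y"
    and P_id: "x \<in> hspace \<Omega> \<Longrightarrow> P x = x"
begin

interpretation P: bounded_linear P by (rule P_lin)

lemmas hsub = hspace_subspace[OF \<Omega>]

lemma P_self_adjoint: "inner (P x) y = inner x (P y)"
  using P_inner[OF P_range, of y x] P_inner[OF P_range, of x y] by (simp add: inner_commute)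

lemma P_norm: "norm (P x) \<le> norm x"
proof -
  have "(norm (P x))\<^sup>2 = inner x (P x)" using P_inner[OF P_range, of x x] by (simp add: power2_norm_eq_inner)
  also have "\<dots> \<le> norm x * norm (P x)" by (rule norm_cauchy_schwarz)
  finally show ?thesis by (cases "norm (P x) = 0") (auto simp: power2_eq_square)
qed

lemma hspace_eqI:
  assumes "x \<in> hspace \<Omega>" "y \<in> hspace \<Omega>" "\<And>z. z \<in> hspace \<Omega> \<Longrightarrow> inner x z = inner y z"
  shows "x = y"
proof -
  have "x - y \<in> hspace \<Omega>" using assms hsub by (simp add: subspace_diff)
  then have "inner (x - y) (x - y) = 0" using assms(3) by (simp add: inner_diff_left)
  then show ?thesis by simp
qed

section \<open>The operator representing the L^2 product\<close>

text \<open>Riesz representative of the L^2 product. The inner projection gives a symmetric operator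
  on the ambient space, the outer one puts the range into \<open>hspace\<close>.\<close>

definition K where "K x = P (fst (P x), 0)"

lemma K_inner: "inner (K x) y = inner (fst (P x)) (fst (P y))"
proof -
  have "inner (K x) y = inner (fst (P x), 0) (P y)" unfolding K_def by (rule P_self_adjoint)
  then show ?thesis by (simp add: inner_prod_def)
qed

lemma K_range: "K x \<in> hspace \<Omega>" by (simp add: K_def P_range)

lemma K_lin: "bounded_linear K"
proof -
  have "bounded_linear (\<lambda>x. P (fst (P x), 0))"
    by (intro bounded_linear_compose[OF P_lin] bounded_linear_Pair bounded_linear_compose[OF bounded_linear_fst P_lin] bounded_linear_zero)
  then show ?thesis by (simp add: K_def[abs_def])
qed

lemma K_sym: "inner (K x) y = inner x (K y)"
proof -
  have "inner x (K y) = inner (fst (P y)) (fst (P x))" using K_inner[of y x] by (simp only: inner_commute)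
  then show ?thesis using K_inner[of x y] by (simp only: inner_commute)
qed

text \<open>\<open>K\<close> sees the first component of \<open>P x\<close> alone, and this
  converges in L^2 along a subsequence by Rellich's theorem.\<close>

lemma K_compact: "compact_operator K"
  unfolding compact_operator_def
proof (intro allI impI)
  fix X :: "nat \<Rightarrow> (real^'n) lsq \<times> ((real^'n) lsq^'n)" assume "bounded (range X)"
  then obtain M where M: "\<And>k. norm (X k) \<le> M" by (auto simp: bounded_iff)
  have "norm (P (X k)) \<le> M" for k using P_norm[of "X k"] M[of k] by linarith
  then obtain r l where r: "strict_mono (r :: nat \<Rightarrow> nat)" "(\<lambda>k. fst (P (X (r k)))) \<longlonglongrightarrow> l"
    using hspace_compact[OF \<Omega> bdd, of "\<lambda>k. P (X k)" M] P_range by blast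
  have "(\<lambda>k. K (X (r k))) \<longlonglongrightarrow> P (l, 0)"
    unfolding K_def by (intro P.tendsto tendsto_Pair r(2) tendsto_const)
  with r(1) show "\<exists>r l. strict_mono r \<and> (\<lambda>k. K (X (r k))) \<longlonglongrightarrow> l" by blast
qed

lemma K_emb:
  assumes "u \<in> H10 \<Omega>" "v \<in> H10 \<Omega>"
  shows "inner (K (emb \<Omega> u)) (emb \<Omega> v) = integral\<^sup>L (lebesgue_on \<Omega>) (\<lambda>x. u x * v x)"
  using assms by (simp add: K_inner P_id H10_emb[OF \<Omega>] inner_emb[OF \<Omega>])

text \<open>The ambient inner product already contains one L^2 term; removing it produces the
  \<open>- 1\<close>.\<close>

lemma dirichlet_form:
  assumes "u \<in> H10 \<Omega>" "v \<in> H10 \<Omega>"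
  shows "integral\<^sup>L (lebesgue_on \<Omega>) (\<lambda>x. weak_grad \<Omega> u x \<bullet> weak_grad \<Omega> v x) + c * integral\<^sup>L (lebesgue_on \<Omega>) (\<lambda>x. u x * v x)
    = inner (emb \<Omega> u + (c - 1) *\<^sub>R K (emb \<Omega> u)) (emb \<Omega> v)"
  using assms K_emb[OF assms] inner_emb[OF \<Omega>, of u v]
  by (simp add: inner_add_left H10_emb[OF \<Omega>] inner_prod_def[of "emb \<Omega> u"] algebra_simps)

text \<open>Both sides of the operator equation lie in \<open>hspace\<close>, which consists of the
  images of \<open>H10\<close>; testing with all of \<open>H10\<close> is therefore equality of
  vectors.\<close>

lemma weak_solution_iff:
  assumes u: "u \<in> H10 \<Omega>" and y: "y \<in> hspace \<Omega>"
    and int: "\<And>\<phi>. \<phi> \<in> H10 \<Omega> \<Longrightarrow> integrable (lebesgue_on \<Omega>) (\<lambda>x. f x * \<phi> x)"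
    and rep: "\<And>\<phi>. \<phi> \<in> H10 \<Omega> \<Longrightarrow> integral\<^sup>L (lebesgue_on \<Omega>) (\<lambda>x. f x * \<phi> x) = inner y (emb \<Omega> \<phi>)"
  shows "weak_solution \<Omega> c f u \<longleftrightarrow> emb \<Omega> u + (c - 1) *\<^sub>R K (emb \<Omega> u) = y"
proof
  have uh: "emb \<Omega> u \<in> hspace \<Omega>" using u by (simp add: H10_emb[OF \<Omega>])
  have x: "emb \<Omega> u + (c - 1) *\<^sub>R K (emb \<Omega> u) \<in> hspace \<Omega>"
    using uh K_range hsub by (simp add: subspace_add subspace_scale)
  assume sol: "weak_solution \<Omega> c f u"
  show "emb \<Omega> u + (c - 1) *\<^sub>R K (emb \<Omega> u) = y"
  proof (rule hspace_eqI[OF x y])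
    fix z assume "z \<in> hspace \<Omega>"
    then obtain \<phi> where \<phi>: "\<phi> \<in> H10 \<Omega>" "emb \<Omega> \<phi> = z" by (rule hspace_represent[OF \<Omega>]) blast
    then show "inner (emb \<Omega> u + (c - 1) *\<^sub>R K (emb \<Omega> u)) z = inner y z"
      using sol dirichlet_form[OF u \<phi>(1), of c] rep[OF \<phi>(1)] unfolding weak_solution_def by auto
  qed
next
  assume "emb \<Omega> u + (c - 1) *\<^sub>R K (emb \<Omega> u) = y"
  then show "weak_solution \<Omega> c f u"
    unfolding weak_solution_def using u int rep dirichlet_form[OF u, of _ c] by simp
qed

text \<open>A solution of the operator equation lies in the range of \<open>K\<close>, hence in
  \<open>hspace\<close>, so vectors of the ambient space may be allowed. For \<open>l = -1\<close>
  the equation forces \<open>x = 0\<close>.\<close>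

lemma dirichlet_eigenvalue_iff:
  "dirichlet_eigenvalue \<Omega> l \<longleftrightarrow> (\<exists>x. x \<noteq> 0 \<and> x = (l + 1) *\<^sub>R K x)"
proof -
  have sol: "weak_solution \<Omega> 0 (\<lambda>x. l * u x) u \<longleftrightarrow> emb \<Omega> u = (l + 1) *\<^sub>R K (emb \<Omega> u)" if u: "u \<in> H10 \<Omega>" for u
  proof -
    have "weak_solution \<Omega> 0 (\<lambda>x. l * u x) u \<longleftrightarrow> emb \<Omega> u + (0 - 1) *\<^sub>R K (emb \<Omega> u) = l *\<^sub>R K (emb \<Omega> u)"
    proof (rule weak_solution_iff[OF u])
      show "l *\<^sub>R K (emb \<Omega> u) \<in> hspace \<Omega>" using K_range hsub by (simp add: subspace_scale)
      fix \<phi> assume \<phi>: "\<phi> \<in> H10 \<Omega>"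
      have "u \<in> L2 \<Omega>" "\<phi> \<in> L2 \<Omega>" using u \<phi> by (auto simp: H10_def H1_def)
      then have "integrable (lebesgue_on \<Omega>) (\<lambda>x. u x * \<phi> x)" by (rule integrable_prod_zext[OF \<Omega>])
      then show "integrable (lebesgue_on \<Omega>) (\<lambda>x. l * u x * \<phi> x)" by (simp add: mult.assoc)
      show "integral\<^sup>L (lebesgue_on \<Omega>) (\<lambda>x. l * u x * \<phi> x) = inner (l *\<^sub>R K (emb \<Omega> u)) (emb \<Omega> \<phi>)"
        by (simp add: mult.assoc K_emb[OF u \<phi>])
    qed
    also have "\<dots> \<longleftrightarrow> emb \<Omega> u = (l + 1) *\<^sub>R K (emb \<Omega> u)" by (auto simp: algebra_simps)
    finally show ?thesis .
  qed
  show ?thesis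
  proof
    assume "dirichlet_eigenvalue \<Omega> l"
    then obtain u where u: "\<not> vanishes \<Omega> u" "weak_solution \<Omega> 0 (\<lambda>x. l * u x) u" unfolding dirichlet_eigenvalue_def by blast
    then have "u \<in> H10 \<Omega>" by (simp add: weak_solution_def)
    with u sol show "\<exists>x. x \<noteq> 0 \<and> x = (l + 1) *\<^sub>R K x"
      using vanishes_emb[OF \<Omega>, of u] by (intro exI[of _ "emb \<Omega> u"]) (auto simp: H10_emb[OF \<Omega>])
  next
    assume "\<exists>x. x \<noteq> 0 \<and> x = (l + 1) *\<^sub>R K x"
    then obtain x where x: "x \<noteq> 0" "x = (l + 1) *\<^sub>R K x" by blast
    then have "x \<in> hspace \<Omega>" using K_range hsub by (metis subspace_scale)
    then obtain u where u: "u \<in> H10 \<Omega>" "emb \<Omega> u = x" by (rule hspace_represent[OF \<Omega>]) blast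
    then have "\<not> vanishes \<Omega> u" using vanishes_emb[OF \<Omega>, of u] x(1) by (auto simp: H10_emb[OF \<Omega>])
    moreover have "weak_solution \<Omega> 0 (\<lambda>x. l * u x) u" using sol[OF u(1)] u(2) x(2) by simp
    ultimately show "dirichlet_eigenvalue \<Omega> l" unfolding dirichlet_eigenvalue_def by blast
  qed
qed

section \<open>The quartic form of the cubic terms\<close>

definition q4 :: "(real^'n) lsq \<times> ((real^'n) lsq^'n) \<Rightarrow> (real^'n) lsq \<times> ((real^'n) lsq^'n) \<Rightarrow> (real^'n) lsq \<times> ((real^'n) lsq^'n) \<Rightarrow> (real^'n) lsq \<times> ((real^'n) lsq^'n) \<Rightarrow> real" where
  "q4 a b c d = integral\<^sup>L lebesgue (\<lambda>x. rep (fst a) x * rep (fst b) x * rep (fst c) x * rep (fst d) x)"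

text \<open>Two rounds of 2 x y \<le> x^2 + y^2; the factor 1/4 is given away.\<close>

lemma product4_le: "\<bar>a * b * c * d\<bar> \<le> a ^ 4 + b ^ 4 + c ^ 4 + d ^ 4" for a b c d :: real
proof -
  have y: "\<bar>x * y\<bar> \<le> (x\<^sup>2 + y\<^sup>2) / 2" for x y :: real
    using sum_squares_bound[of "\<bar>x\<bar>" "\<bar>y\<bar>"] by (simp add: abs_mult)
  have "\<bar>a * b * c * d\<bar> = \<bar>(a * b) * (c * d)\<bar>" by (simp add: mult.assoc)
  also have "\<dots> \<le> ((a * b)\<^sup>2 + (c * d)\<^sup>2) / 2" by (rule y)
  also have "\<dots> = (a\<^sup>2 * b\<^sup>2 + c\<^sup>2 * d\<^sup>2) / 2" by (simp add: power_mult_distrib)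
  also have "\<dots> \<le> (((a\<^sup>2)\<^sup>2 + (b\<^sup>2)\<^sup>2) / 2 + ((c\<^sup>2)\<^sup>2 + (d\<^sup>2)\<^sup>2) / 2) / 2"
    using y[of "a\<^sup>2" "b\<^sup>2"] y[of "c\<^sup>2" "d\<^sup>2"] by (intro divide_right_mono add_mono) auto
  also have "\<dots> = (a ^ 4 + b ^ 4 + c ^ 4 + d ^ 4) / 4" by (simp add: power_mult[symmetric] field_simps)
  also have "\<dots> \<le> a ^ 4 + b ^ 4 + c ^ 4 + d ^ 4"
    using zero_le_even_power'[of a 2] zero_le_even_power'[of b 2] zero_le_even_power'[of c 2] zero_le_even_power'[of d 2] by simp
  finally show ?thesis .
qed

lemma hspace_L4_integral:
  obtains C where "C \<ge> 0" "\<And>h. h \<in> hspace \<Omega> \<Longrightarrow> integrable lebesgue (\<lambda>x. rep (fst h) x ^ 4)"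
    "\<And>h. h \<in> hspace \<Omega> \<Longrightarrow> integral\<^sup>L lebesgue (\<lambda>x. rep (fst h) x ^ 4) \<le> C * norm h ^ 4"
proof -
  obtain C where C: "C \<ge> 0" "\<And>h. h \<in> hspace \<Omega> \<Longrightarrow> (\<integral>\<^sup>+x. ennreal (rep (fst h) x ^ 4) \<partial>lebesgue) \<le> ennreal (C * norm h ^ 4)"
    by (rule hspace_L4[OF \<Omega> card]) blast
  have int: "integrable lebesgue (\<lambda>x. rep (fst h) x ^ 4)" if "h \<in> hspace \<Omega>" for h
  proof (rule integrableI_nonneg)
    show "(\<integral>\<^sup>+x. ennreal (rep (fst h) x ^ 4) \<partial>lebesgue) < \<infinity>"
      using C(2)[OF that] by (rule order_le_less_trans) simp
  qed auto
  have "integral\<^sup>L lebesgue (\<lambda>x. rep (fst h) x ^ 4) \<le> C * norm h ^ 4" if "h \<in> hspace \<Omega>" for h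
  proof -
    have "ennreal (integral\<^sup>L lebesgue (\<lambda>x. rep (fst h) x ^ 4)) \<le> ennreal (C * norm h ^ 4)"
      using C(2)[OF that] nn_integral_eq_integral[OF int[OF that]] by simp
    then show ?thesis using C(1) by (subst (asm) ennreal_le_iff) auto
  qed
  with C(1) int show ?thesis by (rule that)
qed

lemma q4_integrable:
  assumes "a \<in> hspace \<Omega>" "b \<in> hspace \<Omega>" "c \<in> hspace \<Omega>" "d \<in> hspace \<Omega>"
  shows "integrable lebesgue (\<lambda>x. rep (fst a) x * rep (fst b) x * rep (fst c) x * rep (fst d) x)"
proof -
  obtain C where C: "\<And>h. h \<in> hspace \<Omega> \<Longrightarrow> integrable lebesgue (\<lambda>x. rep (fst h) x ^ 4)"
    by (rule hspace_L4_integral) blast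
  show ?thesis
  proof (rule Bochner_Integration.integrable_bound)
    show "integrable lebesgue (\<lambda>x. rep (fst a) x ^ 4 + rep (fst b) x ^ 4 + rep (fst c) x ^ 4 + rep (fst d) x ^ 4)"
      using C assms by simp
    show "AE x in lebesgue. norm (rep (fst a) x * rep (fst b) x * rep (fst c) x * rep (fst d) x)
        \<le> norm (rep (fst a) x ^ 4 + rep (fst b) x ^ 4 + rep (fst c) x ^ 4 + rep (fst d) x ^ 4)"
      using product4_le by (intro AE_I2) (simp add: order_trans[OF _ abs_ge_self])
  qed simp
qed

lemma q4_sym: "q4 a b c d = q4 b a c d" "q4 a b c d = q4 a c b d" "q4 a b c d = q4 a b d c"
  unfolding q4_def by (intro Bochner_Integration.integral_cong; simp)+

lemma q4_rot: "q4 a b c d = q4 b c d a"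
  unfolding q4_def by (intro Bochner_Integration.integral_cong; simp)

lemma q4_add:
  assumes "a \<in> hspace \<Omega>" "b \<in> hspace \<Omega>" "c \<in> hspace \<Omega>" "d \<in> hspace \<Omega>" "d' \<in> hspace \<Omega>"
  shows "q4 a b c (d + d') = q4 a b c d + q4 a b c d'"
proof -
  have "q4 a b c (d + d') = integral\<^sup>L lebesgue (\<lambda>x. rep (fst a) x * rep (fst b) x * rep (fst c) x * rep (fst d) x
      + rep (fst a) x * rep (fst b) x * rep (fst c) x * rep (fst d') x)"
    unfolding q4_def
  proof (rule integral_cong_AE)
    show "AE x in lebesgue. rep (fst a) x * rep (fst b) x * rep (fst c) x * rep (fst (d + d')) x
      = rep (fst a) x * rep (fst b) x * rep (fst c) x * rep (fst d) x + rep (fst a) x * rep (fst b) x * rep (fst c) x * rep (fst d') x"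
      using rep_add[of "fst d" "fst d'"] by eventually_elim (simp add: distrib_left)
  qed measurable
  also have "\<dots> = q4 a b c d + q4 a b c d'"
    unfolding q4_def by (intro Bochner_Integration.integral_add q4_integrable assms)
  finally show ?thesis .
qed

lemma q4_scale: "q4 a b c (r *\<^sub>R d) = r * q4 a b c d"
proof -
  have "q4 a b c (r *\<^sub>R d) = integral\<^sup>L lebesgue (\<lambda>x. r * (rep (fst a) x * rep (fst b) x * rep (fst c) x * rep (fst d) x))"
    unfolding q4_def
  proof (rule integral_cong_AE)
    show "AE x in lebesgue. rep (fst a) x * rep (fst b) x * rep (fst c) x * rep (fst (r *\<^sub>R d)) x
      = r * (rep (fst a) x * rep (fst b) x * rep (fst c) x * rep (fst d) x)"
      using rep_scale[of r "fst d"] by eventually_elim simp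
  qed measurable
  then show ?thesis by (simp add: q4_def)
qed

lemma q4_scale':
  "q4 (r *\<^sub>R a) b c d = r * q4 a b c d" "q4 a (r *\<^sub>R b) c d = r * q4 a b c d" "q4 a b (r *\<^sub>R c) d = r * q4 a b c d"
proof -
  have s1: "q4 (r *\<^sub>R a) b c d = r * q4 a b c d" for a b c d
    unfolding q4_rot[of _ b c d] by (rule q4_scale)
  have s2: "q4 a (r *\<^sub>R b) c d = r * q4 a b c d" for a b c d
    unfolding q4_rot[of a _ c d] by (rule s1)
  show "q4 (r *\<^sub>R a) b c d = r * q4 a b c d" "q4 a (r *\<^sub>R b) c d = r * q4 a b c d" by (rule s1 s2)+
  show "q4 a b (r *\<^sub>R c) d = r * q4 a b c d" unfolding q4_rot[of a b _ d] by (rule s2)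
qed

text \<open>For unit vectors the bound by a sum of fourth powers gives \<open>4 * C\<close>;
  homogeneity in each argument turns this into a product of norms and takes the place of a four-fold
  Hoelder inequality.\<close>

lemma q4_bound:
  obtains C where "C \<ge> 0" "\<And>a b c d. a \<in> hspace \<Omega> \<Longrightarrow> b \<in> hspace \<Omega> \<Longrightarrow> c \<in> hspace \<Omega> \<Longrightarrow> d \<in> hspace \<Omega> \<Longrightarrow>
    \<bar>q4 a b c d\<bar> \<le> C * norm a * norm b * norm c * norm d"
proof -
  obtain C where C: "C \<ge> 0" "\<And>h. h \<in> hspace \<Omega> \<Longrightarrow> integrable lebesgue (\<lambda>x. rep (fst h) x ^ 4)"
    "\<And>h. h \<in> hspace \<Omega> \<Longrightarrow> integral\<^sup>L lebesgue (\<lambda>x. rep (fst h) x ^ 4) \<le> C * norm h ^ 4"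
    by (rule hspace_L4_integral) blast
  have unit: "\<bar>q4 a b c d\<bar> \<le> 4 * C"
    if h: "a \<in> hspace \<Omega>" "b \<in> hspace \<Omega>" "c \<in> hspace \<Omega>" "d \<in> hspace \<Omega>" and n: "norm a = 1" "norm b = 1" "norm c = 1" "norm d = 1" for a b c d
  proof -
    have "\<bar>q4 a b c d\<bar> \<le> integral\<^sup>L lebesgue (\<lambda>x. \<bar>rep (fst a) x * rep (fst b) x * rep (fst c) x * rep (fst d) x\<bar>)"
      unfolding q4_def by (rule integral_abs_bound)
    also have "\<dots> \<le> integral\<^sup>L lebesgue (\<lambda>x. rep (fst a) x ^ 4 + rep (fst b) x ^ 4 + rep (fst c) x ^ 4 + rep (fst d) x ^ 4)"
      using q4_integrable[OF h] C(2) h by (intro integral_mono product4_le integrable_abs) auto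
    also have "\<dots> = integral\<^sup>L lebesgue (\<lambda>x. rep (fst a) x ^ 4) + integral\<^sup>L lebesgue (\<lambda>x. rep (fst b) x ^ 4)
        + integral\<^sup>L lebesgue (\<lambda>x. rep (fst c) x ^ 4) + integral\<^sup>L lebesgue (\<lambda>x. rep (fst d) x ^ 4)"
      using C(2) h by simp
    also have "\<dots> \<le> C + C + C + C" using C(3)[OF h(1)] C(3)[OF h(2)] C(3)[OF h(3)] C(3)[OF h(4)] n by (intro add_mono) auto
    finally show ?thesis by simp
  qed
  have "\<bar>q4 a b c d\<bar> \<le> (4 * C) * norm a * norm b * norm c * norm d"
    if h: "a \<in> hspace \<Omega>" "b \<in> hspace \<Omega>" "c \<in> hspace \<Omega>" "d \<in> hspace \<Omega>" for a b c d
  proof -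
    have s: "q4 (r\<^sub>1 *\<^sub>R a') (r\<^sub>2 *\<^sub>R b') (r\<^sub>3 *\<^sub>R c') (r\<^sub>4 *\<^sub>R d') = r\<^sub>1 * r\<^sub>2 * r\<^sub>3 * r\<^sub>4 * q4 a' b' c' d'" for r\<^sub>1 r\<^sub>2 r\<^sub>3 r\<^sub>4 a' b' c' d'
      by (simp add: q4_scale q4_scale')
    have unit_vec: "\<exists>h'. h' \<in> hspace \<Omega> \<and> norm h' = 1 \<and> h = norm h *\<^sub>R h'" if "h \<in> hspace \<Omega>" "h \<noteq> 0" for h
      using that hsub by (intro exI[of _ "(1 / norm h) *\<^sub>R h"]) (auto intro: subspace_scale)
    have zero: "q4 0 b c d = 0" "q4 a 0 c d = 0" "q4 a b 0 d = 0" "q4 a b c 0 = 0"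
      using q4_scale'(1)[of 0 0 b c d] q4_scale'(2)[of a 0 0 c d] q4_scale'(3)[of a b 0 0 d] q4_scale[of a b c 0 0] by simp_all
    show ?thesis
    proof (cases "a = 0 \<or> b = 0 \<or> c = 0 \<or> d = 0")
      case True
      then show ?thesis using zero by auto
    next
      case False
      obtain a' where a': "a' \<in> hspace \<Omega>" "norm a' = 1" "a = norm a *\<^sub>R a'" using unit_vec[OF h(1)] False by blast
      obtain b' where b': "b' \<in> hspace \<Omega>" "norm b' = 1" "b = norm b *\<^sub>R b'" using unit_vec[OF h(2)] False by blast
      obtain c' where c': "c' \<in> hspace \<Omega>" "norm c' = 1" "c = norm c *\<^sub>R c'" using unit_vec[OF h(3)] False by blast
      obtain d' where d': "d' \<in> hspace \<Omega>" "norm d' = 1" "d = norm d *\<^sub>R d'" using unit_vec[OF h(4)] False by blast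
      have "q4 a b c d = norm a * norm b * norm c * norm d * q4 a' b' c' d'"
        using s[of "norm a" a' "norm b" b' "norm c" c' "norm d" d'] a'(3) b'(3) c'(3) d'(3) by simp
      then have "\<bar>q4 a b c d\<bar> = norm a * norm b * norm c * norm d * \<bar>q4 a' b' c' d'\<bar>" by (simp add: abs_mult)
      also have "\<dots> \<le> norm a * norm b * norm c * norm d * (4 * C)"
        using unit[OF a'(1) b'(1) c'(1) d'(1) a'(2) b'(2) c'(2) d'(2)] by (intro mult_left_mono) auto
      finally show ?thesis by (simp add: mult_ac)
    qed
  qed
  with C(1) show ?thesis by (intro that[of "4 * C"]) auto
qed

text \<open>With three arguments fixed, the form is a bounded functional of the fourth, represented
  by Riesz. Projecting all arguments extends it to the ambient space. \<open>B\<close> and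
  \<open>C\<close> are the same for all \<gamma>.\<close>

lemma trilinear_map:
  obtains B C where "\<And>\<gamma> :: real^'m::finite^'m. (\<And>i k. \<gamma> $ i $ k = \<gamma> $ k $ i) \<Longrightarrow> quartic_form B C \<gamma>"
    "\<And>a b c. B a b c \<in> hspace \<Omega>"
    "\<And>a b c d. a \<in> hspace \<Omega> \<Longrightarrow> b \<in> hspace \<Omega> \<Longrightarrow> c \<in> hspace \<Omega> \<Longrightarrow> d \<in> hspace \<Omega> \<Longrightarrow> inner (B a b c) d = q4 a b c d"
proof -
  obtain C where C: "C \<ge> 0" "\<And>a b c d. a \<in> hspace \<Omega> \<Longrightarrow> b \<in> hspace \<Omega> \<Longrightarrow> c \<in> hspace \<Omega> \<Longrightarrow> d \<in> hspace \<Omega> \<Longrightarrow>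
    \<bar>q4 a b c d\<bar> \<le> C * norm a * norm b * norm c * norm d" by (rule q4_bound) blast
  have Q_bound: "\<bar>q4 (P a) (P b) (P c) (P d)\<bar> \<le> C * norm a * norm b * norm c * norm d" for a b c d
  proof -
    have "\<bar>q4 (P a) (P b) (P c) (P d)\<bar> \<le> C * norm (P a) * norm (P b) * norm (P c) * norm (P d)" by (intro C P_range)
    also have "\<dots> \<le> C * norm a * norm b * norm c * norm d" using C(1) by (intro mult_mono P_norm mult_nonneg_nonneg) auto
    finally show ?thesis .
  qed
  have "\<exists>z. z \<in> hspace \<Omega> \<and> (\<forall>d. inner z d = q4 (P a) (P b) (P c) (P d))" for a b c
  proof -
    have "bounded_linear (\<lambda>d. q4 (P a) (P b) (P c) (P d))"
    proof (rule bounded_linear_intro)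
      show "q4 (P a) (P b) (P c) (P (x + y)) = q4 (P a) (P b) (P c) (P x) + q4 (P a) (P b) (P c) (P y)" for x y
        by (simp add: P.add q4_add P_range)
      show "q4 (P a) (P b) (P c) (P (r *\<^sub>R x)) = r *\<^sub>R q4 (P a) (P b) (P c) (P x)" for r x
        by (simp add: P.scaleR q4_scale)
      show "norm (q4 (P a) (P b) (P c) (P x)) \<le> norm x * (C * norm a * norm b * norm c)" for x
        using Q_bound[of a b c x] by (simp add: mult_ac)
    qed
    then obtain z where z: "z \<in> hspace \<Omega>" "\<And>y. y \<in> hspace \<Omega> \<Longrightarrow> q4 (P a) (P b) (P c) (P y) = inner z y"
      by (rule riesz_subspace[OF hsub hspace_closed[OF \<Omega>]]) blast
    have "inner z d = q4 (P a) (P b) (P c) (P d)" for d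
      using z(2)[OF P_range[of d]] P_self_adjoint[of z d] P_id[OF z(1)] P_id[OF P_range[of d]] by simp
    with z(1) show ?thesis by blast
  qed
  then obtain B where B: "\<And>a b c. B a b c \<in> hspace \<Omega>" "\<And>a b c d. inner (B a b c) d = q4 (P a) (P b) (P c) (P d)" by metis
  have B_eqI: "x = y" if "\<And>d. inner x d = inner y d" for x y :: "(real^'n) lsq \<times> ((real^'n) lsq^'n)"
    using that vector_eq_rdot by blast
  have add1: "q4 (P (a + a')) (P b) (P c) (P d) = q4 (P a) (P b) (P c) (P d) + q4 (P a') (P b) (P c) (P d)" for a a' b c d
    unfolding q4_rot[of _ "P b" "P c" "P d"] P.add by (intro q4_add P_range)
  have scale1: "q4 (P (r *\<^sub>R a)) (P b) (P c) (P d) = r * q4 (P a) (P b) (P c) (P d)" for r a b c d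
    unfolding P.scaleR by (rule q4_scale')
  have "quartic_form B C \<gamma>" if \<gamma>: "\<And>i k. \<gamma> $ i $ k = \<gamma> $ k $ i" for \<gamma> :: "real^'m^'m"
  proof
    show "B (a + a') b c = B a b c + B a' b c" for a a' b c
      by (rule B_eqI) (simp add: B(2) add1 inner_add_left)
    show "B (r *\<^sub>R a) b c = r *\<^sub>R B a b c" for r a b c
      by (rule B_eqI) (simp add: B(2) scale1)
    show "B a b c = B b a c" for a b c
      by (rule B_eqI) (simp only: B(2) q4_sym(1)[of "P a"])
    show "B a b c = B a c b" for a b c
      by (rule B_eqI) (simp only: B(2) q4_sym(2)[of "P a" "P b"])
    show "inner (B a b c) d = inner (B a b d) c" for a b c d
      by (simp only: B(2) q4_sym(3)[of "P a" "P b" "P c"])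
    show "norm (B a b c) \<le> C * norm a * norm b * norm c" for a b c
    proof -
      have "norm (B a b c) * norm (B a b c) = q4 (P a) (P b) (P c) (P (B a b c))"
        unfolding B(2)[symmetric] by (simp add: power2_norm_eq_inner[symmetric] power2_eq_square)
      also have "\<dots> \<le> (C * norm a * norm b * norm c) * norm (B a b c)"
        using Q_bound[of a b c "B a b c"] by linarith
      finally have *: "norm (B a b c) * norm (B a b c) \<le> (C * norm a * norm b * norm c) * norm (B a b c)" .
      have "0 \<le> C * norm a * norm b * norm c" using C(1) by (intro mult_nonneg_nonneg norm_ge_zero)
      with * show ?thesis
        by (cases "B a b c = 0") (simp, rule mult_right_le_imp_le[of _ "norm (B a b c)"], simp_all)
    qed
    show "\<gamma> $ i $ k = \<gamma> $ k $ i" for i k by (rule \<gamma>)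
  qed
  moreover have "inner (B a b c) d = q4 a b c d" if "a \<in> hspace \<Omega>" "b \<in> hspace \<Omega>" "c \<in> hspace \<Omega>" "d \<in> hspace \<Omega>" for a b c d
    using that by (simp add: B(2) P_id)
  ultimately show ?thesis using B(1) by (intro that[of B C]) auto
qed

text \<open>Representatives of embedded functions agree almost everywhere with zero extensions, so
  integrals over the domain become integrals over the space.\<close>

lemma q4_emb:
  assumes "a \<in> H10 \<Omega>" "b \<in> H10 \<Omega>" "c \<in> H10 \<Omega>" "d \<in> H10 \<Omega>"
  shows "integrable (lebesgue_on \<Omega>) (\<lambda>x. a x * b x * c x * d x)"
    "integral\<^sup>L (lebesgue_on \<Omega>) (\<lambda>x. a x * b x * c x * d x) = q4 (emb \<Omega> a) (emb \<Omega> b) (emb \<Omega> c) (emb \<Omega> d)"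
proof -
  have h: "emb \<Omega> a \<in> hspace \<Omega>" "emb \<Omega> b \<in> hspace \<Omega>" "emb \<Omega> c \<in> hspace \<Omega>" "emb \<Omega> d \<in> hspace \<Omega>"
    and h1: "a \<in> H1 \<Omega>" "b \<in> H1 \<Omega>" "c \<in> H1 \<Omega>" "d \<in> H1 \<Omega>"
    using assms by (auto simp: H10_emb[OF \<Omega>])
  have m: "zext \<Omega> u \<in> borel_measurable lebesgue" if "u \<in> H1 \<Omega>" for u
    using H1_weak_grad(1)[OF \<Omega> that] by (simp add: L2_zext[OF \<Omega>] square_integrable_measurable)
  have ae: "AE x in lebesgue. rep (fst (emb \<Omega> a)) x * rep (fst (emb \<Omega> b)) x * rep (fst (emb \<Omega> c)) x * rep (fst (emb \<Omega> d)) x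
      = zext \<Omega> (\<lambda>x. a x * b x * c x * d x) x"
    using rep_emb[OF \<Omega> h1(1)] rep_emb[OF \<Omega> h1(2)] rep_emb[OF \<Omega> h1(3)] rep_emb[OF \<Omega> h1(4)]
    by eventually_elim (simp add: zext_def)
  have meas: "zext \<Omega> (\<lambda>x. a x * b x * c x * d x) \<in> borel_measurable lebesgue"
    unfolding zext_simps using m[OF h1(1)] m[OF h1(2)] m[OF h1(3)] m[OF h1(4)] by (intro borel_measurable_times)
  have "integrable lebesgue (zext \<Omega> (\<lambda>x. a x * b x * c x * d x))"
    using q4_integrable[OF h] ae meas by (subst integrable_cong_AE[symmetric, OF _ _ ae]) auto
  then show "integrable (lebesgue_on \<Omega>) (\<lambda>x. a x * b x * c x * d x)" by (simp add: integrable_zext[OF \<Omega>])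
  show "integral\<^sup>L (lebesgue_on \<Omega>) (\<lambda>x. a x * b x * c x * d x) = q4 (emb \<Omega> a) (emb \<Omega> b) (emb \<Omega> c) (emb \<Omega> d)"
    unfolding integral_zext[OF \<Omega>] q4_def using ae meas by (intro integral_cong_AE[symmetric]) auto
qed

end

section \<open>Solutions of the system and bifurcation sequences\<close>

locale cubic_system = dirichlet_setting \<Omega> P + quartic_form B C \<gamma>
  for \<Omega> :: "(real^'n::finite) set" and P and B :: "(real^'n) lsq \<times> ((real^'n) lsq^'n) \<Rightarrow> _ \<Rightarrow> _ \<Rightarrow> _" and C
    and \<gamma> :: "real^'m::finite^'m" +
  fixes \<mu> :: "real^'m" and \<beta> :: "real^'m^'m"
  assumes \<gamma>: "\<gamma> $ i $ k = (if i = k then \<mu> $ i else \<beta> $ i $ k)"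
    and B_range: "B a b c \<in> hspace \<Omega>"
    and B_q4: "a \<in> hspace \<Omega> \<Longrightarrow> b \<in> hspace \<Omega> \<Longrightarrow> c \<in> hspace \<Omega> \<Longrightarrow> d \<in> hspace \<Omega> \<Longrightarrow> inner (B a b c) d = q4 a b c d"
begin

definition vemb :: "(real^'n \<Rightarrow> real^'m) \<Rightarrow> ((real^'n) lsq \<times> ((real^'n) lsq^'n))^'m" where
  "vemb u = (\<chi> i. emb \<Omega> (\<lambda>x. u x $ i))"

definition operator_solution :: "real^'m \<Rightarrow> ((real^'n) lsq \<times> ((real^'n) lsq^'n))^'m \<Rightarrow> bool" where
  "operator_solution l U \<longleftrightarrow> (\<forall>i. U $ i + (l $ i - 1) *\<^sub>R K (U $ i) = nonlinearity U $ i)"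

lemma nonlinearity_range: "nonlinearity U $ i \<in> hspace \<Omega>"
  unfolding nonlinearity_def vec_lambda_beta by (intro subspace_sum[OF hsub] subspace_scale[OF hsub] B_range)

lemma solves_system_iff:
  assumes "u \<in> H10_vec \<Omega>"
  shows "solves_system \<Omega> \<mu> \<beta> l u \<longleftrightarrow> operator_solution l (vemb u)"
proof -
  have u: "(\<lambda>x. u x $ k) \<in> H10 \<Omega>" for k using assms by (simp add: H10_vec_def)
  have h: "vemb u $ k \<in> hspace \<Omega>" for k using u by (simp add: vemb_def H10_emb[OF \<Omega>])
  have "weak_solution \<Omega> (l $ i) (\<lambda>x. \<mu> $ i * (u x $ i)^3 + (\<Sum>k\<in>UNIV - {i}. \<beta> $ k $ i * (u x $ k)\<^sup>2 * u x $ i)) (\<lambda>x. u x $ i)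
    \<longleftrightarrow> vemb u $ i + (l $ i - 1) *\<^sub>R K (vemb u $ i) = nonlinearity (vemb u) $ i" for i
  proof -
    \<comment> \<open>With \<mu> on the diagonal of \<gamma> the self-interaction is the summand
      \<open>k = i\<close>.\<close>
    have f: "(\<mu> $ i * (u x $ i)^3 + (\<Sum>k\<in>UNIV - {i}. \<beta> $ k $ i * (u x $ k)\<^sup>2 * u x $ i)) * y
        = (\<Sum>k\<in>UNIV. \<gamma> $ k $ i * (u x $ k * u x $ k * u x $ i * y))" for x y
    proof -
      have "(\<Sum>k\<in>UNIV. \<gamma> $ k $ i * (u x $ k * u x $ k * u x $ i * y)) = \<gamma> $ i $ i * (u x $ i * u x $ i * u x $ i * y)
          + (\<Sum>k\<in>UNIV - {i}. \<gamma> $ k $ i * (u x $ k * u x $ k * u x $ i * y))"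
        by (rule sum.remove) auto
      also have "(\<Sum>k\<in>UNIV - {i}. \<gamma> $ k $ i * (u x $ k * u x $ k * u x $ i * y)) = (\<Sum>k\<in>UNIV - {i}. \<beta> $ k $ i * (u x $ k)\<^sup>2 * u x $ i) * y"
        unfolding sum_distrib_right by (intro sum.cong) (auto simp: \<gamma> power2_eq_square)
      finally show ?thesis by (simp add: \<gamma> power3_eq_cube distrib_right)
    qed
    have "weak_solution \<Omega> (l $ i) (\<lambda>x. \<mu> $ i * (u x $ i)^3 + (\<Sum>k\<in>UNIV - {i}. \<beta> $ k $ i * (u x $ k)\<^sup>2 * u x $ i)) (\<lambda>x. u x $ i)
      \<longleftrightarrow> emb \<Omega> (\<lambda>x. u x $ i) + (l $ i - 1) *\<^sub>R K (emb \<Omega> (\<lambda>x. u x $ i)) = nonlinearity (vemb u) $ i"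
    proof (rule weak_solution_iff[OF u nonlinearity_range])
      fix \<phi> assume \<phi>: "\<phi> \<in> H10 \<Omega>"
      note q = q4_emb[OF u u u \<phi>]
      have \<phi>h: "emb \<Omega> \<phi> \<in> hspace \<Omega>" using \<phi> by (simp add: H10_emb[OF \<Omega>])
      show "integrable (lebesgue_on \<Omega>) (\<lambda>x. (\<mu> $ i * (u x $ i)^3 + (\<Sum>k\<in>UNIV - {i}. \<beta> $ k $ i * (u x $ k)\<^sup>2 * u x $ i)) * \<phi> x)"
        unfolding f by (intro Bochner_Integration.integrable_sum integrable_mult_right q(1))
      have "integral\<^sup>L (lebesgue_on \<Omega>) (\<lambda>x. \<Sum>k\<in>UNIV. \<gamma> $ k $ i * (u x $ k * u x $ k * u x $ i * \<phi> x))
          = (\<Sum>k\<in>UNIV. integral\<^sup>L (lebesgue_on \<Omega>) (\<lambda>x. \<gamma> $ k $ i * (u x $ k * u x $ k * u x $ i * \<phi> x)))"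
        by (intro Bochner_Integration.integral_sum integrable_mult_right q(1))
      also have "\<dots> = (\<Sum>k\<in>UNIV. \<gamma> $ k $ i * inner (B (vemb u $ k) (vemb u $ k) (vemb u $ i)) (emb \<Omega> \<phi>))"
        unfolding B_q4[OF h h h \<phi>h] by (intro sum.cong) (simp_all add: q(2) vemb_def)
      also have "\<dots> = inner (nonlinearity (vemb u) $ i) (emb \<Omega> \<phi>)"
        by (simp add: nonlinearity_def inner_sum_left)
      finally show "integral\<^sup>L (lebesgue_on \<Omega>) (\<lambda>x. (\<mu> $ i * (u x $ i)^3 + (\<Sum>k\<in>UNIV - {i}. \<beta> $ k $ i * (u x $ k)\<^sup>2 * u x $ i)) * \<phi> x)
        = inner (nonlinearity (vemb u) $ i) (emb \<Omega> \<phi>)" unfolding f .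
    qed
    then show ?thesis by (simp add: vemb_def)
  qed
  then show ?thesis by (simp add: solves_system_def operator_solution_def)
qed

lemma H1_norm_vec_vemb:
  assumes "u \<in> H10_vec \<Omega>" shows "H1_norm_vec \<Omega> u = norm (vemb u)"
  using assms by (simp add: H1_norm_vec_def H10_vec_def H10_emb[OF \<Omega>] H1_norm_emb[OF \<Omega>] norm_vec_def L2_set_def vemb_def)

lemma nonzero_components_vemb:
  assumes "u \<in> H10_vec \<Omega>" shows "nonzero_components \<Omega> u = {i. vemb u $ i \<noteq> 0}"
  using assms by (simp add: nonzero_components_def H10_vec_def H10_emb[OF \<Omega>] vanishes_emb[OF \<Omega>] vemb_def)

lemma vemb_represent:
  assumes "\<And>i. U $ i \<in> hspace \<Omega>"
  obtains u where "u \<in> H10_vec \<Omega>" "vemb u = U"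
proof -
  have "\<exists>v. v \<in> H10 \<Omega> \<and> emb \<Omega> v = U $ i" for i
    by (rule hspace_represent[OF \<Omega> assms[of i]]) blast
  then obtain v where v: "\<And>i. v i \<in> H10 \<Omega>" "\<And>i. emb \<Omega> (v i) = U $ i" by metis
  show ?thesis
    by (rule that[of "\<lambda>x. \<chi> i. v i x"]) (simp_all add: H10_vec_def vemb_def v vec_eq_iff)
qed

text \<open>Along the subsequence on which component \<open>i\<close> is nonzero its equation may be
  divided by its own norm. Compactness yields convergence of \<open>K (x k)\<close> only; the
  equation upgrades this to convergence of \<open>x k\<close>, which keeps the limit at norm
  1.\<close>

lemma eigenvalue_of_bifurcation:
  fixes lam :: "real^'m"
  assumes bif: "bifurcation_sequence \<Omega> \<mu> \<beta> lam l u" and inf: "infinite {n. i \<in> nonzero_components \<Omega> (u n)}"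
  shows "dirichlet_eigenvalue \<Omega> (lam $ i)"
proof -
  interpret K: bounded_linear K by (rule K_lin)
  have u: "u n \<in> H10_vec \<Omega>" for n using bif by (simp add: bifurcation_sequence_def)
  define U where "U n = vemb (u n)" for n
  have sol: "operator_solution (l n) (U n)" for n
    using bif solves_system_iff[OF u] by (simp add: bifurcation_sequence_def U_def)
  have lim_l: "(\<lambda>n. l n $ i) \<longlonglongrightarrow> - lam $ i"
  proof -
    have "(\<lambda>n. - (l n $ i)) \<longlonglongrightarrow> lam $ i" using bif by (simp add: bifurcation_sequence_def)
    from tendsto_minus[OF this] show ?thesis by simp
  qed
  have lim_U: "(\<lambda>n. norm (U n)) \<longlonglongrightarrow> 0"
    using bif H1_norm_vec_vemb[OF u] by (simp add: bifurcation_sequence_def U_def)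
  obtain r :: "nat \<Rightarrow> nat" where r: "strict_mono r" "\<And>k. r k \<in> {n. i \<in> nonzero_components \<Omega> (u n)}"
    using infinite_enumerate[OF inf] by blast
  have nz: "U (r k) $ i \<noteq> 0" for k using r(2)[of k] nonzero_components_vemb[OF u] by (simp add: U_def)
  define x where "x k = inverse (norm (U (r k) $ i)) *\<^sub>R U (r k) $ i" for k
  define e where "e k = inverse (norm (U (r k) $ i)) *\<^sub>R nonlinearity (U (r k)) $ i" for k
  have norm_x: "norm (x k) = 1" for k using nz[of k] by (simp add: x_def)
  have eq: "x k = e k - (l (r k) $ i - 1) *\<^sub>R K (x k)" for k
  proof -
    have "e k = inverse (norm (U (r k) $ i)) *\<^sub>R (U (r k) $ i + (l (r k) $ i - 1) *\<^sub>R K (U (r k) $ i))"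
      using sol[of "r k"] by (simp add: e_def operator_solution_def)
    also have "\<dots> = x k + (l (r k) $ i - 1) *\<^sub>R K (x k)"
      by (simp only: x_def K.scaleR scaleR_add_right scaleR_scaleR mult.commute)
    finally show ?thesis by simp
  qed
  obtain C' where C': "C' \<ge> 0" "\<And>U i. norm (nonlinearity U $ i) \<le> C' * (norm U)\<^sup>2 * norm (U $ i)"
    by (rule nonlinearity_component_bound) blast
  have e_bound: "norm (e k) \<le> C' * (norm (U (r k)))\<^sup>2" for k
  proof -
    have "norm (e k) = inverse (norm (U (r k) $ i)) * norm (nonlinearity (U (r k)) $ i)" by (simp add: e_def)
    also have "\<dots> \<le> inverse (norm (U (r k) $ i)) * (C' * (norm (U (r k)))\<^sup>2 * norm (U (r k) $ i))"
      by (intro mult_left_mono C'(2)) simp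
    also have "\<dots> = C' * (norm (U (r k)))\<^sup>2" using nz[of k] by (simp add: field_simps)
    finally show ?thesis .
  qed
  have "(\<lambda>k. C' * (norm (U (r k)))\<^sup>2) \<longlonglongrightarrow> C' * 0\<^sup>2"
    by (intro tendsto_intros LIMSEQ_subseq_LIMSEQ[OF lim_U r(1), unfolded o_def])
  then have e0: "e \<longlonglongrightarrow> 0" by (intro Lim_null_comparison[OF always_eventually[rule_format, OF e_bound]]) simp
  obtain s y where s: "strict_mono (s :: nat \<Rightarrow> nat)" "(\<lambda>k. K (x (s k))) \<longlonglongrightarrow> y"
    by (rule compact_operatorD[OF K_compact, of x 1]) (simp_all add: norm_x)
  \<comment> \<open>The coefficients tend to \<open>- lam\<close>, so the factor in front of
    \<open>K\<close> tends to \<open>lam + 1\<close>.\<close>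
  define z where "z = (lam $ i + 1) *\<^sub>R y"
  have "(\<lambda>k. e (s k) - (l (r (s k)) $ i - 1) *\<^sub>R K (x (s k))) \<longlonglongrightarrow> 0 - (- lam $ i - 1) *\<^sub>R y"
    using LIMSEQ_subseq_LIMSEQ[OF e0 s(1)] LIMSEQ_subseq_LIMSEQ[OF lim_l strict_mono_o[OF r(1) s(1)]] s(2)
    unfolding o_def by (intro tendsto_intros)
  moreover have "0 - (- lam $ i - 1) *\<^sub>R y = z" by (simp add: z_def algebra_simps)
  ultimately have z: "(\<lambda>k. x (s k)) \<longlonglongrightarrow> z" by (simp only: eq[symmetric])
  have "norm z = 1" using tendsto_norm[OF z] by (simp add: norm_x LIMSEQ_const_iff)
  then have "z \<noteq> 0" by auto
  moreover have "y = K z" by (rule LIMSEQ_unique[OF s(2) K.tendsto[OF z]])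
  then have "z = (lam $ i + 1) *\<^sub>R K z" by (simp only: z_def[symmetric] flip: \<open>y = K z\<close>)
  ultimately show ?thesis unfolding dirichlet_eigenvalue_iff by blast
qed

lemma bifurcation_of_eigenvalues:
  fixes lam :: "real^'m"
  assumes I: "I \<noteq> {}" and eig: "\<And>i. i \<in> I \<Longrightarrow> dirichlet_eigenvalue \<Omega> (lam $ i)"
  obtains l u where "bifurcation_sequence \<Omega> \<mu> \<beta> lam l u" "\<And>n. nonzero_components \<Omega> (u n) = I"
proof -
  interpret K: bounded_linear K by (rule K_lin)
  \<comment> \<open>The factor \<open>lam $ i + 1\<close> turns the eigenvalue equation into a fixed
    point equation, component by component.\<close>
  interpret G: gradient_system "\<lambda>i x. (lam $ i + 1) *\<^sub>R K x" nonlinearity energy I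
  proof (rule gradient_system.intro)
    show "bounded_linear (\<lambda>x. (lam $ i + 1) *\<^sub>R K x)" for i
      by (intro bounded_linear_compose[OF bounded_linear_scaleR_right K_lin])
    show "compact_operator (\<lambda>x. (lam $ i + 1) *\<^sub>R K x)" for i
      unfolding compact_operator_def
    proof (intro allI impI)
      fix X :: "nat \<Rightarrow> (real^'n) lsq \<times> ((real^'n) lsq^'n)" assume "bounded (range X)"
      then obtain r y where "strict_mono r" "(\<lambda>n. K (X (r n))) \<longlonglongrightarrow> y"
        using K_compact unfolding compact_operator_def by blast
      then show "\<exists>r y. strict_mono r \<and> (\<lambda>n. (lam $ i + 1) *\<^sub>R K (X (r n))) \<longlonglongrightarrow> y"
        by (intro exI[of _ r] exI[of _ "(lam $ i + 1) *\<^sub>R y"] conjI tendsto_intros)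
    qed
    show "inner ((lam $ i + 1) *\<^sub>R K x) y = inner x ((lam $ i + 1) *\<^sub>R K y)" for i x y
      by (simp add: K_sym)
    show "\<exists>v. v \<noteq> 0 \<and> (lam $ i + 1) *\<^sub>R K v = v" if i: "i \<in> I" for i
    proof -
      obtain x where "x \<noteq> 0" "x = (lam $ i + 1) *\<^sub>R K x" using eig[OF i] unfolding dirichlet_eigenvalue_iff by blast
      then show ?thesis by (intro exI[of _ x]) simp
    qed
    show "\<exists>L. \<forall>U V. norm U \<le> R \<longrightarrow> norm V \<le> R \<longrightarrow> norm (nonlinearity U - nonlinearity V) \<le> L * norm (U - V)" for R
      by (rule nonlinearity_lipschitz)
    show "\<exists>L. \<forall>U V. norm U \<le> R \<longrightarrow> norm V \<le> R \<longrightarrow>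
       \<bar>energy V - energy U - inner (nonlinearity U) (V - U)\<bar> \<le> L * (norm (V - U))\<^sup>2" for R
      by (rule energy_expansion)
  qed
  obtain D \<rho>\<^sub>0 where \<rho>0: "\<rho>\<^sub>0 > 0" and small: "\<And>\<rho>. 0 < \<rho> \<Longrightarrow> \<rho> < \<rho>\<^sub>0 \<Longrightarrow> \<exists>U \<tau>. norm U \<le> D \<and> (\<forall>i. i \<notin> I \<longrightarrow> U $ i = 0) \<and>
     (\<forall>i\<in>I. U $ i \<noteq> 0 \<and> \<bar>\<tau> i\<bar> \<le> D * \<rho>\<^sup>2 \<and> U $ i - (lam $ i + 1) *\<^sub>R K (U $ i)
       = \<rho>\<^sup>2 *\<^sub>R nonlinearity U $ i + \<tau> i *\<^sub>R (lam $ i + 1) *\<^sub>R K (U $ i))"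
    by (rule G.small_solutions) blast
  define \<rho> where "\<rho> n = \<rho>\<^sub>0 / (real n + 2)" for n
  have \<rho>: "0 < \<rho> n" "\<rho> n < \<rho>\<^sub>0" for n
  proof -
    show "0 < \<rho> n" using \<rho>0 by (simp add: \<rho>_def)
    have "\<rho>\<^sub>0 * 1 < \<rho>\<^sub>0 * (real n + 2)" using \<rho>0 by (intro mult_strict_left_mono) auto
    then show "\<rho> n < \<rho>\<^sub>0" by (simp add: \<rho>_def divide_less_eq)
  qed
  have \<rho>_lim: "\<rho> \<longlonglongrightarrow> 0"
  proof -
    have "(\<lambda>n. \<rho>\<^sub>0 * inverse (real (n + 2))) \<longlonglongrightarrow> \<rho>\<^sub>0 * 0"
      by (intro tendsto_intros LIMSEQ_ignore_initial_segment[OF lim_inverse_n])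
    then show ?thesis by (simp add: \<rho>_def[abs_def] divide_inverse add.commute)
  qed
  have "\<forall>n. \<exists>U \<tau>. norm U \<le> D \<and> (\<forall>i. i \<notin> I \<longrightarrow> U $ i = 0) \<and>
     (\<forall>i\<in>I. U $ i \<noteq> 0 \<and> \<bar>\<tau> i\<bar> \<le> D * (\<rho> n)\<^sup>2 \<and> U $ i - (lam $ i + 1) *\<^sub>R K (U $ i)
       = (\<rho> n)\<^sup>2 *\<^sub>R nonlinearity U $ i + \<tau> i *\<^sub>R (lam $ i + 1) *\<^sub>R K (U $ i))"
    using small \<rho> by blast
  then obtain U \<tau> where U: "norm (U n) \<le> D" "i \<notin> I \<Longrightarrow> U n $ i = 0"
    "i \<in> I \<Longrightarrow> U n $ i \<noteq> 0" "i \<in> I \<Longrightarrow> \<bar>\<tau> n i\<bar> \<le> D * (\<rho> n)\<^sup>2"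
    "i \<in> I \<Longrightarrow> U n $ i - (lam $ i + 1) *\<^sub>R K (U n $ i) = (\<rho> n)\<^sup>2 *\<^sub>R nonlinearity (U n) $ i + \<tau> n i *\<^sub>R (lam $ i + 1) *\<^sub>R K (U n $ i)"
    for n i
    unfolding choice_iff by blast
  \<comment> \<open>The nonlinearity is homogeneous of degree 3, so this scaling absorbs the factor
    \<open>\<rho>\<^sup>2\<close>.\<close>
  define V where "V n = \<rho> n *\<^sub>R U n" for n
  \<comment> \<open>The multiplier acts on \<open>(lam $ i + 1) *\<^sub>R K\<close>, so it shifts
    the coefficient by that multiple. Inactive components are 0 and keep the limiting
    coefficient.\<close>
  define l where "l n = (\<chi> i. if i \<in> I then - lam $ i - \<tau> n i * (lam $ i + 1) else - lam $ i)" for n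
  have sol: "V n $ i + (l n $ i - 1) *\<^sub>R K (V n $ i) = nonlinearity (V n) $ i" for n i
  proof (cases "i \<in> I")
    case True
    have "V n $ i + (l n $ i - 1) *\<^sub>R K (V n $ i)
        = \<rho> n *\<^sub>R (U n $ i - (lam $ i + 1) *\<^sub>R K (U n $ i) - \<tau> n i *\<^sub>R (lam $ i + 1) *\<^sub>R K (U n $ i))"
      using True by (simp add: V_def l_def K.scaleR algebra_simps)
    also have "\<dots> = \<rho> n *\<^sub>R (\<rho> n)\<^sup>2 *\<^sub>R nonlinearity (U n) $ i" unfolding U(5)[OF True] by simp
    also have "\<dots> = nonlinearity (V n) $ i"
      by (simp add: V_def nonlinearity_scale power3_eq_cube power2_eq_square mult.assoc)
    finally show ?thesis .
  next
    case False
    then have "V n $ i = 0" by (simp add: V_def U(2))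
    then show ?thesis by (simp add: K.zero nonlinearity_def zero3)
  qed
  \<comment> \<open>The abstract solution is only known to lie in the ambient space; its equation
    places it in \<open>hspace\<close>, where \<open>K\<close> and the nonlinearity take their
    values.\<close>
  have range: "V n $ i \<in> hspace \<Omega>" for n i
  proof -
    have "V n $ i = nonlinearity (V n) $ i - (l n $ i - 1) *\<^sub>R K (V n $ i)" using sol[of n i] by (simp add: algebra_simps)
    also have "\<dots> \<in> hspace \<Omega>" by (intro subspace_diff[OF hsub] subspace_scale[OF hsub] nonlinearity_range K_range)
    finally show ?thesis .
  qed
  have "\<exists>u. u \<in> H10_vec \<Omega> \<and> vemb u = V n" for n
    by (rule vemb_represent[of "V n"]) (use range in blast)+
  then obtain u where u: "\<And>n. u n \<in> H10_vec \<Omega>" "\<And>n. vemb (u n) = V n" by metis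
  have nz: "nonzero_components \<Omega> (u n) = I" for n
    unfolding nonzero_components_vemb[OF u(1)] u(2) V_def using U(2,3) \<rho>(1)[of n] by auto
  have lim_l: "(\<lambda>n. - (l n $ i)) \<longlonglongrightarrow> lam $ i" for i
  proof (cases "i \<in> I")
    case True
    have "(\<lambda>n. D * (\<rho> n)\<^sup>2) \<longlonglongrightarrow> D * 0\<^sup>2" by (intro tendsto_intros \<rho>_lim)
    then have "(\<lambda>n. \<tau> n i) \<longlonglongrightarrow> 0"
      using U(4)[OF True] by (intro Lim_null_comparison[of "\<lambda>n. \<tau> n i" "\<lambda>n. D * (\<rho> n)\<^sup>2"]) simp_all
    then have "(\<lambda>n. lam $ i + \<tau> n i * (lam $ i + 1)) \<longlonglongrightarrow> lam $ i + 0 * (lam $ i + 1)" by (intro tendsto_intros)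
    with True show ?thesis by (simp add: l_def add.commute)
  qed (simp add: l_def)
  have "(\<lambda>n. D * \<rho> n) \<longlonglongrightarrow> D * 0" by (intro tendsto_intros \<rho>_lim)
  moreover have "norm (norm (V n)) \<le> D * \<rho> n" for n
    using mult_left_mono[OF U(1)[of n], of "\<rho> n"] \<rho>(1)[of n] by (simp add: V_def mult.commute)
  ultimately have "(\<lambda>n. norm (V n)) \<longlonglongrightarrow> 0"
    by (intro Lim_null_comparison[of "\<lambda>n. norm (V n)" "\<lambda>n. D * \<rho> n"]) simp_all
  then have "(\<lambda>n. H1_norm_vec \<Omega> (u n)) \<longlonglongrightarrow> 0" by (simp only: H1_norm_vec_vemb[OF u(1)] u(2))
  moreover have "solves_system \<Omega> \<mu> \<beta> (l n) (u n)" for n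
    unfolding solves_system_iff[OF u(1)] u(2) operator_solution_def using sol by blast
  ultimately have "bifurcation_sequence \<Omega> \<mu> \<beta> lam l u"
    unfolding bifurcation_sequence_def using u(1) nz I lim_l by simp
  then show ?thesis using nz by (rule that)
qed

end

section \<open>Description of the bifurcation points\<close>

text \<open>All locale parameters are constructed here, so that only the domain and the coefficients
  remain. Sufficiency allows any nonempty index set, which serves both descriptions of bifurcation
  points.\<close>

lemma bifurcation_eigenvalues:
  fixes \<Omega> :: "(real^'n::finite) set" and \<mu> :: "real^'m::finite" and \<beta> :: "real^'m^'m"
  assumes card: "CARD('n) \<in> {3, 4}" and \<Omega>: "bounded \<Omega>" "open \<Omega>" and \<beta>: "\<And>i j. i \<noteq> j \<Longrightarrow> \<beta> $ i $ j = \<beta> $ j $ i"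
  shows "\<lbrakk>bifurcation_sequence \<Omega> \<mu> \<beta> lam l u; infinite {n. i \<in> nonzero_components \<Omega> (u n)}\<rbrakk> \<Longrightarrow> dirichlet_eigenvalue \<Omega> (lam $ i)"
    and "\<lbrakk>I \<noteq> {}; \<forall>i\<in>I. dirichlet_eigenvalue \<Omega> (lam $ i)\<rbrakk> \<Longrightarrow>
      \<exists>l u. bifurcation_sequence \<Omega> \<mu> \<beta> lam l u \<and> (\<forall>n. nonzero_components \<Omega> (u n) = I)"
proof -
  obtain P where P: "bounded_linear P" "\<And>x. P x \<in> hspace \<Omega>" "\<And>x y. y \<in> hspace \<Omega> \<Longrightarrow> inner (P x) y = inner x y"
    "\<And>x. x \<in> hspace \<Omega> \<Longrightarrow> P x = x"
    by (rule orthogonal_projection[OF hspace_subspace[OF \<Omega>(2)] hspace_closed[OF \<Omega>(2)]]) blast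
  interpret D: dirichlet_setting \<Omega> P by (rule dirichlet_setting.intro) (fact card \<Omega> P)+
  define \<gamma> where "\<gamma> = (\<chi> i k. if i = k then \<mu> $ i else \<beta> $ i $ k)"
  have \<gamma>_sym: "\<gamma> $ i $ k = \<gamma> $ k $ i" for i k by (simp add: \<gamma>_def \<beta>)
  obtain B C where B: "\<And>\<gamma> :: real^'m^'m. (\<And>i k. \<gamma> $ i $ k = \<gamma> $ k $ i) \<Longrightarrow> quartic_form B C \<gamma>" "\<And>a b c. B a b c \<in> hspace \<Omega>"
    "\<And>a b c d. a \<in> hspace \<Omega> \<Longrightarrow> b \<in> hspace \<Omega> \<Longrightarrow> c \<in> hspace \<Omega> \<Longrightarrow> d \<in> hspace \<Omega> \<Longrightarrow> inner (B a b c) d = D.q4 a b c d"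
    by (rule D.trilinear_map) blast
  interpret Q: quartic_form B C \<gamma> by (rule B(1)) (rule \<gamma>_sym)
  interpret S: cubic_system \<Omega> P B C \<gamma> \<mu> \<beta>
    by unfold_locales (simp_all add: \<gamma>_def B(2,3))
  show "dirichlet_eigenvalue \<Omega> (lam $ i)"
    if "bifurcation_sequence \<Omega> \<mu> \<beta> lam l u" "infinite {n. i \<in> nonzero_components \<Omega> (u n)}"
    using that by (rule S.eigenvalue_of_bifurcation)
  show "\<exists>l u. bifurcation_sequence \<Omega> \<mu> \<beta> lam l u \<and> (\<forall>n. nonzero_components \<Omega> (u n) = I)"
    if "I \<noteq> {}" "\<forall>i\<in>I. dirichlet_eigenvalue \<Omega> (lam $ i)"
    by (rule S.bifurcation_of_eigenvalues[of I lam]) (use that in blast)+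
qed

text \<open>Meant for the sets of nonzero components, which range over a finite type.\<close>

lemma constant_infinitely_often:
  fixes f :: "nat \<Rightarrow> 'a::finite"
  obtains y where "infinite {n. f n = y}"
proof -
  obtain n\<^sub>0 where "infinite {n. f n = f n\<^sub>0}"
    using pigeonhole_infinite[OF infinite_UNIV_nat, of f] by auto
  then show ?thesis by (rule that)
qed

theorem theorem1p10:
  fixes \<Omega> :: "(real^'n::finite) set"
    and \<mu> :: "real^'m::finite"
    and \<beta> :: "real^'m^'m"
  assumes "CARD('n) \<in> {3, 4}"
    and "bounded \<Omega>"
    and "regular_domain \<Omega>"
    and "CARD('m) \<ge> 2"
    and "\<And>i. \<mu> $ i \<noteq> 0"
    and "\<And>i j. i \<noteq> j \<Longrightarrow> \<beta> $ i $ j = \<beta> $ j $ i"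
    and "\<And>i j. i \<noteq> j \<Longrightarrow> \<beta> $ i $ j \<noteq> 0"
  shows "semi_trivial_bifurcation_points \<Omega> \<mu> \<beta> =
           {lam. \<exists>i. dirichlet_eigenvalue \<Omega> (lam $ i)} \<and>
         (\<forall>d. 1 \<le> d \<and> d \<le> CARD('m) - 1 \<longrightarrow>
           d_semi_trivial_bifurcation_points d \<Omega> \<mu> \<beta> =
             {lam. \<exists>I. card I = d \<and> (\<forall>i\<in>I. dirichlet_eigenvalue \<Omega> (lam $ i))})"
proof -
  have "open \<Omega>" using assms(3) by (simp add: regular_domain_def)
  note bif = bifurcation_eigenvalues[OF assms(1,2) this assms(6)]
  \<comment> \<open>The set of nonzero components may vary along the sequence. One set
    \<open>J\<close> recurs infinitely often, so all its members are eigenvalue indices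
    simultaneously; this is what preserves the count \<open>d\<close>.\<close>
  have eig: "\<exists>n. \<forall>i\<in>nonzero_components \<Omega> (u n). dirichlet_eigenvalue \<Omega> (lam $ i)"
    if "bifurcation_sequence \<Omega> \<mu> \<beta> lam l u" for lam :: "real^'m" and l and u :: "nat \<Rightarrow> real^'n \<Rightarrow> real^'m"
  proof -
    obtain J where J: "infinite {n. nonzero_components \<Omega> (u n) = J}" by (rule constant_infinitely_often)
    then obtain n where n: "nonzero_components \<Omega> (u n) = J" using not_finite_existsD by blast
    have "dirichlet_eigenvalue \<Omega> (lam $ i)" if "i \<in> J" for i
    proof (rule bif(1))
      show "bifurcation_sequence \<Omega> \<mu> \<beta> lam l u" by fact
      show "infinite {n. i \<in> nonzero_components \<Omega> (u n)}"
        using that by (intro infinite_super[OF _ J]) auto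
    qed
    with n show ?thesis by blast
  qed
  have semi: "semi_trivial_bifurcation_points \<Omega> \<mu> \<beta> = {lam. \<exists>i. dirichlet_eigenvalue \<Omega> (lam $ i)}"
  proof (intro equalityI subsetI CollectI)
    fix lam assume "lam \<in> semi_trivial_bifurcation_points \<Omega> \<mu> \<beta>"
    then obtain l u where lu: "bifurcation_sequence \<Omega> \<mu> \<beta> lam l u" "\<forall>n. semi_trivial \<Omega> (u n)"
      unfolding semi_trivial_bifurcation_points_def by blast
    obtain n where "\<forall>i\<in>nonzero_components \<Omega> (u n). dirichlet_eigenvalue \<Omega> (lam $ i)" using eig[OF lu(1)] by blast
    moreover have "nonzero_components \<Omega> (u n) \<noteq> {}" using lu(2) by (simp add: semi_trivial_def)
    ultimately show "\<exists>i. dirichlet_eigenvalue \<Omega> (lam $ i)" by blast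
  next
    fix lam :: "real^'m" assume "lam \<in> {lam. \<exists>i. dirichlet_eigenvalue \<Omega> (lam $ i)}"
    then obtain i where "dirichlet_eigenvalue \<Omega> (lam $ i)" by blast
    then obtain l u where lu: "bifurcation_sequence \<Omega> \<mu> \<beta> lam l u" "\<forall>n. nonzero_components \<Omega> (u n) = {i}"
      using bif(2)[of "{i}" lam \<mu>] by blast
    \<comment> \<open>With at least two components, a single active one leaves another that
      vanishes.\<close>
    have "{i} \<noteq> UNIV"
    proof
      assume "{i} = UNIV"
      then have "CARD('m) = card {i}" by simp
      with assms(4) show False by simp
    qed
    then have "\<forall>n. semi_trivial \<Omega> (u n)" using lu(2) by (simp add: semi_trivial_def)
    with lu(1) show "lam \<in> semi_trivial_bifurcation_points \<Omega> \<mu> \<beta>"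
      unfolding semi_trivial_bifurcation_points_def by blast
  qed
  have "d_semi_trivial_bifurcation_points d \<Omega> \<mu> \<beta> = {lam. \<exists>I. card I = d \<and> (\<forall>i\<in>I. dirichlet_eigenvalue \<Omega> (lam $ i))}"
    if "1 \<le> d" for d
  proof (intro equalityI subsetI CollectI)
    fix lam assume "lam \<in> d_semi_trivial_bifurcation_points d \<Omega> \<mu> \<beta>"
    then obtain l u where lu: "bifurcation_sequence \<Omega> \<mu> \<beta> lam l u" "\<forall>n. card (nonzero_components \<Omega> (u n)) = d"
      unfolding d_semi_trivial_bifurcation_points_def by blast
    obtain n where "\<forall>i\<in>nonzero_components \<Omega> (u n). dirichlet_eigenvalue \<Omega> (lam $ i)" using eig[OF lu(1)] by blast
    with lu(2) show "\<exists>I. card I = d \<and> (\<forall>i\<in>I. dirichlet_eigenvalue \<Omega> (lam $ i))" by blast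
  next
    fix lam :: "real^'m" assume "lam \<in> {lam. \<exists>I. card I = d \<and> (\<forall>i\<in>I. dirichlet_eigenvalue \<Omega> (lam $ i))}"
    then obtain I where I: "card I = d" "\<forall>i\<in>I. dirichlet_eigenvalue \<Omega> (lam $ i)" by blast
    \<comment> \<open>The construction needs an active component, which \<open>1 \<le> d\<close>
      provides.\<close>
    then have "I \<noteq> {}" using that by auto
    then obtain l u where lu: "bifurcation_sequence \<Omega> \<mu> \<beta> lam l u" "\<forall>n. nonzero_components \<Omega> (u n) = I"
      using bif(2)[of I lam \<mu>] I(2) by blast
    then have "\<forall>n. card (nonzero_components \<Omega> (u n)) = d" using I(1) by simp
    with lu(1) show "lam \<in> d_semi_trivial_bifurcation_points d \<Omega> \<mu> \<beta>"
      unfolding d_semi_trivial_bifurcation_points_def by blast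
  qed
  with semi show ?thesis by blast
qed

end
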